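(* Assume $\mathbb{Q}\subset R$. The maps induced by multiplication $$\Theta: S\otimes_{S^W}Z(\mathbf{D}_{W_a})\longrightarrow\mathbf{D}_{Q^\vee},\qquad \Xi:\mathbf{D}_W\otimes_{S^W}Z(\mathbf{D}_{W_a})\longrightarrow\mathbf{D}_{W_a},$$ are ring isomorphisms, where $Z(\mathbf{D}_{W_a})$ denotes the centre of $\mathbf{D}_{W_a}$.
   Context: $R$ is a commutative ring of characteristic $0$ and $F$ is a (one-dimensional commutative) formal group law over $R$. For a lattice $\Lambda$, $R[[\Lambda]]_F$ is the quotient of the power series ring $R[[x_\lambda\mid\lambda\in\Lambda]]$ by the closure of the ideal generated by $x_0$ and $x_{\lambda_1+\lambda_2}-F(x_{\lambda_1},x_{\lambda_2})$. (In the case $F_\beta(x,y)=x+y-\beta xy$ over $R=\mathbb{Z}[\beta]$ one takes instead the quotient of the polynomial ring by the ideal generated by the same elements.) $\Phi$ is a finite irreducible root system with simple roots $\alpha_1,\dots,\alpha_n$, root lattice $Q$, coroot lattice $Q^\vee$, Weyl group $W$, highest root $\theta$. $W_a=Q^\vee\rtimes W$ has elements $t_\lambda w$; $s_i=s_{\alpha_i}$ for $1\le i\le n$, $s_0=t_{\theta^\vee}s_\theta$. $W_a$ acts on $S=R[[Q]]_F$ through $W$ (translations act trivially). Each $x_\alpha$, $\alpha\in\Phi$, is assumed regular in $S$; $\mathcal{Q}=S[\frac1{x_\alpha}\mid\alpha\in\Phi]$. $\mathcal{Q}_{W_a}$ is the free left $\mathcal{Q}$-module with basis $\eta_u$, $u\in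 W_a$, with product $c\eta_u\cdot c'\eta_{u'}=c\,u(c')\eta_{uu'}$; $\mathcal{Q}_{Q^\vee}$ is the analogous commutative algebra with basis $\eta_{t_\lambda}$, $\lambda\in Q^\vee$. $\mathrm{pr}:\mathcal{Q}_{W_a}\to\mathcal{Q}_{Q^\vee}$, $c\eta_{t_\lambda w}\mapsto c\eta_{t_\lambda}$ ($w\in W$); $\imath:\mathcal{Q}_{Q^\vee}\to\mathcal{Q}_{W_a}$, $c\eta_{t_\lambda}\mapsto c\eta_{t_\lambda}$. $X_i=\frac1{x_{\alpha_i}}(1-\eta_{s_i})$ ($1\le i\le n$), $X_0=\frac1{x_{-\theta}}(1-\eta_{s_0})$. $\mathbf{D}_{W_a}$ is the subring of $\mathcal{Q}_{W_a}$ generated by $S,X_0,\dots,X_n$; $\mathbf{D}_W$ is the subring generated by $S,X_1,\dots,X_n$. The formal Peterson subalgebra $\mathbf{D}_{Q^\vee}=\imath(\mathrm{pr}(\mathbf{D}_{W_a}))$ is known to be a subring of $\mathbf{D}_{W_a}$ when $\mathbb{Q}\subset R$, and to coincide with the centralizer of $S$ in $\mathbf{D}_{W_a}$. *)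

theory Defs
  imports
    "HOL-Library.Poly_Mapping"
    "HOL-Computational_Algebra.Group_Closure"
    "HOL-Analysis.Euclidean_Space"
    "HOL-Algebra.Algebra"
begin

unbundle inner_syntax


section \<open>Power series and formal group laws\<close>

text \<open>
  A power series assigns a coefficient to every monomial; a monomial is a finitely supported
  exponent vector. \<open>mps_ring \<Lambda>\<close> is the completion of the polynomial ring in the
  variables \<open>x\<^sub>\<lambda>\<close> (\<open>\<lambda> \<in> \<Lambda>\<close>) at its augmentation ideal: every homogeneous component is a
  polynomial. For infinite \<open>\<Lambda>\<close> this is a proper subring of the ring of all functions on monomials,
  and the topology that goes with it is the one given by the order of vanishing.
\<close>

type_synonym ('v, 'r) mps = "('v \<Rightarrow>\<^sub>0 nat) \<Rightarrow> 'r"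

definition mdeg :: "('v \<Rightarrow>\<^sub>0 nat) \<Rightarrow> nat" where
  "mdeg m = (\<Sum>v\<in>Poly_Mapping.keys m. Poly_Mapping.lookup m v)"

definition mps_ring :: "'v set \<Rightarrow> ('v, 'r::comm_ring_1) mps ring" where
  "mps_ring \<Lambda> =
    \<lparr>carrier = {f. (\<forall>m. f m \<noteq> 0 \<longrightarrow> Poly_Mapping.keys m \<subseteq> \<Lambda>) \<and>
                   (\<forall>d. finite {m. mdeg m = d \<and> f m \<noteq> 0})},
     monoid.mult = (\<lambda>f g m. \<Sum>(a, b)\<in>{(a, b). a + b = m}. f a * g b),
     one = (\<lambda>m. if m = 0 then 1 else 0),
     ring.zero = (\<lambda>m. 0),
     ring.add = (\<lambda>f g m. f m + g m)\<rparr>"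

definition mps_var :: "'v \<Rightarrow> ('v, 'r::comm_ring_1) mps" where
  "mps_var v = (\<lambda>m. if m = Poly_Mapping.single v 1 then 1 else 0)"

text \<open>
  The series \<open>F(x,y) = \<Sum> F i j x\<^sup>i y\<^sup>j\<close> evaluated at \<open>p\<close> and \<open>q\<close>, which must have zero constant term:
  then \<open>p\<^sup>i q\<^sup>j\<close> has no coefficient in degrees below \<open>i + j\<close>, so that the truncated sum below
  is the full one.
\<close>

definition mps_eval2 ::
  "'v set \<Rightarrow> (nat \<Rightarrow> nat \<Rightarrow> 'r::comm_ring_1) \<Rightarrow> ('v, 'r) mps \<Rightarrow> ('v, 'r) mps \<Rightarrow> ('v, 'r) mps" where
  "mps_eval2 \<Lambda> F p q = (\<lambda>m. \<Sum>i\<le>mdeg m. \<Sum>j\<le>mdeg m.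
     F i j * ((p [^]\<^bsub>mps_ring \<Lambda>\<^esub> i) \<otimes>\<^bsub>mps_ring \<Lambda>\<^esub> (q [^]\<^bsub>mps_ring \<Lambda>\<^esub> j)) m)"

text \<open>
  One-dimensional commutative formal group laws; associativity is an identity of power series in
  the three variables with indices 0, 1, 2.
\<close>

definition formal_group_law :: "(nat \<Rightarrow> nat \<Rightarrow> 'r::comm_ring_1) \<Rightarrow> bool" where
  "formal_group_law F \<longleftrightarrow>
     (\<forall>i. F i 0 = (if i = 1 then 1 else 0)) \<and>
     (\<forall>j. F 0 j = (if j = 1 then 1 else 0)) \<and>
     (\<forall>i j. F i j = F j i) \<and>
     (let V = {0, 1, 2::nat}; x = mps_var 0; y = mps_var 1; z = mps_var 2 in
       mps_eval2 V F (mps_eval2 V F x y) z = mps_eval2 V F x (mps_eval2 V F y z))"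

definition contains_rat :: "'r::comm_ring_1 itself \<Rightarrow> bool" where
  "contains_rat _ \<longleftrightarrow> (\<exists>h :: rat \<Rightarrow> 'r. inj h \<and> h 1 = 1 \<and>
     (\<forall>x y. h (x + y) = h x + h y) \<and> (\<forall>x y. h (x * y) = h x * h y))"


section \<open>Formal group algebras\<close>

definition mps_closure :: "'v set \<Rightarrow> ('v, 'r::comm_ring_1) mps set \<Rightarrow> ('v, 'r) mps set" where
  "mps_closure \<Lambda> I =
     {f \<in> carrier (mps_ring \<Lambda>). \<forall>d. \<exists>g\<in>I. \<forall>m. mdeg m < d \<longrightarrow> f m = g m}"

definition fga_ideal ::
  "(nat \<Rightarrow> nat \<Rightarrow> 'r::comm_ring_1) \<Rightarrow> 'v::ab_group_add set \<Rightarrow> ('v, 'r) mps set" where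
  "fga_ideal F \<Lambda> = mps_closure \<Lambda> (genideal (mps_ring \<Lambda>)
     ({mps_var 0} \<union>
      {mps_var (l1 + l2) \<ominus>\<^bsub>mps_ring \<Lambda>\<^esub> mps_eval2 \<Lambda> F (mps_var l1) (mps_var l2) | l1 l2.
         l1 \<in> \<Lambda> \<and> l2 \<in> \<Lambda>}))"

definition fga ::
  "(nat \<Rightarrow> nat \<Rightarrow> 'r::comm_ring_1) \<Rightarrow> 'v::ab_group_add set \<Rightarrow> ('v, 'r) mps set ring" where
  "fga F \<Lambda> = mps_ring \<Lambda> Quot fga_ideal F \<Lambda>"

definition fga_var ::
  "(nat \<Rightarrow> nat \<Rightarrow> 'r::comm_ring_1) \<Rightarrow> 'v::ab_group_add set \<Rightarrow> 'v \<Rightarrow> ('v, 'r) mps set" where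
  "fga_var F \<Lambda> l = fga_ideal F \<Lambda> +>\<^bsub>mps_ring \<Lambda>\<^esub> mps_var l"

text \<open>
  The action \<open>x\<^sub>\<lambda> \<mapsto> x\<^bsub>w \<lambda>\<^esub>\<close> of a bijection \<open>w\<close>: the coefficient of \<open>w f\<close> at the
  monomial \<open>m\<close> is the coefficient of \<open>f\<close> at \<open>m \<circ> w\<close>. Elements of \<^const>\<open>fga\<close> are cosets, and
  \<open>w\<close> acts on them by images.
\<close>

definition mps_act :: "('v \<Rightarrow> 'v) \<Rightarrow> ('v, 'r) mps \<Rightarrow> ('v, 'r) mps" where
  "mps_act w f = (\<lambda>m. f (Poly_Mapping.map_key w m))"

definition fga_act :: "('v \<Rightarrow> 'v) \<Rightarrow> ('v, 'r) mps set \<Rightarrow> ('v, 'r) mps set" where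
  "fga_act w a = mps_act w ` a"


section \<open>Regular elements and localization\<close>

definition regular_elt :: "('a, 'b) ring_scheme \<Rightarrow> 'a \<Rightarrow> bool" where
  "regular_elt A a \<longleftrightarrow> a \<in> carrier A \<and> (\<forall>b\<in>carrier A. a \<otimes>\<^bsub>A\<^esub> b = \<zero>\<^bsub>A\<^esub> \<longrightarrow> b = \<zero>\<^bsub>A\<^esub>)"

inductive_set mult_closure :: "('a, 'b) monoid_scheme \<Rightarrow> 'a set \<Rightarrow> 'a set"
  for A and H where
  one: "\<one>\<^bsub>A\<^esub> \<in> mult_closure A H"
| mult: "h \<in> H \<Longrightarrow> s \<in> mult_closure A H \<Longrightarrow> h \<otimes>\<^bsub>A\<^esub> s \<in> mult_closure A H"

type_synonym 'a frac = "('a \<times> 'a) set"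

definition frac_rel :: "('a, 'b) ring_scheme \<Rightarrow> 'a set \<Rightarrow> (('a \<times> 'a) \<times> ('a \<times> 'a)) set" where
  "frac_rel A M = {((a, s), (b, t)). a \<in> carrier A \<and> b \<in> carrier A \<and> s \<in> M \<and> t \<in> M \<and>
     (\<exists>u\<in>M. u \<otimes>\<^bsub>A\<^esub> (a \<otimes>\<^bsub>A\<^esub> t \<ominus>\<^bsub>A\<^esub> b \<otimes>\<^bsub>A\<^esub> s) = \<zero>\<^bsub>A\<^esub>)}"

definition fraction :: "('a, 'b) ring_scheme \<Rightarrow> 'a set \<Rightarrow> 'a \<Rightarrow> 'a \<Rightarrow> 'a frac" where
  "fraction A M a s = frac_rel A M `` {(a, s)}"

definition localization :: "('a, 'b) ring_scheme \<Rightarrow> 'a set \<Rightarrow> 'a frac ring" where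
  "localization A M =
    \<lparr>carrier = (carrier A \<times> M) // frac_rel A M,
     monoid.mult = (\<lambda>p q. \<Union>(a, s)\<in>p. \<Union>(b, t)\<in>q. fraction A M (a \<otimes>\<^bsub>A\<^esub> b) (s \<otimes>\<^bsub>A\<^esub> t)),
     one = fraction A M \<one>\<^bsub>A\<^esub> \<one>\<^bsub>A\<^esub>,
     ring.zero = fraction A M \<zero>\<^bsub>A\<^esub> \<one>\<^bsub>A\<^esub>,
     ring.add = (\<lambda>p q. \<Union>(a, s)\<in>p. \<Union>(b, t)\<in>q.
              fraction A M (a \<otimes>\<^bsub>A\<^esub> t \<oplus>\<^bsub>A\<^esub> b \<otimes>\<^bsub>A\<^esub> s) (s \<otimes>\<^bsub>A\<^esub> t))\<rparr>"


section \<open>Twisted group rings\<close>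

text \<open>
  The free left \<open>A\<close>-module with basis \<open>\<eta>\<^sub>u\<close> (\<open>u \<in> G\<close>) and product
  \<open>c \<eta>\<^sub>u \<cdot> c' \<eta>\<^bsub>u'\<^esub> = c u(c') \<eta>\<^bsub>u u'\<^esub>\<close>; the element \<open>\<Sum> f u \<eta>\<^sub>u\<close> is represented by its coefficient
  function \<open>f\<close>, which is zero off \<open>G\<close>.
\<close>

definition twisted_group_ring ::
  "('a, 'b) ring_scheme \<Rightarrow> ('g, 'c) monoid_scheme \<Rightarrow> ('g \<Rightarrow> 'a \<Rightarrow> 'a) \<Rightarrow> ('g \<Rightarrow> 'a) ring" where
  "twisted_group_ring A G act =
    \<lparr>carrier = {f. (\<forall>u\<in>carrier G. f u \<in> carrier A) \<and> (\<forall>u. u \<notin> carrier G \<longrightarrow> f u = \<zero>\<^bsub>A\<^esub>) \<and>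
                   finite {u. f u \<noteq> \<zero>\<^bsub>A\<^esub>}},
     monoid.mult = (\<lambda>f g u.
       \<Oplus>\<^bsub>A\<^esub>p\<in>{(v, v'). f v \<noteq> \<zero>\<^bsub>A\<^esub> \<and> g v' \<noteq> \<zero>\<^bsub>A\<^esub> \<and> v \<otimes>\<^bsub>G\<^esub> v' = u}.
         f (fst p) \<otimes>\<^bsub>A\<^esub> act (fst p) (g (snd p))),
     one = (\<lambda>u. if u = \<one>\<^bsub>G\<^esub> then \<one>\<^bsub>A\<^esub> else \<zero>\<^bsub>A\<^esub>),
     ring.zero = (\<lambda>u. \<zero>\<^bsub>A\<^esub>),
     ring.add = (\<lambda>f g u. f u \<oplus>\<^bsub>A\<^esub> g u)\<rparr>"

definition tw_elem :: "('a, 'b) ring_scheme \<Rightarrow> 'a \<Rightarrow> 'g \<Rightarrow> ('g \<Rightarrow> 'a)" where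
  "tw_elem A c u = (\<lambda>v. if v = u then c else \<zero>\<^bsub>A\<^esub>)"  \<comment> \<open>\<open>c \<eta>\<^sub>u\<close>\<close>


section \<open>Centre and tensor products\<close>

definition ring_centre :: "('a, 'b) ring_scheme \<Rightarrow> 'a set" where
  "ring_centre A = {z \<in> carrier A. \<forall>a\<in>carrier A. z \<otimes>\<^bsub>A\<^esub> a = a \<otimes>\<^bsub>A\<^esub> z}"

text \<open>
  \<open>A \<otimes>\<^sub>K B\<close> for \<open>K\<close>-algebras with structure maps \<open>f : K \<rightarrow> A\<close> and \<open>g : K \<rightarrow> B\<close> (with central
  images). \<open>free_ring A B\<close> is the free abelian group on \<open>A \<times> B\<close> with
  \<open>[a, b] \<cdot> [a', b'] = [a a', b b']\<close>, and the tensor product is its quotient by the additive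
  subgroup generated by the usual relations.
\<close>

definition free_ring ::
  "('a, 'c) ring_scheme \<Rightarrow> ('b, 'd) ring_scheme \<Rightarrow> (('a \<times> 'b) \<Rightarrow>\<^sub>0 int) ring" where
  "free_ring A B =
    \<lparr>carrier = {p. Poly_Mapping.keys p \<subseteq> carrier A \<times> carrier B},
     monoid.mult = (\<lambda>p q. \<Sum>(a, b)\<in>Poly_Mapping.keys p. \<Sum>(a', b')\<in>Poly_Mapping.keys q.
               Poly_Mapping.single (a \<otimes>\<^bsub>A\<^esub> a', b \<otimes>\<^bsub>B\<^esub> b')
                 (Poly_Mapping.lookup p (a, b) * Poly_Mapping.lookup q (a', b'))),
     one = Poly_Mapping.single (\<one>\<^bsub>A\<^esub>, \<one>\<^bsub>B\<^esub>) 1,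
     ring.zero = 0,
     ring.add = (+)\<rparr>"

definition tensor_gens ::
  "('k, 'e) ring_scheme \<Rightarrow> ('k \<Rightarrow> 'a) \<Rightarrow> ('a, 'c) ring_scheme \<Rightarrow> ('k \<Rightarrow> 'b) \<Rightarrow> ('b, 'd) ring_scheme
     \<Rightarrow> (('a \<times> 'b) \<Rightarrow>\<^sub>0 int) set" where
  "tensor_gens K f A g B =
     {Poly_Mapping.single (a \<oplus>\<^bsub>A\<^esub> a', b) 1 - Poly_Mapping.single (a, b) 1
        - Poly_Mapping.single (a', b) 1 | a a' b.
        a \<in> carrier A \<and> a' \<in> carrier A \<and> b \<in> carrier B} \<union>
     {Poly_Mapping.single (a, b \<oplus>\<^bsub>B\<^esub> b') 1 - Poly_Mapping.single (a, b) 1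
        - Poly_Mapping.single (a, b') 1 | a b b'.
        a \<in> carrier A \<and> b \<in> carrier B \<and> b' \<in> carrier B} \<union>
     {Poly_Mapping.single (a \<otimes>\<^bsub>A\<^esub> f k, b) 1 - Poly_Mapping.single (a, g k \<otimes>\<^bsub>B\<^esub> b) 1 | a k b.
        a \<in> carrier A \<and> k \<in> carrier K \<and> b \<in> carrier B}"

definition tensor_rels ::
  "('k, 'e) ring_scheme \<Rightarrow> ('k \<Rightarrow> 'a) \<Rightarrow> ('a, 'c) ring_scheme \<Rightarrow> ('k \<Rightarrow> 'b) \<Rightarrow> ('b, 'd) ring_scheme
     \<Rightarrow> (('a \<times> 'b) \<Rightarrow>\<^sub>0 int) set" where
  "tensor_rels K f A g B = group_closure (tensor_gens K f A g B)"

definition tensor_ring ::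
  "('k, 'e) ring_scheme \<Rightarrow> ('k \<Rightarrow> 'a) \<Rightarrow> ('a, 'c) ring_scheme \<Rightarrow> ('k \<Rightarrow> 'b) \<Rightarrow> ('b, 'd) ring_scheme
     \<Rightarrow> (('a \<times> 'b) \<Rightarrow>\<^sub>0 int) set ring" where
  "tensor_ring K f A g B = free_ring A B Quot tensor_rels K f A g B"

definition pure_tensor ::
  "('k, 'e) ring_scheme \<Rightarrow> ('k \<Rightarrow> 'a) \<Rightarrow> ('a, 'c) ring_scheme \<Rightarrow> ('k \<Rightarrow> 'b) \<Rightarrow> ('b, 'd) ring_scheme
     \<Rightarrow> 'a \<Rightarrow> 'b \<Rightarrow> (('a \<times> 'b) \<Rightarrow>\<^sub>0 int) set" where
  "pure_tensor K f A g B a b =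
     tensor_rels K f A g B +>\<^bsub>free_ring A B\<^esub> Poly_Mapping.single (a, b) 1"

text \<open>
  The map \<open>a \<otimes> b \<mapsto> i a \<cdot> j b\<close> into a ring \<open>M\<close>: a formal sum of pairs is sent to the corresponding
  sum of products, and this is constant on every coset of the relations (\<open>tensor_mult_map_coset\<close>),
  so \<^const>\<open>the_elem\<close> picks out its only value there.
\<close>

definition free_mult_map ::
  "('m, 'e) ring_scheme \<Rightarrow> ('a \<Rightarrow> 'm) \<Rightarrow> ('b \<Rightarrow> 'm) \<Rightarrow> (('a \<times> 'b) \<Rightarrow>\<^sub>0 int) \<Rightarrow> 'm" where
  "free_mult_map M i j p =
     (\<Oplus>\<^bsub>M\<^esub>t\<in>Poly_Mapping.keys p. add_pow M (Poly_Mapping.lookup p t) (i (fst t) \<otimes>\<^bsub>M\<^esub> j (snd t)))"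

definition tensor_mult_map ::
  "('m, 'e) ring_scheme \<Rightarrow> ('a \<Rightarrow> 'm) \<Rightarrow> ('b \<Rightarrow> 'm) \<Rightarrow> (('a \<times> 'b) \<Rightarrow>\<^sub>0 int) set \<Rightarrow> 'm" where
  "tensor_mult_map M i j T = the_elem (free_mult_map M i j ` T)"

lemma (in ring) add_minus_minus:
  assumes "x \<in> carrier R" "y \<in> carrier R"
  shows "x \<oplus> y \<ominus> x \<ominus> y = \<zero>"
proof -
  have "x \<oplus> y \<ominus> x = y" using assms by (simp add: a_minus_def a_comm[of x y] a_assoc r_neg)
  then show ?thesis using assms by (simp add: a_minus_def r_neg)
qed

lemma (in ring) free_mult_map_superset:
  assumes "finite T" "Poly_Mapping.keys p \<subseteq> T"
    and "\<And>t. t \<in> T \<Longrightarrow> i (fst t) \<otimes> j (snd t) \<in> carrier R"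
  shows "free_mult_map R i j p =
    (\<Oplus>t\<in>T. add_pow R (Poly_Mapping.lookup p t) (i (fst t) \<otimes> j (snd t)))"
  unfolding free_mult_map_def
proof (rule add.finprod_mono_neutral_cong_left)
  show "add_pow R (Poly_Mapping.lookup p t) (i (fst t) \<otimes> j (snd t)) = \<zero>"
    if "t \<in> T - Poly_Mapping.keys p" for t
    using that by (simp add: in_keys_iff add_pow_def int_pow_0[of "add_monoid R", simplified])
qed (use assms in auto)

lemma (in ring) free_mult_map_diff:
  assumes "\<And>t. t \<in> Poly_Mapping.keys p \<union> Poly_Mapping.keys q \<Longrightarrow> i (fst t) \<otimes> j (snd t) \<in> carrier R"
  shows "free_mult_map R i j (p - q) = free_mult_map R i j p \<ominus> free_mult_map R i j q" (is ?A)
    and "free_mult_map R i j (p + q) = free_mult_map R i j p \<oplus> free_mult_map R i j q" (is ?B)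
proof -
  let ?T = "Poly_Mapping.keys p \<union> Poly_Mapping.keys q"
  have k: "Poly_Mapping.keys (p - q) \<subseteq> ?T" "Poly_Mapping.keys (p + q) \<subseteq> ?T"
    by (auto simp: in_keys_iff lookup_minus lookup_add)
  let ?h = "\<lambda>p. (\<Oplus>t\<in>?T. add_pow R (Poly_Mapping.lookup p t) (i (fst t) \<otimes> j (snd t)))"
  have c: "add_pow R (n::int) (i (fst t) \<otimes> j (snd t)) \<in> carrier R" if "t \<in> ?T" for n t
    using assms[OF that] by simp
  have a: "?h (p + q) = ?h p \<oplus> ?h q" for p q :: "('c \<times> 'd) \<Rightarrow>\<^sub>0 int"
  proof -
    have "?h (p + q) = (\<Oplus>t\<in>?T. add_pow R (Poly_Mapping.lookup p t) (i (fst t) \<otimes> j (snd t)) \<oplus>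
        add_pow R (Poly_Mapping.lookup q t) (i (fst t) \<otimes> j (snd t)))"
    proof (rule finsum_cong')
      fix t assume t: "t \<in> ?T"
      show "add_pow R (Poly_Mapping.lookup (p + q) t) (i (fst t) \<otimes> j (snd t)) =
        add_pow R (Poly_Mapping.lookup p t) (i (fst t) \<otimes> j (snd t)) \<oplus>
        add_pow R (Poly_Mapping.lookup q t) (i (fst t) \<otimes> j (snd t))"
        using group.int_pow_mult[OF a_group, of "i (fst t) \<otimes> j (snd t)"] assms[OF t]
        by (simp add: add_pow_def lookup_add)
    qed (use c in auto)
    also have "\<dots> = ?h p \<oplus> ?h q" by (rule finsum_addf) (use c in auto)
    finally show ?thesis .
  qed
  have cl: "?h r \<in> carrier R" for r :: "('c \<times> 'd) \<Rightarrow>\<^sub>0 int" by (rule finsum_closed) (use c in auto)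
  have e: "free_mult_map R i j r = ?h r" if "Poly_Mapping.keys r \<subseteq> ?T" for r
    by (rule free_mult_map_superset) (use assms that in auto)
  show ?B using a[of p q] k(2) by (subst (1 2 3) e) auto
  have "?h p = ?h (p - q) \<oplus> ?h q" using a[of "p - q" q] by simp
  hence "?h (p - q) = ?h p \<ominus> ?h q" using cl[of "p-q"] cl[of q]
    by (simp add: a_minus_def a_assoc r_neg)
  then show ?A using k(1) by (subst (1 2 3) e) auto
qed

lemma (in ring) free_mult_map_single:
  assumes "i a \<otimes> j b \<in> carrier R"
  shows "free_mult_map R i j (Poly_Mapping.single (a, b) 1) = i a \<otimes> j b"
  unfolding free_mult_map_def using assms
    group.int_pow_1[OF a_group, of "i a \<otimes> j b"]
  by (simp add: finsum_insert[of "{}", simplified] add_pow_def)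

lemma free_mult_map_rels:
  assumes "ring M" "ring A" "ring B" "i \<in> ring_hom A M" "j \<in> ring_hom B M"
    and "\<And>k. k \<in> carrier K \<Longrightarrow> f k \<in> carrier A \<and> g k \<in> carrier B \<and> i (f k) = j (g k)"
    and "r \<in> tensor_rels K f A g B"
  shows "Poly_Mapping.keys r \<subseteq> carrier A \<times> carrier B \<and> free_mult_map M i j r = \<zero>\<^bsub>M\<^esub>"
proof -
  interpret M: ring M by fact
  interpret A: ring A by fact
  interpret B: ring B by fact
  have ij: "i a \<otimes>\<^bsub>M\<^esub> j b \<in> carrier M" if "a \<in> carrier A" "b \<in> carrier B" for a b
    using that assms(4,5) by (simp add: ring_hom_closed)
  have s: "free_mult_map M i j (Poly_Mapping.single (a, b) 1) = i a \<otimes>\<^bsub>M\<^esub> j b"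
    if "a \<in> carrier A" "b \<in> carrier B" for a b
    by (rule M.free_mult_map_single) (rule ij[OF that])
  have d: "free_mult_map M i j (p - q) = free_mult_map M i j p \<ominus>\<^bsub>M\<^esub> free_mult_map M i j q"
    if "Poly_Mapping.keys p \<subseteq> carrier A \<times> carrier B" "Poly_Mapping.keys q \<subseteq> carrier A \<times> carrier B" for p q
    by (rule M.free_mult_map_diff) (metis Un_iff ij mem_Times_iff subsetD that)
  let ?S = "\<lambda>a b. Poly_Mapping.single (a, b) (1::int)"
  have s3: "Poly_Mapping.keys (?S a b - ?S c d - ?S e h) \<subseteq> carrier A \<times> carrier B \<and>
     free_mult_map M i j (?S a b - ?S c d - ?S e h) = i a \<otimes>\<^bsub>M\<^esub> j b \<ominus>\<^bsub>M\<^esub> i c \<otimes>\<^bsub>M\<^esub> j d \<ominus>\<^bsub>M\<^esub> i e \<otimes>\<^bsub>M\<^esub> j h"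
    if "a \<in> carrier A" "b \<in> carrier B" "c \<in> carrier A" "d \<in> carrier B" "e \<in> carrier A" "h \<in> carrier B"
    for a b c d e h
  proof -
    have k: "Poly_Mapping.keys (?S a b - ?S c d) \<subseteq> carrier A \<times> carrier B"
      "Poly_Mapping.keys (?S a b - ?S c d - ?S e h) \<subseteq> carrier A \<times> carrier B"
      using that keys_diff[of "?S a b" "?S c d"] keys_diff[of "?S a b - ?S c d" "?S e h"]
      by (auto simp del: diff_diff_eq)
    show ?thesis using that k
      by (simp add: d s del: diff_diff_eq diff_diff_add)
  qed
  have s2: "Poly_Mapping.keys (?S a b - ?S c d) \<subseteq> carrier A \<times> carrier B \<and>
     free_mult_map M i j (?S a b - ?S c d) = i a \<otimes>\<^bsub>M\<^esub> j b \<ominus>\<^bsub>M\<^esub> i c \<otimes>\<^bsub>M\<^esub> j d"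
    if "a \<in> carrier A" "b \<in> carrier B" "c \<in> carrier A" "d \<in> carrier B" for a b c d
  proof -
    have k: "Poly_Mapping.keys (?S a b - ?S c d) \<subseteq> carrier A \<times> carrier B"
      using that keys_diff[of "?S a b" "?S c d"] by auto
    show ?thesis using that k
      by (simp add: d s)
  qed
  have gen: "Poly_Mapping.keys r \<subseteq> carrier A \<times> carrier B \<and> free_mult_map M i j r = \<zero>\<^bsub>M\<^esub>"
    if "r \<in> tensor_gens K f A g B" for r
    using that unfolding tensor_gens_def
  proof (elim UnE CollectE exE conjE)
    fix a a' b assume h: "a \<in> carrier A" "a' \<in> carrier A" "b \<in> carrier B"
      and r: "r = ?S (a \<oplus>\<^bsub>A\<^esub> a') b - ?S a b - ?S a' b"
    have "i (a \<oplus>\<^bsub>A\<^esub> a') \<otimes>\<^bsub>M\<^esub> j b \<ominus>\<^bsub>M\<^esub> i a \<otimes>\<^bsub>M\<^esub> j b \<ominus>\<^bsub>M\<^esub> i a' \<otimes>\<^bsub>M\<^esub> j b = \<zero>\<^bsub>M\<^esub>"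
      using h assms(4,5) ij[OF h(1,3)] ij[OF h(2,3)]
      by (simp add: ring_hom_add ring_hom_closed M.l_distr M.add_minus_minus)
    then show ?thesis using h unfolding r by (simp add: s3)
  next
    fix a b b' assume h: "a \<in> carrier A" "b \<in> carrier B" "b' \<in> carrier B"
      and r: "r = ?S a (b \<oplus>\<^bsub>B\<^esub> b') - ?S a b - ?S a b'"
    have "i a \<otimes>\<^bsub>M\<^esub> j (b \<oplus>\<^bsub>B\<^esub> b') \<ominus>\<^bsub>M\<^esub> i a \<otimes>\<^bsub>M\<^esub> j b \<ominus>\<^bsub>M\<^esub> i a \<otimes>\<^bsub>M\<^esub> j b' = \<zero>\<^bsub>M\<^esub>"
      using h assms(4,5) ij[OF h(1,2)] ij[OF h(1,3)]
      by (simp add: ring_hom_add ring_hom_closed M.r_distr M.add_minus_minus)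
    then show ?thesis using h unfolding r by (simp add: s3)
  next
    fix a k b assume h: "a \<in> carrier A" "k \<in> carrier K" "b \<in> carrier B"
      and r: "r = ?S (a \<otimes>\<^bsub>A\<^esub> f k) b - ?S a (g k \<otimes>\<^bsub>B\<^esub> b)"
    have c: "f k \<in> carrier A" "g k \<in> carrier B" "i (f k) = j (g k)" using assms(6)[OF h(2)] by auto
    have "i (a \<otimes>\<^bsub>A\<^esub> f k) \<otimes>\<^bsub>M\<^esub> j b = i a \<otimes>\<^bsub>M\<^esub> j (g k \<otimes>\<^bsub>B\<^esub> b)"
      using h c assms(4,5) by (simp add: ring_hom_mult ring_hom_closed M.m_assoc)
    moreover have "i a \<otimes>\<^bsub>M\<^esub> j (g k \<otimes>\<^bsub>B\<^esub> b) \<in> carrier M" using h c by (intro ij) auto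
    ultimately show ?thesis using h c unfolding r by (simp add: s2 a_minus_def M.r_neg)
  qed
  have z: "free_mult_map M i j 0 = \<zero>\<^bsub>M\<^esub>" by (simp add: free_mult_map_def)
  show ?thesis using assms(7) unfolding tensor_rels_def
  proof (induction rule: group_closure.induct)
    case (base r)
    then show ?case using gen[of r] z by auto
  next
    case (diff p q)
    have "Poly_Mapping.keys (p - q) \<subseteq> Poly_Mapping.keys p \<union> Poly_Mapping.keys q"
      by (auto simp: in_keys_iff lookup_minus)
    then show ?case using diff by (auto simp: d a_minus_def)
  qed
qed

lemma tensor_mult_map_coset:
  assumes "ring M" "ring A" "ring B" "i \<in> ring_hom A M" "j \<in> ring_hom B M"
    and "\<And>k. k \<in> carrier K \<Longrightarrow> f k \<in> carrier A \<and> g k \<in> carrier B \<and> i (f k) = j (g k)"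
    and "p \<in> carrier (free_ring A B)"
  shows "tensor_mult_map M i j (tensor_rels K f A g B +>\<^bsub>free_ring A B\<^esub> p) = free_mult_map M i j p"
proof -
  interpret M: ring M by fact
  have ij: "i a \<otimes>\<^bsub>M\<^esub> j b \<in> carrier M" if "a \<in> carrier A" "b \<in> carrier B" for a b
    using that assms(4,5) by (simp add: ring_hom_closed)
  have pk: "Poly_Mapping.keys p \<subseteq> carrier A \<times> carrier B" using assms(7) by (simp add: free_ring_def)
  have pc: "free_mult_map M i j p \<in> carrier M"
    unfolding free_mult_map_def using pk by (intro M.finsum_closed) (force intro: ij)
  have "free_mult_map M i j (r + p) = free_mult_map M i j p" if "r \<in> tensor_rels K f A g B" for r
  proof -
    have r: "Poly_Mapping.keys r \<subseteq> carrier A \<times> carrier B" "free_mult_map M i j r = \<zero>\<^bsub>M\<^esub>"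
      using free_mult_map_rels[OF assms(1-6) that] by auto
    have "free_mult_map M i j (r + p) = free_mult_map M i j r \<oplus>\<^bsub>M\<^esub> free_mult_map M i j p"
      by (rule M.free_mult_map_diff) (metis Un_iff ij mem_Times_iff subsetD r(1) pk)
    then show ?thesis using r(2) pc by simp
  qed
  moreover have "0 \<in> tensor_rels K f A g B" by (simp add: tensor_rels_def)
  ultimately have "free_mult_map M i j ` (tensor_rels K f A g B +>\<^bsub>free_ring A B\<^esub> p) = {free_mult_map M i j p}"
    unfolding a_r_coset_def r_coset_def by (fastforce simp: free_ring_def)
  then show ?thesis by (simp add: tensor_mult_map_def)
qed

lemma tensor_mult_map_pure:
  assumes "ring M" "ring A" "ring B" "i \<in> ring_hom A M" "j \<in> ring_hom B M"
    and "\<And>k. k \<in> carrier K \<Longrightarrow> f k \<in> carrier A \<and> g k \<in> carrier B \<and> i (f k) = j (g k)"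
    and "a \<in> carrier A" "b \<in> carrier B"
  shows "tensor_mult_map M i j (pure_tensor K f A g B a b) = i a \<otimes>\<^bsub>M\<^esub> j b"
proof -
  interpret M: ring M by fact
  show ?thesis unfolding pure_tensor_def
    using assms by (subst tensor_mult_map_coset)
      (auto simp: free_ring_def ring_hom_closed M.free_mult_map_single)
qed


section \<open>Root systems\<close>

definition reflection :: "'v::euclidean_space \<Rightarrow> 'v \<Rightarrow> 'v" where
  "reflection a v = v - (2 * (v \<bullet> a) / (a \<bullet> a)) *\<^sub>R a"

definition coroot :: "'v::euclidean_space \<Rightarrow> 'v" where
  "coroot a = (2 / (a \<bullet> a)) *\<^sub>R a"

text \<open>Reduced crystallographic root systems that span the ambient Euclidean space.\<close>

definition root_system :: "'v::euclidean_space set \<Rightarrow> bool" where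
  "root_system \<Phi> \<longleftrightarrow> finite \<Phi> \<and> 0 \<notin> \<Phi> \<and> Real_Vector_Spaces.span \<Phi> = UNIV \<and>
     (\<forall>a\<in>\<Phi>. \<forall>b\<in>\<Phi>. reflection a b \<in> \<Phi>) \<and>
     (\<forall>a\<in>\<Phi>. \<forall>b\<in>\<Phi>. 2 * (b \<bullet> a) / (a \<bullet> a) \<in> \<int>) \<and>
     (\<forall>a\<in>\<Phi>. \<forall>c. c *\<^sub>R a \<in> \<Phi> \<longrightarrow> c = 1 \<or> c = - 1)"

definition irreducible_root_system :: "'v::euclidean_space set \<Rightarrow> bool" where
  "irreducible_root_system \<Phi> \<longleftrightarrow> root_system \<Phi> \<and>
     \<not> (\<exists>A B. A \<noteq> {} \<and> B \<noteq> {} \<and> A \<inter> B = {} \<and> A \<union> B = \<Phi> \<and> (\<forall>a\<in>A. \<forall>b\<in>B. a \<bullet> b = 0))"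

definition simple_roots :: "'v::euclidean_space set \<Rightarrow> nat \<Rightarrow> (nat \<Rightarrow> 'v) \<Rightarrow> bool" where
  "simple_roots \<Phi> n \<alpha> \<longleftrightarrow> inj_on \<alpha> {1..n} \<and> \<alpha> ` {1..n} \<subseteq> \<Phi> \<and> independent (\<alpha> ` {1..n}) \<and>
     (\<forall>b\<in>\<Phi>. \<exists>c :: nat \<Rightarrow> nat. b = (\<Sum>i=1..n. real (c i) *\<^sub>R \<alpha> i) \<or>
                               b = - (\<Sum>i=1..n. real (c i) *\<^sub>R \<alpha> i))"

definition highest_root :: "'v::euclidean_space set \<Rightarrow> nat \<Rightarrow> (nat \<Rightarrow> 'v) \<Rightarrow> 'v \<Rightarrow> bool" where
  "highest_root \<Phi> n \<alpha> \<theta> \<longleftrightarrow> \<theta> \<in> \<Phi> \<and>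
     (\<forall>b\<in>\<Phi>. \<exists>c :: nat \<Rightarrow> nat. \<theta> - b = (\<Sum>i=1..n. real (c i) *\<^sub>R \<alpha> i))"

definition root_lattice :: "'v::euclidean_space set \<Rightarrow> 'v set" where
  "root_lattice \<Phi> = group_closure \<Phi>"

definition coroot_lattice :: "'v::euclidean_space set \<Rightarrow> 'v set" where
  "coroot_lattice \<Phi> = group_closure (coroot ` \<Phi>)"

definition weyl_group :: "'v::euclidean_space set \<Rightarrow> ('v \<Rightarrow> 'v) set" where
  "weyl_group \<Phi> = generate (BijGroup UNIV) (reflection ` \<Phi>)"

text \<open>\<open>W\<^sub>a = Q\<^sup>\<or> \<rtimes> W\<close>; the pair \<open>(l, w)\<close> stands for \<open>t\<^sub>l w\<close>.\<close>

definition affine_weyl_group :: "'v::euclidean_space set \<Rightarrow> ('v \<times> ('v \<Rightarrow> 'v)) monoid" where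
  "affine_weyl_group \<Phi> =
    \<lparr>carrier = coroot_lattice \<Phi> \<times> weyl_group \<Phi>,
     monoid.mult = (\<lambda>(l, w) (l', w'). (l + w l', w \<circ> w')),
     one = (0, id)\<rparr>"


section \<open>Formal affine Demazure algebras\<close>

definition S_ring ::
  "(nat \<Rightarrow> nat \<Rightarrow> 'r::comm_ring_1) \<Rightarrow> 'v::euclidean_space set \<Rightarrow> ('v, 'r) mps set ring" where
  "S_ring F \<Phi> = fga F (root_lattice \<Phi>)"

definition S_var ::
  "(nat \<Rightarrow> nat \<Rightarrow> 'r::comm_ring_1) \<Rightarrow> 'v::euclidean_space set \<Rightarrow> 'v \<Rightarrow> ('v, 'r) mps set" where
  "S_var F \<Phi> = fga_var F (root_lattice \<Phi>)"

definition S_invariants ::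
  "(nat \<Rightarrow> nat \<Rightarrow> 'r::comm_ring_1) \<Rightarrow> 'v::euclidean_space set \<Rightarrow> ('v, 'r) mps set ring" where
  "S_invariants F \<Phi> =
     (S_ring F \<Phi>)\<lparr>carrier := {s \<in> carrier (S_ring F \<Phi>). \<forall>w\<in>weyl_group \<Phi>. fga_act w s = s}\<rparr>"

definition root_denoms ::
  "(nat \<Rightarrow> nat \<Rightarrow> 'r::comm_ring_1) \<Rightarrow> 'v::euclidean_space set \<Rightarrow> ('v, 'r) mps set set" where
  "root_denoms F \<Phi> = mult_closure (S_ring F \<Phi>) (S_var F \<Phi> ` \<Phi>)"

definition Q_frac ::
  "(nat \<Rightarrow> nat \<Rightarrow> 'r::comm_ring_1) \<Rightarrow> 'v::euclidean_space set \<Rightarrow>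
     ('v, 'r) mps set \<Rightarrow> ('v, 'r) mps set \<Rightarrow> ('v, 'r) mps set frac" where
  "Q_frac F \<Phi> = fraction (S_ring F \<Phi>) (root_denoms F \<Phi>)"

definition Q_ring ::
  "(nat \<Rightarrow> nat \<Rightarrow> 'r::comm_ring_1) \<Rightarrow> 'v::euclidean_space set \<Rightarrow> ('v, 'r) mps set frac ring" where
  "Q_ring F \<Phi> = localization (S_ring F \<Phi>) (root_denoms F \<Phi>)"

text \<open>Translations act trivially, so \<open>t\<^sub>l w\<close> maps \<open>a / s\<close> to \<open>w a / w s\<close>.\<close>

definition Q_act ::
  "'v \<times> ('v \<Rightarrow> 'v) \<Rightarrow> ('v, 'r) mps set frac \<Rightarrow> ('v, 'r) mps set frac" where
  "Q_act u c = map_prod (fga_act (snd u)) (fga_act (snd u)) ` c"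

type_synonym ('v, 'r) qwa = "'v \<times> ('v \<Rightarrow> 'v) \<Rightarrow> ('v, 'r) mps set frac"

definition Q_Wa ::
  "(nat \<Rightarrow> nat \<Rightarrow> 'r::comm_ring_1) \<Rightarrow> 'v::euclidean_space set \<Rightarrow> ('v, 'r) qwa ring" where
  "Q_Wa F \<Phi> = twisted_group_ring (Q_ring F \<Phi>) (affine_weyl_group \<Phi>) Q_act"

definition eta ::
  "(nat \<Rightarrow> nat \<Rightarrow> 'r::comm_ring_1) \<Rightarrow> 'v::euclidean_space set \<Rightarrow> 'v \<times> ('v \<Rightarrow> 'v) \<Rightarrow> ('v, 'r) qwa" where
  "eta F \<Phi> u = tw_elem (Q_ring F \<Phi>) \<one>\<^bsub>Q_ring F \<Phi>\<^esub> u"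

definition Q_emb ::
  "(nat \<Rightarrow> nat \<Rightarrow> 'r::comm_ring_1) \<Rightarrow> 'v::euclidean_space set \<Rightarrow>
     ('v, 'r) mps set frac \<Rightarrow> ('v, 'r) qwa" where
  "Q_emb F \<Phi> c = tw_elem (Q_ring F \<Phi>) c \<one>\<^bsub>affine_weyl_group \<Phi>\<^esub>"

definition S_emb ::
  "(nat \<Rightarrow> nat \<Rightarrow> 'r::comm_ring_1) \<Rightarrow> 'v::euclidean_space set \<Rightarrow>
     ('v, 'r) mps set \<Rightarrow> ('v, 'r) qwa" where
  "S_emb F \<Phi> s = Q_emb F \<Phi> (Q_frac F \<Phi> s \<one>\<^bsub>S_ring F \<Phi>\<^esub>)"

definition X_elem ::
  "(nat \<Rightarrow> nat \<Rightarrow> 'r::comm_ring_1) \<Rightarrow> 'v::euclidean_space set \<Rightarrow> (nat \<Rightarrow> 'v) \<Rightarrow> 'v \<Rightarrow> nat \<Rightarrow>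
     ('v, 'r) qwa" where
  "X_elem F \<Phi> \<alpha> \<theta> i =
     (let root = (if i = 0 then - \<theta> else \<alpha> i);
          s = (if i = 0 then (coroot \<theta>, reflection \<theta>) else (0, reflection (\<alpha> i)))
      in Q_emb F \<Phi> (Q_frac F \<Phi> \<one>\<^bsub>S_ring F \<Phi>\<^esub> (S_var F \<Phi> root))
           \<otimes>\<^bsub>Q_Wa F \<Phi>\<^esub> (\<one>\<^bsub>Q_Wa F \<Phi>\<^esub> \<ominus>\<^bsub>Q_Wa F \<Phi>\<^esub> eta F \<Phi> s))"

definition D_Wa ::
  "(nat \<Rightarrow> nat \<Rightarrow> 'r::comm_ring_1) \<Rightarrow> 'v::euclidean_space set \<Rightarrow> nat \<Rightarrow> (nat \<Rightarrow> 'v) \<Rightarrow> 'v \<Rightarrow>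
     ('v, 'r) qwa ring" where
  "D_Wa F \<Phi> n \<alpha> \<theta> = (Q_Wa F \<Phi>)\<lparr>carrier := generate_ring (Q_Wa F \<Phi>)
     (S_emb F \<Phi> ` carrier (S_ring F \<Phi>) \<union> X_elem F \<Phi> \<alpha> \<theta> ` {0..n})\<rparr>"

definition D_W ::
  "(nat \<Rightarrow> nat \<Rightarrow> 'r::comm_ring_1) \<Rightarrow> 'v::euclidean_space set \<Rightarrow> nat \<Rightarrow> (nat \<Rightarrow> 'v) \<Rightarrow> 'v \<Rightarrow>
     ('v, 'r) qwa ring" where
  "D_W F \<Phi> n \<alpha> \<theta> = (Q_Wa F \<Phi>)\<lparr>carrier := generate_ring (Q_Wa F \<Phi>)
     (S_emb F \<Phi> ` carrier (S_ring F \<Phi>) \<union> X_elem F \<Phi> \<alpha> \<theta> ` {1..n})\<rparr>"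

text \<open>Elements of \<open>\<Q>\<^bsub>Q\<^sup>\<or>\<^esub>\<close> are represented by their coefficient functions on the coroot lattice.\<close>

definition pr ::
  "(nat \<Rightarrow> nat \<Rightarrow> 'r::comm_ring_1) \<Rightarrow> 'v::euclidean_space set \<Rightarrow> ('v, 'r) qwa \<Rightarrow>
     ('v \<Rightarrow> ('v, 'r) mps set frac)" where
  "pr F \<Phi> f = (\<lambda>l. \<Oplus>\<^bsub>Q_ring F \<Phi>\<^esub>w\<in>weyl_group \<Phi>. f (l, w))"

definition imath ::
  "(nat \<Rightarrow> nat \<Rightarrow> 'r::comm_ring_1) \<Rightarrow> 'v::euclidean_space set \<Rightarrow>
     ('v \<Rightarrow> ('v, 'r) mps set frac) \<Rightarrow> ('v, 'r) qwa" where
  "imath F \<Phi> g = (\<lambda>(l, w). if w = id then g l else \<zero>\<^bsub>Q_ring F \<Phi>\<^esub>)"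

definition D_Qv ::
  "(nat \<Rightarrow> nat \<Rightarrow> 'r::comm_ring_1) \<Rightarrow> 'v::euclidean_space set \<Rightarrow> nat \<Rightarrow> (nat \<Rightarrow> 'v) \<Rightarrow> 'v \<Rightarrow>
     ('v, 'r) qwa ring" where
  "D_Qv F \<Phi> n \<alpha> \<theta> =
     (Q_Wa F \<Phi>)\<lparr>carrier := imath F \<Phi> ` pr F \<Phi> ` carrier (D_Wa F \<Phi> n \<alpha> \<theta>)\<rparr>"

definition Z_Wa ::
  "(nat \<Rightarrow> nat \<Rightarrow> 'r::comm_ring_1) \<Rightarrow> 'v::euclidean_space set \<Rightarrow> nat \<Rightarrow> (nat \<Rightarrow> 'v) \<Rightarrow> 'v \<Rightarrow>
     ('v, 'r) qwa ring" where
  "Z_Wa F \<Phi> n \<alpha> \<theta> = (Q_Wa F \<Phi>)\<lparr>carrier := ring_centre (D_Wa F \<Phi> n \<alpha> \<theta>)\<rparr>"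

definition S_tensor_Z ::
  "(nat \<Rightarrow> nat \<Rightarrow> 'r::comm_ring_1) \<Rightarrow> 'v::euclidean_space set \<Rightarrow> nat \<Rightarrow> (nat \<Rightarrow> 'v) \<Rightarrow> 'v \<Rightarrow>
     ((('v, 'r) mps set \<times> ('v, 'r) qwa) \<Rightarrow>\<^sub>0 int) set ring" where
  "S_tensor_Z F \<Phi> n \<alpha> \<theta> =
     tensor_ring (S_invariants F \<Phi>) (\<lambda>s. s) (S_ring F \<Phi>) (S_emb F \<Phi>) (Z_Wa F \<Phi> n \<alpha> \<theta>)"

definition D_W_tensor_Z ::
  "(nat \<Rightarrow> nat \<Rightarrow> 'r::comm_ring_1) \<Rightarrow> 'v::euclidean_space set \<Rightarrow> nat \<Rightarrow> (nat \<Rightarrow> 'v) \<Rightarrow> 'v \<Rightarrow>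
     ((('v, 'r) qwa \<times> ('v, 'r) qwa) \<Rightarrow>\<^sub>0 int) set ring" where
  "D_W_tensor_Z F \<Phi> n \<alpha> \<theta> =
     tensor_ring (S_invariants F \<Phi>) (S_emb F \<Phi>) (D_W F \<Phi> n \<alpha> \<theta>) (S_emb F \<Phi>) (Z_Wa F \<Phi> n \<alpha> \<theta>)"

definition Theta ::
  "(nat \<Rightarrow> nat \<Rightarrow> 'r::comm_ring_1) \<Rightarrow> 'v::euclidean_space set \<Rightarrow>
     ((('v, 'r) mps set \<times> ('v, 'r) qwa) \<Rightarrow>\<^sub>0 int) set \<Rightarrow> ('v, 'r) qwa" where
  "Theta F \<Phi> = tensor_mult_map (Q_Wa F \<Phi>) (S_emb F \<Phi>) (\<lambda>z. z)"

definition Xi ::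
  "(nat \<Rightarrow> nat \<Rightarrow> 'r::comm_ring_1) \<Rightarrow> 'v::euclidean_space set \<Rightarrow>
     ((('v, 'r) qwa \<times> ('v, 'r) qwa) \<Rightarrow>\<^sub>0 int) set \<Rightarrow> ('v, 'r) qwa" where
  "Xi F \<Phi> = tensor_mult_map (Q_Wa F \<Phi>) (\<lambda>d. d) (\<lambda>z. z)"

end

theory Submission
  imports Defs "HOL-Computational_Algebra.Formal_Power_Series"

begin

text \<open>
  Over \<open>\<rat>\<close> the formal group law has a logarithm. It turns the variables \<open>x\<^sub>\<lambda>\<close> into additive elements
  \<open>lg \<lambda>\<close> of \<open>S\<close>, each a unit multiple of \<open>x\<^sub>\<lambda>\<close>. Consequently \<open>S\<close> is preserved by the divided
  differences, and the \<open>lg\<close> separate the elements of \<open>W\<close> after inverting the roots.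

  Let \<open>e\<close> be the average of the \<open>\<eta>\<^sub>w\<close> over \<open>w \<in> W\<close>, and \<open>P = \<imath> \<circ> pr\<close>. Long words in the divided differences
  attached to \<open>lg\<close> kill all products of few logarithms, hence vanish, since an operator supported
  on \<open>W\<close> is determined by its values on such products. By descending induction on the length of the
  word, the two-sided ideal generated by \<open>e\<close> in \<open>D\<^sub>W\<close> contains 1, that is,
  \<open>1 = \<Sum>\<^sub>k a\<^sub>k e d\<^sub>k\<close> with \<open>a\<^sub>k \<in> S\<close> and \<open>d\<^sub>k \<in> D\<^sub>W\<close>.

  For \<open>y \<in> D\<close>, the affine algebra, \<open>P (e y)\<close> is central, it lies in \<open>D\<close> by the formula for 1, and it is
  linear in \<open>y\<close> over the centre. Then \<open>P y = \<Sum>\<^sub>k a\<^sub>k P (e d\<^sub>k y)\<close>, and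
  \<open>y = \<Sum>\<^sub>k\<^sub>,\<^sub>l a\<^sub>l e d\<^sub>k P (e d\<^sub>l y a\<^sub>k)\<close>. So \<open>a\<^sub>k\<close> and \<open>P (e d\<^sub>k _)\<close> form a pair of dual bases of \<open>S\<close> over
  \<open>S\<^sup>W\<close> and of \<open>D\<^bsub>Q\<^sup>\<or>\<^esub>\<close> over the centre at the same time, and similarly for \<open>D\<^sub>W\<close> and \<open>D\<close>; such a simultaneous dual
  basis inverts the multiplication map.
\<close>


section \<open>Power series as a type\<close>

text \<open>R is an arbitrary commutative ring containing the rationals, possibly with zero
  divisors, so no structure theorem for S over its invariants is invoked. What survives is a finite
  dual basis, and the decomposition of 1 provides it. The same decomposition shows that the Peterson
  algebra lies in D and is a ring.

  For a general F the operators X_i need not respect any degree on S. Rescaled by the unit x / lg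
  they become additive divided differences, and these do: counting logarithms in a product is the
  grading that makes long words vanish.

  The rationals enter in three places: integrating the invariant differential to a logarithm,
  averaging over W, and inverting the integer m in w x - u x = m b when two Weyl group elements are
  separated.

  Completeness is the other recurring concern. A power series is an infinite sum of monomials, so
  each passage from polynomials to series, in evaluation, in congruences and in divided differences,
  is controlled by the order of vanishing.\<close>

text \<open>
  Convolution makes the type of all coefficient functions, with no support condition, a commutative
  ring; \<^const>\<open>mps_ring\<close> is a subring, and identities between its elements can be checked here.
\<close>

typedef ('v, 'r) ps = "UNIV :: (('v \<Rightarrow>\<^sub>0 nat) \<Rightarrow> 'r) set"
  morphisms coef Ps by auto

lemma coef_Ps [simp]: "coef (Ps f) = f"
  by (simp add: Ps_inverse)

lemma ps_eqI: "(\<And>m. coef f m = coef g m) \<Longrightarrow> f = g"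
  by (simp add: coef_inject[symmetric] fun_eq_iff)

lemma finite_below: "finite {a :: 'v \<Rightarrow>\<^sub>0 nat. \<forall>v. Poly_Mapping.lookup a v \<le> Poly_Mapping.lookup m v}"
  (is "finite ?A")
proof -
  let ?K = "Poly_Mapping.keys m"
  define B where "B = (\<Sum>v\<in>?K. Poly_Mapping.lookup m v)"
  let ?F = "{f :: 'v \<Rightarrow> nat. \<forall>x. (x \<in> ?K \<longrightarrow> f x \<in> {..B}) \<and> (x \<notin> ?K \<longrightarrow> f x = 0)}"
  have "finite ?F" by (rule finite_set_of_finite_funs) auto
  moreover have "Poly_Mapping.lookup ` ?A \<subseteq> ?F"
  proof (rule image_subsetI)
    fix a assume a: "a \<in> ?A"
    have "Poly_Mapping.lookup a x \<in> {..B}" if "x \<in> ?K" for x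
    proof -
      have "Poly_Mapping.lookup m x \<le> B" unfolding B_def using that by (intro member_le_sum) auto
      moreover have "Poly_Mapping.lookup a x \<le> Poly_Mapping.lookup m x" using a by blast
      ultimately show ?thesis by simp
    qed
    moreover have "Poly_Mapping.lookup a x = 0" if "x \<notin> ?K" for x
    proof -
      have "Poly_Mapping.lookup a x \<le> Poly_Mapping.lookup m x" using a by blast
      then show ?thesis using that by (simp add: in_keys_iff)
    qed
    ultimately show "Poly_Mapping.lookup a \<in> ?F" by blast
  qed
  ultimately have "finite (Poly_Mapping.lookup ` ?A)" by (rule rev_finite_subset)
  then show ?thesis by (rule finite_imageD) (auto intro!: inj_onI simp: lookup_inject)
qed

lemma finite_splits [simp]: "finite {(a, b). a + b = (m :: 'v \<Rightarrow>\<^sub>0 nat)}"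
proof -
  let ?A = "{a :: 'v \<Rightarrow>\<^sub>0 nat. \<forall>v. Poly_Mapping.lookup a v \<le> Poly_Mapping.lookup m v}"
  have "{(a, b). a + b = m} \<subseteq> ?A \<times> ?A" by (auto simp: lookup_add)
  then show ?thesis using finite_below finite_subset by blast
qed

lemma sum_splits_swap: "(\<Sum>(a, b)\<in>{(a, b). a + b = (m :: 'v \<Rightarrow>\<^sub>0 nat)}. f a b) =
    (\<Sum>(a, b)\<in>{(a, b). a + b = m}. f b a)"
  by (rule sum.reindex_bij_witness[of _ "\<lambda>(a, b). (b, a)" "\<lambda>(a, b). (b, a)"]) (auto simp: add.commute)

lemma sum_splits_zero: "(\<Sum>(a, b)\<in>{(a, b). a + b = (m :: 'v \<Rightarrow>\<^sub>0 nat)}. if a = 0 then f b else 0) = f m"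
proof -
  have "(\<Sum>(a, b)\<in>{(a, b). a + b = m}. if a = 0 then f b else 0) =
      (\<Sum>(a, b)\<in>{(0 :: 'v \<Rightarrow>\<^sub>0 nat, m)}. if a = 0 then f b else 0)"
    by (rule sum.mono_neutral_right) (use finite_splits[of m] in \<open>auto split: if_splits\<close>)
  then show ?thesis by simp
qed

lemma sum_splits_assoc:
  "(\<Sum>(ab, c)\<in>{(ab, c). ab + c = (m :: 'v \<Rightarrow>\<^sub>0 nat)}. \<Sum>(a, b)\<in>{(a, b). a + b = ab}. f a b c) =
   (\<Sum>(a, bc)\<in>{(a, bc). a + bc = m}. \<Sum>(b, c)\<in>{(b, c). b + c = bc}. f a b c)"
proof -
  let ?S = "\<lambda>m :: 'v \<Rightarrow>\<^sub>0 nat. {(a, b). a + b = m}"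
  have "(\<Sum>(ab, c)\<in>?S m. \<Sum>(a, b)\<in>?S ab. f a b c) =
      (\<Sum>p\<in>?S m. \<Sum>q\<in>?S (fst p). f (fst q) (snd q) (snd p))" by (simp add: case_prod_unfold)
  also have "\<dots> = (\<Sum>(p, q)\<in>Sigma (?S m) (\<lambda>p. ?S (fst p)). f (fst q) (snd q) (snd p))"
    by (subst sum.Sigma) (use finite_splits in \<open>auto simp: case_prod_unfold\<close>)
  also have "\<dots> = (\<Sum>(p, q)\<in>Sigma (?S m) (\<lambda>p. ?S (snd p)). f (fst p) (fst q) (snd q))"
    by (rule sum.reindex_bij_witness[of _ "\<lambda>((a, bc), (b, c)). ((a + b, c), (a, b))"
          "\<lambda>((ab, c), (a, b)). ((a, b + c), (b, c))"]) (auto simp: add.assoc)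
  also have "\<dots> = (\<Sum>p\<in>?S m. \<Sum>q\<in>?S (snd p). f (fst p) (fst q) (snd q))"
    by (subst sum.Sigma) (use finite_splits in \<open>auto simp: case_prod_unfold\<close>)
  finally show ?thesis by (simp add: case_prod_unfold)
qed

instantiation ps :: (type, comm_ring_1) comm_ring_1
begin

definition "0 = Ps (\<lambda>m. 0)"
definition "1 = Ps (\<lambda>m. if m = 0 then 1 else 0)"
definition "f + g = Ps (\<lambda>m. coef f m + coef g m)"
definition "f - g = Ps (\<lambda>m. coef f m - coef g m)"
definition "- f = Ps (\<lambda>m. - coef f m)"
definition "f * g = Ps (\<lambda>m. \<Sum>(a, b)\<in>{(a, b). a + b = m}. coef f a * coef g b)"

instance
proof
  fix a b c :: "('a, 'b) ps"
  show "a * b * c = a * (b * c)"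
  proof (rule ps_eqI)
    fix m
    have "coef (a * b * c) m = (\<Sum>(u, w)\<in>{(u, w). u + w = m}. \<Sum>(p, q)\<in>{(p, q). p + q = u}. coef a p * coef b q * coef c w)"
      by (simp add: times_ps_def sum_distrib_right case_prod_unfold)
    also have "\<dots> = (\<Sum>(u, w)\<in>{(u, w). u + w = m}. \<Sum>(p, q)\<in>{(p, q). p + q = w}. coef a u * coef b p * coef c q)"
      by (rule sum_splits_assoc)
    also have "\<dots> = coef (a * (b * c)) m"
      by (simp add: times_ps_def sum_distrib_left case_prod_unfold mult.assoc)
    finally show "coef (a * b * c) m = coef (a * (b * c)) m" .
  qed
  show "a * b = b * a"
    by (rule ps_eqI) (simp add: times_ps_def, subst sum_splits_swap, simp add: mult.commute)
  show "1 * a = a"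
  proof (rule ps_eqI)
    fix m
    have "coef (1 * a) m = (\<Sum>(u, v)\<in>{(u, v). u + v = m}. if u = 0 then coef a v else 0)"
      unfolding times_ps_def one_ps_def by (auto intro!: sum.cong)
    then show "coef (1 * a) m = coef a m" by (simp add: sum_splits_zero)
  qed
  show "(a + b) * c = a * c + b * c"
    by (rule ps_eqI) (simp add: times_ps_def plus_ps_def sum.distrib distrib_right case_prod_unfold)
  show "(0 :: ('a, 'b) ps) \<noteq> 1"
    by (simp add: zero_ps_def one_ps_def Ps_inject fun_eq_iff)
qed (auto intro!: ps_eqI simp: plus_ps_def zero_ps_def uminus_ps_def minus_ps_def algebra_simps)

end

lemma coef_simps [simp]:
  "coef 0 m = 0" "coef 1 m = (if m = 0 then 1 else 0)" "coef (f + g) m = coef f m + coef g m"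
  "coef (f - g) m = coef f m - coef g m" "coef (- f) m = - coef f m"
  by (simp_all add: zero_ps_def one_ps_def plus_ps_def minus_ps_def uminus_ps_def)

lemma coef_mult: "coef (f * g) m = (\<Sum>(a, b)\<in>{(a, b). a + b = m}. coef f a * coef g b)"
  by (simp add: times_ps_def)

lemma coef_sum [simp]: "coef (sum f A) m = (\<Sum>i\<in>A. coef (f i) m)"
  by (induction A rule: infinite_finite_induct) auto

definition cst :: "'r::comm_ring_1 \<Rightarrow> ('v, 'r) ps" where
  "cst r = Ps (\<lambda>m. if m = 0 then r else 0)"

lemma coef_cst: "coef (cst r) m = (if m = 0 then r else 0)"
  by (simp add: cst_def)

lemma coef_cst_mult [simp]: "coef (cst r * f) m = r * coef f m"
proof -
  have "coef (cst r * f) m = (\<Sum>(u, v)\<in>{(u, v). u + v = m}. if u = 0 then r * coef f v else 0)"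
    unfolding coef_mult cst_def by (auto intro!: sum.cong)
  then show ?thesis by (simp add: sum_splits_zero)
qed

lemma cst_hom: "cst 0 = 0" "cst 1 = 1" "cst (r + s) = cst r + cst s" "cst (r * s) = cst r * cst s"
  by (auto intro!: ps_eqI simp: coef_cst)

lemma cst_sum: "cst (sum f A) = (\<Sum>i\<in>A. cst (f i))"
  by (induction A rule: infinite_finite_induct) (auto simp: cst_hom)

lemma cst_of_nat: "cst (of_nat n) = of_nat n"
  by (induction n) (auto simp: cst_hom)

definition var :: "'v \<Rightarrow> ('v, 'r::comm_ring_1) ps" where
  "var v = Ps (mps_var v)"

lemma coef_var: "coef (var v) m = (if m = Poly_Mapping.single v 1 then 1 else 0)"
  by (simp add: var_def mps_var_def)


subsection \<open>Order of vanishing\<close>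

lemma mdeg_superset:
  "finite A \<Longrightarrow> Poly_Mapping.keys m \<subseteq> A \<Longrightarrow> mdeg m = (\<Sum>v\<in>A. Poly_Mapping.lookup m v)"
  unfolding mdeg_def by (rule sum.mono_neutral_left) (auto simp: in_keys_iff)

lemma mdeg_add [simp]: "mdeg (a + b) = mdeg a + mdeg b"
proof -
  let ?K = "Poly_Mapping.keys a \<union> Poly_Mapping.keys b"
  have "mdeg (a + b) = (\<Sum>v\<in>?K. Poly_Mapping.lookup (a + b) v)"
    using keys_add[of a b] by (intro mdeg_superset) auto
  then show ?thesis by (simp add: lookup_add sum.distrib mdeg_superset[of ?K])
qed

lemma mdeg_0 [simp]: "mdeg 0 = 0" by (simp add: mdeg_def)

lemma mdeg_single [simp]: "mdeg (Poly_Mapping.single v k) = k"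
  by (subst mdeg_superset[of "{v}"]) auto

lemma mdeg_eq_0 [simp]: "mdeg m = 0 \<longleftrightarrow> m = 0"
  by (auto simp: mdeg_def in_keys_iff intro!: poly_mapping_eqI)

definition ordge :: "nat \<Rightarrow> ('v, 'r::comm_ring_1) ps \<Rightarrow> bool" where
  "ordge d f \<longleftrightarrow> (\<forall>m. mdeg m < d \<longrightarrow> coef f m = 0)"

lemma ordge_0 [simp]: "ordge 0 f" "ordge d 0"
  by (auto simp: ordge_def)

lemma ordge_add: "ordge d f \<Longrightarrow> ordge d g \<Longrightarrow> ordge d (f + g)"
  by (simp add: ordge_def)

lemma ordge_diff: "ordge d f \<Longrightarrow> ordge d g \<Longrightarrow> ordge d (f - g)"
  by (simp add: ordge_def)

lemma ordge_sum: "(\<And>i. i \<in> A \<Longrightarrow> ordge d (f i)) \<Longrightarrow> ordge d (sum f A)"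
  by (auto simp: ordge_def)

lemma ordge_mono: "ordge d f \<Longrightarrow> e \<le> d \<Longrightarrow> ordge e f"
  by (auto simp: ordge_def)

lemma ordge_mult:
  assumes "ordge d f" "ordge e g" shows "ordge (d + e) (f * g)"
  unfolding ordge_def
proof (intro allI impI)
  fix m :: "'a \<Rightarrow>\<^sub>0 nat" assume m: "mdeg m < d + e"
  have "coef f a * coef g b = 0" if "a + b = m" for a b
  proof (cases "mdeg a < d")
    case False
    then have "mdeg b < e" using m that by auto
    then show ?thesis using assms(2) by (simp add: ordge_def)
  qed (use assms(1) in \<open>simp add: ordge_def\<close>)
  then show "coef (f * g) m = 0" by (auto simp: coef_mult intro!: sum.neutral)
qed

lemma ordge_mult_left: "ordge d f \<Longrightarrow> ordge d (g * f)"
  using ordge_mult[of 0 g d f] by simp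

lemma ordge_mult_right: "ordge d f \<Longrightarrow> ordge d (f * g)"
  using ordge_mult[of d f 0 g] by simp

lemma ordge_power: "ordge (Suc 0) p \<Longrightarrow> ordge n (p ^ n)"
  by (induction n) (use ordge_mult[of "Suc 0" p] in auto)

lemma ordge_var: "ordge (Suc 0) (var v)"
  by (simp add: ordge_def coef_var) (metis mdeg_0 mdeg_single nat.distinct(1))

lemma ordge_eqI:
  assumes "\<And>d. ordge d (f - g)" shows "f = g"
proof (rule ps_eqI)
  fix m show "coef f m = coef g m" using assms[of "Suc (mdeg m)"] by (auto simp: ordge_def)
qed

text \<open>The infinite sum of the \<open>f i\<close>. Cutting off at \<open>mdeg m\<close> loses
  nothing when \<open>f i\<close> vanishes to order \<open>i\<close>, the convergence condition
  carried by the lemmas below.\<close>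

definition isum :: "(nat \<Rightarrow> ('v, 'r::comm_ring_1) ps) \<Rightarrow> ('v, 'r) ps" where
  "isum f = Ps (\<lambda>m. \<Sum>i\<le>mdeg m. coef (f i) m)"

lemma isum_approx:
  assumes "\<And>i. ordge i (f i)"
  shows "ordge d (isum f - (\<Sum>i<d. f i))"
  unfolding ordge_def
proof (intro allI impI)
  fix m :: "'a \<Rightarrow>\<^sub>0 nat" assume "mdeg m < d"
  then have "(\<Sum>i<d. coef (f i) m) = (\<Sum>i\<le>mdeg m. coef (f i) m)"
    using assms by (intro sum.mono_neutral_right) (auto simp: ordge_def)
  then show "coef (isum f - (\<Sum>i<d. f i)) m = 0" by (simp add: isum_def)
qed

text \<open>The sum is the only series congruent to all partial sums, because a series of infinite
  order of vanishing is 0. Identities of infinite sums are later checked on partial sums in this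
  way.\<close>

lemma isum_eqI:
  assumes "\<And>i. ordge i (f i)" "\<And>d. ordge d (g - (\<Sum>i<d. f i))"
  shows "g = isum f"
proof (rule ordge_eqI)
  fix d show "ordge d (g - isum f)"
    using ordge_diff[OF assms(2)[of d] isum_approx[of f d, OF assms(1)]] by simp
qed

text \<open>Additive maps that respect the order of vanishing are continuous for the topology it
  defines, so they pass through infinite sums.\<close>

lemma isum_map:
  assumes "\<And>i. ordge i (f i)" "\<And>f g. T (f - g) = T f - T g" "\<And>d f. ordge d f \<Longrightarrow> ordge d (T f)"
  shows "T (isum f) = isum (\<lambda>i. T (f i))"
proof (rule isum_eqI)
  have 0: "T 0 = 0" using assms(2)[of 0 0] by simp
  have m: "T (- f) = - T f" for f using assms(2)[of 0 f] 0 by simp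
  have a: "T (f + g) = T f + T g" for f g using assms(2)[of f "- g"] m by simp
  have s: "T (sum f A) = (\<Sum>i\<in>A. T (f i))" for f and A :: "nat set"
    by (induction A rule: infinite_finite_induct) (auto simp: 0 a)
  show "ordge d (T (isum f) - (\<Sum>i<d. T (f i)))" for d
    using assms(3)[OF isum_approx[of f d, OF assms(1)]] by (simp add: assms(2) s)
qed (use assms in auto)

lemma isum_mult: "(\<And>i. ordge i (f i)) \<Longrightarrow> g * isum f = isum (\<lambda>i. g * f i)"
  by (rule isum_map) (auto simp: right_diff_distrib ordge_mult_left)


subsection \<open>Evaluation of one-variable series\<close>

text \<open>The coefficients are series rather than scalars, so that F(p, q) arises by iterating
  this one-variable evaluation (\<open>ev2\<close>).\<close>

definition ev :: "(nat \<Rightarrow> ('v, 'r::comm_ring_1) ps) \<Rightarrow> ('v, 'r) ps \<Rightarrow> ('v, 'r) ps" where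
  "ev a p = isum (\<lambda>i. a i * p ^ i)"

lemma ordge_ev_term: "ordge (Suc 0) p \<Longrightarrow> ordge i (a i * p ^ i)"
  by (simp add: ordge_mult_left ordge_power)

lemma ev_approx: "ordge (Suc 0) p \<Longrightarrow> ordge d (ev a p - (\<Sum>i<d. a i * p ^ i))"
  unfolding ev_def by (rule isum_approx) (rule ordge_ev_term)

lemma ev_eqI: "ordge (Suc 0) p \<Longrightarrow> (\<And>d. ordge d (g - (\<Sum>i<d. a i * p ^ i))) \<Longrightarrow> g = ev a p"
  unfolding ev_def by (rule isum_eqI) (auto intro: ordge_ev_term)

lemma ev_zero: "ev a 0 = a 0"
proof (rule ev_eqI[symmetric])
  fix d show "ordge d (a 0 - (\<Sum>i<d. a i * 0 ^ i))"
    by (cases d) (simp_all add: sum.lessThan_Suc_shift del: sum.lessThan_Suc)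
qed simp

lemma ev_split:
  assumes "ordge (Suc 0) p" shows "ev a p = a 0 + p * ev (\<lambda>i. a (Suc i)) p"
proof (rule ev_eqI[symmetric, OF assms])
  fix d
  have "(\<Sum>i<Suc d. a i * p ^ i) = a 0 + p * (\<Sum>i<d. a (Suc i) * p ^ i)"
    by (simp add: sum.lessThan_Suc_shift sum_distrib_left algebra_simps del: sum.lessThan_Suc)
  moreover have "ordge d (p * (ev (\<lambda>i. a (Suc i)) p - (\<Sum>i<d. a (Suc i) * p ^ i)))"
    by (intro ordge_mult_left ev_approx assms)
  ultimately have "ordge d (a 0 + p * ev (\<lambda>i. a (Suc i)) p - (\<Sum>i<Suc d. a i * p ^ i))"
    by (simp add: algebra_simps)
  \<comment> \<open>The shifted sum has one term more than the partial sum that is asked for; that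
    term, \<open>a d * p ^ d\<close>, itself has order \<open>d\<close>.\<close>
  then have "ordge d (a 0 + p * ev (\<lambda>i. a (Suc i)) p - (\<Sum>i<Suc d. a i * p ^ i) + a d * p ^ d)"
    by (rule ordge_add) (simp add: ordge_ev_term assms)
  then show "ordge d (a 0 + p * ev (\<lambda>i. a (Suc i)) p - (\<Sum>i<d. a i * p ^ i))"
    by (simp add: algebra_simps)
qed

lemma isum_zero [simp]: "isum (\<lambda>i. 0) = 0"
  by (rule ps_eqI) (simp add: isum_def)

lemma ev_one: "ordge (Suc 0) p \<Longrightarrow> ev (\<lambda>i. if i = 0 then c else 0) p = c"
  by (subst ev_split) (auto simp: ev_def)

lemma ev_X: "ordge (Suc 0) p \<Longrightarrow> ev (\<lambda>i. if i = Suc 0 then 1 else 0) p = p"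
  by (subst ev_split) (auto simp: ev_one)

text \<open>Cauchy product: the product of the partial sums runs over a square, the partial sum of
  the product over a triangle, and the terms in between have \<open>i + j\<close> at least
  \<open>d\<close>, hence order \<open>d\<close>.\<close>

lemma ev_mult:
  assumes p: "ordge (Suc 0) p"
  shows "ev (\<lambda>n. \<Sum>i\<le>n. a i * b (n - i)) p = ev a p * ev b p"
proof (rule ev_eqI[symmetric, OF p])
  fix d
  let ?A = "\<Sum>i<d. a i * p ^ i" and ?B = "\<Sum>i<d. b i * p ^ i"
  let ?t = "\<lambda>i j. a i * p ^ i * (b j * p ^ j)"
  have "(\<Sum>n<d. (\<Sum>i\<le>n. a i * b (n - i)) * p ^ n) = (\<Sum>n<d. \<Sum>i\<le>n. ?t i (n - i))"
    by (auto simp: sum_distrib_right power_add[symmetric] intro!: sum.cong)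
       (simp add: algebra_simps power_add[symmetric])
  also have "\<dots> = (\<Sum>(i, j)\<in>{(i, j). i + j < d}. ?t i j)"
    by (rule sum.triangle_reindex[symmetric])
  finally have 1: "(\<Sum>n<d. (\<Sum>i\<le>n. a i * b (n - i)) * p ^ n) = (\<Sum>(i, j)\<in>{(i, j). i + j < d}. ?t i j)" .
  have 2: "?A * ?B = (\<Sum>(i, j)\<in>{..<d} \<times> {..<d}. ?t i j)"
    by (simp add: sum_product sum.cartesian_product)
  have "?A * ?B - (\<Sum>(i, j)\<in>{(i, j). i + j < d}. ?t i j) =
      (\<Sum>(i, j)\<in>{..<d} \<times> {..<d} - {(i, j). i + j < d}. ?t i j)"
    unfolding 2 by (subst sum_diff[symmetric]) auto
  moreover have "ordge d \<dots>"
  proof (rule ordge_sum, clarsimp)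
    fix i j assume "\<not> i + j < d"
    then show "ordge d (?t i j)"
      using ordge_mult[OF ordge_ev_term[OF p, of i a] ordge_ev_term[OF p, of j b]]
      by (meson not_less ordge_mono)
  qed
  moreover have "ordge d (ev a p * ev b p - ?A * ?B)"
  proof -
    have "ev a p * ev b p - ?A * ?B = (ev a p - ?A) * ev b p + ?A * (ev b p - ?B)"
      by (simp add: algebra_simps)
    then show ?thesis
      by (simp add: ordge_add ordge_mult_left ordge_mult_right ev_approx p)
  qed
  ultimately have "ordge d ((ev a p * ev b p - ?A * ?B) + (?A * ?B - (\<Sum>(i, j)\<in>{(i, j). i + j < d}. ?t i j)))"
    by (metis (no_types, lifting) ordge_add)
  then show "ordge d (ev a p * ev b p - (\<Sum>n<d. (\<Sum>i\<le>n. a i * b (n - i)) * p ^ n))"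
    by (simp add: 1)
qed

lemma ev_hom:
  assumes p: "ordge (Suc 0) p"
    and T: "\<And>f g. T (f - g) = T f - T g" "\<And>f g. T (f * g) = T f * T g" "T 1 = 1"
      "\<And>d f. ordge d f \<Longrightarrow> ordge d (T f)"
  shows "T (ev a p) = ev (\<lambda>i. T (a i)) (T p)"
proof -
  have pow: "T (p ^ i) = T p ^ i" for i by (induction i) (auto simp: T)
  show ?thesis unfolding ev_def
    by (subst isum_map[of _ T]) (simp_all add: T pow ordge_ev_term[OF p])
qed


subsection \<open>Substitutions on monomials\<close>

text \<open>\<open>\<phi>\<close> runs backwards, from monomials of the result to monomials of the
  argument, and \<open>A\<close> is the set of monomials allowed in the result. Setting a variable
  to 0, renaming variables and the action of a bijection of the index set are all of this
  form.\<close>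

definition subst_ps :: "('v \<Rightarrow>\<^sub>0 nat) set \<Rightarrow> (('v \<Rightarrow>\<^sub>0 nat) \<Rightarrow> ('u \<Rightarrow>\<^sub>0 nat)) \<Rightarrow> ('u, 'r) ps \<Rightarrow> ('v, 'r::comm_ring_1) ps" where
  "subst_ps A \<phi> f = Ps (\<lambda>m. if m \<in> A then coef f (\<phi> m) else 0)"

lemma coef_subst_ps: "coef (subst_ps A \<phi> f) m = (if m \<in> A then coef f (\<phi> m) else 0)"
  by (simp add: subst_ps_def)

lemma subst_ps_diff: "subst_ps A \<phi> (f - g) = subst_ps A \<phi> f - subst_ps A \<phi> g"
  by (rule ps_eqI) (simp add: coef_subst_ps)

lemma subst_ps_add: "subst_ps A \<phi> (f + g) = subst_ps A \<phi> f + subst_ps A \<phi> g"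
  by (rule ps_eqI) (simp add: coef_subst_ps)

lemma ordge_subst_ps: "(\<And>m. m \<in> A \<Longrightarrow> mdeg (\<phi> m) = mdeg m) \<Longrightarrow> ordge d f \<Longrightarrow> ordge d (subst_ps A \<phi> f)"
  by (auto simp: ordge_def coef_subst_ps)

text \<open>A product of monomials lies in \<open>A\<close> only if both factors do, so nothing
  leaks in from outside. Bijectivity onto \<open>B\<close>, which is closed under factors too,
  matches the splittings of \<open>m\<close> with those of its image.\<close>

lemma subst_ps_mult:
  assumes A: "\<And>a b. a + b \<in> A \<longleftrightarrow> a \<in> A \<and> b \<in> A" and B: "\<And>a b. a + b \<in> B \<longleftrightarrow> a \<in> B \<and> b \<in> B"
    and add: "\<And>a b. a \<in> A \<Longrightarrow> b \<in> A \<Longrightarrow> \<phi> (a + b) = \<phi> a + \<phi> b"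
    and bij: "bij_betw \<phi> A B"
  shows "subst_ps A \<phi> (f * g) = subst_ps A \<phi> f * subst_ps A \<phi> g"
proof (rule ps_eqI)
  fix m
  show "coef (subst_ps A \<phi> (f * g)) m = coef (subst_ps A \<phi> f * subst_ps A \<phi> g) m"
  proof (cases "m \<in> A")
    case False
    then have "coef (subst_ps A \<phi> f) a * coef (subst_ps A \<phi> g) b = 0" if "a + b = m" for a b
      using A[of a b] that by (auto simp: coef_subst_ps)
    then have "(\<Sum>(a, b)\<in>{(a, b). a + b = m}. coef (subst_ps A \<phi> f) a * coef (subst_ps A \<phi> g) b) = 0"
      by (intro sum.neutral) auto
    then show ?thesis using False by (simp add: coef_mult coef_subst_ps)
  next
    case m: True
    let ?\<psi> = "inv_into A \<phi>"
    have pB: "\<phi> a \<in> B" if "a \<in> A" for a using bij that by (auto simp: bij_betw_def)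
    have psi: "?\<psi> b \<in> A" "\<phi> (?\<psi> b) = b" if "b \<in> B" for b
      using bij that by (auto simp: bij_betw_def inv_into_into f_inv_into_f)
    have psi2: "?\<psi> (\<phi> a) = a" if "a \<in> A" for a using bij that by (auto simp: bij_betw_def)
    have "coef (subst_ps A \<phi> f * subst_ps A \<phi> g) m =
        (\<Sum>(a, b)\<in>{(a, b). a + b = m}. coef f (\<phi> a) * coef g (\<phi> b))"
      unfolding coef_mult using A m by (auto simp: coef_subst_ps intro!: sum.cong)
    also have "\<dots> = (\<Sum>(a, b)\<in>{(a, b). a + b = \<phi> m}. coef f a * coef g b)"
    proof (rule sum.reindex_bij_witness[of _ "\<lambda>(a, b). (?\<psi> a, ?\<psi> b)" "\<lambda>(a, b). (\<phi> a, \<phi> b)"])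
      fix p assume "p \<in> {(a, b). a + b = \<phi> m}"
      then obtain a b where p: "p = (a, b)" "a + b = \<phi> m" by blast
      then have ab: "a \<in> B" "b \<in> B" using B[of a b] pB[OF m] by auto
      have "\<phi> (?\<psi> a + ?\<psi> b) = \<phi> m" using ab p by (simp add: add psi)
      then have "?\<psi> a + ?\<psi> b = m" using psi(1) ab A m psi2 by metis
      then show "(case p of (a, b) \<Rightarrow> (?\<psi> a, ?\<psi> b)) \<in> {(a, b). a + b = m}" by (simp add: p)
      show "(case case p of (a, b) \<Rightarrow> (?\<psi> a, ?\<psi> b) of (a, b) \<Rightarrow> (\<phi> a, \<phi> b)) = p"
        using ab by (simp add: p psi)
    qed (use A m in \<open>auto simp: psi2 add\<close>)
    finally show ?thesis using m by (simp add: coef_subst_ps coef_mult)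
  qed
qed

lemma subst_ps_cst: "0 \<in> A \<Longrightarrow> \<phi> 0 = 0 \<Longrightarrow> inj_on \<phi> A \<Longrightarrow> subst_ps A \<phi> (cst c) = cst c"
  by (rule ps_eqI) (auto simp: coef_subst_ps coef_cst dest: inj_onD[of \<phi> A _ 0])


subsection \<open>Partial derivatives\<close>

definition pd :: "'v \<Rightarrow> ('v, 'r::comm_ring_1) ps \<Rightarrow> ('v, 'r) ps" where
  "pd v f = Ps (\<lambda>m. of_nat (Suc (Poly_Mapping.lookup m v)) * coef f (m + Poly_Mapping.single v 1))"

lemma coef_pd: "coef (pd v f) m = of_nat (Suc (Poly_Mapping.lookup m v)) * coef f (m + Poly_Mapping.single v 1)"
  by (simp add: pd_def)

lemma pd_add: "pd v (f + g) = pd v f + pd v g"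
  by (rule ps_eqI) (simp add: coef_pd algebra_simps)

lemma pd_diff: "pd v (f - g) = pd v f - pd v g"
  by (rule ps_eqI) (simp add: coef_pd algebra_simps)

lemma pd_sum: "pd v (sum f A) = (\<Sum>i\<in>A. pd v (f i))"
  by (rule ps_eqI) (simp add: coef_pd sum_distrib_left)

lemma pd_cst: "pd v (cst c) = 0"
proof (rule ps_eqI)
  fix m
  have "mdeg (m + Poly_Mapping.single v (1::nat)) \<noteq> 0" unfolding mdeg_add by simp
  then show "coef (pd v (cst c)) m = coef 0 m" by (simp add: coef_pd coef_cst del: mdeg_add)
qed

lemma pd_var: "pd v (var u) = (if u = v then 1 else 0)"
proof (rule ps_eqI)
  fix m
  have "m + Poly_Mapping.single v (1::nat) = Poly_Mapping.single u 1 \<longleftrightarrow> u = v \<and> m = 0"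
  proof
    assume h: "m + Poly_Mapping.single v 1 = Poly_Mapping.single u (1::nat)"
    have "mdeg (m + Poly_Mapping.single v 1) = Suc 0" unfolding h by simp
    then have "mdeg m = 0" unfolding mdeg_add by simp
    then have "m = 0" by simp
    then have "Poly_Mapping.keys (Poly_Mapping.single v (1::nat)) = Poly_Mapping.keys (Poly_Mapping.single u (1::nat))"
      using h by simp
    then show "u = v \<and> m = 0" using \<open>m = 0\<close> by simp
  qed auto
  then show "coef (pd v (var u)) m = coef (if u = v then 1 else 0) m"
    by (auto simp: coef_pd coef_var)
qed

lemma ordge_pd: "ordge (Suc d) f \<Longrightarrow> ordge d (pd v f)"
  by (simp add: ordge_def coef_pd)

text \<open>If only terms with \<open>v\<close> dividing \<open>a\<close> contribute, one factor
  \<open>v\<close> can be cancelled from \<open>a\<close> and from the whole monomial. In the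
  Leibniz rule the exponent of \<open>v\<close> in \<open>a\<close> appears as a coefficient and
  kills the other terms.\<close>

lemma sum_splits_shift:
  fixes m :: "'v \<Rightarrow>\<^sub>0 nat"
  assumes "\<And>a b. Poly_Mapping.lookup a v = 0 \<Longrightarrow> h a b = 0"
  shows "(\<Sum>(a, b)\<in>{(a, b). a + b = m + Poly_Mapping.single v 1}. h a b) =
    (\<Sum>(a, b)\<in>{(a, b). a + b = m}. h (a + Poly_Mapping.single v 1) b)"
proof -
  let ?e = "Poly_Mapping.single v (1::nat)"
  have "(\<Sum>(a, b)\<in>{(a, b). a + b = m + ?e}. h a b) =
      (\<Sum>(a, b)\<in>{(a, b). a + b = m + ?e \<and> Poly_Mapping.lookup a v \<noteq> 0}. h a b)"
    using finite_splits[of "m + ?e"] assms by (intro sum.mono_neutral_right) auto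
  also have "\<dots> = (\<Sum>(a, b)\<in>{(a, b). a + b = m}. h (a + ?e) b)"
  proof (rule sum.reindex_bij_witness[of _ "\<lambda>(a, b). (a + ?e, b)" "\<lambda>(a, b). (a - ?e, b)"], goal_cases)
    case (1 p)
    then obtain a b where p: "p = (a, b)" "Poly_Mapping.lookup a v \<noteq> 0" by auto
    have "a - ?e + ?e = a" using p(2)
      by (intro poly_mapping_eqI) (auto simp: lookup_add lookup_minus lookup_single when_def)
    then show ?case using p by simp
  next
    case (2 p)
    then obtain a b where p: "p = (a, b)" "Poly_Mapping.lookup a v \<noteq> 0" "a + b = m + ?e" by auto
    have "a - ?e + ?e = a" using p(2)
      by (intro poly_mapping_eqI) (auto simp: lookup_add lookup_minus lookup_single when_def)
    then have "a - ?e + b + ?e = m + ?e" using p(3) by (metis add.assoc add.commute)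
    then show ?case using p by simp
  next
    case (3 p) then show ?case by auto
  next
    case (4 p) then show ?case by (auto simp: lookup_add add_ac)
  next
    case (5 p)
    then obtain a b where p: "p = (a, b)" "Poly_Mapping.lookup a v \<noteq> 0" by auto
    have "a - ?e + ?e = a" using p(2)
      by (intro poly_mapping_eqI) (auto simp: lookup_add lookup_minus lookup_single when_def)
    then show ?case using p by simp
  qed
  finally show ?thesis .
qed

lemma pd_mult: "pd v (f * g) = pd v f * g + f * pd v g"
proof (rule ps_eqI)
  fix m
  let ?e = "Poly_Mapping.single v (1::nat)" and ?l = "\<lambda>a. Poly_Mapping.lookup a v"
  let ?S = "{(a, b). a + b = m + ?e}"
  have "coef (pd v (f * g)) m = (\<Sum>(a, b)\<in>?S. of_nat (Suc (?l m)) * (coef f a * coef g b))"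
    by (simp add: coef_pd coef_mult sum_distrib_left case_prod_unfold)
  \<comment> \<open>The exponent of \<open>v\<close> in \<open>m + ?e\<close> is the sum of its
    exponents in the two factors; this splits the derivative into its two Leibniz terms.\<close>
  also have "\<dots> = (\<Sum>(a, b)\<in>?S. of_nat (?l a + ?l b) * (coef f a * coef g b))"
  proof (rule sum.cong, simp, clarify)
    fix a b assume "a + b = m + ?e"
    then have "?l (a + b) = ?l (m + ?e)" by simp
    then have "?l a + ?l b = Suc (?l m)" by (simp add: lookup_add)
    then show "of_nat (Suc (?l m)) * (coef f a * coef g b) = of_nat (?l a + ?l b) * (coef f a * coef g b)" by simp
  qed
  also have "\<dots> = (\<Sum>(a, b)\<in>?S. of_nat (?l a) * coef f a * coef g b) + (\<Sum>(a, b)\<in>?S. of_nat (?l b) * coef g b * coef f a)"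
    by (simp add: sum.distrib[symmetric] case_prod_unfold algebra_simps)
  also have "(\<Sum>(a, b)\<in>?S. of_nat (?l b) * coef g b * coef f a) = (\<Sum>(a, b)\<in>?S. of_nat (?l a) * coef g a * coef f b)"
    by (rule sum_splits_swap)
  also have "(\<Sum>(a, b)\<in>?S. of_nat (?l a) * coef g a * coef f b) = coef (pd v g * f) m"
    by (subst sum_splits_shift) (auto simp: coef_mult coef_pd lookup_add)
  also have "(\<Sum>(a, b)\<in>?S. of_nat (?l a) * coef f a * coef g b) = coef (pd v f * g) m"
    by (subst sum_splits_shift) (auto simp: coef_mult coef_pd lookup_add)
  finally show "coef (pd v (f * g)) m = coef (pd v f * g + f * pd v g) m" by (simp add: mult.commute)
qed

lemma pd_power: "pd v (p ^ Suc i) = of_nat (Suc i) * p ^ i * pd v p"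
  by (induction i) (auto simp: pd_mult algebra_simps)

lemma pd_ev:
  assumes p: "ordge (Suc 0) p" and a: "\<And>i. pd v (a i) = 0"
  shows "pd v (ev a p) = ev (\<lambda>i. of_nat (Suc i) * a (Suc i)) p * pd v p"
proof (rule ordge_eqI)
  fix d
  let ?b = "\<lambda>i. of_nat (Suc i) * a (Suc i)"
  have one: "pd v 1 = 0" using pd_cst[of v 1] by (simp add: cst_hom)
  \<comment> \<open>Differentiation lowers the order of vanishing by one, so the series is
    approximated to order \<open>Suc d\<close> in order to control its derivative to order
    \<open>d\<close>.\<close>
  have "pd v (\<Sum>i<Suc d. a i * p ^ i) = (\<Sum>i<d. ?b i * p ^ i) * pd v p"
    unfolding sum.lessThan_Suc_shift
    by (simp add: pd_add pd_sum pd_mult a one pd_power sum_distrib_right del: power_Suc)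
       (simp add: algebra_simps)
  then have "pd v (ev a p) - ev ?b p * pd v p =
      pd v (ev a p - (\<Sum>i<Suc d. a i * p ^ i)) - (ev ?b p - (\<Sum>i<d. ?b i * p ^ i)) * pd v p"
    by (simp add: pd_diff algebra_simps del: sum.lessThan_Suc)
  moreover have "ordge d (pd v (ev a p - (\<Sum>i<Suc d. a i * p ^ i)))"
    by (rule ordge_pd) (rule ev_approx[OF p])
  moreover have "ordge d ((ev ?b p - (\<Sum>i<d. ?b i * p ^ i)) * pd v p)"
    by (rule ordge_mult_right) (rule ev_approx[OF p])
  ultimately show "ordge d (pd v (ev a p) - ev ?b p * pd v p)"
    by (simp add: ordge_diff)
qed


section \<open>The logarithm of a formal group law\<close>

definition evf :: "'r::comm_ring_1 fps \<Rightarrow> ('v, 'r) ps \<Rightarrow> ('v, 'r) ps" where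
  "evf a p = ev (\<lambda>i. cst (fps_nth a i)) p"

definition ev2 :: "(nat \<Rightarrow> nat \<Rightarrow> 'r::comm_ring_1) \<Rightarrow> ('v, 'r) ps \<Rightarrow> ('v, 'r) ps \<Rightarrow> ('v, 'r) ps" where
  "ev2 F p q = ev (\<lambda>j. ev (\<lambda>i. cst (F i j)) p) q"

lemma evf_mult: "ordge (Suc 0) p \<Longrightarrow> evf (a * b) p = evf a p * evf b p"
  unfolding evf_def by (subst ev_mult[symmetric]) (auto simp: fps_mult_nth cst_hom cst_sum atLeast0AtMost)

lemma evf_1: "ordge (Suc 0) p \<Longrightarrow> evf 1 p = 1"
  unfolding evf_def using ev_one[of p 1] by (simp add: if_distrib cst_hom cong: if_cong)

lemma pd_evf:
  assumes "ordge (Suc 0) p" shows "pd v (evf a p) = evf (fps_deriv a) p * pd v p"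
  unfolding evf_def using assms by (subst pd_ev) (auto simp: pd_cst cst_hom cst_of_nat algebra_simps)

locale fgl =
  fixes F :: "nat \<Rightarrow> nat \<Rightarrow> 'r::comm_ring_1"
  assumes fgl: "formal_group_law F"
begin

lemma F_i0: "F i 0 = (if i = 1 then 1 else 0)" and F_0j: "F 0 j = (if j = 1 then 1 else 0)"
  using fgl by (auto simp: formal_group_law_def)

lemma ev2_zero_right: "ordge (Suc 0) p \<Longrightarrow> ev2 F p 0 = p"
  using ev_X[of p] by (simp add: ev2_def ev_zero F_i0 if_distrib cst_hom cong: if_cong)

lemma ev2_split_right:
  assumes "ordge (Suc 0) p" "ordge (Suc 0) q"
  shows "ev2 F p q = p + q * ev (\<lambda>j. ev (\<lambda>i. cst (F i (Suc j))) p) q"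
proof -
  have "ev (\<lambda>i. cst (F i 0)) p = p" using ev2_zero_right[OF assms(1)] by (simp add: ev2_def ev_zero)
  then show ?thesis unfolding ev2_def by (subst ev_split[OF assms(2)]) simp
qed

lemma ordge_ev2:
  assumes "ordge (Suc 0) p" "ordge (Suc 0) q" shows "ordge (Suc 0) (ev2 F p q)"
  by (simp add: ev2_split_right ordge_add ordge_mult_right assms)

lemma ev2_hom:
  assumes p: "ordge (Suc 0) p" "ordge (Suc 0) q"
    and T: "\<And>f g. T (f - g) = T f - T g" "\<And>f g. T (f * g) = T f * T g" "\<And>c. T (cst c) = cst c"
      "\<And>d f. ordge d f \<Longrightarrow> ordge d (T f)"
  shows "T (ev2 F p q) = ev2 F (T p) (T q)"
proof -
  have 1: "T 1 = 1" using T(3)[of 1] by (simp add: cst_hom)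
  show ?thesis unfolding ev2_def
    by (simp add: ev_hom[of _ T] p T 1)
qed

end

section \<open>Translation between \<open>mps_ring\<close> and the type of power series\<close>

lemma mps_ring_simps [simp]:
  "f \<otimes>\<^bsub>mps_ring V\<^esub> g = coef (Ps f * Ps g)" "\<one>\<^bsub>mps_ring V\<^esub> = coef 1" "\<zero>\<^bsub>mps_ring V\<^esub> = coef 0"
  "f \<oplus>\<^bsub>mps_ring V\<^esub> g = coef (Ps f + Ps g)"
  by (simp_all add: mps_ring_def fun_eq_iff coef_mult)

lemma Ps_coef [simp]: "Ps (coef f) = f"
  by (rule coef_inverse)

lemma mps_ring_pow: "f [^]\<^bsub>mps_ring V\<^esub> (n::nat) = coef (Ps f ^ n)"
  by (induction n) (simp_all add: mult.commute)

text \<open>Both sides collect the same terms F i j p^i q^j up to the degree of the monomial; only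
  the order of the two finite summations differs.\<close>

lemma mps_eval2_eq:
  assumes p: "ordge (Suc 0) (Ps p)" "ordge (Suc 0) (Ps q)"
  shows "mps_eval2 V F p q = coef (ev2 F (Ps p) (Ps q))"
proof
  fix m
  have a: "coef (ev (\<lambda>i. cst (F i j)) (Ps p) * Ps q ^ j) m =
      (\<Sum>i\<le>mdeg m. F i j * coef (Ps p ^ i * Ps q ^ j) m)" for j
  proof -
    have "ev (\<lambda>i. cst (F i j)) (Ps p) * Ps q ^ j = isum (\<lambda>i. Ps q ^ j * (cst (F i j) * Ps p ^ i))"
      unfolding ev_def by (subst mult.commute, rule isum_mult) (rule ordge_ev_term[OF p(1)])
    also have "\<dots> = isum (\<lambda>i. cst (F i j) * (Ps p ^ i * Ps q ^ j))" by (simp add: mult_ac)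
    finally show ?thesis by (simp add: isum_def)
  qed
  have "coef (ev2 F (Ps p) (Ps q)) m = (\<Sum>j\<le>mdeg m. \<Sum>i\<le>mdeg m. F i j * coef (Ps p ^ i * Ps q ^ j) m)"
    unfolding ev2_def by (subst ev_def) (simp add: isum_def a)
  also have "\<dots> = (\<Sum>i\<le>mdeg m. \<Sum>j\<le>mdeg m. F i j * coef (Ps p ^ i * Ps q ^ j) m)"
    by (rule sum.swap)
  finally show "mps_eval2 V F p q m = coef (ev2 F (Ps p) (Ps q)) m"
    by (simp add: mps_eval2_def mps_ring_pow)
qed

text \<open>Substitution of 0 for the variable \<open>v\<close>.\<close>

definition restr :: "'v \<Rightarrow> ('v, 'r) ps \<Rightarrow> ('v, 'r::comm_ring_1) ps" where
  "restr v = subst_ps {m. Poly_Mapping.lookup m v = 0} (\<lambda>m. m)"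

lemma restr_hom: "restr v (f - g) = restr v f - restr v g" "restr v (f * g) = restr v f * restr v g"
  "restr v (cst c) = cst c" "ordge d f \<Longrightarrow> ordge d (restr v f)"
  unfolding restr_def
     apply (rule subst_ps_diff)
    apply (rule subst_ps_mult[where B = "{m. Poly_Mapping.lookup m v = 0}"])
  by (auto simp: lookup_add bij_betw_def intro: subst_ps_cst ordge_subst_ps)

lemma restr_1: "restr v 1 = 1" using restr_hom(3)[of v 1] by (simp add: cst_hom)

lemma restr_var: "restr v (var u) = (if u = v then 0 else var u)"
  by (rule ps_eqI) (auto simp: restr_def coef_subst_ps coef_var lookup_single)

lemmas restr_ev = ev_hom[where T = "restr v" for v, OF _ restr_hom(1,2) restr_1 restr_hom(4)]

section \<open>The invariant differential\<close>

context fgl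
begin

text \<open>\<open>omega\<close> is the derivative of F(x, y) in y at y = 0. The invariant
  differential is dx / omega(x), so the logarithm will be the integral of
  \<open>inv_omega\<close>.\<close>

definition omega :: "'r fps" where "omega = Abs_fps (\<lambda>i. F i 1)"

definition inv_omega :: "'r fps" where "inv_omega = fps_right_inverse omega 1"

lemma omega_inv: "omega * inv_omega = 1"
  unfolding inv_omega_def by (rule fps_right_inverse) (simp add: omega_def F_0j)

lemma assoc_ev2:
  "ev2 F (ev2 F (var 0) (var 1)) (var (2::nat)) = ev2 F (var 0) (ev2 F (var 1) (var 2))"
proof -
  have v: "ordge (Suc 0) (Ps (mps_var i))" for i :: nat using ordge_var[of i] by (simp add: var_def)
  show ?thesis
    using fgl unfolding formal_group_law_def Let_def
    by (simp add: mps_eval2_eq v ordge_ev2 coef_inject var_def)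
qed

text \<open>The derivative of the associativity law at \<open>z = 0\<close>.\<close>

lemma omega_ev2:
  fixes x y :: "(nat, 'r) ps"
  defines "x \<equiv> var 0" and "y \<equiv> var 1"
  shows "evf omega (ev2 F x y) = pd 1 (ev2 F x y) * evf omega y"
proof -
  define z :: "(nat, 'r) ps" where "z = var 2"
  have o: "ordge (Suc 0) x" "ordge (Suc 0) y" "ordge (Suc 0) z" by (simp_all add: x_def y_def z_def ordge_var)
  have oF: "ordge (Suc 0) (ev2 F x y)" "ordge (Suc 0) (ev2 F y z)" using o by (simp_all add: ordge_ev2)
  have pdc: "pd v (ev (\<lambda>i. cst (c i)) p) = ev (\<lambda>i. of_nat (Suc i) * cst (c (Suc i))) p * pd v p"
    if "ordge (Suc 0) p" for v :: nat and c and p :: "(nat, 'r) ps" using that by (simp add: pd_ev pd_cst)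
  have px: "pd 2 x = 0" "pd 2 y = 0" "pd 2 z = 1" "pd (Suc 0) x = 0" "pd (Suc 0) y = 1"
    by (simp_all add: x_def y_def z_def pd_var)
  have pF: "pd 2 (ev2 F x y) = 0" unfolding ev2_def by (simp add: pd_ev pdc o px)
  have r: "restr 2 x = x" "restr 2 y = y" "restr 2 z = 0" by (simp_all add: x_def y_def z_def restr_var)
  have rF: "restr 2 (ev2 F x y) = ev2 F x y"
    by (subst ev2_hom[where T = "restr 2"]) (auto simp: o restr_hom r)
  have rF': "restr 2 (ev2 F y z) = y"
    by (subst ev2_hom[where T = "restr 2"]) (auto simp: o restr_hom r ev2_zero_right)
  have rn: "restr 2 (of_nat i) = (of_nat i :: (nat, 'r) ps)" for i
    using restr_hom(3)[of 2 "of_nat i"] by (simp add: cst_of_nat)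
  \<comment> \<open>\<open>pd 2\<close> followed by \<open>restr 2\<close> is the z-derivative at z
    = 0. On F(F(x, y), z) it gives omega at F(x, y).\<close>
  have "restr 2 (pd 2 (ev2 F (ev2 F x y) z)) = evf omega (ev2 F x y)"
    unfolding ev2_def[of F _ z]
    by (simp add: pd_ev pdc oF o px pF restr_ev r ev_zero restr_hom restr_1 rF omega_def evf_def)
  \<comment> \<open>On F(x, F(y, z)) the chain rule gives the derivative of F in its second argument
    at (x, y), times a factor that turns out to be omega(y).\<close>
  moreover have "restr 2 (pd 2 (ev2 F x (ev2 F y z))) =
      ev (\<lambda>j. of_nat (Suc j) * ev (\<lambda>i. cst (F i (Suc j))) x) y * restr 2 (pd 2 (ev2 F y z))"
    unfolding ev2_def[of F x]
    by (simp add: pd_ev pdc oF o px restr_ev r restr_hom rF' rn del: of_nat_Suc)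
  moreover have "restr 2 (pd 2 (ev2 F y z)) = evf omega y"
    unfolding ev2_def
    by (simp add: pd_ev pdc oF o px restr_ev r ev_zero restr_hom restr_1 omega_def evf_def)
  moreover have "pd 1 (ev2 F x y) = ev (\<lambda>j. of_nat (Suc j) * ev (\<lambda>i. cst (F i (Suc j))) x) y"
    unfolding ev2_def by (simp add: pd_ev pdc oF o px del: of_nat_Suc)
  moreover have "ev2 F (ev2 F x y) z = ev2 F x (ev2 F y z)"
    using assoc_ev2 by (simp add: x_def y_def z_def)
  ultimately show ?thesis by simp
qed

end

locale fgl_rat = fgl F for F :: "nat \<Rightarrow> nat \<Rightarrow> 'r::comm_ring_1" +
  assumes rat: "contains_rat TYPE('r)"
begin

definition nat_inv :: "nat \<Rightarrow> 'r" where "nat_inv k = (SOME r. of_nat k * r = 1)"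

lemma nat_inv:
  assumes "k > 0" shows "of_nat k * nat_inv k = 1"
proof -
  obtain h :: "rat \<Rightarrow> 'r" where h: "h 1 = 1" "\<And>x y. h (x + y) = h x + h y" "\<And>x y. h (x * y) = h x * h y"
    using rat unfolding contains_rat_def by blast
  have h0: "h 0 = 0" using h(2)[of 0 0] by simp
  have n: "h (of_nat k) = of_nat k" for k by (induction k) (auto simp: h h0)
  have "of_nat k * h (1 / of_nat k) = h (of_nat k * (1 / of_nat k))" by (simp only: h n)
  also have "\<dots> = 1" using assms h by simp
  finally show ?thesis unfolding nat_inv_def by (rule someI)
qed

definition logF :: "'r fps" where
  "logF = Abs_fps (\<lambda>i. case i of 0 \<Rightarrow> 0 | Suc j \<Rightarrow> nat_inv (Suc j) * fps_nth inv_omega j)"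

lemma logF_nth: "fps_nth logF 0 = 0" "fps_nth logF (Suc 0) = 1"
proof -
  have "fps_nth (omega * inv_omega) 0 = 1" by (simp add: omega_inv)
  then have "fps_nth inv_omega 0 = 1" by (simp add: omega_def F_0j)
  then show "fps_nth logF 0 = 0" "fps_nth logF (Suc 0) = 1"
    using nat_inv[of 1] by (simp_all add: logF_def)
qed

lemma deriv_logF: "fps_deriv logF = inv_omega"
proof (rule fps_ext)
  fix n
  have "of_nat (Suc n) * (nat_inv (Suc n) * fps_nth inv_omega n) = fps_nth inv_omega n"
    using nat_inv[of "Suc n"] by (simp add: mult.assoc[symmetric] del: of_nat_Suc)
  then show "fps_nth (fps_deriv logF) n = fps_nth inv_omega n" by (simp add: logF_def)
qed

text \<open>Uniqueness of integration: as positive integers are invertible, a series with zero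
  derivative in \<open>v\<close> has no monomial involving \<open>v\<close>, so it is determined by
  its value at \<open>v\<close> = 0.\<close>

lemma pd_restr_zero:
  assumes "pd v f = 0" "restr v f = 0" shows "f = (0 :: ('v, 'r) ps)"
proof (rule ps_eqI)
  fix m
  show "coef f m = coef 0 m"
  proof (cases "Poly_Mapping.lookup m v")
    case 0
    have "coef (restr v f) m = 0" by (simp add: assms)
    then show ?thesis using 0 by (simp add: restr_def coef_subst_ps)
  next
    case (Suc k)
    let ?e = "Poly_Mapping.single v (1::nat)"
    have e: "m - ?e + ?e = m" using Suc
      by (intro poly_mapping_eqI) (auto simp: lookup_add lookup_minus lookup_single when_def)
    have "coef (pd v f) (m - ?e) = 0" by (simp add: assms)
    then have z: "of_nat (Suc k) * coef f m = 0"
      using Suc e by (simp add: coef_pd lookup_minus)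
    have "of_nat (Suc k) * nat_inv (Suc k) * coef f m = nat_inv (Suc k) * (of_nat (Suc k) * coef f m)"
      by (simp only: mult_ac)
    then show ?thesis using z nat_inv[of "Suc k"] by (simp del: of_nat_Suc)
  qed
qed

text \<open>The defect \<open>L\<close> of additivity has zero derivative in y: after multiplication
  by the unit omega(y) this is \<open>omega_ev2\<close>. At y = 0 it vanishes because F(x, 0) =
  x.\<close>

lemma logF_ev2_nat:
  "evf logF (ev2 F (var 0) (var 1)) = evf logF (var 0) + evf logF (var (1::nat))"
proof -
  define x y :: "(nat, 'r) ps" where "x = var 0" and "y = var 1"
  have o: "ordge (Suc 0) x" "ordge (Suc 0) y" by (simp_all add: x_def y_def ordge_var)
  have oF: "ordge (Suc 0) (ev2 F x y)" using o by (simp_all add: ordge_ev2)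
  have px: "pd (Suc 0) x = 0" "pd (Suc 0) y = 1" by (simp_all add: x_def y_def pd_var)
  define L where "L = evf logF (ev2 F x y) - evf logF x - evf logF y"
  have pL: "pd (Suc 0) L = evf inv_omega (ev2 F x y) * pd (Suc 0) (ev2 F x y) - evf inv_omega y"
    by (simp add: L_def pd_diff pd_evf o oF px deriv_logF)
  have i: "evf omega p * evf inv_omega p = 1" if "ordge (Suc 0) p" for p :: "(nat, 'r) ps"
    using that by (simp add: evf_mult[symmetric] omega_inv evf_1)
  have om: "evf omega (ev2 F x y) = pd (Suc 0) (ev2 F x y) * evf omega y"
    using omega_ev2 by (simp add: x_def y_def)
  have "pd (Suc 0) L * evf omega y = evf inv_omega (ev2 F x y) * (pd (Suc 0) (ev2 F x y) * evf omega y) - evf omega y * evf inv_omega y"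
    unfolding pL by (simp add: algebra_simps)
  also have "\<dots> = evf omega (ev2 F x y) * evf inv_omega (ev2 F x y) - evf omega y * evf inv_omega y"
    by (simp add: om mult.commute)
  also have "\<dots> = 0" by (simp add: i o oF)
  finally have "pd (Suc 0) L * (evf omega y * evf inv_omega y) = 0" by (simp add: mult.assoc[symmetric])
  then have 1: "pd (Suc 0) L = 0" by (simp add: i o)
  have r: "restr (Suc 0) x = x" "restr (Suc 0) y = 0" by (simp_all add: x_def y_def restr_var)
  have "restr (Suc 0) (ev2 F x y) = x"
    by (subst ev2_hom[where T = "restr (Suc 0)"]) (auto simp: o restr_hom r ev2_zero_right)
  then have "restr (Suc 0) L = 0"
    by (simp add: L_def restr_hom evf_def restr_ev o oF r ev_zero logF_nth cst_hom)
  with 1 have "L = 0" by (rule pd_restr_zero)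
  then show ?thesis by (simp add: L_def x_def y_def algebra_simps)
qed

text \<open>Transport of the previous identity along the renaming of 0 to u and 1 to v. The renaming
  is bijective on monomials only for distinct variables; the diagonal case is recovered in the
  quotient, in \<open>ell_add\<close>.\<close>

lemma logF_ev2:
  assumes "u \<noteq> v"
  shows "evf logF (ev2 F (var u) (var v)) = evf logF (var u) + evf logF (var v)"
proof -
  let ?l = Poly_Mapping.lookup
  let ?A = "{m. Poly_Mapping.keys m \<subseteq> {u, v}}" and ?B = "{m. Poly_Mapping.keys m \<subseteq> {0, Suc 0}}"
  let ?s = "\<lambda>a b i j. Poly_Mapping.single a i + Poly_Mapping.single b (j::nat)"
  let ?\<phi> = "\<lambda>m. ?s (0::nat) (Suc 0) (?l m u) (?l m v)"
  define T :: "(nat, 'r) ps \<Rightarrow> ('a, 'r) ps" where "T = subst_ps ?A ?\<phi>"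
  have keys: "Poly_Mapping.keys (a + b) = Poly_Mapping.keys a \<union> Poly_Mapping.keys b" for a b :: "'w \<Rightarrow>\<^sub>0 nat"
    by (auto simp: in_keys_iff lookup_add)
  have exp: "m = ?s a b (?l m a) (?l m b)" if "Poly_Mapping.keys m \<subseteq> {a, b}" "a \<noteq> b" for m :: "'w \<Rightarrow>\<^sub>0 nat" and a b
    using that by (intro poly_mapping_eqI) (auto simp: lookup_add lookup_single when_def in_keys_iff)
  have bij: "bij_betw ?\<phi> ?A ?B"
  proof (rule bij_betw_byWitness[where f' = "\<lambda>m. ?s u v (?l m 0) (?l m (Suc 0))"])
    show "\<forall>a\<in>?A. ?s u v (?l (?\<phi> a) 0) (?l (?\<phi> a) (Suc 0)) = a"
      using exp[of _ u v, symmetric] assms by (auto simp: lookup_add lookup_single)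
    show "\<forall>a\<in>?B. ?\<phi> (?s u v (?l a 0) (?l a (Suc 0))) = a"
      using exp[of _ 0 "Suc 0", symmetric] assms by (auto simp: lookup_add lookup_single)
  qed (auto simp: keys split: if_splits)
  have deg: "mdeg (?\<phi> m) = mdeg m" if "m \<in> ?A" for m
    using exp[of m u v] assms that by (metis (no_types, lifting) mdeg_add mdeg_single mem_Collect_eq)
  have T: "T (f - g) = T f - T g" "T (f + g) = T f + T g" "T (f * g) = T f * T g" "T (cst c) = cst c"
    "ordge d f \<Longrightarrow> ordge d (T f)" for f g c d
  proof -
    show "T (f * g) = T f * T g" unfolding T_def
      by (rule subst_ps_mult[where B = ?B, OF _ _ _ bij])
        (simp_all only: keys lookup_add single_add mem_Collect_eq Un_subset_iff add_ac)
    show "T (cst c) = cst c" unfolding T_def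
      by (rule subst_ps_cst) (use bij in \<open>auto simp: bij_betw_def\<close>)
    show "ordge d f \<Longrightarrow> ordge d (T f)" unfolding T_def by (rule ordge_subst_ps[OF deg])
  qed (simp_all add: T_def subst_ps_diff subst_ps_add)
  have Tv: "T (var (if w = u then 0 else Suc 0)) = var w" if "w \<in> {u, v}" for w
  proof (rule ps_eqI)
    fix m
    have "?\<phi> m = Poly_Mapping.single (if w = u then 0 else Suc 0) 1 \<longleftrightarrow> m = Poly_Mapping.single w 1" if "m \<in> ?A"
    proof -
      have "?\<phi> (Poly_Mapping.single w 1) = Poly_Mapping.single (if w = u then 0 else Suc 0) 1"
        using \<open>w \<in> _\<close> assms by (auto simp: lookup_single)
      moreover have "Poly_Mapping.single w (1::nat) \<in> ?A" using \<open>w \<in> _\<close> by auto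
      ultimately show ?thesis using bij that inj_onD[of ?\<phi> ?A m "Poly_Mapping.single w 1"]
        by (auto simp: bij_betw_def)
    qed
    moreover have "Poly_Mapping.single w (1::nat) \<in> ?A" using that by auto
    ultimately show "coef (T (var (if w = u then 0 else Suc 0))) m = coef (var w) m"
      by (auto simp: T_def coef_subst_ps coef_var)
  qed
  have Tu: "T (var 0) = var u" "T (var (Suc 0)) = var v" using Tv[of u] Tv[of v] assms by auto
  have one: "T 1 = 1" using T(4)[of 1] by (simp add: cst_hom)
  have Te: "T (evf a p) = evf a (T p)" if "ordge (Suc 0) p" for a p
    unfolding evf_def using that by (subst ev_hom[where T = T]) (auto simp: T one)
  have "T (ev2 F (var 0) (var 1)) = ev2 F (var u) (var v)"
    using ev2_hom[OF ordge_var ordge_var, of T] by (simp add: T Tu)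
  then show ?thesis
    using arg_cong[OF logF_ev2_nat, of T] by (simp add: T Te ordge_var ordge_ev2 Tu)
qed

end


section \<open>Formal group algebras\<close>

definition act_ps :: "('v \<Rightarrow> 'v) \<Rightarrow> ('v, 'r) ps \<Rightarrow> ('v, 'r::comm_ring_1) ps" where
  "act_ps w = subst_ps UNIV (Poly_Mapping.map_key w)"

lemma coef_act_ps: "coef (act_ps w f) = mps_act w (coef f)"
  by (simp add: fun_eq_iff act_ps_def coef_subst_ps mps_act_def)

lemma bij_map_key:
  fixes w :: "'v \<Rightarrow> 'v"
  assumes "bij w" shows "bij (Poly_Mapping.map_key w :: _ \<Rightarrow> ('v \<Rightarrow>\<^sub>0 'b::zero))"
proof (rule o_bij)
  have i: "inj w" "inj (inv_into UNIV w)" using assms by (auto simp: bij_is_inj bij_imp_bij_inv)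
  have e: "w \<circ> inv_into UNIV w = (\<lambda>x. x)" "inv_into UNIV w \<circ> w = (\<lambda>x. x)"
    using assms by (simp_all add: fun_eq_iff bij_is_surj surj_f_inv_f bij_is_inj)
  show "Poly_Mapping.map_key (inv_into UNIV w) \<circ> Poly_Mapping.map_key w = (id :: ('v \<Rightarrow>\<^sub>0 'b) \<Rightarrow> _)"
    "Poly_Mapping.map_key w \<circ> Poly_Mapping.map_key (inv_into UNIV w) = (id :: ('v \<Rightarrow>\<^sub>0 'b) \<Rightarrow> _)"
    by (rule ext, simp only: comp_apply map_key_compose[OF i(2,1)] map_key_compose[OF i] e map_key_id id_apply)+
qed

lemma mdeg_map_key:
  assumes "bij w" shows "mdeg (Poly_Mapping.map_key w m) = mdeg m"
proof -
  have i: "inj w" using assms by (rule bij_is_inj)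
  have "mdeg (Poly_Mapping.map_key w m) = (\<Sum>v\<in>w -` Poly_Mapping.keys m. Poly_Mapping.lookup m (w v))"
    by (simp add: mdeg_def keys_map_key[OF i] map_key.rep_eq i)
  also have "\<dots> = (\<Sum>v\<in>Poly_Mapping.keys m. Poly_Mapping.lookup m v)"
    by (rule sum.reindex_bij_betw)
      (simp add: bij_betw_def inj_on_subset[OF i] surj_image_vimage_eq bij_is_surj[OF assms])
  finally show ?thesis by (simp add: mdeg_def)
qed

lemma act_ps_hom:
  assumes "bij w"
  shows "act_ps w (f - g) = act_ps w f - act_ps w g" "act_ps w (f + g) = act_ps w f + act_ps w g"
    "act_ps w (f * g) = act_ps w f * act_ps w g" "act_ps w (cst c) = cst c"
    "ordge d f \<Longrightarrow> ordge d (act_ps w f)" "act_ps w (var v) = var (w v)"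
proof -
  have i: "inj w" using assms by (rule bij_is_inj)
  have b: "bij_betw (Poly_Mapping.map_key w :: _ \<Rightarrow> ('a \<Rightarrow>\<^sub>0 nat)) UNIV UNIV" by (rule bij_map_key[OF assms])
  show "act_ps w (f * g) = act_ps w f * act_ps w g"
    unfolding act_ps_def by (rule subst_ps_mult[where B = UNIV]) (simp_all add: map_key_plus[OF i] b)
  show "act_ps w (cst c) = cst c"
    unfolding act_ps_def by (rule subst_ps_cst) (use b in \<open>auto simp: bij_betw_def map_key_zero[OF i]\<close>)
  show "ordge d f \<Longrightarrow> ordge d (act_ps w f)"
    unfolding act_ps_def by (rule ordge_subst_ps) (rule mdeg_map_key[OF assms])
  show "act_ps w (var v) = var (w v)"
  proof (rule ps_eqI)
    fix m
    have "Poly_Mapping.map_key w m = Poly_Mapping.map_key w (Poly_Mapping.single (w v) (1::nat)) \<longleftrightarrow> m = Poly_Mapping.single (w v) 1"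
      by (rule inj_eq) (rule bij_is_inj[OF b])
    then have "Poly_Mapping.map_key w m = Poly_Mapping.single v 1 \<longleftrightarrow> m = Poly_Mapping.single (w v) 1"
      unfolding map_key_single[OF i] .
    then show "coef (act_ps w (var v)) m = coef (var (w v)) m"
      by (simp add: act_ps_def coef_subst_ps coef_var)
  qed
qed (simp_all add: act_ps_def subst_ps_diff subst_ps_add)

lemma act_ps_1: "bij w \<Longrightarrow> act_ps w 1 = 1"
  using act_ps_hom(4)[of w 1] by (simp add: cst_hom)

lemma act_ps_comp: "bij u \<Longrightarrow> bij w \<Longrightarrow> act_ps (u \<circ> w) f = act_ps u (act_ps w f)"
  by (rule ps_eqI) (simp add: act_ps_def coef_subst_ps map_key_compose[symmetric] bij_is_inj)

lemma act_ps_id: "act_ps id f = f"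
  by (rule ps_eqI) (simp add: act_ps_def coef_subst_ps id_def map_key_id)

text \<open>The lattice sits in a real vector space and is therefore torsion-free, which
  \<open>ell_add\<close> relies on.\<close>

locale formal_group_algebra = fgl_rat F for F :: "nat \<Rightarrow> nat \<Rightarrow> 'r::comm_ring_1" +
  fixes \<Lambda> :: "'v::real_vector set"
  assumes L_0: "0 \<in> \<Lambda>" and L_diff: "\<lbrakk>l \<in> \<Lambda>; m \<in> \<Lambda>\<rbrakk> \<Longrightarrow> l - m \<in> \<Lambda>"
begin

lemma L_uminus: "l \<in> \<Lambda> \<Longrightarrow> - l \<in> \<Lambda>" using L_diff[OF L_0, of l] by simp
lemma L_add: "l \<in> \<Lambda> \<Longrightarrow> m \<in> \<Lambda> \<Longrightarrow> l + m \<in> \<Lambda>" using L_diff[OF _ L_uminus, of l m] by simp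

section \<open>Power series belonging to the completed polynomial ring\<close>

definition good :: "('v, 'r) ps \<Rightarrow> bool" where "good f \<longleftrightarrow> coef f \<in> carrier (mps_ring \<Lambda>)"

lemma good_iff: "good f \<longleftrightarrow> (\<forall>m. coef f m \<noteq> 0 \<longrightarrow> Poly_Mapping.keys m \<subseteq> \<Lambda>) \<and> (\<forall>d. finite {m. mdeg m = d \<and> coef f m \<noteq> 0})"
  by (simp add: good_def mps_ring_def)

lemma good_keys: "good f \<Longrightarrow> coef f m \<noteq> 0 \<Longrightarrow> Poly_Mapping.keys m \<subseteq> \<Lambda>" by (simp add: good_iff)
lemma good_finite: "good f \<Longrightarrow> finite {m. mdeg m = d \<and> coef f m \<noteq> 0}" by (simp add: good_iff)

lemma goodI:
  assumes "\<And>m. coef f m \<noteq> 0 \<Longrightarrow> Poly_Mapping.keys m \<subseteq> \<Lambda>"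
    "\<And>d. finite (S d)" "\<And>d m. mdeg m = d \<Longrightarrow> coef f m \<noteq> 0 \<Longrightarrow> m \<in> S d"
  shows "good f"
  unfolding good_iff using assms(1)
proof (intro conjI allI impI)
  fix d show "finite {m. mdeg m = d \<and> coef f m \<noteq> 0}"
    by (rule finite_subset[OF _ assms(2)[of d]]) (use assms(3) in auto)
qed auto

lemma good_add:
  assumes "good f" "good g" shows "good (f + g)" and "good (f - g)"
proof -
  let ?S = "\<lambda>d. {m. mdeg m = d \<and> coef f m \<noteq> 0} \<union> {m. mdeg m = d \<and> coef g m \<noteq> 0}"
  have fin: "finite (?S d)" for d using assms by (simp add: good_finite)
  have k: "Poly_Mapping.keys m \<subseteq> \<Lambda>" if "coef f m \<noteq> 0 \<or> coef g m \<noteq> 0" for m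
    using that good_keys assms by blast
  show "good (f + g)" by (rule goodI[where S = ?S], rule k) (use fin in auto)
  show "good (f - g)" by (rule goodI[where S = ?S], rule k) (use fin in auto)
qed

lemma good_0: "good 0" by (auto simp: good_iff)

lemma good_cst: "good (cst c)"
  by (rule goodI[where S = "\<lambda>d. {0}"]) (auto simp: coef_cst split: if_splits)

lemma good_1: "good 1" using good_cst[of 1] by (simp add: cst_hom)

lemma good_var: "v \<in> \<Lambda> \<Longrightarrow> good (var v)"
  by (rule goodI[where S = "\<lambda>d. {Poly_Mapping.single v 1}"]) (auto simp: coef_var split: if_splits)

lemma coef_mult_neq_0:
  assumes "coef (f * g) m \<noteq> 0"
  obtains a b where "a + b = m" "coef f a \<noteq> 0" "coef g b \<noteq> 0"
proof -
  obtain p where "p \<in> {(a, b). a + b = m}" "(case p of (a, b) \<Rightarrow> coef f a * coef g b) \<noteq> 0"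
    using assms unfolding coef_mult by (rule sum.not_neutral_contains_not_neutral)
  moreover obtain a b where "p = (a, b)" by (cases p)
  ultimately show thesis by (intro that[of a b]) auto
qed

lemma good_mult: assumes "good f" "good g" shows "good (f * g)"
proof (rule goodI)
  fix m assume "coef (f * g) m \<noteq> 0"
  then obtain a b where "a + b = m" "coef f a \<noteq> 0" "coef g b \<noteq> 0" by (rule coef_mult_neq_0)
  then show "Poly_Mapping.keys m \<subseteq> \<Lambda>" using good_keys assms keys_add[of a b] by blast
next
  \<comment> \<open>A monomial of degree \<open>d\<close> in the product splits into monomials of
    degree at most \<open>d\<close>, and each factor has only finitely many of those.\<close>
  let ?F = "\<lambda>h d. \<Union>i\<le>d. {m. mdeg m = i \<and> coef h m \<noteq> 0}"
  let ?S = "\<lambda>d. (\<lambda>(a, b). a + b) ` (?F f d \<times> ?F g d)"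
  fix d
  show "finite (?S d)" using assms by (intro finite_imageI finite_cartesian_product finite_UN_I) (auto simp: good_finite)
  fix m assume m: "mdeg m = d" "coef (f * g) m \<noteq> 0"
  obtain a b where "a + b = m" "coef f a \<noteq> 0" "coef g b \<noteq> 0" using m(2) by (rule coef_mult_neq_0)
  then show "m \<in> ?S d" using m by (intro image_eqI[of _ _ "(a, b)"]) auto
qed

lemma good_power: "good f \<Longrightarrow> good (f ^ n)"
  by (induction n) (auto simp: good_1 good_mult)

lemma good_sum: "(\<And>i. i \<in> A \<Longrightarrow> good (f i)) \<Longrightarrow> good (sum f A)"
  by (induction A rule: infinite_finite_induct) (auto simp: good_0 good_add)

lemma good_isum:
  assumes "\<And>i. good (f i)" "\<And>i. ordge i (f i)" shows "good (isum f)"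
proof (rule goodI)
  have ex: "\<exists>i\<le>mdeg m. coef (f i) m \<noteq> 0" if "coef (isum f) m \<noteq> 0" for m
    using that by (force simp: isum_def intro: ccontr sum.neutral)
  fix m assume "coef (isum f) m \<noteq> 0"
  then show "Poly_Mapping.keys m \<subseteq> \<Lambda>" using ex good_keys assms by blast
next
  have ex: "\<exists>i\<le>mdeg m. coef (f i) m \<noteq> 0" if "coef (isum f) m \<noteq> 0" for m
    using that by (force simp: isum_def intro: ccontr sum.neutral)
  let ?S = "\<lambda>d. \<Union>i\<le>d. {m. mdeg m = d \<and> coef (f i) m \<noteq> 0}"
  fix d show "finite (?S d)" using assms(1) by (auto simp: good_finite)
  fix m assume "mdeg m = d" "coef (isum f) m \<noteq> 0"
  then show "m \<in> ?S d" using ex by auto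
qed

lemma good_ev: "ordge (Suc 0) p \<Longrightarrow> good p \<Longrightarrow> (\<And>i. good (a i)) \<Longrightarrow> good (ev a p)"
  unfolding ev_def by (rule good_isum) (auto simp: good_mult good_power ordge_ev_term)

lemma good_evf: "ordge (Suc 0) p \<Longrightarrow> good p \<Longrightarrow> good (evf a p)"
  unfolding evf_def by (rule good_ev) (auto simp: good_cst)

lemma good_ev2: "ordge (Suc 0) p \<Longrightarrow> good p \<Longrightarrow> ordge (Suc 0) q \<Longrightarrow> good q \<Longrightarrow> good (ev2 F p q)"
  unfolding ev2_def by (intro good_ev good_cst)

abbreviation "P \<equiv> mps_ring \<Lambda> :: ('v, 'r) mps ring"

lemma P_carrier: "x \<in> carrier P \<longleftrightarrow> (\<exists>f. good f \<and> x = coef f)"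
  by (auto simp: good_def) (metis coef_Ps)

lemma P_cring: "cring P"
proof (rule cringI)
  show "abelian_group P"
  proof (rule abelian_groupI)
    fix a assume "a \<in> carrier P"
    then obtain f where f: "good f" "a = coef f" by (auto simp: P_carrier)
    have "coef (0 - f) \<in> carrier P" using good_add(2)[OF good_0 f(1)] by (simp only: good_def)
    then show "\<exists>b\<in>carrier P. b \<oplus>\<^bsub>P\<^esub> a = \<zero>\<^bsub>P\<^esub>" by (rule bexI[rotated]) (simp add: f)
  next
    fix a b assume "a \<in> carrier P" "b \<in> carrier P"
    then obtain f g where "good f" "a = coef f" "good g" "b = coef g" by (auto simp: P_carrier)
    then show "a \<oplus>\<^bsub>P\<^esub> b \<in> carrier P" by (simp add: good_add good_def[symmetric])
  qed (use good_0 in \<open>simp_all add: good_def algebra_simps\<close>)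
  show "comm_monoid P"
  proof (rule comm_monoidI)
    fix a b assume "a \<in> carrier P" "b \<in> carrier P"
    then obtain f g where "good f" "a = coef f" "good g" "b = coef g" by (auto simp: P_carrier)
    then show "a \<otimes>\<^bsub>P\<^esub> b \<in> carrier P" by (simp add: good_mult good_def[symmetric])
  qed (use good_1 in \<open>simp_all add: good_def algebra_simps\<close>)
qed (simp add: algebra_simps)

sublocale P: cring P by (rule P_cring)

lemma P_minus: "good f \<Longrightarrow> good g \<Longrightarrow> coef f \<ominus>\<^bsub>P\<^esub> coef g = coef (f - g)"
proof -
  assume f: "good f" and g: "good g"
  have c: "coef f \<in> carrier P" "coef g \<in> carrier P" "coef (- g) \<in> carrier P"
    using f g good_add(2)[OF good_0 g] by (auto simp: good_def)
  have "coef (- g) \<oplus>\<^bsub>P\<^esub> coef g = \<zero>\<^bsub>P\<^esub>" by simp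
  then have "\<ominus>\<^bsub>P\<^esub> coef g = coef (- g)" using c P.minus_equality by blast
  then show ?thesis by (simp add: a_minus_def)
qed

section \<open>The closed ideal of relations\<close>

abbreviation "gens \<equiv> {mps_var 0} \<union>
      {mps_var (l1 + l2) \<ominus>\<^bsub>P\<^esub> mps_eval2 \<Lambda> F (mps_var l1) (mps_var l2) | l1 l2. l1 \<in> \<Lambda> \<and> l2 \<in> \<Lambda>}"

lemma coef_var': "mps_var v = coef (var v)" by (simp add: var_def)

lemma gens_eq: "gens = insert (coef (var 0)) {coef (var (l1 + l2) - ev2 F (var l1) (var l2)) | l1 l2. l1 \<in> \<Lambda> \<and> l2 \<in> \<Lambda>}"
proof -
  have *: "mps_var (l1 + l2) \<ominus>\<^bsub>P\<^esub> mps_eval2 \<Lambda> F (mps_var l1) (mps_var l2) = coef (var (l1 + l2) - ev2 F (var l1) (var l2))"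
    if "l1 \<in> \<Lambda>" "l2 \<in> \<Lambda>" for l1 l2
    unfolding coef_var' using that
    by (subst mps_eval2_eq) (simp_all add: ordge_var P_minus good_var L_add good_ev2)
  then have "{mps_var (l1 + l2) \<ominus>\<^bsub>P\<^esub> mps_eval2 \<Lambda> F (mps_var l1) (mps_var l2) | l1 l2. l1 \<in> \<Lambda> \<and> l2 \<in> \<Lambda>} =
      {coef (var (l1 + l2) - ev2 F (var l1) (var l2)) | l1 l2. l1 \<in> \<Lambda> \<and> l2 \<in> \<Lambda>}"
    by (intro Collect_cong ex_cong1) (metis *)
  then show ?thesis by (simp add: coef_var')
qed

lemma gens_good: "gens \<subseteq> carrier P"
  unfolding gens_eq by (auto simp: good_def[symmetric] good_var L_0 L_add good_add good_ev2 ordge_var)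

text \<open>\<open>J0\<close> is the algebraic ideal of the relations and \<open>J\<close> its
  closure. Both are moved to the type of power series, where subtraction and \<open>ordge\<close>
  are at hand.\<close>

definition J0 :: "('v, 'r) ps set" where "J0 = {f. coef f \<in> genideal P gens}"
definition J :: "('v, 'r) ps set" where "J = {f. coef f \<in> fga_ideal F \<Lambda>}"

lemma ideal0: "ideal (genideal P gens) P" by (rule P.genideal_ideal[OF gens_good])

lemma J0_good: "f \<in> J0 \<Longrightarrow> good f"
  using additive_subgroup.a_subset[OF ideal.axioms(1)[OF ideal0]] by (auto simp: J0_def good_def)

lemma J0_diff: "f \<in> J0 \<Longrightarrow> g \<in> J0 \<Longrightarrow> f - g \<in> J0"
  using P.minus_closed ideal.axioms(1)[OF ideal0, THEN additive_subgroup.a_subgroup, THEN subgroup.m_closed, of "coef f" "\<ominus>\<^bsub>P\<^esub> coef g"]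
    ideal.axioms(1)[OF ideal0, THEN additive_subgroup.a_inv_closed, of "coef g"]
    P_minus[OF J0_good J0_good, of f g]
  by (auto simp: J0_def a_minus_def)

lemma J0_mult: "f \<in> J0 \<Longrightarrow> good g \<Longrightarrow> g * f \<in> J0"
  using ideal.I_l_closed[OF ideal0, of "coef f" "coef g"] by (simp add: J0_def good_def)

lemma J0_0: "0 \<in> J0"
  using additive_subgroup.zero_closed[OF ideal.axioms(1)[OF ideal0]] by (simp add: J0_def)

lemma J_iff: "f \<in> J \<longleftrightarrow> good f \<and> (\<forall>d. \<exists>g\<in>J0. ordge d (f - g))"
proof -
  have "(\<exists>g\<in>genideal P gens. \<forall>m. mdeg m < d \<longrightarrow> coef f m = g m) \<longleftrightarrow> (\<exists>g\<in>J0. ordge d (f - g))" for d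
  proof
    assume "\<exists>g\<in>genideal P gens. \<forall>m. mdeg m < d \<longrightarrow> coef f m = g m"
    then obtain g where "g \<in> genideal P gens" "\<forall>m. mdeg m < d \<longrightarrow> coef f m = g m" by blast
    then show "\<exists>g\<in>J0. ordge d (f - g)" by (intro bexI[of _ "Ps g"]) (auto simp: J0_def ordge_def)
  next
    assume "\<exists>g\<in>J0. ordge d (f - g)"
    then show "\<exists>g\<in>genideal P gens. \<forall>m. mdeg m < d \<longrightarrow> coef f m = g m" by (force simp: J0_def ordge_def)
  qed
  then show ?thesis by (simp add: J_def fga_ideal_def mps_closure_def good_def)
qed

lemma J_good: "f \<in> J \<Longrightarrow> good f" by (simp add: J_iff)

lemma J_approx: "f \<in> J \<Longrightarrow> \<exists>g\<in>J0. ordge d (f - g)" by (simp add: J_iff)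

lemma J0_J: "f \<in> J0 \<Longrightarrow> f \<in> J"
  unfolding J_iff by (auto simp: J0_good intro!: bexI[of _ f])

lemma J_0: "0 \<in> J" using J0_J J0_0 by auto

lemma J_diff: assumes f: "f \<in> J" and g: "g \<in> J" shows "f - g \<in> J"
  unfolding J_iff
proof (intro conjI allI)
  show "good (f - g)" using f g by (simp add: good_add J_good)
  fix d
  obtain f' g' where h: "f' \<in> J0" "ordge d (f - f')" "g' \<in> J0" "ordge d (g - g')"
    using J_approx[OF f] J_approx[OF g] by blast
  have "ordge d (f - g - (f' - g'))" using ordge_diff[OF h(2,4)] by (simp add: algebra_simps)
  then show "\<exists>h\<in>J0. ordge d (f - g - h)" using J0_diff h by blast
qed

lemma J_uminus: "f \<in> J \<Longrightarrow> - f \<in> J" using J_diff[OF J_0] by simp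

lemma J_add: "f \<in> J \<Longrightarrow> g \<in> J \<Longrightarrow> f + g \<in> J" using J_diff[OF _ J_uminus] by simp

lemma J_mult: assumes f: "f \<in> J" and g: "good g" shows "g * f \<in> J"
  unfolding J_iff
proof (intro conjI allI)
  show "good (g * f)" using f g by (simp add: good_mult J_good)
  fix d
  obtain f' where h: "f' \<in> J0" "ordge d (f - f')" using J_approx[OF f] by blast
  have "ordge d (g * f - g * f')" using ordge_mult_left[OF h(2), of g] by (simp add: algebra_simps)
  then show "\<exists>h\<in>J0. ordge d (g * f - h)" using J0_mult h g by blast
qed

lemma J_sum: "(\<And>i. i \<in> A \<Longrightarrow> f i \<in> J) \<Longrightarrow> sum f A \<in> J"
  by (induction A rule: infinite_finite_induct) (auto simp: J_0 J_add)

text \<open>Closure is idempotent: approximating twice to the same order is as good as approximating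
  once.\<close>

lemma J_closed: assumes "good f" "\<And>d. \<exists>g\<in>J. ordge d (f - g)" shows "f \<in> J"
  unfolding J_iff
proof (intro conjI allI)
  fix d
  obtain g h where h: "g \<in> J" "ordge d (f - g)" "h \<in> J0" "ordge d (g - h)" using assms(2) J_approx by blast
  then show "\<exists>g\<in>J0. ordge d (f - g)" using ordge_add[OF h(2,4)] by auto
qed (rule assms(1))

lemma J_var_0: "var 0 \<in> J" and J_var_add: "\<lbrakk>l \<in> \<Lambda>; m \<in> \<Lambda>\<rbrakk> \<Longrightarrow> var (l + m) - ev2 F (var l) (var m) \<in> J"
proof -
  have "gens \<subseteq> genideal P gens" by (rule P.genideal_self[OF gens_good])
  then have "insert (coef (var 0)) {coef (var (l1 + l2) - ev2 F (var l1) (var l2)) | l1 l2. l1 \<in> \<Lambda> \<and> l2 \<in> \<Lambda>} \<subseteq> genideal P gens"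
    by (simp only: gens_eq)
  then have "var 0 \<in> J0" "l \<in> \<Lambda> \<Longrightarrow> m \<in> \<Lambda> \<Longrightarrow> var (l + m) - ev2 F (var l) (var m) \<in> J0"
    unfolding J0_def by blast+
  then show "var 0 \<in> J" "\<lbrakk>l \<in> \<Lambda>; m \<in> \<Lambda>\<rbrakk> \<Longrightarrow> var (l + m) - ev2 F (var l) (var m) \<in> J" using J0_J by auto
qed

lemma J_power: assumes "p - q \<in> J" "good p" "good q" shows "p ^ n - q ^ n \<in> J"
proof (induction n)
  case (Suc n)
  have "p ^ Suc n - q ^ Suc n = p * (p ^ n - q ^ n) + q ^ n * (p - q)" by (simp add: algebra_simps)
  then show ?case using Suc assms by (simp add: J_add J_mult good_power)
qed (simp add: J_0)

text \<open>For partial sums this is the congruence of powers. It extends to the infinite series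
  because \<open>J\<close> is closed.\<close>

lemma J_ev:
  assumes "p - q \<in> J" "good p" "good q" "ordge (Suc 0) p" "ordge (Suc 0) q" "\<And>i. good (a i)"
  shows "ev a p - ev a q \<in> J"
proof (rule J_closed)
  show "good (ev a p - ev a q)" using assms by (simp add: good_add good_ev)
  fix d
  have "(\<Sum>i<d. a i * (p ^ i - q ^ i)) \<in> J" using assms by (intro J_sum J_mult J_power)
  moreover have "ordge d ((ev a p - (\<Sum>i<d. a i * p ^ i)) - (ev a q - (\<Sum>i<d. a i * q ^ i)))"
    using assms by (intro ordge_diff ev_approx)
  ultimately show "\<exists>g\<in>J. ordge d (ev a p - ev a q - g)"
    by (intro bexI) (auto simp: algebra_simps sum_subtractf)
qed

lemma J_ideal: "ideal (fga_ideal F \<Lambda>) P"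
proof (rule idealI)
  have J: "coef f \<in> fga_ideal F \<Lambda> \<longleftrightarrow> f \<in> J" for f by (simp add: J_def)
  have Jx: "x \<in> fga_ideal F \<Lambda> \<longleftrightarrow> (\<exists>f\<in>J. x = coef f)" for x by (auto simp: J_def) (metis coef_Ps)
  show "subgroup (fga_ideal F \<Lambda>) (add_monoid P)"
  proof (rule subgroup.intro)
    show "fga_ideal F \<Lambda> \<subseteq> carrier (add_monoid P)" by (auto simp: Jx good_def[symmetric] J_good)
    fix x assume "x \<in> fga_ideal F \<Lambda>"
    then obtain f where f: "f \<in> J" "x = coef f" by (auto simp: Jx)
    have "inv\<^bsub>add_monoid P\<^esub> x = \<ominus>\<^bsub>P\<^esub> x" by (simp add: a_inv_def)
    also have "\<dots> = \<zero>\<^bsub>P\<^esub> \<ominus>\<^bsub>P\<^esub> x" using f J_good[OF f(1)] unfolding good_def by (simp add: a_minus_def)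
    also have "\<dots> = coef (0 - f)" using P_minus[OF good_0 J_good[OF f(1)]] f by simp
    finally show "inv\<^bsub>add_monoid P\<^esub> x \<in> fga_ideal F \<Lambda>" using J_diff[OF J_0 f(1)] by (simp add: J)
  qed (auto simp: Jx J_add J_0)
  fix a x assume "a \<in> fga_ideal F \<Lambda>" "x \<in> carrier P"
  then show "x \<otimes>\<^bsub>P\<^esub> a \<in> fga_ideal F \<Lambda>" "a \<otimes>\<^bsub>P\<^esub> x \<in> fga_ideal F \<Lambda>"
    using J_mult by (auto simp: Jx P_carrier mult.commute)
qed (rule P.ring_axioms)

sublocale I: ideal "fga_ideal F \<Lambda>" P by (rule J_ideal)

section \<open>The quotient ring and its elements as classes of power series\<close>

abbreviation "S \<equiv> fga F \<Lambda>"

definition cls :: "('v, 'r) ps \<Rightarrow> ('v, 'r) mps set" where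
  "cls f = fga_ideal F \<Lambda> +>\<^bsub>P\<^esub> coef f"

lemma S_cring: "cring S" unfolding fga_def by (rule I.quotient_is_cring[OF P_cring])

lemma S_carrier: "a \<in> carrier S \<longleftrightarrow> (\<exists>f. good f \<and> a = cls f)"
  unfolding fga_def FactRing_def A_RCOSETS_def' cls_def by (simp add: P_carrier Bex_def) blast

lemma cls_closed [simp, intro]: "good f \<Longrightarrow> cls f \<in> carrier S" by (auto simp: S_carrier)

lemma S_cases: assumes "a \<in> carrier S" obtains f where "good f" "a = cls f"
  using assms by (auto simp: S_carrier)

lemma cls_hom:
  "good f \<Longrightarrow> good g \<Longrightarrow> cls f \<oplus>\<^bsub>S\<^esub> cls g = cls (f + g)"
  "good f \<Longrightarrow> good g \<Longrightarrow> cls f \<otimes>\<^bsub>S\<^esub> cls g = cls (f * g)"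
  "\<one>\<^bsub>S\<^esub> = cls 1" "\<zero>\<^bsub>S\<^esub> = cls 0"
proof -
  note h = I.rcos_ring_hom[folded fga_def]
  show "\<one>\<^bsub>S\<^esub> = cls 1" using ring_hom_one[OF h] by (simp add: cls_def)
  show "\<zero>\<^bsub>S\<^esub> = cls 0" using ring_hom_zero[OF h P.ring_axioms cring.axioms(1)[OF S_cring]] by (simp add: cls_def)
  assume "good f" "good g"
  then show "cls f \<oplus>\<^bsub>S\<^esub> cls g = cls (f + g)" "cls f \<otimes>\<^bsub>S\<^esub> cls g = cls (f * g)"
    using ring_hom_add[OF h, of "coef f" "coef g"] ring_hom_mult[OF h, of "coef f" "coef g"]
    by (simp_all add: cls_def good_def)
qed

lemma cls_eq_iff: "good f \<Longrightarrow> good g \<Longrightarrow> cls f = cls g \<longleftrightarrow> f - g \<in> J"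
proof -
  assume f: "good f" and g: "good g"
  have "cls f = cls g \<longleftrightarrow> coef f \<ominus>\<^bsub>P\<^esub> coef g \<in> fga_ideal F \<Lambda>"
    unfolding cls_def using f g by (intro P.quotient_eq_iff_same_a_r_cos[OF J_ideal, symmetric]) (auto simp: good_def)
  then show ?thesis using f g by (simp add: P_minus J_def)
qed

lemma cls_minus: "good f \<Longrightarrow> good g \<Longrightarrow> cls f \<ominus>\<^bsub>S\<^esub> cls g = cls (f - g)"
proof -
  assume f: "good f" and g: "good g"
  interpret S: cring S by (rule S_cring)
  have "cls (f - g) \<oplus>\<^bsub>S\<^esub> cls g = cls f" using f g by (simp add: cls_hom good_add)
  then show ?thesis using f g by (metis (no_types, lifting) S.add.inv_solve_right' a_minus_def cls_closed good_add(2))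
qed

lemma fga_var_cls: "fga_var F \<Lambda> v = cls (var v)"
  by (simp add: fga_var_def cls_def coef_var')


subsection \<open>The logarithm in the formal group algebra\<close>

abbreviation "xv v \<equiv> cls (var v)"

definition ell :: "'v \<Rightarrow> ('v, 'r) mps set" where "ell v = cls (evf logF (var v))"

lemma good_log: "v \<in> \<Lambda> \<Longrightarrow> good (evf logF (var v))"
  by (simp add: good_evf good_var ordge_var)

lemma ell_closed: "v \<in> \<Lambda> \<Longrightarrow> ell v \<in> carrier S"
  by (simp add: ell_def good_log)

lemma ell_add_distinct:
  assumes "l \<in> \<Lambda>" "m \<in> \<Lambda>" "l \<noteq> m" shows "ell (l + m) = ell l \<oplus>\<^bsub>S\<^esub> ell m"
proof -
  have "evf logF (var (l + m)) - evf logF (ev2 F (var l) (var m)) \<in> J"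
    unfolding evf_def using assms
    by (intro J_ev J_var_add good_var good_ev2 ordge_ev2 ordge_var L_add good_cst)
  then show ?thesis
    using assms by (simp add: ell_def cls_hom good_log logF_ev2 cls_eq_iff L_add good_add)
qed

lemma ell_0: "ell 0 = \<zero>\<^bsub>S\<^esub>"
proof -
  have "evf logF (var 0) - evf logF 0 \<in> J"
    unfolding evf_def by (rule J_ev) (auto simp: J_var_0 good_var L_0 good_0 ordge_var good_cst)
  moreover have "evf logF (0 :: ('v, 'r) ps) = 0" by (simp add: evf_def ev_zero logF_nth cst_hom)
  ultimately show ?thesis by (simp add: ell_def cls_hom cls_eq_iff good_log L_0 good_0)
qed

text \<open>\<open>ell_add_distinct\<close> says nothing for l = m. For nonzero l the double is
  reached by adding distinct elements only: 3l = l + 2l, -l = l + (-2l), 0 = 2l + (-2l) and 2l = 3l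
  + (-l).\<close>

lemma ell_add:
  assumes "l \<in> \<Lambda>" "m \<in> \<Lambda>" shows "ell (l + m) = ell l \<oplus>\<^bsub>S\<^esub> ell m"
proof (cases "l = m")
  case False then show ?thesis using ell_add_distinct assms by simp
next
  case True
  interpret S: cring S by (rule S_cring)
  show ?thesis
  proof (cases "l = 0")
    case True then show ?thesis using \<open>l = m\<close> by (simp add: ell_0)
  next
    case False
    have sc: "real a *\<^sub>R l = real b *\<^sub>R l \<longleftrightarrow> a = b" "real a *\<^sub>R l = - (real b *\<^sub>R l) \<longleftrightarrow> a + b = 0" for a b
    proof -
      show "real a *\<^sub>R l = real b *\<^sub>R l \<longleftrightarrow> a = b" using False by simp
      have "real a *\<^sub>R l = - (real b *\<^sub>R l) \<longleftrightarrow> (real a + real b) *\<^sub>R l = 0"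
        by (simp add: scaleR_add_left eq_neg_iff_add_eq_0)
      then show "real a *\<^sub>R l = - (real b *\<^sub>R l) \<longleftrightarrow> a + b = 0" using False by (simp flip: of_nat_add)
    qed
    have d: "l \<noteq> l + l" "l \<noteq> - (l + l)" "l + l \<noteq> - (l + l)" "l + (l + l) \<noteq> - l"
      using sc(1)[of 1 2] sc(2)[of 1 2] sc(2)[of 2 2] sc(2)[of 3 1] by (simp_all add: scaleR_2 scaleR_left_distrib[of 1 2 l, simplified])
    have l: "l \<in> \<Lambda>" "l + l \<in> \<Lambda>" using assms by (auto intro: L_add)
    note L = l L_uminus[OF l(2)] L_add[OF l] L_uminus[OF l(1)]
    note c = L[THEN ell_closed]
    have 1: "ell (l + (l + l)) = ell l \<oplus>\<^bsub>S\<^esub> ell (l + l)" using d L by (intro ell_add_distinct)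
    have 2: "ell (- l) = ell l \<oplus>\<^bsub>S\<^esub> ell (- (l + l))" using ell_add_distinct[OF L(1,3) d(2)] by simp
    have 3: "\<zero>\<^bsub>S\<^esub> = ell (l + l) \<oplus>\<^bsub>S\<^esub> ell (- (l + l))" using ell_add_distinct[OF L(2,3) d(3)] by (simp add: ell_0)
    have "ell (l + l) = ell (l + (l + l)) \<oplus>\<^bsub>S\<^esub> ell (- l)" using ell_add_distinct[OF L(4,5) d(4)] by simp
    also have "\<dots> = (ell l \<oplus>\<^bsub>S\<^esub> ell l) \<oplus>\<^bsub>S\<^esub> (ell (l + l) \<oplus>\<^bsub>S\<^esub> ell (- (l + l)))"
      unfolding 1 2 using c by (simp add: S.a_ac)
    also have "\<dots> = ell l \<oplus>\<^bsub>S\<^esub> ell l" unfolding 3[symmetric] using c by simp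
    finally show ?thesis using True by simp
  qed
qed

text \<open>The logarithm is x times a series with constant term 1, and such a series is
  invertible.\<close>

lemma ell_unit:
  assumes "v \<in> \<Lambda>"
  shows "\<exists>u\<in>carrier S. \<exists>u'\<in>carrier S. u \<otimes>\<^bsub>S\<^esub> u' = \<one>\<^bsub>S\<^esub> \<and> ell v = xv v \<otimes>\<^bsub>S\<^esub> u"
proof -
  let ?b = "fps_shift 1 logF"
  have "?b * fps_right_inverse ?b 1 = 1" by (rule fps_right_inverse) (simp add: logF_nth)
  then have "evf ?b (var v) * evf (fps_right_inverse ?b 1) (var v) = 1"
    by (simp add: evf_mult[symmetric] ordge_var evf_1)
  moreover have "evf logF (var v) = var v * evf ?b (var v)"
    unfolding evf_def by (subst ev_split) (simp_all add: ordge_var logF_nth cst_hom)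
  moreover have "good (evf ?b (var v))" "good (evf (fps_right_inverse ?b 1) (var v))"
    using assms by (simp_all add: good_evf good_var ordge_var)
  ultimately show ?thesis using assms
    by (intro bexI[of _ "cls (evf ?b (var v))"] bexI[of _ "cls (evf (fps_right_inverse ?b 1) (var v))"])
      (auto simp: cls_hom good_var ell_def)
qed


subsection \<open>The action of lattice automorphisms\<close>

definition latt_aut :: "('v \<Rightarrow> 'v) \<Rightarrow> bool" where
  "latt_aut w \<longleftrightarrow> bij w \<and> w 0 = 0 \<and> (\<forall>l m. w (l + m) = w l + w m) \<and> w ` \<Lambda> = \<Lambda>"

lemma latt_autD: assumes "latt_aut w" shows "bij w" "w 0 = 0" "w (l + m) = w l + w m" "l \<in> \<Lambda> \<Longrightarrow> w l \<in> \<Lambda>"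
  using assms by (auto simp: latt_aut_def)

lemma good_act:
  assumes "latt_aut w" "good f" shows "good (act_ps w f)"
proof (rule goodI)
  have w: "bij w" "inj w" using latt_autD(1)[OF assms(1)] by (auto simp: bij_is_inj)
  fix m assume "coef (act_ps w f) m \<noteq> 0"
  then have k: "w -` Poly_Mapping.keys m \<subseteq> \<Lambda>"
    using good_keys[OF assms(2), of "Poly_Mapping.map_key w m"] by (simp add: coef_act_ps mps_act_def keys_map_key[OF w(2)])
  show "Poly_Mapping.keys m \<subseteq> \<Lambda>"
  proof
    fix v assume v: "v \<in> Poly_Mapping.keys m"
    obtain u where "v = w u" using bij_is_surj[OF w(1)] by (metis surjD)
    then show "v \<in> \<Lambda>" using v k latt_autD(4)[OF assms(1)] by auto
  qed
next
  have w: "bij w" using latt_autD(1)[OF assms(1)] .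
  let ?S = "\<lambda>d. Poly_Mapping.map_key w -` {m. mdeg m = d \<and> coef f m \<noteq> 0}"
  fix d
  show "finite (?S d)" by (intro finite_vimageI good_finite assms bij_is_inj bij_map_key w)
  fix m assume "mdeg m = d" "coef (act_ps w f) m \<noteq> 0"
  then show "m \<in> ?S d" by (simp add: coef_act_ps mps_act_def mdeg_map_key[OF w])
qed

lemma act_ev2:
  assumes w: "latt_aut w" shows "act_ps w (ev2 F (var l) (var m)) = ev2 F (var (w l)) (var (w m))"
  by (subst ev2_hom[where T = "act_ps w"]) (simp_all add: ordge_var act_ps_hom[OF latt_autD(1)[OF w]])

lemma act_evf:
  assumes w: "latt_aut w" shows "act_ps w (evf a (var l)) = evf a (var (w l))"
  unfolding evf_def
  by (subst ev_hom[where T = "act_ps w"])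
    (simp_all add: ordge_var act_ps_hom[OF latt_autD(1)[OF w]] act_ps_1[OF latt_autD(1)[OF w]])

text \<open>Generators go to generators, so the preimage of the algebraic ideal is an ideal
  containing them. The passage to the closure uses that the action keeps the order of
  vanishing.\<close>

lemma act_J: assumes w: "latt_aut w" and f: "f \<in> J" shows "act_ps w f \<in> J"
proof -
  have b: "bij w" using latt_autD(1)[OF w] .
  have gens: "mps_act w ` gens \<subseteq> genideal P gens"
  proof -
    have "mps_act w ` gens \<subseteq> gens"
      unfolding gens_eq
      by (auto simp: coef_act_ps[symmetric] act_ps_hom[OF b] latt_autD[OF w] act_ev2[OF w])
         (use latt_autD(4)[OF w] in blast)
    then show ?thesis using P.genideal_self[OF gens_good] by blast
  qed
  have hom: "mps_act w \<in> ring_hom P P"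
  proof (rule ring_hom_memI)
    show "mps_act w \<one>\<^bsub>P\<^esub> = \<one>\<^bsub>P\<^esub>" unfolding mps_ring_simps coef_act_ps[symmetric] act_ps_1[OF b] ..
  next
    fix a c assume "a \<in> carrier P" "c \<in> carrier P"
    then obtain f g where "good f" "a = coef f" "good g" "c = coef g" by (auto simp: P_carrier)
    then show "mps_act w a \<in> carrier P" "mps_act w (a \<otimes>\<^bsub>P\<^esub> c) = mps_act w a \<otimes>\<^bsub>P\<^esub> mps_act w c"
      "mps_act w (a \<oplus>\<^bsub>P\<^esub> c) = mps_act w a \<oplus>\<^bsub>P\<^esub> mps_act w c"
      using good_act[OF w, of f] by (simp_all add: good_def coef_act_ps[symmetric] act_ps_hom[OF b] del: coef_simps)
  qed
  interpret h: ring_hom_ring P P "mps_act w" by unfold_locales (rule hom)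
  have "ideal {r \<in> carrier P. mps_act w r \<in> genideal P gens} P" by (rule h.ideal_vimage[OF ideal0])
  then have "genideal P gens \<subseteq> {r \<in> carrier P. mps_act w r \<in> genideal P gens}"
    by (rule P.genideal_minimal) (use gens gens_good in blast)
  then have 0: "act_ps w g \<in> J0" if "g \<in> J0" for g using that by (auto simp: J0_def coef_act_ps)
  show ?thesis unfolding J_iff
  proof (intro conjI allI)
    show "good (act_ps w f)" using f by (simp add: good_act[OF w] J_good)
    fix d
    obtain g where "g \<in> J0" "ordge d (f - g)" using J_approx[OF f] by blast
    then show "\<exists>g\<in>J0. ordge d (act_ps w f - g)"
      using 0 act_ps_hom(5)[OF b, of d "f - g"] by (auto simp: act_ps_hom(1)[OF b])
  qed
qed

lemma latt_aut_inv: assumes "latt_aut w" shows "latt_aut (inv_into UNIV w)"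
proof -
  have b: "bij w" using latt_autD(1)[OF assms] .
  have i: "inv_into UNIV w (w v) = v" "w (inv_into UNIV w v) = v" for v
    using b by (auto simp: bij_is_inj bij_is_surj surj_f_inv_f)
  have "inv_into UNIV w (l + m) = inv_into UNIV w l + inv_into UNIV w m" for l m
    using latt_autD(3)[OF assms, of "inv_into UNIV w l" "inv_into UNIV w m"] i by metis
  moreover have "inv_into UNIV w ` \<Lambda> = \<Lambda>"
  proof -
    have "inv_into UNIV w ` (w ` \<Lambda>) = \<Lambda>" by (simp add: image_image i)
    then show ?thesis using assms by (simp add: latt_aut_def)
  qed
  ultimately show ?thesis using b i latt_autD(2)[OF assms] unfolding latt_aut_def
    by (metis bij_imp_bij_inv)
qed

text \<open>\<open>fga_act\<close> takes images of cosets, so the claim needs w(J) = J and not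
  merely w(J) inside J. The inverse automorphism supplies the other inclusion.\<close>

lemma act_cls: assumes w: "latt_aut w" and f: "good f" shows "fga_act w (cls f) = cls (act_ps w f)"
proof -
  have b: "bij w" and bi: "bij (inv_into UNIV w)" using latt_autD(1)[OF w] by (auto simp: bij_imp_bij_inv)
  have cls_im: "cls g = (\<lambda>j. coef (j + g)) ` J" for g
  proof -
    have "fga_ideal F \<Lambda> = coef ` J"
    proof (intro equalityI subsetI)
      fix h assume "h \<in> fga_ideal F \<Lambda>"
      then have "Ps h \<in> J" by (simp add: J_def)
      then have "coef (Ps h) \<in> coef ` J" by (rule imageI)
      then show "h \<in> coef ` J" by simp
    qed (auto simp: J_def)
    then show ?thesis unfolding cls_def a_r_coset_def r_coset_def by (auto simp: image_iff)
  qed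
  have "J \<subseteq> act_ps w ` J"
  proof
    fix g assume g: "g \<in> J"
    have "act_ps w (act_ps (inv_into UNIV w) g) = g"
      using act_ps_comp[OF b bi, of g] b by (simp add: bij_is_surj surj_iff[THEN iffD1] act_ps_id)
    then show "g \<in> act_ps w ` J" using act_J[OF latt_aut_inv[OF w] g] by (metis imageI)
  qed
  then have "act_ps w ` J = J" using act_J[OF w] by blast
  then have "(\<lambda>j. coef (j + act_ps w f)) ` act_ps w ` J = cls (act_ps w f)" by (simp add: cls_im)
  then show ?thesis by (simp add: fga_act_def cls_im image_image act_ps_hom[OF b] flip: coef_act_ps)
qed

lemma fga_act_hom: assumes w: "latt_aut w" shows "fga_act w \<in> ring_hom S S"
proof (rule ring_hom_memI)
  have b: "bij w" using latt_autD(1)[OF w] .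
  show "fga_act w \<one>\<^bsub>S\<^esub> = \<one>\<^bsub>S\<^esub>" by (simp add: cls_hom act_cls[OF w] good_1 act_ps_1[OF b])
  fix a c assume "a \<in> carrier S" "c \<in> carrier S"
  then show "fga_act w a \<in> carrier S" "fga_act w (a \<otimes>\<^bsub>S\<^esub> c) = fga_act w a \<otimes>\<^bsub>S\<^esub> fga_act w c"
    "fga_act w (a \<oplus>\<^bsub>S\<^esub> c) = fga_act w a \<oplus>\<^bsub>S\<^esub> fga_act w c"
    by (auto elim!: S_cases simp: act_cls[OF w] good_act[OF w] cls_hom good_mult good_add act_ps_hom[OF b])
qed

lemma fga_act_id: "fga_act id a = (a :: ('v, 'r) mps set)"
proof -
  have "mps_act id f = f" for f :: "('v, 'r) mps" using coef_act_ps[of id "Ps f"] by (simp add: act_ps_id)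
  then have "mps_act id = (\<lambda>f :: ('v, 'r) mps. f)" by (rule ext)
  then show ?thesis by (simp add: fga_act_def)
qed

lemma fga_act_comp:
  fixes u w :: "'v \<Rightarrow> 'v" and a :: "('v, 'r) mps set"
  assumes "bij u" "bij w" shows "fga_act (u \<circ> w) a = fga_act u (fga_act w a)"
proof -
  have "mps_act (u \<circ> w) f = mps_act u (mps_act w f)" for f :: "('v, 'r) mps"
    using coef_act_ps[of "u \<circ> w" "Ps f"] coef_act_ps[of u "act_ps w (Ps f)"] coef_act_ps[of w "Ps f"]
    by (simp add: act_ps_comp[OF assms])
  then show ?thesis by (simp add: fga_act_def image_image)
qed

lemma fga_act_var: "latt_aut w \<Longrightarrow> v \<in> \<Lambda> \<Longrightarrow> fga_act w (xv v) = xv (w v)"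
  by (simp add: act_cls good_var act_ps_hom latt_autD(1))

lemma fga_act_ell: "latt_aut w \<Longrightarrow> v \<in> \<Lambda> \<Longrightarrow> fga_act w (ell v) = ell (w v)"
  by (simp add: ell_def act_cls good_log act_evf)

lemma fga_nat_inverse:
  fixes k :: nat
  assumes "k > 0"
  shows "\<exists>c\<in>carrier S. add_pow S k c = \<one>\<^bsub>S\<^esub> \<and> (\<forall>w. latt_aut w \<longrightarrow> fga_act w c = c)"
proof (intro bexI conjI allI impI)
  interpret S: cring S by (rule S_cring)
  let ?c = "cls (cst (nat_inv k))"
  have "add_pow S j ?c = cls (of_nat j * cst (nat_inv k))" for j :: nat
  proof (induction j)
    case 0 then show ?case by (simp add: cls_hom)
  next
    case (Suc j)
    have "good (of_nat j * cst (nat_inv k))" using good_cst[of "of_nat j"] by (simp add: cst_of_nat good_mult good_cst)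
    then show ?case using Suc by (simp add: S.add.nat_pow_Suc add_pow_def[symmetric] cls_hom good_cst algebra_simps)
  qed
  moreover have "of_nat k * cst (nat_inv k) = (1 :: ('v, 'r) ps)"
    using nat_inv[OF assms] by (metis cst_hom(2,4) cst_of_nat)
  ultimately show "add_pow S k ?c = \<one>\<^bsub>S\<^esub>" by (simp add: cls_hom)
  show "?c \<in> carrier S" by (simp add: good_cst)
  fix w assume "latt_aut w"
  then show "fga_act w ?c = ?c" by (simp add: act_cls good_cst act_ps_hom latt_autD(1))
qed


subsection \<open>Divisibility of differences\<close>

text \<open>For a generator \<open>x\<^sub>v\<close> the quotient comes from \<open>F(p, q) - p \<in> (q)\<close>; the general case needs control
  of the order of vanishing, because a power series is an infinite sum of monomials.\<close>

definition divb :: "'v \<Rightarrow> 'v set" where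
  "divb b = {c \<in> \<Lambda>. \<exists>g. good g \<and> var c - var b * g \<in> J}"

lemma var_add_mod:
  assumes "l \<in> \<Lambda>" "c \<in> \<Lambda>"
  shows "\<exists>h. good h \<and> var (l + c) - var l - var c * h \<in> J"
proof -
  let ?h = "ev (\<lambda>j. ev (\<lambda>i. cst (F i (Suc j))) (var l)) (var c)"
  have "good ?h" using assms by (intro good_ev good_cst good_var ordge_var)
  moreover have "var (l + c) - var l - var c * ?h \<in> J"
    using J_var_add[OF assms] ev2_split_right[OF ordge_var ordge_var, of l c]
    by (simp add: algebra_simps)
  ultimately show ?thesis by blast
qed

lemma divb_self: "b \<in> \<Lambda> \<Longrightarrow> b \<in> divb b"
  by (auto simp: divb_def J_0 good_1 intro!: exI[of _ 1])

lemma divb_add: assumes "b \<in> \<Lambda>" "c \<in> divb b" "d \<in> divb b" shows "c + d \<in> divb b"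
proof -
  obtain g h where g: "good g" "var c - var b * g \<in> J" and h: "good h" "var d - var b * h \<in> J"
    and L: "c \<in> \<Lambda>" "d \<in> \<Lambda>" using assms by (auto simp: divb_def)
  obtain k where k: "good k" "var (c + d) - var c - var d * k \<in> J" using var_add_mod[OF L] by blast
  have "(var (c + d) - var c - var d * k) + (var c - var b * g) + k * (var d - var b * h) \<in> J"
    using g h k by (intro J_add J_mult)
  then have "var (c + d) - var b * (g + k * h) \<in> J" by (simp add: algebra_simps)
  then show ?thesis using g h k L L_add unfolding divb_def by (auto intro!: good_add good_mult exI[of _ "g + k * h"])
qed

lemma divb_uminus: assumes "b \<in> \<Lambda>" "c \<in> divb b" shows "- c \<in> divb b"
proof -
  obtain g where g: "good g" "var c - var b * g \<in> J" and L: "c \<in> \<Lambda>" using assms by (auto simp: divb_def)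
  obtain k where k: "good k" "var (- c + c) - var (- c) - var c * k \<in> J" using var_add_mod[OF L_uminus[OF L] L] by blast
  have "var 0 - (var (- c + c) - var (- c) - var c * k) - k * (var c - var b * g) \<in> J"
    by (rule J_diff[OF J_diff[OF J_var_0 k(2)] J_mult[OF g(2) k(1)]])
  then have "var (- c) - var b * (- (k * g)) \<in> J" by (simp add: algebra_simps)
  moreover have "good (- (k * g))" using good_add(2)[OF good_0 good_mult[OF k(1) g(1)]] by simp
  ultimately show ?thesis using L_uminus[OF L] unfolding divb_def by blast
qed

lemma divb_int: assumes "b \<in> \<Lambda>" shows "of_int k *\<^sub>R b \<in> divb b"
proof -
  have n: "real j *\<^sub>R b \<in> divb b" for j
  proof (induction j)
    case 0 show ?case using L_0 J_var_0 good_0 by (auto simp: divb_def intro!: exI[of _ 0])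
  next
    case (Suc j) then show ?case using divb_add[OF assms divb_self[OF assms] Suc] by (simp add: scaleR_add_left)
  qed
  show ?thesis using n divb_uminus[OF assms n] by (cases k rule: int_cases2) auto
qed

text \<open>The hypothesis \<open>wd\<close> is the shape of a reflection in \<open>b\<close> on the
  lattice. Quotients are found for variables, extended to monomials by a twisted Leibniz rule, and
  then summed degree by degree.\<close>

lemma divided_difference:
  assumes b: "b \<in> \<Lambda>" and w: "latt_aut w" and wd: "\<And>l. l \<in> \<Lambda> \<Longrightarrow> \<exists>k::int. w l = l - of_int k *\<^sub>R b"
    and a: "a \<in> carrier S"
  shows "\<exists>c\<in>carrier S. a \<ominus>\<^bsub>S\<^esub> fga_act w a = xv b \<otimes>\<^bsub>S\<^esub> c"
proof -
  let ?T = "act_ps w"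
  have bw: "bij w" using latt_autD(1)[OF w] .
  note T = act_ps_hom[OF bw] act_ps_1[OF bw]
  \<comment> \<open>The quotient must have order \<open>d - 1\<close>, one less than a monomial of
    degree \<open>d\<close>: enough to sum infinitely many quotients. In degree 0 truncated
    subtraction leaves no demand.\<close>
  define D where "D d f g \<longleftrightarrow> good g \<and> ordge (d - 1) g \<and> f - ?T f - var b * g \<in> J" for d f g
  have gen: "\<exists>g. D 1 (var l) g" if l: "l \<in> \<Lambda>" for l
  proof -
    obtain k :: int where k: "w l = l - of_int k *\<^sub>R b" using wd[OF l] by blast
    define c where "c = of_int k *\<^sub>R b"
    have c: "w l + c = l" using k by (simp add: c_def)
    obtain g where g: "good g" "var c - var b * g \<in> J" and L: "c \<in> \<Lambda>"
      using divb_int[OF b, of k] by (auto simp: divb_def c_def)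
    obtain h where h: "good h" "var l - var (w l) - var c * h \<in> J"
      using var_add_mod[OF latt_autD(4)[OF w l] L] unfolding c by blast
    have "(var l - var (w l) - var c * h) + h * (var c - var b * g) \<in> J"
      using g h by (intro J_add J_mult)
    then have "D 1 (var l) (h * g)"
      using g h by (simp add: D_def good_mult T algebra_simps)
    then show ?thesis by blast
  qed
  have mono: "\<exists>g. D (mdeg m) (Ps (\<lambda>m'. if m' = m then 1 else 0)) g" if "Poly_Mapping.keys m \<subseteq> \<Lambda>" for m
    using that
  proof (induction "mdeg m" arbitrary: m)
    case 0
    then have "Ps (\<lambda>m'. if m' = m then 1 else 0) = (1 :: ('v, 'r) ps)" by (intro ps_eqI) auto
    then show ?case by (auto simp: T D_def good_0 J_0 intro!: exI[of _ 0])
  next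
    case (Suc d)
    have "m \<noteq> 0" using Suc(2) by auto
    then obtain v where v: "v \<in> Poly_Mapping.keys m" by (metis keys_eq_empty ex_in_conv)
    define m' where "m' = m - Poly_Mapping.single v 1"
    have m: "m = Poly_Mapping.single v 1 + m'" using v
      by (intro poly_mapping_eqI) (auto simp: m'_def lookup_add lookup_minus lookup_single when_def in_keys_iff)
    have d: "mdeg m' = d" using Suc(2) unfolding m by simp
    have keys: "Poly_Mapping.keys m' \<subseteq> \<Lambda>" using Suc(3) by (auto simp: m'_def in_keys_iff lookup_minus subset_iff)
    let ?M = "Ps (\<lambda>u. if u = m' then 1 else 0) :: ('v, 'r) ps"
    have M: "good ?M" "ordge d ?M"
      by (rule goodI[where S = "\<lambda>_. {m'}"]) (use keys d in \<open>auto simp: ordge_def split: if_splits\<close>)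
    have eq: "Ps (\<lambda>u. if u = m then 1 else 0) = var v * ?M"
    proof (rule ps_eqI)
      fix u :: "'v \<Rightarrow>\<^sub>0 nat"
      have "coef (var v * ?M) u = (\<Sum>p\<in>{(p, q). p + q = u}. if p = (Poly_Mapping.single v 1, m') then 1 else 0)"
        unfolding coef_mult by (intro sum.cong) (auto simp: coef_var split: if_splits)
      also have "\<dots> = (if u = m then 1 else 0)"
        unfolding sum.delta[OF finite_splits] using m by auto
      finally show "coef (Ps (\<lambda>u. if u = m then 1 else 0)) u = coef (var v * ?M) u" by simp
    qed
    obtain g where g: "D d ?M g" using Suc(1)[OF d[symmetric] keys] d by auto
    obtain h where h: "D 1 (var v) h" using gen v Suc(3) by blast
    have v\<Lambda>: "v \<in> \<Lambda>" using v Suc(3) by blast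
    \<comment> \<open>Twisted Leibniz rule: vM - T(vM) = M (v - Tv) + Tv (M - TM).\<close>
    have "?M * (var v - ?T (var v) - var b * h) + ?T (var v) * (?M - ?T ?M - var b * g) \<in> J"
      using g h M v\<Lambda> by (intro J_add J_mult) (auto simp: D_def T good_var latt_autD(4)[OF w])
    then have J: "var v * ?M - ?T (var v * ?M) - var b * (?M * h + ?T (var v) * g) \<in> J"
      by (simp add: T algebra_simps)
    have o: "ordge d (?M * h + ?T (var v) * g)"
    proof (cases d)
      case (Suc e)
      then show ?thesis using M(2) g ordge_mult[of "Suc 0" "?T (var v)" e g]
        by (auto simp: D_def T ordge_var intro!: ordge_add ordge_mult_right)
    qed simp
    have "good (?M * h + ?T (var v) * g)"
      using g h M v\<Lambda> by (intro good_add good_mult) (auto simp: D_def T good_var latt_autD(4)[OF w])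
    then show ?case using J o Suc(2)[symmetric] unfolding eq by (auto simp: D_def)
  qed
  obtain f where f: "good f" "a = cls f" using a by (rule S_cases)
  let ?S = "\<lambda>d. {m. mdeg m = d \<and> coef f m \<noteq> 0}"
  let ?M = "\<lambda>m. Ps (\<lambda>u. if u = m then 1 else 0) :: ('v, 'r) ps"
  define q where "q m = (SOME g. D (mdeg m) (?M m) g)" for m
  have q: "D (mdeg m) (?M m) (q m)" if "coef f m \<noteq> 0" for m
    unfolding q_def by (rule someI_ex) (rule mono[OF good_keys[OF f(1) that]])
  define fd where "fd d = (\<Sum>m\<in>?S d. cst (coef f m) * ?M m)" for d
  define gd where "gd d = (\<Sum>m\<in>?S d. cst (coef f m) * q m)" for d
  have fin: "finite (?S d)" for d by (rule good_finite[OF f(1)])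
  have fd: "coef (fd d) m = (if mdeg m = d then coef f m else 0)" for d m
    unfolding fd_def using fin[of d] by (auto simp: if_distrib sum.delta cong: if_cong)
  have ofd: "ordge d (fd d)" for d by (auto simp: ordge_def fd)
  have f_sum: "f = isum fd" by (rule ps_eqI) (simp add: isum_def fd)
  have gfd: "good (fd d)" for d
    by (rule goodI[where S = "\<lambda>_. ?S d"]) (use f fin in \<open>auto simp: fd good_keys split: if_splits\<close>)
  have ggd: "good (gd d)" "ordge (d - 1) (gd d)" for d
    unfolding gd_def using q by (auto simp: D_def intro!: good_sum good_mult good_cst ordge_sum ordge_mult_left)
  have Jd: "fd d - ?T (fd d) - var b * gd d \<in> J" for d
  proof -
    have s: "?T (sum h A) = (\<Sum>i\<in>A. ?T (h i))" for h and A :: "('v \<Rightarrow>\<^sub>0 nat) set"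
      by (induction A rule: infinite_finite_induct) (use T(1)[of 0 0] in \<open>auto simp: T\<close>)
    have "fd d - ?T (fd d) - var b * gd d = (\<Sum>m\<in>?S d. cst (coef f m) * (?M m - ?T (?M m) - var b * q m))"
      unfolding fd_def gd_def s by (simp add: T sum_distrib_left sum_subtractf[symmetric] algebra_simps)
    moreover have "\<dots> \<in> J" using q by (intro J_sum J_mult good_cst) (auto simp: D_def)
    ultimately show ?thesis by simp
  qed
  \<comment> \<open>The quotient in degree \<open>Suc d\<close> has order \<open>d\<close>, which is
    the convergence condition of \<open>isum\<close>. Degree 0 is left out since constants are fixed
    by the action.\<close>
  define g where "g = isum (\<lambda>d. gd (Suc d))"
  have og: "ordge d (gd (Suc d))" for d using ggd(2)[of "Suc d"] by simp
  have good_g: "good g" unfolding g_def by (rule good_isum) (use ggd og in auto)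
  have "f - ?T f - var b * g \<in> J"
  proof (rule J_closed)
    show "good (f - ?T f - var b * g)"
      using f good_g b by (intro good_add good_mult good_act[OF w] good_var)
    fix d
    have s: "?T (sum h A) = (\<Sum>i\<in>A. ?T (h i))" for h and A :: "nat set"
      by (induction A rule: infinite_finite_induct) (use T(1)[of 0 0] in \<open>auto simp: T\<close>)
    have 0: "?S 0 \<subseteq> {0}" by auto
    let ?h = "(\<Sum>i<d. fd (Suc i) - ?T (fd (Suc i)) - var b * gd (Suc i)) + (fd 0 - ?T (fd 0))"
    have fd0: "fd 0 = cst (coef f 0)" by (rule ps_eqI) (simp add: fd coef_cst)
    have J: "?h \<in> J" using Jd by (intro J_add J_sum) (auto simp: fd0 T J_0)
    have o: "ordge d (f - (\<Sum>i<Suc d. fd i))"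
      using isum_approx[of fd "Suc d", OF ofd] unfolding f_sum[symmetric] by (rule ordge_mono) simp
    have og': "ordge d (g - (\<Sum>i<d. gd (Suc i)))" unfolding g_def by (rule isum_approx) (rule og)
    have "f - ?T f - var b * g - ?h = (f - (\<Sum>i<Suc d. fd i)) - ?T (f - (\<Sum>i<Suc d. fd i)) - var b * (g - (\<Sum>i<d. gd (Suc i)))"
      unfolding T s sum.lessThan_Suc_shift
      by (simp add: sum_subtractf sum.distrib sum_distrib_left algebra_simps T s)
    then have "ordge d (f - ?T f - var b * g - ?h)"
      by (simp only:) (rule ordge_diff[OF ordge_diff[OF o T(5)[OF o]] ordge_mult_left[OF og']])
    then show "\<exists>h\<in>J. ordge d (f - ?T f - var b * g - h)" using J by blast
  qed
  then have "cls (f - ?T f) = cls (var b * g)"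
    using f good_g b by (subst cls_eq_iff) (auto intro!: good_add good_mult good_act[OF w] good_var)
  then show ?thesis using f good_g b
    by (intro bexI[of _ "cls g"]) (auto simp: act_cls[OF w] cls_minus good_act[OF w] cls_hom good_var)
qed

end


section \<open>Localization of a commutative ring\<close>

locale localized_ring = cring A for A :: "('a, 'b) ring_scheme" (structure) +
  fixes M
  assumes M_carr: "M \<subseteq> carrier A" and M_one: "\<one> \<in> M"
    and M_mult: "\<lbrakk>s \<in> M; t \<in> M\<rbrakk> \<Longrightarrow> s \<otimes> t \<in> M"
begin

abbreviation "L \<equiv> localization A M"
abbreviation "fr \<equiv> fraction A M"

lemma M_in [simp, intro]: "s \<in> M \<Longrightarrow> s \<in> carrier A"
  using M_carr by blast

lemma frac_rel_iff: "((a, s), (b, t)) \<in> frac_rel A M \<longleftrightarrow>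
   a \<in> carrier A \<and> b \<in> carrier A \<and> s \<in> M \<and> t \<in> M \<and> (\<exists>u\<in>M. u \<otimes> (a \<otimes> t) = u \<otimes> (b \<otimes> s))"
proof -
  have "u \<otimes> (a \<otimes> t \<ominus> b \<otimes> s) = \<zero> \<longleftrightarrow> u \<otimes> (a \<otimes> t) = u \<otimes> (b \<otimes> s)"
    if "a \<in> carrier A" "b \<in> carrier A" "s \<in> M" "t \<in> M" "u \<in> M" for u
  proof -
    have "u \<otimes> (a \<otimes> t \<ominus> b \<otimes> s) = u \<otimes> (a \<otimes> t) \<ominus> u \<otimes> (b \<otimes> s)"
      using that by (simp add: a_minus_def r_distr r_minus)
    then show ?thesis using that by (simp add: r_right_minus_eq)
  qed
  then show ?thesis by (auto simp: frac_rel_def)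
qed

lemma equiv_frac: "equiv (carrier A \<times> M) (frac_rel A M)"
proof (rule equivI)
  show "frac_rel A M \<subseteq> (carrier A \<times> M) \<times> (carrier A \<times> M)" by (auto simp: frac_rel_def)
  show "refl_on (carrier A \<times> M) (frac_rel A M)"
    using M_one by (auto simp: refl_on_def frac_rel_iff)
  show "sym (frac_rel A M)"
  proof (rule symI, clarify)
    fix a s b t assume "((a, s), (b, t)) \<in> frac_rel A M"
    then show "((b, t), (a, s)) \<in> frac_rel A M" unfolding frac_rel_iff by metis
  qed
  show "trans (frac_rel A M)"
  proof (rule transI, clarify)
    fix a s b t c w assume h: "((a, s), (b, t)) \<in> frac_rel A M" "((b, t), (c, w)) \<in> frac_rel A M"
    then obtain u v where u: "u \<in> M" "u \<otimes> (a \<otimes> t) = u \<otimes> (b \<otimes> s)" and v: "v \<in> M" "v \<otimes> (b \<otimes> w) = v \<otimes> (c \<otimes> t)"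
      unfolding frac_rel_iff by blast
    have c: "a \<in> carrier A" "b \<in> carrier A" "c \<in> carrier A" "s \<in> M" "t \<in> M" "w \<in> M"
      using h by (auto simp: frac_rel_iff)
    \<comment> \<open>The middle denominator \<open>t\<close> has to enter the witness, because
      denominators need not be regular in this locale.\<close>
    have "(u \<otimes> v \<otimes> t) \<otimes> (a \<otimes> w) = (u \<otimes> (a \<otimes> t)) \<otimes> (v \<otimes> w)" using c u(1) v(1) by (simp add: m_ac)
    also have "\<dots> = (v \<otimes> (b \<otimes> w)) \<otimes> (u \<otimes> s)" unfolding u using c u(1) v(1) by (simp add: m_ac)
    also have "\<dots> = (u \<otimes> v \<otimes> t) \<otimes> (c \<otimes> s)" unfolding v using c u(1) v(1) by (simp add: m_ac)
    finally have "(u \<otimes> v \<otimes> t) \<otimes> (a \<otimes> w) = (u \<otimes> v \<otimes> t) \<otimes> (c \<otimes> s)" .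
    moreover have "u \<otimes> v \<otimes> t \<in> M" using u v c by (simp add: M_mult)
    ultimately show "((a, s), (c, w)) \<in> frac_rel A M" using c unfolding frac_rel_iff by blast
  qed
qed

lemma fr_eq_iff:
  assumes "a \<in> carrier A" "b \<in> carrier A" "s \<in> M" "t \<in> M"
  shows "fr a s = fr b t \<longleftrightarrow> (\<exists>u\<in>M. u \<otimes> (a \<otimes> t) = u \<otimes> (b \<otimes> s))"
  unfolding fraction_def using assms eq_equiv_class_iff[OF equiv_frac, of "(a, s)" "(b, t)"]
  by (auto simp: frac_rel_iff)

lemma fr_eqI:
  assumes "a \<in> carrier A" "b \<in> carrier A" "s \<in> M" "t \<in> M" "a \<otimes> t = b \<otimes> s"
  shows "fr a s = fr b t"
  using assms M_one by (auto simp: fr_eq_iff intro!: bexI[of _ \<one>])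

lemma L_carrier_iff: "p \<in> carrier L \<longleftrightarrow> (\<exists>a\<in>carrier A. \<exists>s\<in>M. p = fr a s)"
  by (auto simp: localization_def quotient_def fraction_def)

lemma fr_carr [simp, intro]: "a \<in> carrier A \<Longrightarrow> s \<in> M \<Longrightarrow> fr a s \<in> carrier L"
  by (auto simp: L_carrier_iff)

lemma L_cases:
  assumes "p \<in> carrier L" obtains a s where "a \<in> carrier A" "s \<in> M" "p = fr a s"
  using assms by (auto simp: L_carrier_iff)

lemma L_mult [simp]:
  assumes "a \<in> carrier A" "b \<in> carrier A" "s \<in> M" "t \<in> M"
  shows "fr a s \<otimes>\<^bsub>L\<^esub> fr b t = fr (a \<otimes> b) (s \<otimes> t)"
proof -
  let ?f = "\<lambda>p q. case p of (a, s) \<Rightarrow> case q of (b, t) \<Rightarrow> fr (a \<otimes> b) (s \<otimes> t)"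
  have "congruent2 (frac_rel A M) (frac_rel A M) ?f"
  proof (rule congruent2I', clarsimp)
    fix a s a' s' b t b' t'
    assume h: "((a, s), (a', s')) \<in> frac_rel A M" "((b, t), (b', t')) \<in> frac_rel A M"
    then obtain u v where u: "u \<in> M" "u \<otimes> (a \<otimes> s') = u \<otimes> (a' \<otimes> s)" and v: "v \<in> M" "v \<otimes> (b \<otimes> t') = v \<otimes> (b' \<otimes> t)"
      unfolding frac_rel_iff by blast
    have c: "a \<in> carrier A" "b \<in> carrier A" "a' \<in> carrier A" "b' \<in> carrier A" "s \<in> M" "t \<in> M" "s' \<in> M" "t' \<in> M"
      using h by (auto simp: frac_rel_iff)
    have "(u \<otimes> v) \<otimes> ((a \<otimes> b) \<otimes> (s' \<otimes> t')) = (u \<otimes> (a \<otimes> s')) \<otimes> (v \<otimes> (b \<otimes> t'))"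
      using c u(1) v(1) by (simp add: m_ac)
    also have "\<dots> = (u \<otimes> v) \<otimes> ((a' \<otimes> b') \<otimes> (s \<otimes> t))" unfolding u v using c u(1) v(1) by (simp add: m_ac)
    finally show "fr (a \<otimes> b) (s \<otimes> t) = fr (a' \<otimes> b') (s' \<otimes> t')"
      using c u(1) v(1) by (subst fr_eq_iff) (auto simp: M_mult intro!: bexI[of _ "u \<otimes> v"])
  qed
  from UN_equiv_class2[OF equiv_frac equiv_frac this, of "(a, s)" "(b, t)"]
  show ?thesis using assms
    by (simp add: localization_def fraction_def case_prod_unfold)
qed

lemma L_add [simp]:
  assumes "a \<in> carrier A" "b \<in> carrier A" "s \<in> M" "t \<in> M"
  shows "fr a s \<oplus>\<^bsub>L\<^esub> fr b t = fr (a \<otimes> t \<oplus> b \<otimes> s) (s \<otimes> t)"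
proof -
  let ?f = "\<lambda>p q. case p of (a, s) \<Rightarrow> case q of (b, t) \<Rightarrow> fr (a \<otimes> t \<oplus> b \<otimes> s) (s \<otimes> t)"
  have "congruent2 (frac_rel A M) (frac_rel A M) ?f"
  proof (rule congruent2I', clarsimp)
    fix a s a' s' b t b' t'
    assume h: "((a, s), (a', s')) \<in> frac_rel A M" "((b, t), (b', t')) \<in> frac_rel A M"
    then obtain u v where u: "u \<in> M" "u \<otimes> (a \<otimes> s') = u \<otimes> (a' \<otimes> s)" and v: "v \<in> M" "v \<otimes> (b \<otimes> t') = v \<otimes> (b' \<otimes> t)"
      unfolding frac_rel_iff by blast
    have c: "a \<in> carrier A" "b \<in> carrier A" "a' \<in> carrier A" "b' \<in> carrier A" "s \<in> M" "t \<in> M" "s' \<in> M" "t' \<in> M"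
      using h by (auto simp: frac_rel_iff)
    have "(u \<otimes> v) \<otimes> ((a \<otimes> t \<oplus> b \<otimes> s) \<otimes> (s' \<otimes> t')) =
        (u \<otimes> (a \<otimes> s')) \<otimes> (v \<otimes> t \<otimes> t') \<oplus> (v \<otimes> (b \<otimes> t')) \<otimes> (u \<otimes> s \<otimes> s')"
      using c u(1) v(1) by (simp add: m_ac l_distr r_distr)
    also have "\<dots> = (u \<otimes> v) \<otimes> ((a' \<otimes> t' \<oplus> b' \<otimes> s') \<otimes> (s \<otimes> t))" unfolding u v
      using c u(1) v(1) by (simp add: m_ac l_distr r_distr)
    finally show "fr (a \<otimes> t \<oplus> b \<otimes> s) (s \<otimes> t) = fr (a' \<otimes> t' \<oplus> b' \<otimes> s') (s' \<otimes> t')"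
      using c u(1) v(1) by (subst fr_eq_iff) (auto simp: M_mult intro!: bexI[of _ "u \<otimes> v"])
  qed
  from UN_equiv_class2[OF equiv_frac equiv_frac this, of "(a, s)" "(b, t)"]
  show ?thesis using assms
    by (simp add: localization_def fraction_def case_prod_unfold)
qed

lemma L_one: "\<one>\<^bsub>L\<^esub> = fr \<one> \<one>" and L_zero: "\<zero>\<^bsub>L\<^esub> = fr \<zero> \<one>"
  by (simp_all add: localization_def)

lemma cring_L: "cring L"
proof (rule cringI)
  show "abelian_group L"
  proof (rule abelian_groupI)
    fix x y z assume "x \<in> carrier L" "y \<in> carrier L" "z \<in> carrier L"
    then show "x \<oplus>\<^bsub>L\<^esub> y \<oplus>\<^bsub>L\<^esub> z = x \<oplus>\<^bsub>L\<^esub> (y \<oplus>\<^bsub>L\<^esub> z)"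
      by (elim L_cases) (simp add: M_mult m_ac a_ac l_distr r_distr)
  next
    fix x assume x: "x \<in> carrier L"
    then obtain a s where a: "a \<in> carrier A" "s \<in> M" "x = fr a s" by (rule L_cases)
    have "fr (\<ominus> a) s \<oplus>\<^bsub>L\<^esub> x = fr \<zero> \<one>"
      unfolding a(3) using a(1,2) M_one
      by (simp add: l_minus l_neg) (rule fr_eqI, simp_all add: M_mult)
    then show "\<exists>y\<in>carrier L. y \<oplus>\<^bsub>L\<^esub> x = \<zero>\<^bsub>L\<^esub>" unfolding L_zero by (rule bexI) (use a in simp)
  next
    fix x y assume "x \<in> carrier L" "y \<in> carrier L"
    then show "x \<oplus>\<^bsub>L\<^esub> y \<in> carrier L" "x \<oplus>\<^bsub>L\<^esub> y = y \<oplus>\<^bsub>L\<^esub> x" "\<zero>\<^bsub>L\<^esub> \<oplus>\<^bsub>L\<^esub> x = x"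
      by (elim L_cases; simp add: M_mult M_one L_zero m_comm a_comm)+
  qed (simp add: L_zero M_one)
  show "comm_monoid L"
  proof (rule comm_monoidI)
    fix x y z assume "x \<in> carrier L" "y \<in> carrier L" "z \<in> carrier L"
    then show "x \<otimes>\<^bsub>L\<^esub> y \<in> carrier L" "x \<otimes>\<^bsub>L\<^esub> y = y \<otimes>\<^bsub>L\<^esub> x" "x \<otimes>\<^bsub>L\<^esub> y \<otimes>\<^bsub>L\<^esub> z = x \<otimes>\<^bsub>L\<^esub> (y \<otimes>\<^bsub>L\<^esub> z)"
      "\<one>\<^bsub>L\<^esub> \<otimes>\<^bsub>L\<^esub> x = x"
      by (elim L_cases; simp add: M_mult M_one L_one m_ac)+
  qed (simp add: L_one M_one)
  fix x y z assume "x \<in> carrier L" "y \<in> carrier L" "z \<in> carrier L"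
  then show "(x \<oplus>\<^bsub>L\<^esub> y) \<otimes>\<^bsub>L\<^esub> z = x \<otimes>\<^bsub>L\<^esub> z \<oplus>\<^bsub>L\<^esub> y \<otimes>\<^bsub>L\<^esub> z"
  proof (elim L_cases)
    fix a s b t c w assume h: "a \<in> carrier A" "s \<in> M" "b \<in> carrier A" "t \<in> M" "c \<in> carrier A" "w \<in> M"
      and "x = fr a s" "y = fr b t" "z = fr c w"
    then show ?thesis
      by (simp add: M_mult) (rule fr_eqI, simp_all add: M_mult m_ac l_distr r_distr)
  qed
qed

lemma fr_inverse:
  assumes "s \<in> M" shows "fr \<one> s \<otimes>\<^bsub>L\<^esub> fr s \<one> = \<one>\<^bsub>L\<^esub>"
  using assms M_one by (simp add: L_one) (rule fr_eqI, simp_all)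

lemma fr_inj:
  assumes "\<And>s. s \<in> M \<Longrightarrow> regular_elt A s" "a \<in> carrier A" "b \<in> carrier A"
  shows "fr a \<one> = fr b \<one> \<longleftrightarrow> a = b"
proof
  assume "fr a \<one> = fr b \<one>"
  then obtain u where u: "u \<in> M" "u \<otimes> a = u \<otimes> b" using assms(2,3) M_one by (auto simp: fr_eq_iff)
  have "u \<otimes> (a \<ominus> b) = \<zero>" using u assms by (simp add: a_minus_def r_distr r_minus r_neg)
  then have "a \<ominus> b = \<zero>" using assms u(1) unfolding regular_elt_def by auto
  then show "a = b" using assms by (simp add: r_right_minus_eq)
qed simp

end

lemma mult_closure_localized:
  assumes "cring A" "H \<subseteq> carrier A" shows "localized_ring A (mult_closure A H)"
proof -
  interpret cring A by fact
  have c: "s \<in> carrier A" if "s \<in> mult_closure A H" for s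
    using that by induction (use assms in auto)
  have "s \<otimes>\<^bsub>A\<^esub> t \<in> mult_closure A H" if "s \<in> mult_closure A H" "t \<in> mult_closure A H" for s t
    using that
  proof (induction)
    case (mult h s)
    then have "h \<otimes>\<^bsub>A\<^esub> s \<otimes>\<^bsub>A\<^esub> t = h \<otimes>\<^bsub>A\<^esub> (s \<otimes>\<^bsub>A\<^esub> t)" using assms c by (auto intro: m_assoc)
    then show ?case using mult by (auto intro: mult_closure.mult)
  qed (use c in auto)
  then show ?thesis using c by unfold_locales (auto intro: mult_closure.one)
qed

lemma (in cring) mult_closure_regular:
  assumes "\<And>h. h \<in> H \<Longrightarrow> regular_elt R h" "s \<in> mult_closure R H"
  shows "regular_elt R s"
  using assms(2)
proof induction
  case (mult h s)
  have c: "h \<in> carrier R" "s \<in> carrier R" using assms(1) mult by (auto simp: regular_elt_def)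
  show ?case unfolding regular_elt_def
  proof (intro conjI ballI impI)
    fix b assume b: "b \<in> carrier R" "h \<otimes> s \<otimes> b = \<zero>"
    then have "h \<otimes> (s \<otimes> b) = \<zero>" using c by (simp add: m_assoc)
    then have "s \<otimes> b = \<zero>" using assms(1)[OF mult(1)] b(1) c unfolding regular_elt_def by blast
    then show "b = \<zero>" using mult.IH b(1) unfolding regular_elt_def by blast
  qed (use c in auto)
qed (auto simp: regular_elt_def)


section \<open>Twisted group rings\<close>

locale twisted = A: cring A + G: group G
  for A :: "('a, 'b) ring_scheme" (structure) and G :: "('g, 'c) monoid_scheme" +
  fixes act :: "'g \<Rightarrow> 'a \<Rightarrow> 'a"
  assumes act_hom: "u \<in> carrier G \<Longrightarrow> act u \<in> ring_hom A A"
    and act_one: "a \<in> carrier A \<Longrightarrow> act \<one>\<^bsub>G\<^esub> a = a"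
    and act_mult: "\<lbrakk>u \<in> carrier G; v \<in> carrier G; a \<in> carrier A\<rbrakk> \<Longrightarrow> act (u \<otimes>\<^bsub>G\<^esub> v) a = act u (act v a)"
begin

abbreviation "T \<equiv> twisted_group_ring A G act"
abbreviation "tw \<equiv> tw_elem A"

lemma act_simps [simp]:
  assumes "u \<in> carrier G"
  shows "a \<in> carrier A \<Longrightarrow> act u a \<in> carrier A"
    "\<lbrakk>a \<in> carrier A; b \<in> carrier A\<rbrakk> \<Longrightarrow> act u (a \<otimes> b) = act u a \<otimes> act u b"
    "\<lbrakk>a \<in> carrier A; b \<in> carrier A\<rbrakk> \<Longrightarrow> act u (a \<oplus> b) = act u a \<oplus> act u b"
    "act u \<one> = \<one>" "act u \<zero> = \<zero>"
  using act_hom[OF assms] ring_hom_zero[OF act_hom[OF assms] A.ring_axioms A.ring_axioms]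
  by (auto simp: ring_hom_closed ring_hom_mult ring_hom_add ring_hom_one)

lemma T_carrier: "f \<in> carrier T \<longleftrightarrow> (\<forall>u. f u \<in> carrier A) \<and> (\<forall>u. u \<notin> carrier G \<longrightarrow> f u = \<zero>) \<and> finite {u. f u \<noteq> \<zero>}"
  by (auto simp: twisted_group_ring_def)

lemma T_val: "f \<in> carrier T \<Longrightarrow> f u \<in> carrier A" by (simp add: T_carrier)

lemma T_off: "f \<in> carrier T \<Longrightarrow> u \<notin> carrier G \<Longrightarrow> f u = \<zero>" by (simp add: T_carrier)

lemma T_fin: "f \<in> carrier T \<Longrightarrow> finite {u. f u \<noteq> \<zero>}" by (simp add: T_carrier)

lemma T_supp: "f \<in> carrier T \<Longrightarrow> {u. f u \<noteq> \<zero>} \<subseteq> carrier G" by (auto simp: T_carrier)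

lemma T_simps: "\<zero>\<^bsub>T\<^esub> = (\<lambda>u. \<zero>)" "\<one>\<^bsub>T\<^esub> = tw \<one> \<one>\<^bsub>G\<^esub>" "f \<oplus>\<^bsub>T\<^esub> g = (\<lambda>u. f u \<oplus> g u)"
  unfolding twisted_group_ring_def tw_elem_def by simp_all

lemma tw_val: "tw c u v = (if v = u then c else \<zero>)"
  by (simp add: tw_elem_def)

lemma tw_carr [simp]: "c \<in> carrier A \<Longrightarrow> u \<in> carrier G \<Longrightarrow> tw c u \<in> carrier T"
proof -
  assume c: "c \<in> carrier A" "u \<in> carrier G"
  have "finite {v. tw c u v \<noteq> \<zero>}" by (rule finite_subset[of _ "{u}"]) (auto simp: tw_val)
  then show ?thesis unfolding T_carrier using c by (simp add: tw_val)
qed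

lemma T_mult: "(f \<otimes>\<^bsub>T\<^esub> g) u = (\<Oplus>p\<in>{(v, v'). f v \<noteq> \<zero> \<and> g v' \<noteq> \<zero> \<and> v \<otimes>\<^bsub>G\<^esub> v' = u}.
    f (fst p) \<otimes> act (fst p) (g (snd p)))"
  by (simp add: twisted_group_ring_def)

text \<open>Solving v v' = u for v' turns the sum over pairs into a sum over \<open>v\<close> alone.
  Allowing any finite \<open>I\<close> around the support lets several products be summed over a
  common index set.\<close>

lemma mult_eq:
  assumes f: "f \<in> carrier T" and g: "g \<in> carrier T"
    and I: "finite I" "{u. f u \<noteq> \<zero>} \<subseteq> I" "I \<subseteq> carrier G" and u: "u \<in> carrier G"
  shows "(f \<otimes>\<^bsub>T\<^esub> g) u = (\<Oplus>v\<in>I. f v \<otimes> act v (g (inv\<^bsub>G\<^esub> v \<otimes>\<^bsub>G\<^esub> u)))"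
proof -
  let ?P = "{(v, v'). f v \<noteq> \<zero> \<and> g v' \<noteq> \<zero> \<and> v \<otimes>\<^bsub>G\<^esub> v' = u}"
  let ?J = "{v. f v \<noteq> \<zero> \<and> g (inv\<^bsub>G\<^esub> v \<otimes>\<^bsub>G\<^esub> u) \<noteq> \<zero>}"
  let ?h = "\<lambda>v. f v \<otimes> act v (g (inv\<^bsub>G\<^esub> v \<otimes>\<^bsub>G\<^esub> u))"
  have JG: "?J \<subseteq> carrier G" using T_supp[OF f] by auto
  have P: "?P = (\<lambda>v. (v, inv\<^bsub>G\<^esub> v \<otimes>\<^bsub>G\<^esub> u)) ` ?J"
  proof (intro equalityI subsetI)
    fix p assume "p \<in> ?P"
    then obtain v v' where p: "p = (v, v')" "f v \<noteq> \<zero>" "g v' \<noteq> \<zero>" "v \<otimes>\<^bsub>G\<^esub> v' = u" by auto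
    then have c: "v \<in> carrier G" "v' \<in> carrier G" using T_supp f g by auto
    then have "inv\<^bsub>G\<^esub> v \<otimes>\<^bsub>G\<^esub> u = v'" using p(4) by (auto simp: G.m_assoc[symmetric])
    then show "p \<in> (\<lambda>v. (v, inv\<^bsub>G\<^esub> v \<otimes>\<^bsub>G\<^esub> u)) ` ?J" using p by auto
  next
    fix p assume "p \<in> (\<lambda>v. (v, inv\<^bsub>G\<^esub> v \<otimes>\<^bsub>G\<^esub> u)) ` ?J"
    then show "p \<in> ?P" using JG u by (auto simp: G.m_assoc[symmetric])
  qed
  have h: "?h v \<in> carrier A" if "v \<in> carrier G" for v using that T_val[OF f] T_val[OF g] by simp
  have "(f \<otimes>\<^bsub>T\<^esub> g) u = (\<Oplus>p\<in>?P. f (fst p) \<otimes> act (fst p) (g (snd p)))"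
    by (rule T_mult)
  also have "\<dots> = (\<Oplus>v\<in>?J. ?h v)"
    unfolding P by (subst A.finsum_reindex) (use JG T_val[OF f] T_val[OF g] in \<open>auto intro!: inj_onI\<close>)
  also have "\<dots> = (\<Oplus>v\<in>I. ?h v)"
  proof (rule A.add.finprod_mono_neutral_cong_left[OF I(1)])
    show "?J \<subseteq> I" using I(2) by auto
    fix v assume v: "v \<in> I - ?J"
    then have "v \<in> carrier G" using I(3) by auto
    then show "?h v = \<zero>" using v T_val[OF f] T_val[OF g] by auto
  qed (use I(3) h in auto)
  finally show ?thesis .
qed

lemma mult_off: "f \<in> carrier T \<Longrightarrow> g \<in> carrier T \<Longrightarrow> u \<notin> carrier G \<Longrightarrow> (f \<otimes>\<^bsub>T\<^esub> g) u = \<zero>"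
proof -
  assume f: "f \<in> carrier T" and g: "g \<in> carrier T" and u: "u \<notin> carrier G"
  have e: "{(v, v'). f v \<noteq> \<zero> \<and> g v' \<noteq> \<zero> \<and> v \<otimes>\<^bsub>G\<^esub> v' = u} = {}"
    using u T_supp[OF f] T_supp[OF g] by auto
  show ?thesis unfolding T_mult e by simp
qed

lemma T_ext:
  assumes "f \<in> carrier T" "g \<in> carrier T" "\<And>u. u \<in> carrier G \<Longrightarrow> f u = g u" shows "f = g"
  using assms T_off by (metis ext)

lemma mult_closed:
  assumes f: "f \<in> carrier T" and g: "g \<in> carrier T" shows "f \<otimes>\<^bsub>T\<^esub> g \<in> carrier T"
  unfolding T_carrier
proof (intro conjI allI impI)
  let ?F = "{u. f u \<noteq> \<zero>}" and ?H = "{u. g u \<noteq> \<zero>}"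
  show val: "(f \<otimes>\<^bsub>T\<^esub> g) u \<in> carrier A" for u
    by (cases "u \<in> carrier G")
      (use f g T_val[OF f] T_val[OF g] T_supp[OF f] T_fin[OF f] in \<open>auto simp: mult_eq[of f g ?F] mult_off intro!: A.finsum_closed\<close>)
  have "{u. (f \<otimes>\<^bsub>T\<^esub> g) u \<noteq> \<zero>} \<subseteq> (\<lambda>(v, v'). v \<otimes>\<^bsub>G\<^esub> v') ` (?F \<times> ?H)"
  proof
    fix u assume u: "u \<in> {u. (f \<otimes>\<^bsub>T\<^esub> g) u \<noteq> \<zero>}"
    have "{(v, v'). f v \<noteq> \<zero> \<and> g v' \<noteq> \<zero> \<and> v \<otimes>\<^bsub>G\<^esub> v' = u} \<noteq> {}"
    proof
      assume e: "{(v, v'). f v \<noteq> \<zero> \<and> g v' \<noteq> \<zero> \<and> v \<otimes>\<^bsub>G\<^esub> v' = u} = {}"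
      have "(f \<otimes>\<^bsub>T\<^esub> g) u = \<zero>" unfolding T_mult e by simp
      then show False using u by simp
    qed
    then show "u \<in> (\<lambda>(v, v'). v \<otimes>\<^bsub>G\<^esub> v') ` (?F \<times> ?H)" by auto
  qed
  then show "finite {u. (f \<otimes>\<^bsub>T\<^esub> g) u \<noteq> \<zero>}"
    using T_fin[OF f] T_fin[OF g] by (meson finite_SigmaI finite_imageI finite_subset)
qed (use mult_off f g in auto)

lemma tw_mult_eq:
  assumes "c \<in> carrier A" "v \<in> carrier G" "g \<in> carrier T" "u \<in> carrier G"
  shows "(tw c v \<otimes>\<^bsub>T\<^esub> g) u = c \<otimes> act v (g (inv\<^bsub>G\<^esub> v \<otimes>\<^bsub>G\<^esub> u))"
  using assms T_val[OF assms(3)] by (subst mult_eq[where I = "{v}"]) (auto simp: tw_val)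

lemma tw_mult_tw:
  assumes "c \<in> carrier A" "v \<in> carrier G" "c' \<in> carrier A" "v' \<in> carrier G"
  shows "tw c v \<otimes>\<^bsub>T\<^esub> tw c' v' = tw (c \<otimes> act v c') (v \<otimes>\<^bsub>G\<^esub> v')"
proof (rule T_ext)
  fix u assume u: "u \<in> carrier G"
  have "inv\<^bsub>G\<^esub> v \<otimes>\<^bsub>G\<^esub> u = v' \<longleftrightarrow> u = v \<otimes>\<^bsub>G\<^esub> v'"
    using assms u by (metis G.inv_closed G.inv_inv G.inv_solve_left G.m_closed)
  then show "(tw c v \<otimes>\<^bsub>T\<^esub> tw c' v') u = tw (c \<otimes> act v c') (v \<otimes>\<^bsub>G\<^esub> v') u"
    using assms u by (auto simp: tw_mult_eq tw_val)
qed (use assms in \<open>auto simp: mult_closed\<close>)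

lemma add_closed:
  assumes f: "f \<in> carrier T" and g: "g \<in> carrier T" shows "f \<oplus>\<^bsub>T\<^esub> g \<in> carrier T"
  unfolding T_carrier T_simps
proof (intro conjI allI impI)
  have "{u. f u \<oplus> g u \<noteq> \<zero>} \<subseteq> {u. f u \<noteq> \<zero>} \<union> {u. g u \<noteq> \<zero>}" by auto
  then show "finite {u. f u \<oplus> g u \<noteq> \<zero>}"
    using T_fin[OF f] T_fin[OF g] by (metis finite_Un finite_subset)
qed (simp_all add: T_val[OF f] T_val[OF g] T_off[OF f] T_off[OF g])

lemma abelian_group_T: "abelian_group T"
proof (rule abelian_groupI)
  fix f assume f: "f \<in> carrier T"
  have "{u. \<ominus> f u \<noteq> \<zero>} \<subseteq> {u. f u \<noteq> \<zero>}" by auto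
  then have "finite {u. \<ominus> f u \<noteq> \<zero>}" using T_fin[OF f] finite_subset by blast
  then have "(\<lambda>u. \<ominus> f u) \<in> carrier T"
    unfolding T_carrier by (simp add: T_val[OF f] T_off[OF f])
  then show "\<exists>g\<in>carrier T. g \<oplus>\<^bsub>T\<^esub> f = \<zero>\<^bsub>T\<^esub>"
    using T_val[OF f] by (auto simp: T_simps fun_eq_iff A.l_neg intro!: bexI[of _ "\<lambda>u. \<ominus> f u"])
next
  fix f g h assume "f \<in> carrier T" "g \<in> carrier T" "h \<in> carrier T"
  then show "f \<oplus>\<^bsub>T\<^esub> g \<oplus>\<^bsub>T\<^esub> h = f \<oplus>\<^bsub>T\<^esub> (g \<oplus>\<^bsub>T\<^esub> h)" by (simp add: T_simps fun_eq_iff A.a_assoc T_val)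
next
  fix f g assume "f \<in> carrier T" "g \<in> carrier T"
  then show "f \<oplus>\<^bsub>T\<^esub> g = g \<oplus>\<^bsub>T\<^esub> f" by (simp add: T_simps fun_eq_iff A.a_comm T_val)
next
  show "\<zero>\<^bsub>T\<^esub> \<in> carrier T" unfolding T_carrier T_simps by simp
  fix f assume "f \<in> carrier T"
  then show "\<zero>\<^bsub>T\<^esub> \<oplus>\<^bsub>T\<^esub> f = f" by (simp add: T_simps T_val)
qed (rule add_closed)

lemma l_distr_T:
  assumes "f \<in> carrier T" "g \<in> carrier T" "h \<in> carrier T"
  shows "(f \<oplus>\<^bsub>T\<^esub> g) \<otimes>\<^bsub>T\<^esub> h = f \<otimes>\<^bsub>T\<^esub> h \<oplus>\<^bsub>T\<^esub> g \<otimes>\<^bsub>T\<^esub> h"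
proof (rule T_ext)
  fix u assume u: "u \<in> carrier G"
  let ?I = "{u. f u \<noteq> \<zero>} \<union> {u. g u \<noteq> \<zero>}"
  have I: "finite ?I" "?I \<subseteq> carrier G" using T_fin T_supp assms by auto
  have "((f \<oplus>\<^bsub>T\<^esub> g) \<otimes>\<^bsub>T\<^esub> h) u = (\<Oplus>v\<in>?I. (f v \<oplus> g v) \<otimes> act v (h (inv\<^bsub>G\<^esub> v \<otimes>\<^bsub>G\<^esub> u)))"
    by (subst mult_eq[where I = ?I]) (use assms assms[THEN T_val] I u add_closed in \<open>auto simp: T_simps\<close>)
  also have "\<dots> = (\<Oplus>v\<in>?I. f v \<otimes> act v (h (inv\<^bsub>G\<^esub> v \<otimes>\<^bsub>G\<^esub> u)) \<oplus> g v \<otimes> act v (h (inv\<^bsub>G\<^esub> v \<otimes>\<^bsub>G\<^esub> u)))"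
    by (rule A.finsum_cong') (use assms assms[THEN T_val] I in \<open>auto simp: A.l_distr subset_iff\<close>)
  also have "\<dots> = (f \<otimes>\<^bsub>T\<^esub> h) u \<oplus> (g \<otimes>\<^bsub>T\<^esub> h) u"
    by (subst A.finsum_addf) (use assms assms[THEN T_val] I u in \<open>auto simp: mult_eq[where I = ?I] subset_iff\<close>)
  finally show "((f \<oplus>\<^bsub>T\<^esub> g) \<otimes>\<^bsub>T\<^esub> h) u = (f \<otimes>\<^bsub>T\<^esub> h \<oplus>\<^bsub>T\<^esub> g \<otimes>\<^bsub>T\<^esub> h) u" by (simp add: T_simps)
qed (use assms in \<open>auto simp: mult_closed add_closed\<close>)

lemma r_distr_T:
  assumes "f \<in> carrier T" "g \<in> carrier T" "h \<in> carrier T"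
  shows "h \<otimes>\<^bsub>T\<^esub> (f \<oplus>\<^bsub>T\<^esub> g) = h \<otimes>\<^bsub>T\<^esub> f \<oplus>\<^bsub>T\<^esub> h \<otimes>\<^bsub>T\<^esub> g"
proof (rule T_ext)
  fix u assume u: "u \<in> carrier G"
  let ?I = "{u. h u \<noteq> \<zero>}"
  have I: "finite ?I" "?I \<subseteq> carrier G" using T_fin T_supp assms by auto
  have "(h \<otimes>\<^bsub>T\<^esub> (f \<oplus>\<^bsub>T\<^esub> g)) u = (\<Oplus>v\<in>?I. h v \<otimes> act v (f (inv\<^bsub>G\<^esub> v \<otimes>\<^bsub>G\<^esub> u) \<oplus> g (inv\<^bsub>G\<^esub> v \<otimes>\<^bsub>G\<^esub> u)))"
    by (subst mult_eq[where I = ?I]) (use assms assms[THEN T_val] I u add_closed in \<open>auto simp: T_simps\<close>)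
  also have "\<dots> = (\<Oplus>v\<in>?I. h v \<otimes> act v (f (inv\<^bsub>G\<^esub> v \<otimes>\<^bsub>G\<^esub> u)) \<oplus> h v \<otimes> act v (g (inv\<^bsub>G\<^esub> v \<otimes>\<^bsub>G\<^esub> u)))"
    by (rule A.finsum_cong') (use assms assms[THEN T_val] I in \<open>auto simp: A.r_distr subset_iff\<close>)
  also have "\<dots> = (h \<otimes>\<^bsub>T\<^esub> f) u \<oplus> (h \<otimes>\<^bsub>T\<^esub> g) u"
    by (subst A.finsum_addf) (use assms assms[THEN T_val] I u in \<open>auto simp: mult_eq[where I = ?I] subset_iff\<close>)
  finally show "(h \<otimes>\<^bsub>T\<^esub> (f \<oplus>\<^bsub>T\<^esub> g)) u = (h \<otimes>\<^bsub>T\<^esub> f \<oplus>\<^bsub>T\<^esub> h \<otimes>\<^bsub>T\<^esub> g) u" by (simp add: T_simps)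
qed (use assms in \<open>auto simp: mult_closed add_closed\<close>)

text \<open>Every element is a finite sum of monomials c eta_u. Additive identities are reduced to
  monomials by this rule.\<close>

lemma T_induct [consumes 1, case_names zero add]:
  assumes "f \<in> carrier T" "P \<zero>\<^bsub>T\<^esub>"
    "\<And>c u f. c \<in> carrier A \<Longrightarrow> u \<in> carrier G \<Longrightarrow> f \<in> carrier T \<Longrightarrow> P f \<Longrightarrow> P (tw c u \<oplus>\<^bsub>T\<^esub> f)"
  shows "P f"
proof -
  have "finite {u. f u \<noteq> \<zero>}" by (rule T_fin[OF assms(1)])
  then show ?thesis using assms(1)
  proof (induction "{u. f u \<noteq> \<zero>}" arbitrary: f rule: finite_induct)
    case empty
    then have "f = \<zero>\<^bsub>T\<^esub>" by (auto simp: T_simps)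
    then show ?case using assms(2) by simp
  next
    case (insert v I)
    let ?g = "\<lambda>u. if u = v then \<zero> else f u"
    have I: "I = {u. ?g u \<noteq> \<zero>}" using insert by (auto split: if_splits)
    have g: "?g \<in> carrier T" using insert(1) I[symmetric] T_val[OF insert(5)] T_off[OF insert(5)] by (auto simp: T_carrier)
    have "v \<in> carrier G" using insert(4) insert(5) T_supp by blast
    then have "P (tw (f v) v \<oplus>\<^bsub>T\<^esub> ?g)" using insert(3)[OF I g] g T_val[OF insert(5)] by (intro assms(3)) auto
    moreover have "tw (f v) v \<oplus>\<^bsub>T\<^esub> ?g = f" using T_val[OF insert(5)] by (auto simp: T_simps tw_val)
    ultimately show ?case by simp
  qed
qed

text \<open>Both sides are additive in each factor, so three inductions reduce the claim to
  monomials, where it is \<open>act_mult\<close> together with associativity in the group and in the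
  coefficient ring.\<close>

lemma m_assoc_T:
  assumes "f \<in> carrier T" "g \<in> carrier T" "h \<in> carrier T"
  shows "f \<otimes>\<^bsub>T\<^esub> g \<otimes>\<^bsub>T\<^esub> h = f \<otimes>\<^bsub>T\<^esub> (g \<otimes>\<^bsub>T\<^esub> h)"
proof -
  interpret T: abelian_group T by (rule abelian_group_T)
  have z: "\<zero>\<^bsub>T\<^esub> \<otimes>\<^bsub>T\<^esub> k = \<zero>\<^bsub>T\<^esub>" "k \<otimes>\<^bsub>T\<^esub> \<zero>\<^bsub>T\<^esub> = \<zero>\<^bsub>T\<^esub>" if "k \<in> carrier T" for k
    using that l_distr_T[of "\<zero>\<^bsub>T\<^esub>" "\<zero>\<^bsub>T\<^esub>" k] r_distr_T[of "\<zero>\<^bsub>T\<^esub>" "\<zero>\<^bsub>T\<^esub>" k]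
    by (simp_all add: mult_closed)
  have 1: "tw c u \<otimes>\<^bsub>T\<^esub> tw c' u' \<otimes>\<^bsub>T\<^esub> h = tw c u \<otimes>\<^bsub>T\<^esub> (tw c' u' \<otimes>\<^bsub>T\<^esub> h)"
    if cu: "c \<in> carrier A" "u \<in> carrier G" "c' \<in> carrier A" "u' \<in> carrier G" for c u c' u'
    using assms(3)
  proof (induction h rule: T_induct)
    case zero then show ?case using cu by (simp add: z mult_closed)
  next
    case (add d v f)
    then show ?case using cu
      by (simp add: r_distr_T mult_closed tw_mult_tw G.m_assoc A.m_assoc act_mult)
  qed
  have 2: "tw c u \<otimes>\<^bsub>T\<^esub> g \<otimes>\<^bsub>T\<^esub> h = tw c u \<otimes>\<^bsub>T\<^esub> (g \<otimes>\<^bsub>T\<^esub> h)"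
    if cu: "c \<in> carrier A" "u \<in> carrier G" for c u
    using assms(2)
  proof (induction g rule: T_induct)
    case zero then show ?case using cu assms by (simp add: z)
  next
    case (add d v f)
    then show ?case using cu assms by (simp add: r_distr_T l_distr_T mult_closed 1)
  qed
  show ?thesis using assms(1)
  proof (induction f rule: T_induct)
    case zero then show ?case using assms by (simp add: z mult_closed)
  next
    case (add d v f)
    then show ?case using assms by (simp add: l_distr_T mult_closed 2)
  qed
qed

lemma ring_T: "ring T"
proof (rule ringI)
  show "monoid T"
  proof (rule monoidI)
    fix f assume f: "f \<in> carrier T"
    show "\<one>\<^bsub>T\<^esub> \<otimes>\<^bsub>T\<^esub> f = f"
      by (rule T_ext) (use f T_val[OF f] in \<open>auto simp: T_simps mult_closed tw_mult_eq act_one\<close>)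
    interpret T: abelian_group T by (rule abelian_group_T)
    show "f \<otimes>\<^bsub>T\<^esub> \<one>\<^bsub>T\<^esub> = f" using f
    proof (induction f rule: T_induct)
      case zero
      then show ?case using l_distr_T[of "\<zero>\<^bsub>T\<^esub>" "\<zero>\<^bsub>T\<^esub>" "\<one>\<^bsub>T\<^esub>"] by (simp add: T_simps(2) mult_closed)
    next
      case (add c u f)
      then show ?case by (simp add: T_simps(2) l_distr_T tw_mult_tw)
    qed
  qed (auto simp: mult_closed m_assoc_T T_simps(2))
qed (auto simp: abelian_group_T l_distr_T r_distr_T)

lemma T_minus: "f \<in> carrier T \<Longrightarrow> g \<in> carrier T \<Longrightarrow> (f \<ominus>\<^bsub>T\<^esub> g) u = f u \<ominus> g u"
proof -
  assume f: "f \<in> carrier T" and g: "g \<in> carrier T"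
  interpret T: ring T by (rule ring_T)
  have "(f \<ominus>\<^bsub>T\<^esub> g \<oplus>\<^bsub>T\<^esub> g) = f" using f g by (simp add: a_minus_def T.a_assoc T.l_neg)
  then have "(f \<ominus>\<^bsub>T\<^esub> g) u \<oplus> g u = f u" by (simp add: T_simps fun_eq_iff)
  moreover have "(f \<ominus>\<^bsub>T\<^esub> g) u \<in> carrier A" using f g by (intro T_val) auto
  ultimately show "(f \<ominus>\<^bsub>T\<^esub> g) u = f u \<ominus> g u" using f g
    by (metis (no_types, lifting) A.add.inv_solve_right T_val a_minus_def)
qed

end


section \<open>Tensor products and dual bases\<close>

lemma (in abelian_monoid) finsum_Times:
  assumes "finite A" "finite B" "\<And>a b. a \<in> A \<Longrightarrow> b \<in> B \<Longrightarrow> f (a, b) \<in> carrier G"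
  shows "(\<Oplus>p\<in>A \<times> B. f p) = (\<Oplus>a\<in>A. \<Oplus>b\<in>B. f (a, b))"
  using assms(1,3)
proof (induction A rule: finite_induct)
  case (insert x A)
  have "insert x A \<times> B = Pair x ` B \<union> A \<times> B" by auto
  then have "(\<Oplus>p\<in>insert x A \<times> B. f p) = (\<Oplus>p\<in>Pair x ` B. f p) \<oplus> (\<Oplus>p\<in>A \<times> B. f p)"
    using insert assms(2) by (simp only:) (rule finsum_Un_disjoint, auto)
  also have "(\<Oplus>p\<in>Pair x ` B. f p) = (\<Oplus>b\<in>B. f (x, b))"
    by (rule add.finprod_reindex) (use insert in \<open>auto simp: inj_on_def\<close>)
  finally show ?case using insert by (simp add: finsum_closed Pi_iff)
qed simp

lemma (in ring) finsum_subring: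
  assumes H: "subring H R" and "finite A" "\<And>a. a \<in> A \<Longrightarrow> f a \<in> H"
  shows "finsum (R\<lparr>carrier := H\<rparr>) f A = finsum R f A"
  using assms(2,3)
proof (induction A rule: finite_induct)
  case empty
  interpret H: ring "R\<lparr>carrier := H\<rparr>" by (rule subring_is_ring[OF H])
  show ?case by (simp add: H.finsum_empty)
next
  case (insert x A)
  interpret H: ring "R\<lparr>carrier := H\<rparr>" by (rule subring_is_ring[OF H])
  have "finsum (R\<lparr>carrier := H\<rparr>) f (insert x A) = f x \<oplus> finsum (R\<lparr>carrier := H\<rparr>) f A"
    using insert by (subst H.finsum_insert) auto
  also have "\<dots> = finsum R f (insert x A)"
    using insert subringE(1)[OF H] by (subst finsum_insert) auto
  finally show ?case .
qed

lemma group_closure_sum: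
  "(\<And>i. i \<in> A \<Longrightarrow> f i \<in> group_closure S) \<Longrightarrow> (\<Sum>i\<in>A. f i) \<in> group_closure S"
  by (induction A rule: infinite_finite_induct) (auto intro: group_closure_add)

lemma free_abelian_generated:
  fixes p :: "'x \<Rightarrow>\<^sub>0 int"
  assumes "Poly_Mapping.keys p \<subseteq> XX"
  shows "p \<in> group_closure ((\<lambda>x. Poly_Mapping.single x 1) ` XX)"
proof -
  let ?G = "group_closure ((\<lambda>x. Poly_Mapping.single x (1::int)) ` XX)"
  have nat: "Poly_Mapping.single x (int k) \<in> ?G" if "x \<in> XX" for x k
  proof (induction k)
    case (Suc k)
    have "Poly_Mapping.single x (int (Suc k)) = Poly_Mapping.single x (int k) + Poly_Mapping.single x 1"
      by (simp add: single_add[symmetric] add.commute)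
    moreover have "Poly_Mapping.single x 1 \<in> ?G" using that by (intro group_closure.base) auto
    ultimately show ?case using group_closure_add[OF Suc] by simp
  qed simp
  have int: "Poly_Mapping.single x k \<in> ?G" if "x \<in> XX" for x k
  proof (cases k rule: int_cases2)
    case (nonpos j)
    then have "Poly_Mapping.single x k = - Poly_Mapping.single x (int j)" by (simp add: single_uminus)
    then show ?thesis using nat[OF that] by simp
  qed (use nat that in simp)
  have *: "p = (\<Sum>x\<in>Poly_Mapping.keys p. Poly_Mapping.single x (Poly_Mapping.lookup p x))"
    by (rule poly_mapping_eqI) (simp add: lookup_sum lookup_single when_def in_keys_iff)
  moreover have "\<dots> \<in> ?G" by (rule group_closure_sum) (use int assms in auto)
  ultimately show ?thesis by (subst *)
qed

text \<open>\<open>p\<close> and \<open>\<phi>\<close> form a dual basis of A over K,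
  \<open>p\<close> and \<open>\<psi>\<close> one of C over B, with the same elements
  \<open>p\<close>. The inverse of multiplication sends x to the sum of p_l (x) \<psi>_l(x): a (x) b
  is the sum of p_l f(\<phi>_l a) (x) b, the scalars from K move across the tensor sign, and
  \<open>\<psi>_mult\<close> turns g(\<phi>_l a) b into \<psi>_l(a b).\<close>

locale dual_basis =
  M: ring M + A: ring A + B: ring B
  for M :: "('m, 'x) ring_scheme" and A :: "('a, 'y) ring_scheme" and B :: "('b, 'z) ring_scheme" +
  fixes i :: "'a \<Rightarrow> 'm" and j :: "'b \<Rightarrow> 'm" and K :: "('k, 'w) ring_scheme" and f g
    and C :: "'m set" and L :: "'l set" and p :: "'l \<Rightarrow> 'a" and \<phi> :: "'l \<Rightarrow> 'a \<Rightarrow> 'k" and \<psi> :: "'l \<Rightarrow> 'm \<Rightarrow> 'b"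
  assumes i_hom: "i \<in> ring_hom A M" and j_hom: "j \<in> ring_hom B M"
    and K: "k \<in> carrier K \<Longrightarrow> f k \<in> carrier A \<and> g k \<in> carrier B \<and> i (f k) = j (g k)"
    and commute: "\<lbrakk>a \<in> carrier A; b \<in> carrier B\<rbrakk> \<Longrightarrow> i a \<otimes>\<^bsub>M\<^esub> j b = j b \<otimes>\<^bsub>M\<^esub> i a"
    and C: "subring C M" and ij_C: "\<lbrakk>a \<in> carrier A; b \<in> carrier B\<rbrakk> \<Longrightarrow> i a \<otimes>\<^bsub>M\<^esub> j b \<in> C"
    and L: "finite L" and p: "l \<in> L \<Longrightarrow> p l \<in> carrier A"
    and \<phi>: "\<lbrakk>l \<in> L; a \<in> carrier A\<rbrakk> \<Longrightarrow> \<phi> l a \<in> carrier K"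
    and p_\<phi>: "a \<in> carrier A \<Longrightarrow> a = (\<Oplus>\<^bsub>A\<^esub>l\<in>L. p l \<otimes>\<^bsub>A\<^esub> f (\<phi> l a))"
    and \<psi>: "\<lbrakk>l \<in> L; x \<in> C\<rbrakk> \<Longrightarrow> \<psi> l x \<in> carrier B"
    and \<psi>_add: "\<lbrakk>l \<in> L; x \<in> C; y \<in> C\<rbrakk> \<Longrightarrow> \<psi> l (x \<oplus>\<^bsub>M\<^esub> y) = \<psi> l x \<oplus>\<^bsub>B\<^esub> \<psi> l y"
    and \<psi>_mult: "\<lbrakk>l \<in> L; a \<in> carrier A; b \<in> carrier B\<rbrakk> \<Longrightarrow> \<psi> l (i a \<otimes>\<^bsub>M\<^esub> j b) = g (\<phi> l a) \<otimes>\<^bsub>B\<^esub> b"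
    and p_\<psi>: "x \<in> C \<Longrightarrow> x = (\<Oplus>\<^bsub>M\<^esub>l\<in>L. i (p l) \<otimes>\<^bsub>M\<^esub> j (\<psi> l x))"
begin

abbreviation "R \<equiv> tensor_rels K f A g B"
abbreviation "Fr \<equiv> free_ring A B"
abbreviation "XX \<equiv> carrier A \<times> carrier B"
abbreviation "\<delta> a b \<equiv> Poly_Mapping.single (a, b) (1::int)"
abbreviation "fm \<equiv> free_mult_map M i j"

lemma hom_closed: "a \<in> carrier A \<Longrightarrow> i a \<in> carrier M" "b \<in> carrier B \<Longrightarrow> j b \<in> carrier M"
  using i_hom j_hom by (auto simp: ring_hom_closed)

lemma Fr_iff: "q \<in> carrier Fr \<longleftrightarrow> Poly_Mapping.keys q \<subseteq> XX" by (simp add: free_ring_def)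

lemma Fr_add: "q \<in> carrier Fr \<Longrightarrow> r \<in> carrier Fr \<Longrightarrow> q + r \<in> carrier Fr"
  and Fr_diff: "q \<in> carrier Fr \<Longrightarrow> r \<in> carrier Fr \<Longrightarrow> q - r \<in> carrier Fr"
  unfolding Fr_iff using keys_add[of q r] keys_diff[of q r] by blast+

lemma Fr_single: "a \<in> carrier A \<Longrightarrow> b \<in> carrier B \<Longrightarrow> \<delta> a b \<in> carrier Fr" by (simp add: Fr_iff)

lemma Fr_0: "0 \<in> carrier Fr" by (simp add: Fr_iff)

lemma Fr_sum: "(\<And>l. l \<in> S \<Longrightarrow> h l \<in> carrier Fr) \<Longrightarrow> sum h S \<in> carrier Fr"
  by (induction S rule: infinite_finite_induct) (auto simp: Fr_0 Fr_add)

lemma Fr_induct [consumes 1, case_names single zero diff]: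
  assumes "q \<in> carrier Fr" "\<And>a b. a \<in> carrier A \<Longrightarrow> b \<in> carrier B \<Longrightarrow> P (\<delta> a b)" "P 0"
    "\<And>q r. q \<in> carrier Fr \<Longrightarrow> r \<in> carrier Fr \<Longrightarrow> P q \<Longrightarrow> P r \<Longrightarrow> P (q - r)"
  shows "P q"
proof -
  have "q \<in> group_closure ((\<lambda>x. Poly_Mapping.single x 1) ` XX)"
    using assms(1) by (intro free_abelian_generated) (simp add: Fr_iff)
  then have "q \<in> carrier Fr \<and> P q"
    by induction (use assms in \<open>auto simp: Fr_single Fr_diff Fr_0\<close>)
  then show ?thesis by simp
qed

lemma fm_diff: "fm (q - r) = fm q \<ominus>\<^bsub>M\<^esub> fm r"
  and fm_add: "fm (q + r) = fm q \<oplus>\<^bsub>M\<^esub> fm r"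
  if "q \<in> carrier Fr" "r \<in> carrier Fr"
proof -
  have "i (fst t) \<otimes>\<^bsub>M\<^esub> j (snd t) \<in> carrier M" if t: "t \<in> Poly_Mapping.keys q \<union> Poly_Mapping.keys r" for t
  proof -
    have "t \<in> XX" using t \<open>q \<in> carrier Fr\<close> \<open>r \<in> carrier Fr\<close> unfolding Fr_iff by blast
    then show ?thesis using hom_closed by (simp add: mem_Times_iff)
  qed
  then show "fm (q - r) = fm q \<ominus>\<^bsub>M\<^esub> fm r" "fm (q + r) = fm q \<oplus>\<^bsub>M\<^esub> fm r"
    by (rule M.free_mult_map_diff; blast)+
qed

lemma fm_single: "\<lbrakk>a \<in> carrier A; b \<in> carrier B\<rbrakk> \<Longrightarrow> fm (\<delta> a b) = i a \<otimes>\<^bsub>M\<^esub> j b"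
  by (rule M.free_mult_map_single) (simp add: hom_closed)

lemma fm_0: "fm 0 = \<zero>\<^bsub>M\<^esub>" by (simp add: free_mult_map_def)

lemma C_sub: "C \<subseteq> carrier M" using C by (rule subringE(1))

lemma C_diff: "x \<in> C \<Longrightarrow> y \<in> C \<Longrightarrow> x \<ominus>\<^bsub>M\<^esub> y \<in> C"
  unfolding a_minus_def using subringE[OF C] by auto

lemma fm_C: "q \<in> carrier Fr \<Longrightarrow> fm q \<in> C"
  by (induction rule: Fr_induct) (use subringE(2)[OF C] in \<open>auto simp: fm_single ij_C fm_0 fm_diff C_diff\<close>)

lemma fm_closed: "q \<in> carrier Fr \<Longrightarrow> fm q \<in> carrier M" using fm_C C_sub by auto

lemma fm_sum: "finite S \<Longrightarrow> (\<And>l. l \<in> S \<Longrightarrow> h l \<in> carrier Fr) \<Longrightarrow> fm (sum h S) = (\<Oplus>\<^bsub>M\<^esub>l\<in>S. fm (h l))"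
  by (induction S rule: finite_induct) (auto simp: fm_0 fm_add Fr_sum fm_closed)

lemma R_0: "0 \<in> R" and R_diff: "q \<in> R \<Longrightarrow> r \<in> R \<Longrightarrow> q - r \<in> R" and R_add: "q \<in> R \<Longrightarrow> r \<in> R \<Longrightarrow> q + r \<in> R"
  and R_minus: "q \<in> R \<Longrightarrow> - q \<in> R"
  by (auto simp: tensor_rels_def intro: group_closure.diff group_closure_add)

lemma R_gen: "q \<in> tensor_gens K f A g B \<Longrightarrow> q \<in> R"
  by (simp add: tensor_rels_def group_closure.base)

lemma R_rel1: "\<lbrakk>a \<in> carrier A; a' \<in> carrier A; b \<in> carrier B\<rbrakk> \<Longrightarrow> \<delta> (a \<oplus>\<^bsub>A\<^esub> a') b - \<delta> a b - \<delta> a' b \<in> R"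
  and R_rel2: "\<lbrakk>a \<in> carrier A; b \<in> carrier B; b' \<in> carrier B\<rbrakk> \<Longrightarrow> \<delta> a (b \<oplus>\<^bsub>B\<^esub> b') - \<delta> a b - \<delta> a b' \<in> R"
  and R_rel3: "\<lbrakk>a \<in> carrier A; k \<in> carrier K; b \<in> carrier B\<rbrakk> \<Longrightarrow> \<delta> (a \<otimes>\<^bsub>A\<^esub> f k) b - \<delta> a (g k \<otimes>\<^bsub>B\<^esub> b) \<in> R"
  by (rule R_gen; unfold tensor_gens_def; blast)+

lemma R_fm: "r \<in> R \<Longrightarrow> r \<in> carrier Fr \<and> fm r = \<zero>\<^bsub>M\<^esub>"
  using free_mult_map_rels[where K = K and f = f and g = g, OF M.ring_axioms A.ring_axioms B.ring_axioms i_hom j_hom K] by (simp add: Fr_iff)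

lemma R_sum: "(\<And>l. l \<in> S \<Longrightarrow> h l \<in> R) \<Longrightarrow> sum h S \<in> R"
  by (induction S rule: infinite_finite_induct) (auto simp: R_0 R_add)

lemma R_zero_left: "b \<in> carrier B \<Longrightarrow> \<delta> \<zero>\<^bsub>A\<^esub> b \<in> R"
  using R_minus[OF R_rel1[of "\<zero>\<^bsub>A\<^esub>" "\<zero>\<^bsub>A\<^esub>" b]] by simp

lemma R_finsum:
  assumes "finite S" "\<And>l. l \<in> S \<Longrightarrow> h l \<in> carrier A" "b \<in> carrier B"
  shows "\<delta> (\<Oplus>\<^bsub>A\<^esub>l\<in>S. h l) b - (\<Sum>l\<in>S. \<delta> (h l) b) \<in> R"
  using assms(1,2)
proof (induction S rule: finite_induct)
  case empty then show ?case using R_zero_left assms(3) by simp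
next
  case (insert x S)
  have c: "(\<Oplus>\<^bsub>A\<^esub>l\<in>S. h l) \<in> carrier A" using insert by auto
  have "\<delta> (h x \<oplus>\<^bsub>A\<^esub> (\<Oplus>\<^bsub>A\<^esub>l\<in>S. h l)) b - \<delta> (h x) b - \<delta> (\<Oplus>\<^bsub>A\<^esub>l\<in>S. h l) b \<in> R"
    using insert assms(3) c by (intro R_rel1) auto
  from R_add[OF this insert(3)] show ?case using insert by (simp add: algebra_simps)
qed

definition expand :: "'m \<Rightarrow> ('a \<times> 'b) \<Rightarrow>\<^sub>0 int" where
  "expand x = (\<Sum>l\<in>L. \<delta> (p l) (\<psi> l x))"

lemma expand_Fr: "x \<in> C \<Longrightarrow> expand x \<in> carrier Fr"
  unfolding expand_def by (intro Fr_sum Fr_single p \<psi>)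

lemma expand_add: "x \<in> C \<Longrightarrow> y \<in> C \<Longrightarrow> expand (x \<oplus>\<^bsub>M\<^esub> y) - expand x - expand y \<in> R"
  unfolding expand_def sum_subtractf[symmetric]
  by (intro R_sum) (simp add: \<psi>_add R_rel2 p \<psi>)

lemma expand_diff:
  assumes "x \<in> C" "y \<in> C" shows "expand (x \<ominus>\<^bsub>M\<^esub> y) - (expand x - expand y) \<in> R"
proof -
  have c: "x \<in> carrier M" "y \<in> carrier M" using assms C_sub by auto
  then have e: "x \<ominus>\<^bsub>M\<^esub> y \<oplus>\<^bsub>M\<^esub> y = x" by (simp add: a_minus_def M.a_assoc M.l_neg)
  have "expand x - expand (x \<ominus>\<^bsub>M\<^esub> y) - expand y \<in> R"
    using expand_add[OF C_diff[OF assms] assms(2)] unfolding e .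
  from R_minus[OF this] show ?thesis by (simp add: algebra_simps)
qed

lemma expand_0: "expand \<zero>\<^bsub>M\<^esub> \<in> R"
  using R_minus[OF expand_add[of "\<zero>\<^bsub>M\<^esub>" "\<zero>\<^bsub>M\<^esub>"]] subringE(2)[OF C] by simp

text \<open>The injectivity half: modulo the relations an element is recovered from its image.
  Everything is additive, so pure tensors suffice.\<close>

lemma expand_fm: "q \<in> carrier Fr \<Longrightarrow> q - expand (fm q) \<in> R"
proof (induction rule: Fr_induct)
  case (single a b)
  have c: "p l \<otimes>\<^bsub>A\<^esub> f (\<phi> l a) \<in> carrier A" if "l \<in> L" for l using that p K \<phi> single by auto
  have "\<delta> a b - (\<Sum>l\<in>L. \<delta> (p l \<otimes>\<^bsub>A\<^esub> f (\<phi> l a)) b) \<in> R"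
    using R_finsum[where h = "\<lambda>l. p l \<otimes>\<^bsub>A\<^esub> f (\<phi> l a)", OF L c single(2)] p_\<phi>[OF single(1)] by simp
  moreover have "(\<Sum>l\<in>L. \<delta> (p l \<otimes>\<^bsub>A\<^esub> f (\<phi> l a)) b) - expand (i a \<otimes>\<^bsub>M\<^esub> j b) \<in> R"
    unfolding expand_def sum_subtractf[symmetric]
    using single by (intro R_sum) (simp add: \<psi>_mult R_rel3 p \<phi>)
  ultimately have "\<delta> a b - (\<Sum>l\<in>L. \<delta> (p l \<otimes>\<^bsub>A\<^esub> f (\<phi> l a)) b) +
      ((\<Sum>l\<in>L. \<delta> (p l \<otimes>\<^bsub>A\<^esub> f (\<phi> l a)) b) - expand (i a \<otimes>\<^bsub>M\<^esub> j b)) \<in> R" by (rule R_add)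
  then show ?case using single by (simp add: fm_single)
next
  case zero
  then show ?case using R_minus[OF expand_0] by (simp add: fm_0)
next
  case (diff q r)
  have "(q - expand (fm q)) - (r - expand (fm r)) - (expand (fm q \<ominus>\<^bsub>M\<^esub> fm r) - (expand (fm q) - expand (fm r))) \<in> R"
    using diff by (intro R_diff[OF R_diff[OF diff(3,4)]] expand_diff fm_C)
  then show ?case using diff by (simp add: fm_diff algebra_simps)
qed

lemma fm_expand:
  assumes x: "x \<in> C" shows "fm (expand x) = x"
proof -
  have "fm (expand x) = (\<Oplus>\<^bsub>M\<^esub>l\<in>L. fm (\<delta> (p l) (\<psi> l x)))"
    unfolding expand_def by (rule fm_sum[OF L]) (simp add: Fr_single p \<psi> x)
  also have "\<dots> = (\<Oplus>\<^bsub>M\<^esub>l\<in>L. i (p l) \<otimes>\<^bsub>M\<^esub> j (\<psi> l x))"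
    by (rule M.finsum_cong') (simp_all add: fm_single p \<psi> x hom_closed)
  also have "\<dots> = x" by (rule p_\<psi>[OF x, symmetric])
  finally show ?thesis .
qed

lemma fm_eq_0: "q \<in> carrier Fr \<Longrightarrow> fm q = \<zero>\<^bsub>M\<^esub> \<longleftrightarrow> q \<in> R"
  using expand_fm[of q] R_add[OF _ expand_0, of "q - expand \<zero>\<^bsub>M\<^esub>"] R_fm[of q] by auto

section \<open>Multiplication in the free ring and in the tensor product\<close>

abbreviation "fmul \<equiv> monoid.mult Fr"

text \<open>The keys of a difference may be fewer than those of its parts; summing over a common
  superset makes the product visibly bilinear.\<close>

lemma fmul_superset:
  assumes "finite S" "finite T" "Poly_Mapping.keys q \<subseteq> S" "Poly_Mapping.keys r \<subseteq> T"
  shows "fmul q r = (\<Sum>x\<in>S. \<Sum>y\<in>T. Poly_Mapping.single (fst x \<otimes>\<^bsub>A\<^esub> fst y, snd x \<otimes>\<^bsub>B\<^esub> snd y)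
    (Poly_Mapping.lookup q x * Poly_Mapping.lookup r y))"
proof -
  let ?h = "\<lambda>x y. Poly_Mapping.single (fst x \<otimes>\<^bsub>A\<^esub> fst y, snd x \<otimes>\<^bsub>B\<^esub> snd y)
    (Poly_Mapping.lookup q x * Poly_Mapping.lookup r y)"
  have "fmul q r = (\<Sum>x\<in>Poly_Mapping.keys q. \<Sum>y\<in>Poly_Mapping.keys r. ?h x y)"
    by (simp add: free_ring_def case_prod_unfold)
  also have "\<dots> = (\<Sum>x\<in>Poly_Mapping.keys q. \<Sum>y\<in>T. ?h x y)"
    by (intro sum.cong refl sum.mono_neutral_left) (use assms in \<open>auto simp: in_keys_iff\<close>)
  also have "\<dots> = (\<Sum>x\<in>S. \<Sum>y\<in>T. ?h x y)"
    by (intro sum.mono_neutral_left) (use assms in \<open>auto simp: in_keys_iff\<close>)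
  finally show ?thesis .
qed

lemma fmul_diff_left: "fmul (q - q') r = fmul q r - fmul q' r"
proof -
  let ?S = "Poly_Mapping.keys q \<union> Poly_Mapping.keys q'"
  have "Poly_Mapping.keys (q - q') \<subseteq> ?S" by (rule keys_diff)
  then show ?thesis
    by (simp add: fmul_superset[of ?S "Poly_Mapping.keys r"] lookup_minus left_diff_distrib single_diff sum_subtractf)
qed

lemma fmul_diff_right: "fmul r (q - q') = fmul r q - fmul r q'"
proof -
  let ?S = "Poly_Mapping.keys q \<union> Poly_Mapping.keys q'"
  have "Poly_Mapping.keys (q - q') \<subseteq> ?S" by (rule keys_diff)
  then show ?thesis
    by (simp add: fmul_superset[of "Poly_Mapping.keys r" ?S] lookup_minus right_diff_distrib single_diff sum_subtractf)
qed

lemma fmul_0: "fmul 0 r = 0" "fmul r 0 = 0" by (simp_all add: free_ring_def)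

lemma fmul_single: "fmul (\<delta> a b) (\<delta> a' b') = \<delta> (a \<otimes>\<^bsub>A\<^esub> a') (b \<otimes>\<^bsub>B\<^esub> b')"
  by (simp add: free_ring_def)

lemma fmul_Fr: "q \<in> carrier Fr \<Longrightarrow> r \<in> carrier Fr \<Longrightarrow> fmul q r \<in> carrier Fr"
proof (induction q rule: Fr_induct)
  case (single a b)
  from single(3,1,2) show ?case
    by (induction r rule: Fr_induct) (auto simp: fmul_single Fr_single fmul_0 Fr_0 fmul_diff_right Fr_diff)
qed (auto simp: fmul_0 Fr_0 fmul_diff_left Fr_diff)

lemma fm_fmul: "q \<in> carrier Fr \<Longrightarrow> r \<in> carrier Fr \<Longrightarrow> fm (fmul q r) = fm q \<otimes>\<^bsub>M\<^esub> fm r"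
proof (induction q rule: Fr_induct)
  case (single a b)
  from single(3,1,2) show ?case
  proof (induction r rule: Fr_induct)
    case (single a' b')
    have c: "i a \<in> carrier M" "i a' \<in> carrier M" "j b \<in> carrier M" "j b' \<in> carrier M"
      using single hom_closed by auto
    have "i a \<otimes>\<^bsub>M\<^esub> i a' \<otimes>\<^bsub>M\<^esub> (j b \<otimes>\<^bsub>M\<^esub> j b') = i a \<otimes>\<^bsub>M\<^esub> (i a' \<otimes>\<^bsub>M\<^esub> j b) \<otimes>\<^bsub>M\<^esub> j b'"
      using c by (simp add: M.m_assoc)
    \<comment> \<open>Here the images of A and B have to commute.\<close>
    also have "\<dots> = i a \<otimes>\<^bsub>M\<^esub> j b \<otimes>\<^bsub>M\<^esub> (i a' \<otimes>\<^bsub>M\<^esub> j b')"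
      using single c by (simp add: commute[of a' b] M.m_assoc)
    finally show ?case using single i_hom j_hom
      by (simp add: fmul_single fm_single ring_hom_mult)
  next
    case zero then show ?case by (simp add: fmul_0 fm_0 fm_single hom_closed)
  next
    case (diff q r) then show ?case
      by (simp add: fmul_diff_right fm_diff fmul_Fr Fr_single fm_single hom_closed fm_closed M.r_distr M.r_minus a_minus_def)
  qed
next
  case zero then show ?case by (simp add: fmul_0 fm_0 fm_closed)
next
  case (diff q q') then show ?case
    by (simp add: fmul_diff_left fm_diff fmul_Fr fm_closed M.l_distr M.l_minus a_minus_def)
qed

lemma coset: "R +>\<^bsub>Fr\<^esub> q = (\<lambda>r. r + q) ` R"
  by (auto simp: a_r_coset_def r_coset_def free_ring_def)

lemma coset_memI: "r \<in> R \<Longrightarrow> r + q \<in> R +>\<^bsub>Fr\<^esub> q"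
  unfolding coset by (rule imageI)

lemma coset_memE:
  assumes "x \<in> R +>\<^bsub>Fr\<^esub> q" obtains r where "r \<in> R" "x = r + q"
  using assms unfolding coset by (rule imageE) (rule that)

lemma coset_self: "q \<in> R +>\<^bsub>Fr\<^esub> q" using coset_memI[OF R_0, of q] by simp

lemma coset_eq_iff: "R +>\<^bsub>Fr\<^esub> q = R +>\<^bsub>Fr\<^esub> q' \<longleftrightarrow> q - q' \<in> R"
proof
  assume h: "R +>\<^bsub>Fr\<^esub> q = R +>\<^bsub>Fr\<^esub> q'"
  have "q \<in> R +>\<^bsub>Fr\<^esub> q'" using coset_self[of q] unfolding h .
  then show "q - q' \<in> R" by (rule coset_memE) simp
next
  assume h: "q - q' \<in> R"
  show "R +>\<^bsub>Fr\<^esub> q = R +>\<^bsub>Fr\<^esub> q'"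
  proof (intro equalityI subsetI)
    fix x assume "x \<in> R +>\<^bsub>Fr\<^esub> q"
    then obtain r where r: "r \<in> R" "x = r + q" by (rule coset_memE)
    then show "x \<in> R +>\<^bsub>Fr\<^esub> q'" using coset_memI[OF R_add[OF r(1) h], of q'] by simp
  next
    fix x assume "x \<in> R +>\<^bsub>Fr\<^esub> q'"
    then obtain r where r: "r \<in> R" "x = r + q'" by (rule coset_memE)
    then show "x \<in> R +>\<^bsub>Fr\<^esub> q" using coset_memI[OF R_diff[OF r(1) h], of q] by simp
  qed
qed

abbreviation "Te \<equiv> tensor_ring K f A g B"

text \<open>That \<open>R\<close> is an ideal is read off from the multiplication map:
  \<open>R\<close> is the kernel of \<open>fm\<close> (\<open>fm_eq_0\<close>) and \<open>fm\<close>
  is multiplicative, so the product of cosets does not depend on representatives.\<close>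

lemma coset_mult:
  assumes "q \<in> carrier Fr" "r \<in> carrier Fr"
  shows "(R +>\<^bsub>Fr\<^esub> q) \<otimes>\<^bsub>Te\<^esub> (R +>\<^bsub>Fr\<^esub> r) = R +>\<^bsub>Fr\<^esub> fmul q r"
proof -
  have "R +>\<^bsub>Fr\<^esub> fmul x y = R +>\<^bsub>Fr\<^esub> fmul q r" if xy: "x \<in> R +>\<^bsub>Fr\<^esub> q" "y \<in> R +>\<^bsub>Fr\<^esub> r" for x y
  proof -
    obtain s where s: "x = s + q" "s \<in> R" using xy(1) by (rule coset_memE)
    obtain t where t: "y = t + r" "t \<in> R" using xy(2) by (rule coset_memE)
    have c: "x \<in> carrier Fr" "y \<in> carrier Fr" "s \<in> carrier Fr" "t \<in> carrier Fr"
      using s t assms R_fm Fr_add by auto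
    have "fm x = fm q" "fm y = fm r" using s t c assms R_fm by (auto simp: fm_add fm_closed)
    then have "fm (fmul x y - fmul q r) = \<zero>\<^bsub>M\<^esub>"
      using c assms by (simp add: fm_diff fmul_Fr fm_fmul fm_closed M.r_right_minus_eq)
    then show ?thesis using c assms by (simp add: coset_eq_iff fm_eq_0 fmul_Fr Fr_diff)
  qed
  then have "(\<Union>x\<in>R +>\<^bsub>Fr\<^esub> q. \<Union>y\<in>R +>\<^bsub>Fr\<^esub> r. R +>\<^bsub>Fr\<^esub> fmul x y) =
      (\<Union>x\<in>R +>\<^bsub>Fr\<^esub> q. \<Union>y\<in>R +>\<^bsub>Fr\<^esub> r. R +>\<^bsub>Fr\<^esub> fmul q r)"
    by (intro SUP_cong refl)
  also have "\<dots> = R +>\<^bsub>Fr\<^esub> fmul q r" using coset_self[of q] coset_self[of r] by blast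
  finally show ?thesis by (simp only: tensor_ring_def FactRing_def rcoset_mult_def monoid.simps)
qed

lemma coset_add: "(R +>\<^bsub>Fr\<^esub> q) \<oplus>\<^bsub>Te\<^esub> (R +>\<^bsub>Fr\<^esub> r) = R +>\<^bsub>Fr\<^esub> (q + r)"
proof -
  have "(R +>\<^bsub>Fr\<^esub> q) \<oplus>\<^bsub>Te\<^esub> (R +>\<^bsub>Fr\<^esub> r) = {x + y | x y. x \<in> R +>\<^bsub>Fr\<^esub> q \<and> y \<in> R +>\<^bsub>Fr\<^esub> r}"
    unfolding tensor_ring_def FactRing_def set_add_def set_mult_def free_ring_def ring.simps monoid.simps by auto
  also have "\<dots> = R +>\<^bsub>Fr\<^esub> (q + r)"
  proof (intro equalityI subsetI)
    fix z assume "z \<in> R +>\<^bsub>Fr\<^esub> (q + r)"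
    then obtain s where s: "s \<in> R" "z = s + (q + r)" by (rule coset_memE)
    then have "z = (s + q) + r" by (simp add: add.assoc)
    then show "z \<in> {x + y | x y. x \<in> R +>\<^bsub>Fr\<^esub> q \<and> y \<in> R +>\<^bsub>Fr\<^esub> r}"
      using coset_memI[OF s(1)] coset_self by blast
  next
    fix z assume "z \<in> {x + y | x y. x \<in> R +>\<^bsub>Fr\<^esub> q \<and> y \<in> R +>\<^bsub>Fr\<^esub> r}"
    then obtain x y where xy: "z = x + y" "x \<in> R +>\<^bsub>Fr\<^esub> q" "y \<in> R +>\<^bsub>Fr\<^esub> r" by blast
    obtain s where s: "s \<in> R" "x = s + q" using xy(2) by (rule coset_memE)
    obtain t where t: "t \<in> R" "y = t + r" using xy(3) by (rule coset_memE)
    have "z = (s + t) + (q + r)" using xy s t by (simp add: algebra_simps)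
    then show "z \<in> R +>\<^bsub>Fr\<^esub> (q + r)" using coset_memI[OF R_add[OF s(1) t(1)]] by simp
  qed
  finally show ?thesis .
qed

lemma Te_carrier: "carrier Te = (\<lambda>q. R +>\<^bsub>Fr\<^esub> q) ` carrier Fr"
  by (auto simp: tensor_ring_def FactRing_def A_RCOSETS_def RCOSETS_def a_r_coset_def)

lemma tmm_coset: "q \<in> carrier Fr \<Longrightarrow> tensor_mult_map M i j (R +>\<^bsub>Fr\<^esub> q) = fm q"
  using tensor_mult_map_coset[where K = K and f = f and g = g, OF M.ring_axioms A.ring_axioms B.ring_axioms i_hom j_hom K] by simp

theorem tensor_mult_map_iso: "tensor_mult_map M i j \<in> ring_iso Te (M\<lparr>carrier := C\<rparr>)"
proof -
  have "tensor_mult_map M i j \<in> ring_hom Te (M\<lparr>carrier := C\<rparr>)"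
  proof (rule ring_hom_memI)
    fix x y assume "x \<in> carrier Te" "y \<in> carrier Te"
    then obtain q r where q: "x = R +>\<^bsub>Fr\<^esub> q" "q \<in> carrier Fr" and r: "y = R +>\<^bsub>Fr\<^esub> r" "r \<in> carrier Fr"
      by (auto simp: Te_carrier)
    show "tensor_mult_map M i j x \<in> carrier (M\<lparr>carrier := C\<rparr>)" using q by (simp add: tmm_coset fm_C)
    show "tensor_mult_map M i j (x \<otimes>\<^bsub>Te\<^esub> y) = tensor_mult_map M i j x \<otimes>\<^bsub>M\<lparr>carrier := C\<rparr>\<^esub> tensor_mult_map M i j y"
      using q r by (simp add: coset_mult tmm_coset fmul_Fr fm_fmul)
    show "tensor_mult_map M i j (x \<oplus>\<^bsub>Te\<^esub> y) = tensor_mult_map M i j x \<oplus>\<^bsub>M\<lparr>carrier := C\<rparr>\<^esub> tensor_mult_map M i j y"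
      using q r by (simp add: coset_add tmm_coset Fr_add fm_add)
  next
    have "\<one>\<^bsub>Te\<^esub> = R +>\<^bsub>Fr\<^esub> \<delta> \<one>\<^bsub>A\<^esub> \<one>\<^bsub>B\<^esub>" by (simp add: tensor_ring_def FactRing_def free_ring_def)
    then show "tensor_mult_map M i j \<one>\<^bsub>Te\<^esub> = \<one>\<^bsub>M\<lparr>carrier := C\<rparr>\<^esub>"
      using i_hom j_hom by (simp add: tmm_coset Fr_single fm_single ring_hom_one)
  qed
  moreover have "bij_betw (tensor_mult_map M i j) (carrier Te) C"
  proof (rule bij_betwI')
    fix x y assume "x \<in> carrier Te" "y \<in> carrier Te"
    then obtain q r where q: "x = R +>\<^bsub>Fr\<^esub> q" "q \<in> carrier Fr" and r: "y = R +>\<^bsub>Fr\<^esub> r" "r \<in> carrier Fr"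
      by (auto simp: Te_carrier)
    have "fm q = fm r \<longleftrightarrow> fm (q - r) = \<zero>\<^bsub>M\<^esub>"
      using q r by (simp add: fm_diff fm_closed M.r_right_minus_eq)
    then show "tensor_mult_map M i j x = tensor_mult_map M i j y \<longleftrightarrow> x = y"
      using q r by (simp add: tmm_coset coset_eq_iff fm_eq_0 Fr_diff)
  next
    fix x assume "x \<in> carrier Te"
    then show "tensor_mult_map M i j x \<in> C" by (auto simp: Te_carrier tmm_coset fm_C)
  next
    fix x assume x: "x \<in> C"
    have "R +>\<^bsub>Fr\<^esub> expand x \<in> carrier Te" using x expand_Fr by (auto simp: Te_carrier)
    then show "\<exists>y\<in>carrier Te. x = tensor_mult_map M i j y"
      using x by (intro bexI) (auto simp: tmm_coset expand_Fr fm_expand)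
  qed
  ultimately show ?thesis by (simp add: ring_iso_def)
qed

end


section \<open>Weyl groups\<close>

lemma group_closure_of_nat:
  fixes x :: "'v::real_vector"
  assumes "x \<in> group_closure S" shows "real k *\<^sub>R x \<in> group_closure S"
  by (induction k) (auto simp: scaleR_add_left assms group_closure_add)

lemma group_closure_linear_image:
  assumes "linear w" "\<And>x. x \<in> S \<Longrightarrow> w x \<in> S" "x \<in> group_closure S" shows "w x \<in> group_closure S"
  using assms(3)
  by induction (use assms in \<open>auto simp: linear_0 linear_diff intro: group_closure.intros\<close>)

lemma linear_reflection: "linear (reflection a)"
  unfolding reflection_def
  by (rule linearI) (simp_all add: inner_add_left add_divide_distrib distrib_left scaleR_add_left scaleR_diff_right)

lemma reflection_self: "a \<noteq> 0 \<Longrightarrow> reflection a a = - a"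
  by (simp add: reflection_def scaleR_2)

lemma reflection_reflection [simp]: "reflection a (reflection a v) = v"
  by (cases "a = 0") (auto simp: reflection_def algebra_simps inner_diff_left)

lemma reflection_invol [simp]: "reflection a \<circ> reflection a = id"
  by (simp add: fun_eq_iff)

lemma inner_reflection: "reflection a u \<bullet> reflection a v = u \<bullet> v"
  by (cases "a = 0") (auto simp: reflection_def inner_diff_left inner_diff_right inner_commute field_simps)

lemma reflection_uminus: "reflection (- a) = reflection a"
  by (simp add: reflection_def fun_eq_iff)

lemma reflection_conj:
  assumes "linear w" "\<And>x y. w x \<bullet> w y = x \<bullet> y"
  shows "reflection (w a) (w v) = w (reflection a v)"
  by (simp add: reflection_def assms linear_diff linear_scale)

definition rprod :: "'v::euclidean_space list \<Rightarrow> 'v \<Rightarrow> 'v" where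
  "rprod as = foldr (\<lambda>a f. reflection a \<circ> f) as id"

lemma rprod_simps [simp]: "rprod [] = id" "rprod (a # as) = reflection a \<circ> rprod as"
  by (simp_all add: rprod_def)

lemma rprod_append: "rprod (as @ bs) = rprod as \<circ> rprod bs"
  by (induction as) (auto simp: o_assoc)

lemma rprod_rev: "rprod (rev as) \<circ> rprod as = id"
  by (induction as) (auto simp: rprod_append fun_eq_iff)

lemma linear_rprod: "linear (rprod as)"
proof (induction as)
  case (Cons a as)
  then show ?case using linear_compose[OF Cons linear_reflection[of a]] by (simp only: rprod_simps)
qed (simp only: rprod_simps linear_id)

lemma inner_rprod: "rprod as u \<bullet> rprod as v = u \<bullet> v"
  by (induction as) (auto simp: inner_reflection)

text \<open>Reflections are involutions, so inverses add nothing and every element is a plain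
  product. Properties of the Weyl group then follow by induction on words.\<close>

lemma weyl_group_rprod: "weyl_group \<Phi> = {rprod as | as. set as \<subseteq> \<Phi>}"
proof (intro equalityI subsetI)
  interpret B: group "BijGroup (UNIV :: 'a set)" by (rule group_BijGroup)
  have bij: "bij (reflection a)" for a :: 'a by (rule o_bij) (rule reflection_invol)+
  have inB: "reflection a \<in> carrier (BijGroup UNIV)" for a :: 'a
    using bij by (simp add: BijGroup_def Bij_def)
  have bijr: "bij (rprod as)" for as :: "'a list"
  proof (induction as)
    case (Cons a as)
    then show ?case unfolding rprod_simps by (rule bij_comp[OF _ bij])
  qed (simp only: rprod_simps bij_id)
  have bij_one: "\<one>\<^bsub>BijGroup UNIV\<^esub> = (id :: 'a \<Rightarrow> 'a)" by (simp add: BijGroup_def fun_eq_iff)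
  have mult: "f \<otimes>\<^bsub>BijGroup UNIV\<^esub> g = f \<circ> g" if "bij f" "bij g" for f g :: "'a \<Rightarrow> 'a"
    using that by (simp add: BijGroup_def Bij_def compose_def fun_eq_iff)
  fix w
  {
    assume "w \<in> weyl_group \<Phi>"
    then show "w \<in> {rprod as | as. set as \<subseteq> \<Phi>}"
      unfolding weyl_group_def
    proof induction
      case one
      then show ?case using rprod_simps(1) by (auto simp: bij_one intro!: exI[of _ "[]"])
    next
      case (incl h)
      then obtain a where "h = reflection a" "a \<in> \<Phi>" by auto
      then show ?case by (auto intro!: exI[of _ "[a]"])
    next
      case (inv h)
      then obtain a where a: "h = reflection a" "a \<in> \<Phi>" by auto
      have "inv\<^bsub>BijGroup UNIV\<^esub> h = h"
        by (rule B.inv_equality) (auto simp: a inB mult bij bij_one)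
      then show ?case using a by (auto intro!: exI[of _ "[a]"])
    next
      case (eng h1 h2)
      then obtain as bs where "h1 = rprod as" "h2 = rprod bs" "set as \<subseteq> \<Phi>" "set bs \<subseteq> \<Phi>" by auto
      then show ?case by (auto simp: mult bijr rprod_append intro!: exI[of _ "as @ bs"])
    qed
  }
  {
    assume "w \<in> {rprod as | as. set as \<subseteq> \<Phi>}"
    then obtain as where "w = rprod as" "set as \<subseteq> \<Phi>" by auto
    then show "w \<in> weyl_group \<Phi>"
      unfolding weyl_group_def
    proof (induction as arbitrary: w)
      case Nil
      then show ?case using generate.one[of "BijGroup UNIV" "reflection ` \<Phi>"] by (simp only: bij_one rprod_simps)
    next
      case (Cons a as)
      have "reflection a \<otimes>\<^bsub>BijGroup UNIV\<^esub> rprod as \<in> generate (BijGroup UNIV) (reflection ` \<Phi>)"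
        by (rule generate.eng[OF generate.incl Cons.IH[OF refl]]) (use Cons in auto)
      then show ?case unfolding Cons.prems(1) rprod_simps by (simp only: mult[OF bij bijr])
    qed
  }
qed

lemma weyl_id [simp]: "id \<in> weyl_group \<Phi>"
  unfolding weyl_group_rprod by (auto intro!: exI[of _ "[]"])

lemma weyl_reflection: "a \<in> \<Phi> \<Longrightarrow> reflection a \<in> weyl_group \<Phi>"
  unfolding weyl_group_rprod by (auto intro!: exI[of _ "[a]"])

lemma weyl_comp: "u \<in> weyl_group \<Phi> \<Longrightarrow> w \<in> weyl_group \<Phi> \<Longrightarrow> u \<circ> w \<in> weyl_group \<Phi>"
  unfolding weyl_group_rprod
  by (clarify, rule_tac x = "as @ asa" in exI) (auto simp: rprod_append)

lemma weyl_linear: "w \<in> weyl_group \<Phi> \<Longrightarrow> linear w"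
  unfolding weyl_group_rprod by (auto simp: linear_rprod)

lemma weyl_inner: "w \<in> weyl_group \<Phi> \<Longrightarrow> w x \<bullet> w y = x \<bullet> y"
  unfolding weyl_group_rprod by (auto simp: inner_rprod)

lemma weyl_inverse:
  assumes "w \<in> weyl_group \<Phi>"
  obtains v where "v \<in> weyl_group \<Phi>" "v \<circ> w = id" "w \<circ> v = id"
proof -
  obtain as where as: "w = rprod as" "set as \<subseteq> \<Phi>" using assms unfolding weyl_group_rprod by auto
  have "rprod (rev as) \<in> weyl_group \<Phi>" unfolding weyl_group_rprod using as by (auto intro!: exI[of _ "rev as"])
  moreover have "rprod (rev as) \<circ> w = id" "w \<circ> rprod (rev as) = id"
    using rprod_rev[of as] rprod_rev[of "rev as"] as by auto
  ultimately show thesis by (rule that)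
qed

lemma weyl_bij: "w \<in> weyl_group \<Phi> \<Longrightarrow> bij w"
  by (metis o_bij weyl_inverse)

lemma weyl_funpow: "w \<in> weyl_group \<Phi> \<Longrightarrow> (w ^^ k) \<in> weyl_group \<Phi>"
  by (induction k) (auto intro: weyl_comp simp: id_def[symmetric])

locale roots =
  fixes \<Phi> :: "'v::euclidean_space set" and n :: nat and \<alpha> :: "nat \<Rightarrow> 'v"
  assumes root_system: "root_system \<Phi>" and simple: "simple_roots \<Phi> n \<alpha>"
begin

abbreviation "W \<equiv> weyl_group \<Phi>"
definition "I = {1..n}"

lemma finite_I [simp]: "finite I" by (simp add: I_def)

lemma fin: "finite \<Phi>" and nz: "0 \<notin> \<Phi>" and span_roots: "Real_Vector_Spaces.span \<Phi> = UNIV"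
  and refl_root: "\<lbrakk>a \<in> \<Phi>; b \<in> \<Phi>\<rbrakk> \<Longrightarrow> reflection a b \<in> \<Phi>"
  and cartan_int: "\<lbrakk>a \<in> \<Phi>; b \<in> \<Phi>\<rbrakk> \<Longrightarrow> 2 * (b \<bullet> a) / (a \<bullet> a) \<in> \<int>"
  and reduced: "\<lbrakk>a \<in> \<Phi>; c *\<^sub>R a \<in> \<Phi>\<rbrakk> \<Longrightarrow> c = 1 \<or> c = - 1"
  using root_system by (auto simp: root_system_def)

lemma \<alpha>_root: "i \<in> I \<Longrightarrow> \<alpha> i \<in> \<Phi>" and \<alpha>_inj: "inj_on \<alpha> I" and \<alpha>_indep: "\<not> Real_Vector_Spaces.dependent (\<alpha> ` I)"
  and root_expand: "b \<in> \<Phi> \<Longrightarrow> \<exists>c :: nat \<Rightarrow> nat. b = (\<Sum>i\<in>I. real (c i) *\<^sub>R \<alpha> i) \<or> b = - (\<Sum>i\<in>I. real (c i) *\<^sub>R \<alpha> i)"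
  using simple unfolding simple_roots_def I_def[symmetric] by auto

lemma root_ne0: "a \<in> \<Phi> \<Longrightarrow> a \<noteq> 0" using nz by auto

lemma uminus_root: "a \<in> \<Phi> \<Longrightarrow> - a \<in> \<Phi>"
  using refl_root[of a a] reflection_self[of a] root_ne0 by auto

lemma weyl_root:
  assumes "w \<in> W" "b \<in> \<Phi>" shows "w b \<in> \<Phi>"
proof -
  have "rprod as b \<in> \<Phi>" if "set as \<subseteq> \<Phi>" for as
    using that by (induction as) (auto simp: assms(2) refl_root)
  then show ?thesis using assms(1) unfolding weyl_group_rprod by auto
qed

text \<open>An element is determined by the map it induces on the finite set of roots, since the
  roots span.\<close>

lemma finite_weyl: "finite W"
proof -
  have "inj_on (\<lambda>w. restrict w \<Phi>) W"
  proof (rule inj_onI)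
    fix u w assume h: "u \<in> W" "w \<in> W" "restrict u \<Phi> = restrict w \<Phi>"
    have "u b = w b" if "b \<in> \<Phi>" for b using h(3) that by (metis restrict_apply')
    then have "u x = w x" for x
      using linear_eq_on_span[OF weyl_linear weyl_linear, OF h(1,2), of \<Phi> x] span_roots by auto
    then show "u = w" by auto
  qed
  moreover have "(\<lambda>w. restrict w \<Phi>) ` W \<subseteq> \<Phi> \<rightarrow>\<^sub>E \<Phi>" using weyl_root by auto
  then have "finite ((\<lambda>w. restrict w \<Phi>) ` W)" using fin by (meson finite_PiE finite_subset)
  ultimately show ?thesis by (rule finite_imageD[rotated])
qed

lemma weyl_root_lattice: "w \<in> W \<Longrightarrow> x \<in> root_lattice \<Phi> \<Longrightarrow> w x \<in> root_lattice \<Phi>"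
  unfolding root_lattice_def by (rule group_closure_linear_image) (auto simp: weyl_linear weyl_root)

lemma weyl_coroot: "w \<in> W \<Longrightarrow> w (coroot a) = coroot (w a)"
  by (simp add: coroot_def weyl_inner linear_scale[OF weyl_linear])

lemma weyl_coroot_lattice: "w \<in> W \<Longrightarrow> x \<in> coroot_lattice \<Phi> \<Longrightarrow> w x \<in> coroot_lattice \<Phi>"
  unfolding coroot_lattice_def
  by (rule group_closure_linear_image) (auto simp: weyl_linear weyl_root weyl_coroot)

lemma root_in_lattice: "a \<in> \<Phi> \<Longrightarrow> a \<in> root_lattice \<Phi>"
  unfolding root_lattice_def by (rule group_closure.base) simp

lemma reflection_lattice:
  assumes "a \<in> \<Phi>" "x \<in> root_lattice \<Phi>" shows "\<exists>k :: int. reflection a x = x - of_int k *\<^sub>R a"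
proof -
  have "2 * (x \<bullet> a) / (a \<bullet> a) \<in> \<int>"
    using assms(2) unfolding root_lattice_def
  proof induction
    case (diff s t)
    then have "2 * (s \<bullet> a) / (a \<bullet> a) - 2 * (t \<bullet> a) / (a \<bullet> a) \<in> \<int>" by simp
    then show ?case by (simp add: inner_diff_left right_diff_distrib diff_divide_distrib)
  qed (use cartan_int assms in auto)
  then show ?thesis unfolding reflection_def by (metis Ints_cases)
qed

lemma affine_group: "group (affine_weyl_group \<Phi>)"
proof (rule groupI)
  show "\<one>\<^bsub>affine_weyl_group \<Phi>\<^esub> \<in> carrier (affine_weyl_group \<Phi>)"
    by (simp add: affine_weyl_group_def coroot_lattice_def)
  fix x assume "x \<in> carrier (affine_weyl_group \<Phi>)"
  then obtain l w where x: "x = (l, w)" "l \<in> coroot_lattice \<Phi>" "w \<in> W" by (auto simp: affine_weyl_group_def)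
  obtain v where v: "v \<in> W" "v \<circ> w = id" "w \<circ> v = id" using weyl_inverse[OF x(3)] .
  \<comment> \<open>The inverse of t_l w is t_m v with v the inverse of w and m = - v l.\<close>
  have "- v l \<in> coroot_lattice \<Phi>" using weyl_coroot_lattice[OF v(1) x(2)] by (simp add: coroot_lattice_def)
  then show "\<exists>y\<in>carrier (affine_weyl_group \<Phi>). y \<otimes>\<^bsub>affine_weyl_group \<Phi>\<^esub> x = \<one>\<^bsub>affine_weyl_group \<Phi>\<^esub>"
    using x v by (intro bexI[of _ "(- v l, v)"]) (auto simp: affine_weyl_group_def)
  show "\<one>\<^bsub>affine_weyl_group \<Phi>\<^esub> \<otimes>\<^bsub>affine_weyl_group \<Phi>\<^esub> x = x" by (auto simp: affine_weyl_group_def)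
next
  fix x y assume "x \<in> carrier (affine_weyl_group \<Phi>)" "y \<in> carrier (affine_weyl_group \<Phi>)"
  then show "x \<otimes>\<^bsub>affine_weyl_group \<Phi>\<^esub> y \<in> carrier (affine_weyl_group \<Phi>)"
    using weyl_coroot_lattice unfolding coroot_lattice_def
    by (auto simp: affine_weyl_group_def coroot_lattice_def weyl_comp intro!: group_closure_add)
next
  fix x y z assume "x \<in> carrier (affine_weyl_group \<Phi>)" "y \<in> carrier (affine_weyl_group \<Phi>)"
    "z \<in> carrier (affine_weyl_group \<Phi>)"
  then show "x \<otimes>\<^bsub>affine_weyl_group \<Phi>\<^esub> y \<otimes>\<^bsub>affine_weyl_group \<Phi>\<^esub> z =
      x \<otimes>\<^bsub>affine_weyl_group \<Phi>\<^esub> (y \<otimes>\<^bsub>affine_weyl_group \<Phi>\<^esub> z)"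
    by (auto simp: affine_weyl_group_def linear_add[OF weyl_linear] add.assoc o_assoc)
qed


subsection \<open>Simple reflections\<close>

definition co :: "nat \<Rightarrow> 'v \<Rightarrow> real" where
  "co i v = Real_Vector_Spaces.representation (\<alpha> ` I) v (\<alpha> i)"

lemma span_simple: "Real_Vector_Spaces.span (\<alpha> ` I) = UNIV"
proof -
  have "b \<in> Real_Vector_Spaces.span (\<alpha> ` I)" if "b \<in> \<Phi>" for b
  proof -
    have "(\<Sum>i\<in>I. real (c i) *\<^sub>R \<alpha> i) \<in> Real_Vector_Spaces.span (\<alpha> ` I)" for c
      by (intro real_vector.span_sum real_vector.span_scale real_vector.span_base) auto
    then show ?thesis using root_expand[OF that] real_vector.span_neg by metis
  qed
  then have "Real_Vector_Spaces.span \<Phi> \<subseteq> Real_Vector_Spaces.span (\<alpha> ` I)"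
    by (intro real_vector.span_minimal) (auto simp: real_vector.subspace_span)
  then show ?thesis using span_roots by auto
qed

lemma co_add: "co i (u + v) = co i u + co i v" and co_diff: "co i (u - v) = co i u - co i v"
  and co_scale: "co i (r *\<^sub>R v) = r * co i v" and co_minus: "co i (- v) = - co i v"
  using \<alpha>_indep span_simple
  by (simp_all add: co_def real_vector.representation_add real_vector.representation_diff
      real_vector.representation_scale real_vector.representation_neg)

lemma co_\<alpha>: "i \<in> I \<Longrightarrow> j \<in> I \<Longrightarrow> co i (\<alpha> j) = (if i = j then 1 else 0)"
  using \<alpha>_indep \<alpha>_inj by (auto simp: co_def real_vector.representation_basis inj_on_eq_iff)

lemma co_0: "co i 0 = 0" using co_scale[of i 0 0] by simp

lemma co_sum: "finite A \<Longrightarrow> co i (\<Sum>j\<in>A. f j) = (\<Sum>j\<in>A. co i (f j))"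
  by (induction A rule: finite_induct) (auto simp: co_add co_0)

lemma co_expand: "i \<in> I \<Longrightarrow> co i (\<Sum>j\<in>I. c j *\<^sub>R \<alpha> j) = c i"
  by (simp add: co_sum co_scale co_\<alpha> if_distrib cong: if_cong)

lemma root_co:
  assumes "b \<in> \<Phi>"
  shows "b = (\<Sum>i\<in>I. co i b *\<^sub>R \<alpha> i)" "(\<forall>i\<in>I. co i b \<in> \<nat>) \<or> (\<forall>i\<in>I. - co i b \<in> \<nat>)"
proof -
  obtain c :: "nat \<Rightarrow> nat" where c: "b = (\<Sum>i\<in>I. real (c i) *\<^sub>R \<alpha> i) \<or> b = - (\<Sum>i\<in>I. real (c i) *\<^sub>R \<alpha> i)"
    using root_expand[OF assms] by blast
  have "(\<forall>i\<in>I. co i b = real (c i)) \<or> (\<forall>i\<in>I. co i b = - real (c i))"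
    using c by (auto simp: co_minus co_expand)
  then show "(\<forall>i\<in>I. co i b \<in> \<nat>) \<or> (\<forall>i\<in>I. - co i b \<in> \<nat>)" by auto
  show "b = (\<Sum>i\<in>I. co i b *\<^sub>R \<alpha> i)"
    using c
  proof
    assume h: "b = (\<Sum>i\<in>I. real (c i) *\<^sub>R \<alpha> i)"
    have "(\<Sum>i\<in>I. co i b *\<^sub>R \<alpha> i) = (\<Sum>i\<in>I. real (c i) *\<^sub>R \<alpha> i)"
      by (rule sum.cong) (auto simp: h co_expand)
    then show ?thesis using h by simp
  next
    assume h: "b = - (\<Sum>i\<in>I. real (c i) *\<^sub>R \<alpha> i)"
    have "(\<Sum>i\<in>I. co i b *\<^sub>R \<alpha> i) = (\<Sum>i\<in>I. - real (c i) *\<^sub>R \<alpha> i)"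
      by (rule sum.cong) (auto simp: h co_minus co_expand)
    then show ?thesis using h by (simp add: sum_negf)
  qed
qed

definition pos :: "'v \<Rightarrow> bool" where
  "pos b \<longleftrightarrow> b \<in> \<Phi> \<and> (\<forall>i\<in>I. co i b \<ge> 0)"

lemma pos_or_neg: "b \<in> \<Phi> \<Longrightarrow> pos b \<or> pos (- b)"
  using root_co(2)[of b] uminus_root[of b] unfolding pos_def co_minus
  by (metis Nats_cases of_nat_0_le_iff)

lemma pos_ex: "b \<in> \<Phi> \<Longrightarrow> \<exists>i\<in>I. co i b \<noteq> 0"
  using root_co(1)[of b] root_ne0[of b] by (metis (no_types, lifting) scaleR_eq_0_iff sum.neutral)

lemma not_pos_neg: "pos b \<Longrightarrow> \<not> pos (- b)"
  using pos_ex[of b] by (force simp: pos_def co_minus)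

lemma pos_\<alpha>: "i \<in> I \<Longrightarrow> pos (\<alpha> i)"
  by (auto simp: pos_def \<alpha>_root co_\<alpha>)

lemma pos_if_co_pos: "b \<in> \<Phi> \<Longrightarrow> i \<in> I \<Longrightarrow> co i b > 0 \<Longrightarrow> pos b"
  using pos_or_neg[of b] by (force simp: pos_def co_minus)

text \<open>The reflection changes only the coordinate at \<open>\<alpha> i\<close>. As the root
  system is reduced, a positive root other than \<open>\<alpha> i\<close> has a positive coordinate
  elsewhere, and a single positive coordinate forces a root to be positive.\<close>

lemma simple_perm:
  assumes "pos b" "i \<in> I" "b \<noteq> \<alpha> i"
  shows "pos (reflection (\<alpha> i) b)" "reflection (\<alpha> i) b \<noteq> \<alpha> i"
proof -
  have b: "b \<in> \<Phi>" using assms by (simp add: pos_def)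
  have "\<exists>j\<in>I. j \<noteq> i \<and> co j b \<noteq> 0"
  proof (rule ccontr)
    assume h: "\<not> ?thesis"
    have "b = (\<Sum>j\<in>I. co j b *\<^sub>R \<alpha> j)" by (rule root_co(1)[OF b])
    also have "\<dots> = (\<Sum>j\<in>I. if j = i then co i b *\<^sub>R \<alpha> i else 0)"
      using h by (intro sum.cong) auto
    also have "\<dots> = co i b *\<^sub>R \<alpha> i" using assms(2) by simp
    finally have e: "b = co i b *\<^sub>R \<alpha> i" .
    then have "co i b = 1 \<or> co i b = - 1" using reduced[OF \<alpha>_root[OF assms(2)], of "co i b"] b by simp
    moreover have "co i b \<ge> 0" using assms by (auto simp: pos_def)
    ultimately show False using e assms(3) by auto
  qed
  then obtain j where j: "j \<in> I" "j \<noteq> i" "co j b \<noteq> 0" by auto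
  then have "co j b > 0" using assms(1) by (force simp: pos_def)
  moreover have "co j (reflection (\<alpha> i) b) = co j b"
    using j assms(2) by (simp add: reflection_def co_diff co_scale co_\<alpha>)
  ultimately show "pos (reflection (\<alpha> i) b)"
    using pos_if_co_pos[OF refl_root[OF \<alpha>_root[OF assms(2)] b] j(1)] by simp
  show "reflection (\<alpha> i) b \<noteq> \<alpha> i"
  proof
    assume "reflection (\<alpha> i) b = \<alpha> i"
    then have "b = reflection (\<alpha> i) (\<alpha> i)" by (metis reflection_reflection)
    then have "b = - \<alpha> i" using reflection_self root_ne0 \<alpha>_root assms(2) by auto
    then show False using assms(1) pos_\<alpha>[OF assms(2)] not_pos_neg by auto
  qed
qed

definition sprod :: "nat list \<Rightarrow> 'v \<Rightarrow> 'v" where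
  "sprod is = rprod (map \<alpha> is)"

lemma sprod_simps [simp]: "sprod [] = id" "sprod (i # is) = reflection (\<alpha> i) \<circ> sprod is"
  "sprod (is @ js) = sprod is \<circ> sprod js"
  by (simp_all add: sprod_def rprod_append)

lemma sprod_weyl: "set is \<subseteq> I \<Longrightarrow> sprod is \<in> W"
  unfolding weyl_group_rprod sprod_def
  by (auto simp: subset_iff intro!: exI[of _ "map \<alpha> is"] \<alpha>_root)

text \<open>Induction on the height, the sum of the coordinates: if b is not simple, some simple
  reflection s_i carries it to a positive root b' of smaller height, and s_b = s_i s_b' s_i.\<close>

lemma reflection_simple_prod:
  assumes "pos b" shows "\<exists>is. set is \<subseteq> I \<and> reflection b = sprod is"
  using assms
proof (induction "nat \<lfloor>\<Sum>i\<in>I. co i b\<rfloor>" arbitrary: b rule: less_induct)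
  case less
  have b: "b \<in> \<Phi>" using less by (simp add: pos_def)
  show ?case
  proof (cases "\<exists>i\<in>I. b = \<alpha> i")
    case True
    then obtain i where "i \<in> I" "b = \<alpha> i" by auto
    then show ?thesis by (intro exI[of _ "[i]"]) auto
  next
    case False
    \<comment> \<open>Otherwise b, a nonnegative combination of simple roots, would have a
      nonpositive inner product with itself.\<close>
    have "\<exists>i\<in>I. b \<bullet> \<alpha> i > 0"
    proof (rule ccontr)
      assume h: "\<not> ?thesis"
      have "b \<bullet> b = b \<bullet> (\<Sum>i\<in>I. co i b *\<^sub>R \<alpha> i)" using root_co(1)[OF b] by simp
      also have "\<dots> = (\<Sum>i\<in>I. co i b * (b \<bullet> \<alpha> i))" by (simp add: inner_sum_right)
      also have "\<dots> \<le> 0" using h less(2) by (intro sum_nonpos mult_nonneg_nonpos) (auto simp: pos_def not_less)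
      finally show False using root_ne0[OF b] by (metis inner_eq_zero_iff inner_ge_zero order_antisym)
    qed
    then obtain i where i: "i \<in> I" "b \<bullet> \<alpha> i > 0" by auto
    define k where "k = 2 * (b \<bullet> \<alpha> i) / (\<alpha> i \<bullet> \<alpha> i)"
    define b' where "b' = reflection (\<alpha> i) b"
    have a: "\<alpha> i \<in> \<Phi>" "\<alpha> i \<bullet> \<alpha> i > 0" using \<alpha>_root i root_ne0 by auto
    have k: "k > 0" "k \<in> \<int>" using i a cartan_int[OF a(1) b] by (auto simp: k_def)
    have b': "b' = b - k *\<^sub>R \<alpha> i" by (simp add: b'_def reflection_def k_def)
    have p: "pos b'" unfolding b'_def using simple_perm(1)[OF less(2) i(1)] False i by auto
    have "(\<Sum>j\<in>I. co j b') = (\<Sum>j\<in>I. co j b) - (\<Sum>j\<in>I. if j = i then k else 0)"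
      unfolding sum_subtractf[symmetric] b' using i
      by (intro sum.cong) (auto simp: co_diff co_scale co_\<alpha>)
    then have s: "(\<Sum>j\<in>I. co j b') = (\<Sum>j\<in>I. co j b) - k" using i by simp
    have "0 \<le> (\<Sum>j\<in>I. co j b')" using p by (intro sum_nonneg) (auto simp: pos_def)
    \<comment> \<open>The induction measure is the floor of a real number, so a positive drop would
      not suffice; integrality of \<open>k\<close> makes it at least 1.\<close>
    moreover have "k \<ge> 1" using k by (metis Ints_cases of_int_0_less_iff of_int_1_le_iff zless_imp_add1_zle add_0)
    ultimately have "nat \<lfloor>\<Sum>j\<in>I. co j b'\<rfloor> < nat \<lfloor>\<Sum>j\<in>I. co j b\<rfloor>"
      using s by linarith
    from less(1)[OF this p] obtain "is" where "is": "set is \<subseteq> I" "reflection b' = sprod is" by auto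
    have "reflection b v = reflection (\<alpha> i) (reflection b' (reflection (\<alpha> i) v))" for v
      using reflection_conj[OF linear_reflection inner_reflection, of "\<alpha> i" b' "reflection (\<alpha> i) v"]
      by (simp add: b'_def)
    then have "reflection b = sprod (i # is @ [i])" using "is" by (auto simp: fun_eq_iff)
    then show ?thesis using "is" i by (intro exI[of _ "i # is @ [i]"]) auto
  qed
qed

lemma weyl_sprod:
  assumes "w \<in> W" shows "\<exists>is. set is \<subseteq> I \<and> w = sprod is"
proof -
  have "\<exists>is. set is \<subseteq> I \<and> rprod as = sprod is" if "set as \<subseteq> \<Phi>" for as
    using that
  proof (induction as)
    case Nil then show ?case by (auto intro!: exI[of _ "[]"])
  next
    case (Cons a as)
    have "\<exists>is. set is \<subseteq> I \<and> reflection a = sprod is"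
      using pos_or_neg[of a] reflection_simple_prod[of a] reflection_simple_prod[of "- a"] Cons(2)
      by (auto simp: reflection_uminus)
    then obtain "is" js where "set is \<subseteq> I" "reflection a = sprod is" "set js \<subseteq> I" "rprod as = sprod js"
      using Cons by auto
    then show ?case by (intro exI[of _ "is @ js"]) auto
  qed
  then show ?thesis using assms unfolding weyl_group_rprod by auto
qed

text \<open>Reading the word from its right end, the image of \<open>\<alpha> i\<close> stops being
  positive at some letter j. A simple reflection does this only to its own root, so the image just
  before is \<open>\<alpha> j\<close>, and multiplying by s_i on the right deletes that
  letter.\<close>

lemma sprod_exchange:
  assumes "set is \<subseteq> I" "i \<in> I" "\<not> pos (sprod is (\<alpha> i))"
  shows "\<exists>js. set js \<subseteq> I \<and> length is = Suc (length js) \<and> sprod is \<circ> reflection (\<alpha> i) = sprod js"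
  using assms(1,3)
proof (induction "is")
  case Nil
  then show ?case using pos_\<alpha>[OF assms(2)] by simp
next
  case (Cons j "is")
  show ?case
  proof (cases "pos (sprod is (\<alpha> i))")
    case False
    then obtain js where "set js \<subseteq> I" "length is = Suc (length js)" "sprod is \<circ> reflection (\<alpha> i) = sprod js"
      using Cons by (metis insert_subset list.set(2))
    note js = this
    have "sprod (j # is) \<circ> reflection (\<alpha> i) = sprod (j # js)"
      by (simp only: sprod_simps o_assoc[symmetric] js(3))
    moreover have "set (j # js) \<subseteq> I" "length (j # is) = Suc (length (j # js))" using Cons(2) js by auto
    ultimately show ?thesis by blast
  next
    case True
    have j: "j \<in> I" using Cons(2) by simp
    have "sprod is (\<alpha> i) = \<alpha> j"
      using simple_perm(1)[OF True j] Cons(3) by auto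
    then have "reflection (\<alpha> j) (sprod is v) = sprod is (reflection (\<alpha> i) v)" for v
      using reflection_conj[of "sprod is" "\<alpha> i" v] by (simp add: sprod_def linear_rprod inner_rprod)
    then have "sprod (j # is) \<circ> reflection (\<alpha> i) = sprod is" by (auto simp: fun_eq_iff)
    moreover have "set is \<subseteq> I" "length (j # is) = Suc (length is)" using Cons(2) by auto
    ultimately show ?thesis by blast
  qed
qed

text \<open>If the word ends in i, the image of \<open>\<alpha> i\<close> is minus its image under
  the remaining word, which is therefore not positive. The exchange step then shortens the word by
  two letters.\<close>

lemma pos_preserving_id:
  assumes "set is \<subseteq> I" "\<And>b. pos b \<Longrightarrow> pos (sprod is b)" shows "sprod is = id"
  using assms
proof (induction "length is" arbitrary: "is" rule: less_induct)
  case less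
  show ?case
  proof (cases "is" rule: rev_cases)
    case Nil then show ?thesis by simp
  next
    case (snoc js i)
    have i: "i \<in> I" "set js \<subseteq> I" using less(2) snoc by auto
    have "sprod is (\<alpha> i) = - sprod js (\<alpha> i)"
      using snoc reflection_self[of "\<alpha> i"] root_ne0 \<alpha>_root[OF i(1)] linear_neg[OF linear_rprod]
      by (auto simp: sprod_def rprod_append)
    then have "\<not> pos (sprod js (\<alpha> i))"
      using less(3)[OF pos_\<alpha>[OF i(1)]] not_pos_neg by auto
    then obtain ks where ks: "set ks \<subseteq> I" "length js = Suc (length ks)" "sprod js \<circ> reflection (\<alpha> i) = sprod ks"
      using sprod_exchange[OF i(2,1)] by blast
    then have "sprod is = sprod ks" using snoc by simp
    moreover have "sprod ks = id" using less ks snoc calculation by auto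
    ultimately show ?thesis by simp
  qed
qed

text \<open>A regular vector has trivial stabiliser. A translate g v on which the fewest positive
  roots are negative is strictly dominant; the conjugate of w by g fixes it, hence preserves
  positivity of roots, and \<open>pos_preserving_id\<close> applies.\<close>

lemma regular_fixed_id:
  assumes w: "w \<in> W" and v: "w v = v" and reg: "\<And>b. b \<in> \<Phi> \<Longrightarrow> v \<bullet> b \<noteq> 0"
  shows "w = id"
proof -
  let ?N = "\<lambda>g. card {b. pos b \<and> g v \<bullet> b < 0}"
  have fp: "finite {b. pos b \<and> P b}" for P using fin by (rule finite_subset[rotated]) (auto simp: pos_def)
  obtain g where g: "g \<in> W" "\<And>h. h \<in> W \<Longrightarrow> ?N g \<le> ?N h"
    using ex_has_least_nat[of "\<lambda>g. g \<in> W" id ?N] weyl_id by blast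
  obtain g' where g': "g' \<in> W" "g' \<circ> g = id" "g \<circ> g' = id" using weyl_inverse[OF g(1)] .
  define v' where "v' = g v"
  have reg': "v' \<bullet> b \<noteq> 0" if "b \<in> \<Phi>" for b
  proof -
    have "v' \<bullet> b = g v \<bullet> g (g' b)" using g'(3) by (simp add: v'_def pointfree_idE)
    also have "\<dots> = v \<bullet> g' b" by (rule weyl_inner[OF g(1)])
    finally show ?thesis using reg weyl_root[OF g'(1) that] by simp
  qed
  have simple_pos: "v' \<bullet> \<alpha> i > 0" if i: "i \<in> I" for i
  proof (rule ccontr)
    assume "\<not> v' \<bullet> \<alpha> i > 0"
    then have neg: "v' \<bullet> \<alpha> i < 0" using reg'[OF \<alpha>_root[OF i]] by linarith
    let ?s = "reflection (\<alpha> i)"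
    have eq: "?s v' \<bullet> b = v' \<bullet> ?s b" for b
      using inner_reflection[of "\<alpha> i" "?s v'" b] by simp
    \<comment> \<open>\<open>?s\<close> permutes the positive roots other than
      \<open>\<alpha> i\<close>, and \<open>\<alpha> i\<close> itself is no longer negative on the
      reflected vector: the count drops, against minimality.\<close>
    have "{b. pos b \<and> ?s v' \<bullet> b < 0} \<subseteq> ?s ` ({b. pos b \<and> v' \<bullet> b < 0} - {\<alpha> i})"
    proof
      fix b assume b: "b \<in> {b. pos b \<and> ?s v' \<bullet> b < 0}"
      have "b \<noteq> \<alpha> i"
      proof
        assume "b = \<alpha> i"
        then have "?s v' \<bullet> b = - (v' \<bullet> \<alpha> i)"
          unfolding eq using reflection_self[OF root_ne0[OF \<alpha>_root[OF i]]] by simp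
        then show False using b neg by simp
      qed
      then have "?s b \<in> {b. pos b \<and> v' \<bullet> b < 0} - {\<alpha> i}" using simple_perm[OF _ i] b eq by auto
      then show "b \<in> ?s ` ({b. pos b \<and> v' \<bullet> b < 0} - {\<alpha> i})" by (metis image_eqI reflection_reflection)
    qed
    then have "card {b. pos b \<and> ?s v' \<bullet> b < 0} \<le> card ({b. pos b \<and> v' \<bullet> b < 0} - {\<alpha> i})"
      using fp by (meson card_image_le card_mono finite_Diff finite_imageI le_trans)
    also have "\<dots> < card {b. pos b \<and> v' \<bullet> b < 0}"
      using neg pos_\<alpha>[OF i] by (intro psubset_card_mono fp) auto
    finally have "?N (?s \<circ> g) < ?N g" by (simp add: v'_def)
    moreover have "?s \<circ> g \<in> W" by (intro weyl_comp weyl_reflection \<alpha>_root[OF i] g(1))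
    ultimately show False using g(2) by fastforce
  qed
  have pos_inner: "v' \<bullet> b > 0" if "pos b" for b
  proof -
    have "v' \<bullet> b = (\<Sum>i\<in>I. co i b * (v' \<bullet> \<alpha> i))"
      using root_co(1)[of b] that by (metis (no_types, lifting) inner_scaleR_right inner_sum_right pos_def sum.cong)
    also have "\<dots> \<ge> 0" using that simple_pos by (intro sum_nonneg mult_nonneg_nonneg) (auto simp: pos_def less_imp_le)
    finally show ?thesis using reg'[of b] that by (simp add: pos_def less_eq_real_def)
  qed
  define w' where "w' = g \<circ> w \<circ> g'"
  have w': "w' \<in> W" unfolding w'_def using g g' w by (intro weyl_comp) auto
  have fix': "w' v' = v'" using g'(2) v by (simp add: w'_def v'_def pointfree_idE)
  have "pos (w' b)" if "pos b" for b
  proof -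
    have "w' b \<in> \<Phi>" using weyl_root[OF w'] that by (simp add: pos_def)
    moreover have "v' \<bullet> w' b = v' \<bullet> b" using weyl_inner[OF w', of v' b] fix' by simp
    moreover have "v' \<bullet> (- w' b) > 0" if "pos (- w' b)" using pos_inner[OF that] .
    ultimately show ?thesis using pos_or_neg[of "w' b"] pos_inner[OF that] by auto
  qed
  moreover obtain "is" where "set is \<subseteq> I" "w' = sprod is" using weyl_sprod[OF w'] by auto
  ultimately have "w' = id" using pos_preserving_id by auto
  then have "g' \<circ> w' \<circ> g = id" using g'(2) by simp
  moreover have "g' \<circ> w' \<circ> g = (g' \<circ> g) \<circ> w \<circ> (g' \<circ> g)" unfolding w'_def by (simp add: o_assoc)
  ultimately show ?thesis using g'(2) by simp
qed

text \<open>If no root were orthogonal to the fixed space, a generic fixed vector would avoid all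
  root hyperplanes, against \<open>regular_fixed_id\<close>. The generic vector is built one root at
  a time.\<close>

lemma root_orthogonal_to_fixed:
  assumes w: "w \<in> W" "w \<noteq> id"
  shows "\<exists>b\<in>\<Phi>. \<forall>u. w u = u \<longrightarrow> u \<bullet> b = 0"
proof (rule ccontr)
  assume "\<not> ?thesis"
  then have ex: "\<exists>u. w u = u \<and> u \<bullet> b \<noteq> 0" if "b \<in> \<Phi>" for b using that by auto
  have "\<exists>v. w v = v \<and> (\<forall>b\<in>B. v \<bullet> b \<noteq> 0)" if "B \<subseteq> \<Phi>" for B
    using finite_subset[OF that fin] that
  proof (induction B)
    case empty then show ?case by (auto intro!: exI[of _ 0] simp: linear_0 weyl_linear[OF w(1)])
  next
    case (insert b B)
    then obtain v where v: "w v = v" "\<forall>b\<in>B. v \<bullet> b \<noteq> 0" by auto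
    obtain u where u: "w u = u" "u \<bullet> b \<noteq> 0" using ex insert(4) by auto
    have "finite ((\<lambda>c. - (v \<bullet> c) / (u \<bullet> c)) ` insert b B)" using insert(1) by simp
    \<comment> \<open>The excluded values are those at which v + t u meets a root hyperplane. For c
      orthogonal to u the quotient is 0 by convention; there v alone is already off the
      hyperplane.\<close>
    then obtain t :: real where t: "t \<notin> (\<lambda>c. - (v \<bullet> c) / (u \<bullet> c)) ` insert b B"
      using ex_new_if_finite[OF infinite_UNIV_char_0] by blast
    have "(v + t *\<^sub>R u) \<bullet> c \<noteq> 0" if "c \<in> insert b B" for c
    proof
      assume h: "(v + t *\<^sub>R u) \<bullet> c = 0"
      show False
      proof (cases "u \<bullet> c = 0")
        case True
        then show False using h v(2) u(2) that by (auto simp: inner_add_left)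
      next
        case False
        then have "t = - (v \<bullet> c) / (u \<bullet> c)" using h by (simp add: inner_add_left field_simps)
        then show False using t that by blast
      qed
    qed
    moreover have "w (v + t *\<^sub>R u) = v + t *\<^sub>R u"
      using v u by (simp add: linear_add linear_scale weyl_linear[OF w(1)])
    ultimately show ?case by blast
  qed
  from this[OF order_refl] obtain v where "w v = v" "\<forall>b\<in>\<Phi>. v \<bullet> b \<noteq> 0" by auto
  then show False using regular_fixed_id w by blast
qed

text \<open>
  If \<open>w\<close> has order \<open>m\<close> and the root \<open>b\<close> is orthogonal to the fixed space of \<open>w\<close>, then the sum of the
  orbit of \<open>b\<close> vanishes, and \<open>w - 1\<close> sends \<open>\<Sum>k<m. k w\<^sup>k b\<close> to \<open>m b\<close>.
\<close>

lemma weyl_moves_by_root: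
  assumes w: "w \<in> W" "w \<noteq> id"
  shows "\<exists>x\<in>root_lattice \<Phi>. \<exists>b\<in>\<Phi>. \<exists>m>0. w x - x = real m *\<^sub>R b"
proof -
  obtain b where b: "b \<in> \<Phi>" "\<And>u. w u = u \<Longrightarrow> u \<bullet> b = 0" using root_orthogonal_to_fixed[OF w] by blast
  have "\<not> inj (\<lambda>k. w ^^ k)"
    using finite_weyl weyl_funpow[OF w(1)] by (meson finite_subset image_subsetI infinite_iff_countable_subset)
  then obtain i j where ij: "i < j" "w ^^ i = w ^^ j" unfolding inj_on_def by (metis nat_neq_iff)
  define m where "m = j - i"
  have m: "m > 0" using ij by (simp add: m_def)
  have lin: "linear w" by (rule weyl_linear[OF w(1)])
  have wm: "(w ^^ m) x = x" for x
  proof -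
    have j: "j = i + m" using ij by (simp add: m_def)
    have "w ^^ j = w ^^ i \<circ> w ^^ m" unfolding j by (rule funpow_add)
    then have "(w ^^ i) ((w ^^ m) x) = (w ^^ i) x" using ij by (metis comp_apply)
    then show ?thesis using weyl_bij[OF weyl_funpow[OF w(1)]] by (metis bij_pointE)
  qed
  let ?f = "\<lambda>k. (w ^^ k) b"
  define P where "P = (\<Sum>k<m. ?f k)"
  have shift: "(\<Sum>k<m. g (Suc k)) = (\<Sum>k<m. g k) - g 0 + (g m :: 'v)" for g
    using sum.lessThan_Suc_shift[of g m] by (simp add: algebra_simps)
  have "w P = (\<Sum>k<m. ?f (Suc k))" by (simp add: P_def linear_sum[OF lin])
  also have "\<dots> = P" unfolding shift[of ?f] by (simp add: P_def wm)
  finally have wP: "w P = P" .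
  \<comment> \<open>The orbit sum \<open>P\<close> is fixed by w, so it is orthogonal to
    \<open>b\<close> and, by invariance of the inner product, to the whole orbit. Being a sum over
    that orbit, it is orthogonal to itself.\<close>
  have orth: "P \<bullet> ?f k = 0" for k
  proof -
    have "(w ^^ k) P = P" by (induction k) (auto simp: wP)
    then have "P \<bullet> ?f k = (w ^^ k) P \<bullet> (w ^^ k) b" by simp
    also have "\<dots> = P \<bullet> b" by (rule weyl_inner[OF weyl_funpow[OF w(1)]])
    also have "\<dots> = 0" by (rule b(2)[OF wP])
    finally show ?thesis .
  qed
  have "P \<bullet> P = (\<Sum>k<m. P \<bullet> ?f k)" by (subst (2) P_def) (rule inner_sum_right)
  then have "P \<bullet> P = 0" by (simp add: orth)
  then have P0: "P = 0" by simp
  define x where "x = (\<Sum>k<m. real k *\<^sub>R ?f k)"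
  have "w x = (\<Sum>k<m. real k *\<^sub>R ?f (Suc k))"
    by (simp add: x_def linear_sum[OF lin] linear_scale[OF lin])
  also have "\<dots> = (\<Sum>k<m. real (Suc k) *\<^sub>R ?f (Suc k)) - (\<Sum>k<m. ?f (Suc k))"
    by (simp add: sum_subtractf[symmetric] algebra_simps)
  also have "\<dots> = x + real m *\<^sub>R b"
    unfolding shift[of "\<lambda>k. real k *\<^sub>R ?f k"] shift[of ?f] using P0 by (simp add: x_def[symmetric] P_def[symmetric] wm)
  finally have "w x - x = real m *\<^sub>R b" by simp
  moreover have "x \<in> root_lattice \<Phi>"
    unfolding x_def root_lattice_def
    by (intro group_closure_sum group_closure_of_nat)
      (use root_in_lattice weyl_root[OF weyl_funpow[OF w(1)] b(1)] in \<open>auto simp: root_lattice_def\<close>)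
  ultimately show ?thesis using b(1) m by blast
qed

text \<open>Apply the previous result to the product of the inverse of u with w, then transport by
  u. The difference has the form m b so that its logarithm becomes invertible together with the
  roots and the integers.\<close>

lemma weyl_separated:
  assumes "u \<in> W" "w \<in> W" "u \<noteq> w"
  shows "\<exists>x\<in>root_lattice \<Phi>. \<exists>b\<in>\<Phi>. \<exists>m>0. w x - u x = real m *\<^sub>R b"
proof -
  obtain v where v: "v \<in> W" "v \<circ> u = id" "u \<circ> v = id" using weyl_inverse[OF assms(1)] .
  have "v \<circ> w \<noteq> id"
  proof
    assume "v \<circ> w = id"
    then have "u \<circ> (v \<circ> w) = u" by simp
    then show False using v(3) assms(3) by (simp add: o_assoc)
  qed
  then obtain x b m where x: "x \<in> root_lattice \<Phi>" "b \<in> \<Phi>" "m > 0" "(v \<circ> w) x - x = real m *\<^sub>R b"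
    using weyl_moves_by_root[OF weyl_comp[OF v(1) assms(2)]] by blast
  have "u ((v \<circ> w) x - x) = real m *\<^sub>R u b" unfolding x(4) by (simp add: linear_scale[OF weyl_linear[OF assms(1)]])
  then have "w x - u x = real m *\<^sub>R u b"
    using v(3) by (simp add: linear_diff[OF weyl_linear[OF assms(1)]] pointfree_idE)
  then show ?thesis using x weyl_root[OF assms(1)] by blast
qed

end


section \<open>The formal affine Demazure algebra\<close>

context twisted
begin

definition emb :: "'a \<Rightarrow> 'g \<Rightarrow> 'a" where "emb c = tw c \<one>\<^bsub>G\<^esub>"
definition et :: "'g \<Rightarrow> 'g \<Rightarrow> 'a" where "et u = tw \<one> u"

sublocale T: ring T by (rule ring_T)

lemma emb_closed [simp]: "c \<in> carrier A \<Longrightarrow> emb c \<in> carrier T"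
  and et_closed [simp]: "u \<in> carrier G \<Longrightarrow> et u \<in> carrier T"
  by (simp_all add: emb_def et_def)

lemma tw_add: "\<lbrakk>c \<in> carrier A; d \<in> carrier A\<rbrakk> \<Longrightarrow> tw (c \<oplus> d) u = tw c u \<oplus>\<^bsub>T\<^esub> tw d u"
  by (auto simp: T_simps tw_val)

lemma emb_hom: "emb \<in> ring_hom A T"
  by (rule ring_hom_memI) (auto simp: emb_def tw_mult_tw act_one tw_add T_simps(2))

lemma emb_simps:
  "\<lbrakk>c \<in> carrier A; d \<in> carrier A\<rbrakk> \<Longrightarrow> emb (c \<otimes> d) = emb c \<otimes>\<^bsub>T\<^esub> emb d"
  "\<lbrakk>c \<in> carrier A; d \<in> carrier A\<rbrakk> \<Longrightarrow> emb (c \<oplus> d) = emb c \<oplus>\<^bsub>T\<^esub> emb d"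
  "emb \<one> = \<one>\<^bsub>T\<^esub>" "emb \<zero> = \<zero>\<^bsub>T\<^esub>"
  using emb_hom by (auto simp: ring_hom_mult ring_hom_add ring_hom_one)
    (metis A.ring_axioms ring_T ring_hom_zero)

lemma emb_minus: "\<lbrakk>c \<in> carrier A; d \<in> carrier A\<rbrakk> \<Longrightarrow> emb (c \<ominus> d) = emb c \<ominus>\<^bsub>T\<^esub> emb d"
proof -
  assume c: "c \<in> carrier A" and d: "d \<in> carrier A"
  have "emb (c \<ominus> d) \<oplus>\<^bsub>T\<^esub> emb d = emb (c \<ominus> d \<oplus> d)" using c d by (simp add: emb_simps)
  also have "c \<ominus> d \<oplus> d = c" using c d by (simp add: a_minus_def A.a_assoc A.l_neg)
  finally have "emb (c \<ominus> d) \<oplus>\<^bsub>T\<^esub> emb d = emb c" .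
  then show ?thesis using c d by (metis A.minus_closed T.add.inv_solve_right' a_minus_def emb_closed)
qed

lemma emb_val: "emb c u = (if u = \<one>\<^bsub>G\<^esub> then c else \<zero>)"
  by (simp add: emb_def tw_val)

lemma et_mult: "\<lbrakk>u \<in> carrier G; v \<in> carrier G\<rbrakk> \<Longrightarrow> et u \<otimes>\<^bsub>T\<^esub> et v = et (u \<otimes>\<^bsub>G\<^esub> v)"
  by (simp add: et_def tw_mult_tw)

lemma et_one: "et \<one>\<^bsub>G\<^esub> = \<one>\<^bsub>T\<^esub>" by (simp add: et_def T_simps)

lemma et_emb: "\<lbrakk>u \<in> carrier G; c \<in> carrier A\<rbrakk> \<Longrightarrow> et u \<otimes>\<^bsub>T\<^esub> emb c = emb (act u c) \<otimes>\<^bsub>T\<^esub> et u"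
  by (simp add: et_def emb_def tw_mult_tw)

lemma emb_mult_val:
  assumes "c \<in> carrier A" "f \<in> carrier T" shows "(emb c \<otimes>\<^bsub>T\<^esub> f) u = c \<otimes> f u"
proof (cases "u \<in> carrier G")
  case True
  then show ?thesis using assms T_val[OF assms(2)] by (simp add: emb_def tw_mult_eq act_one)
qed (use assms in \<open>simp add: mult_off T_off\<close>)

lemma mult_emb_val:
  assumes c: "c \<in> carrier A" and f: "f \<in> carrier T" and u: "u \<in> carrier G"
  shows "(f \<otimes>\<^bsub>T\<^esub> emb c) u = f u \<otimes> act u c"
  using f
proof (induction f rule: T_induct)
  case zero
  have "\<zero>\<^bsub>T\<^esub> \<otimes>\<^bsub>T\<^esub> emb c = \<zero>\<^bsub>T\<^esub>" using c by simp
  then show ?case using c u by (simp add: T_simps)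
next
  case (add d v f)
  have e: "(tw d v \<oplus>\<^bsub>T\<^esub> f) \<otimes>\<^bsub>T\<^esub> emb c = tw d v \<otimes>\<^bsub>T\<^esub> emb c \<oplus>\<^bsub>T\<^esub> f \<otimes>\<^bsub>T\<^esub> emb c"
    using add c by (intro l_distr_T) auto
  have 1: "(tw d v \<otimes>\<^bsub>T\<^esub> emb c) u = tw d v u \<otimes> act u c"
    using add c u unfolding emb_def by (simp add: tw_mult_tw) (simp add: tw_val)
  have "((tw d v \<oplus>\<^bsub>T\<^esub> f) \<otimes>\<^bsub>T\<^esub> emb c) u = tw d v u \<otimes> act u c \<oplus> f u \<otimes> act u c"
    unfolding e 1[symmetric] add(4)[symmetric] by (rule fun_cong[OF T_simps(3)])
  also have "\<dots> = (tw d v u \<oplus> f u) \<otimes> act u c"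
    by (rule A.l_distr[symmetric]) (use add c u T_val[OF add(3)] in \<open>auto simp: tw_val\<close>)
  also have "\<dots> = (tw d v \<oplus>\<^bsub>T\<^esub> f) u \<otimes> act u c" by (simp only: T_simps(3))
  finally show ?case .
qed

end

section \<open>The Weyl group acting on S and its logarithms\<close>

locale demazure = roots \<Phi> n \<alpha> for \<Phi> :: "'v::euclidean_space set" and n \<alpha> +
  fixes F :: "nat \<Rightarrow> nat \<Rightarrow> 'r::comm_ring_1" and \<theta> :: 'v
  assumes fgl: "formal_group_law F" and rat: "contains_rat TYPE('r)" and \<theta>: "\<theta> \<in> \<Phi>"
    and x_regular: "\<And>\<beta>. \<beta> \<in> \<Phi> \<Longrightarrow> regular_elt (S_ring F \<Phi>) (S_var F \<Phi> \<beta>)"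
begin

abbreviation "\<Lambda> \<equiv> root_lattice \<Phi>"
abbreviation "SR \<equiv> S_ring F \<Phi>"
abbreviation "QR \<equiv> Q_ring F \<Phi>"
abbreviation "WA \<equiv> affine_weyl_group \<Phi>"
abbreviation "TR \<equiv> Q_Wa F \<Phi>"
abbreviation "xx \<equiv> S_var F \<Phi>"

lemma fga: "formal_group_algebra F \<Lambda>"
proof
  show "formal_group_law F" by (rule fgl)
  show "contains_rat TYPE('r)" by (rule rat)
qed (auto simp: root_lattice_def intro: group_closure.diff)

interpretation fga: formal_group_algebra F \<Lambda>
  rewrites "fga F \<Lambda> = SR" and "fga_var F \<Lambda> = xx"
  by (simp_all add: fga S_ring_def S_var_def)

definition lg :: "'v \<Rightarrow> ('v, 'r) mps set" where "lg = formal_group_algebra.ell F \<Lambda>"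

sublocale S: cring SR by (rule fga.S_cring)

lemma weyl_latt_aut:
  assumes "w \<in> W" shows "fga.latt_aut w"
proof -
  obtain v where v: "v \<in> W" "v \<circ> w = id" "w \<circ> v = id" using weyl_inverse[OF assms] .
  have "w ` \<Lambda> = \<Lambda>"
  proof (intro equalityI subsetI)
    fix l assume "l \<in> \<Lambda>"
    then have "v l \<in> \<Lambda>" "l = w (v l)" using weyl_root_lattice[OF v(1)] v(3) by (simp_all add: pointfree_idE)
    then show "l \<in> w ` \<Lambda>" by blast
  qed (use weyl_root_lattice[OF assms] in blast)
  then show ?thesis
    using weyl_bij[OF assms] weyl_linear[OF assms] by (simp add: fga.latt_aut_def linear_0 linear_add)
qed

lemma xx_closed: "v \<in> \<Lambda> \<Longrightarrow> xx v \<in> carrier SR"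
  using fga.fga_var_cls[of v] by (simp add: fga.good_var)

lemma s_hom: "w \<in> W \<Longrightarrow> fga_act w \<in> ring_hom SR SR"
  using fga.fga_act_hom[OF weyl_latt_aut] .

lemma s_simps:
  assumes "w \<in> W"
  shows "a \<in> carrier SR \<Longrightarrow> fga_act w a \<in> carrier SR"
    "\<lbrakk>a \<in> carrier SR; b \<in> carrier SR\<rbrakk> \<Longrightarrow> fga_act w (a \<otimes>\<^bsub>SR\<^esub> b) = fga_act w a \<otimes>\<^bsub>SR\<^esub> fga_act w b"
    "\<lbrakk>a \<in> carrier SR; b \<in> carrier SR\<rbrakk> \<Longrightarrow> fga_act w (a \<oplus>\<^bsub>SR\<^esub> b) = fga_act w a \<oplus>\<^bsub>SR\<^esub> fga_act w b"
    "fga_act w \<one>\<^bsub>SR\<^esub> = \<one>\<^bsub>SR\<^esub>" "fga_act w \<zero>\<^bsub>SR\<^esub> = \<zero>\<^bsub>SR\<^esub>"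
  using s_hom[OF assms] ring_hom_zero[OF s_hom[OF assms] S.ring_axioms S.ring_axioms]
  by (auto simp: ring_hom_closed ring_hom_mult ring_hom_add ring_hom_one)

lemma s_minus: "\<lbrakk>w \<in> W; a \<in> carrier SR; b \<in> carrier SR\<rbrakk> \<Longrightarrow> fga_act w (a \<ominus>\<^bsub>SR\<^esub> b) = fga_act w a \<ominus>\<^bsub>SR\<^esub> fga_act w b"
proof -
  assume w: "w \<in> W" and a: "a \<in> carrier SR" and b: "b \<in> carrier SR"
  have "fga_act w (a \<ominus>\<^bsub>SR\<^esub> b) \<oplus>\<^bsub>SR\<^esub> fga_act w b = fga_act w (a \<ominus>\<^bsub>SR\<^esub> b \<oplus>\<^bsub>SR\<^esub> b)"
    using a b w by (simp add: s_simps)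
  also have "a \<ominus>\<^bsub>SR\<^esub> b \<oplus>\<^bsub>SR\<^esub> b = a" using a b by (simp add: a_minus_def S.a_assoc S.l_neg)
  finally show ?thesis using a b w
    by (metis S.add.inv_solve_right' S.minus_closed a_minus_def s_simps(1))
qed

lemma s_id: "fga_act id a = (a :: ('v, 'r) mps set)" by (rule fga.fga_act_id)

lemma s_comp: "\<lbrakk>u \<in> W; w \<in> W\<rbrakk> \<Longrightarrow> fga_act (u \<circ> w) a = fga_act u (fga_act w (a :: ('v, 'r) mps set))"
  by (rule fga.fga_act_comp) (auto intro: weyl_bij)

lemma s_var: "\<lbrakk>w \<in> W; v \<in> \<Lambda>\<rbrakk> \<Longrightarrow> fga_act w (xx v) = xx (w v)"
  using fga.fga_act_var[OF weyl_latt_aut] fga.fga_var_cls by simp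

lemma s_lg: "\<lbrakk>w \<in> W; v \<in> \<Lambda>\<rbrakk> \<Longrightarrow> fga_act w (lg v) = lg (w v)"
  unfolding lg_def by (rule fga.fga_act_ell[OF weyl_latt_aut])

lemma lg_closed: "v \<in> \<Lambda> \<Longrightarrow> lg v \<in> carrier SR"
  unfolding lg_def by (rule fga.ell_closed)

lemma lg_add: "\<lbrakk>u \<in> \<Lambda>; v \<in> \<Lambda>\<rbrakk> \<Longrightarrow> lg (u + v) = lg u \<oplus>\<^bsub>SR\<^esub> lg v"
  unfolding lg_def by (rule fga.ell_add)

lemma lg_0: "lg 0 = \<zero>\<^bsub>SR\<^esub>"
  unfolding lg_def by (rule fga.ell_0)

lemma lg_unit: "v \<in> \<Lambda> \<Longrightarrow> \<exists>u\<in>carrier SR. \<exists>u'\<in>carrier SR. u \<otimes>\<^bsub>SR\<^esub> u' = \<one>\<^bsub>SR\<^esub> \<and> lg v = xx v \<otimes>\<^bsub>SR\<^esub> u"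
  unfolding lg_def using fga.ell_unit fga.fga_var_cls by simp

lemma lattice_zero: "0 \<in> \<Lambda>" and lattice_diff: "\<lbrakk>u \<in> \<Lambda>; v \<in> \<Lambda>\<rbrakk> \<Longrightarrow> u - v \<in> \<Lambda>"
  using fga.L_0 fga.L_diff by auto

lemma lg_diff: "\<lbrakk>u \<in> \<Lambda>; v \<in> \<Lambda>\<rbrakk> \<Longrightarrow> lg (u - v) = lg u \<ominus>\<^bsub>SR\<^esub> lg v"
  using lg_add[of "u - v" v] lattice_diff[of u v] lg_closed
  by (metis S.add.inv_solve_right' a_minus_def diff_add_cancel)

lemma divided_difference:
  assumes "\<beta> \<in> \<Phi>" "a \<in> carrier SR"
  shows "\<exists>c\<in>carrier SR. a \<ominus>\<^bsub>SR\<^esub> fga_act (reflection \<beta>) a = xx \<beta> \<otimes>\<^bsub>SR\<^esub> c"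
  using fga.divided_difference[OF root_in_lattice[OF assms(1)] weyl_latt_aut[OF weyl_reflection[OF assms(1)]]
      reflection_lattice[OF assms(1)] assms(2)] fga.fga_var_cls by simp

lemma nat_inverse:
  assumes "k > 0" shows "\<exists>c\<in>carrier SR. add_pow SR (k::nat) c = \<one>\<^bsub>SR\<^esub> \<and> (\<forall>w\<in>W. fga_act w c = c)"
  using fga.fga_nat_inverse[OF assms] weyl_latt_aut by blast


subsection \<open>Fractions\<close>

abbreviation "M \<equiv> root_denoms F \<Phi>"

lemma loc: "localized_ring SR M"
  unfolding root_denoms_def
  by (rule mult_closure_localized) (use S.cring_axioms xx_closed root_in_lattice in auto)

sublocale loc: localized_ring SR M
  rewrites "localization SR M = QR" and "fraction SR M = Q_frac F \<Phi>"
  by (simp_all add: loc Q_ring_def Q_frac_def)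

sublocale Q: cring QR by (rule loc.cring_L)

lemma M_regular: "s \<in> M \<Longrightarrow> regular_elt SR s"
  unfolding root_denoms_def by (erule S.mult_closure_regular[rotated]) (use x_regular in auto)

lemma M_act: assumes w: "w \<in> W" and s: "s \<in> M" shows "fga_act w s \<in> M"
  using s unfolding root_denoms_def
proof induction
  case one then show ?case using s_simps(4)[OF w] mult_closure.one by metis
next
  case (mult h s)
  have c: "h \<in> carrier SR" "s \<in> carrier SR" using mult(1,2) xx_closed root_in_lattice loc.M_in
    by (auto simp: root_denoms_def)
  have "fga_act w h \<in> xx ` \<Phi>" using mult(1) s_var[OF w] root_in_lattice weyl_root[OF w] by auto
  then show ?case using s_simps(2)[OF w c] mult(3) mult_closure.mult by metis
qed

abbreviation "fr \<equiv> Q_frac F \<Phi>"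
abbreviation "q a \<equiv> fr a \<one>\<^bsub>SR\<^esub>"

text \<open>A fraction is an equivalence class and the action takes its image. The image is a whole
  class again, because the inverse Weyl group element maps back.\<close>

lemma Q_act_fr:
  assumes w: "w \<in> W" and a: "a \<in> carrier SR" "s \<in> M"
  shows "Q_act (l, w) (fr a s) = fr (fga_act w a) (fga_act w s)"
proof -
  obtain v where v: "v \<in> W" "v \<circ> w = id" "w \<circ> v = id" using weyl_inverse[OF w] .
  have rel: "((fga_act u a, fga_act u s), (fga_act u b, fga_act u t)) \<in> frac_rel SR M"
    if u: "u \<in> W" and h: "((a, s), (b, t)) \<in> frac_rel SR M" for u a s b t
  proof -
    obtain k where k: "k \<in> M" "k \<otimes>\<^bsub>SR\<^esub> (a \<otimes>\<^bsub>SR\<^esub> t) = k \<otimes>\<^bsub>SR\<^esub> (b \<otimes>\<^bsub>SR\<^esub> s)"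
      and c: "a \<in> carrier SR" "b \<in> carrier SR" "s \<in> M" "t \<in> M" using h unfolding loc.frac_rel_iff by blast
    have "fga_act u k \<otimes>\<^bsub>SR\<^esub> (fga_act u a \<otimes>\<^bsub>SR\<^esub> fga_act u t) = fga_act u k \<otimes>\<^bsub>SR\<^esub> (fga_act u b \<otimes>\<^bsub>SR\<^esub> fga_act u s)"
      using arg_cong[OF k(2), of "fga_act u"] k(1) c by (simp add: s_simps[OF u])
    then show ?thesis unfolding loc.frac_rel_iff using M_act[OF u] k(1) c s_simps(1)[OF u] by blast
  qed
  have inv: "fga_act w (fga_act v b) = (b :: ('v, 'r) mps set)" for b
    using s_comp[OF w v(1), of b] v(3) by (simp add: s_id)
  show ?thesis
  proof (intro equalityI subsetI)
    fix p assume "p \<in> Q_act (l, w) (fr a s)"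
    then obtain b t where "((a, s), (b, t)) \<in> frac_rel SR M" "p = (fga_act w b, fga_act w t)"
      by (auto simp: Q_act_def Q_frac_def fraction_def)
    then show "p \<in> fr (fga_act w a) (fga_act w s)"
      using rel[OF w] by (auto simp: Q_frac_def fraction_def)
  next
    fix p assume "p \<in> fr (fga_act w a) (fga_act w s)"
    then obtain b t where p: "p = (b, t)" "((fga_act w a, fga_act w s), (b, t)) \<in> frac_rel SR M"
      by (cases p) (auto simp: Q_frac_def fraction_def)
    have inv': "fga_act v (fga_act w b) = (b :: ('v, 'r) mps set)" for b
      using s_comp[OF v(1) w, of b] v(2) by (simp add: s_id)
    have "((a, s), (fga_act v b, fga_act v t)) \<in> frac_rel SR M" using rel[OF v(1) p(2)] by (simp add: inv')
    moreover have "p = map_prod (fga_act w) (fga_act w) (fga_act v b, fga_act v t)" by (simp add: p inv)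
    ultimately show "p \<in> Q_act (l, w) (fr a s)"
      unfolding Q_act_def Q_frac_def fraction_def by (simp del: map_prod_simp)
  qed
qed

section \<open>The twisted group ring of the affine Weyl group\<close>

lemma WA_carrier: "(l, w) \<in> carrier WA \<longleftrightarrow> l \<in> coroot_lattice \<Phi> \<and> w \<in> W"
  and WA_mult: "(l, w) \<otimes>\<^bsub>WA\<^esub> (l', w') = (l + w l', w \<circ> w')" and WA_one: "\<one>\<^bsub>WA\<^esub> = (0, id)"
  by (simp_all add: affine_weyl_group_def)

lemma tw: "twisted QR WA Q_act"
proof -
  interpret G: group WA by (rule affine_group)
  show ?thesis
  proof
    fix u assume "u \<in> carrier WA"
    then obtain l w where u: "u = (l, w)" "w \<in> W" by (auto simp: affine_weyl_group_def)
    show "Q_act u \<in> ring_hom QR QR"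
    proof (rule ring_hom_memI)
      show "Q_act u \<one>\<^bsub>QR\<^esub> = \<one>\<^bsub>QR\<^esub>"
        using u by (simp add: loc.L_one Q_act_fr loc.M_one s_simps)
      fix a b assume "a \<in> carrier QR" "b \<in> carrier QR"
      then show "Q_act u a \<in> carrier QR" "Q_act u (a \<otimes>\<^bsub>QR\<^esub> b) = Q_act u a \<otimes>\<^bsub>QR\<^esub> Q_act u b"
         "Q_act u (a \<oplus>\<^bsub>QR\<^esub> b) = Q_act u a \<oplus>\<^bsub>QR\<^esub> Q_act u b"
        using u by (elim loc.L_cases; simp add: Q_act_fr s_simps M_act loc.M_mult)+
    qed
  next
    fix a assume "a \<in> carrier QR"
    then show "Q_act \<one>\<^bsub>WA\<^esub> a = a" by (elim loc.L_cases) (simp add: WA_one Q_act_fr s_id)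
  next
    fix u v a assume "u \<in> carrier WA" "v \<in> carrier WA" "a \<in> carrier QR"
    moreover from this obtain l w l' w' where "u = (l, w)" "w \<in> W" "v = (l', w')" "w' \<in> W"
      by (auto simp: affine_weyl_group_def)
    ultimately show "Q_act (u \<otimes>\<^bsub>WA\<^esub> v) a = Q_act u (Q_act v a)"
      by (elim loc.L_cases) (simp add: WA_mult Q_act_fr s_comp weyl_comp s_simps M_act)
  qed
qed

sublocale tw: twisted QR WA Q_act
  rewrites "twisted_group_ring QR WA Q_act = TR"
  by (simp_all add: tw Q_Wa_def)

abbreviation "Qe \<equiv> tw.emb"
abbreviation "\<eta> w \<equiv> tw.et (0, w)"
abbreviation "Se s \<equiv> Qe (q s)"

lemma zero_coroot: "0 \<in> coroot_lattice \<Phi>" by (simp add: coroot_lattice_def)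

lemma w_carrier [simp]: "w \<in> W \<Longrightarrow> (0, w) \<in> carrier WA" by (simp add: WA_carrier zero_coroot)

lemma one_M [simp]: "\<one>\<^bsub>SR\<^esub> \<in> M" by (rule loc.M_one)

lemma q_closed [simp]: "a \<in> carrier SR \<Longrightarrow> q a \<in> carrier QR" by simp

lemma q_simps:
  "\<lbrakk>a \<in> carrier SR; b \<in> carrier SR\<rbrakk> \<Longrightarrow> q (a \<otimes>\<^bsub>SR\<^esub> b) = q a \<otimes>\<^bsub>QR\<^esub> q b"
  "\<lbrakk>a \<in> carrier SR; b \<in> carrier SR\<rbrakk> \<Longrightarrow> q (a \<oplus>\<^bsub>SR\<^esub> b) = q a \<oplus>\<^bsub>QR\<^esub> q b"
  "q \<one>\<^bsub>SR\<^esub> = \<one>\<^bsub>QR\<^esub>" "q \<zero>\<^bsub>SR\<^esub> = \<zero>\<^bsub>QR\<^esub>"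
  by (simp_all add: loc.L_one loc.L_zero)

lemma q_minus: "\<lbrakk>a \<in> carrier SR; b \<in> carrier SR\<rbrakk> \<Longrightarrow> q (a \<ominus>\<^bsub>SR\<^esub> b) = q a \<ominus>\<^bsub>QR\<^esub> q b"
proof -
  assume a: "a \<in> carrier SR" and b: "b \<in> carrier SR"
  have "q (a \<ominus>\<^bsub>SR\<^esub> b) \<oplus>\<^bsub>QR\<^esub> q b = q (a \<ominus>\<^bsub>SR\<^esub> b \<oplus>\<^bsub>SR\<^esub> b)"
    using a b by (simp only: q_simps S.minus_closed)
  also have "a \<ominus>\<^bsub>SR\<^esub> b \<oplus>\<^bsub>SR\<^esub> b = a" using a b by (simp add: a_minus_def S.a_assoc S.l_neg)
  finally show ?thesis using a b
    by (metis Q.add.inv_solve_right' S.minus_closed a_minus_def q_closed)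
qed

lemma q_inj: "\<lbrakk>a \<in> carrier SR; b \<in> carrier SR\<rbrakk> \<Longrightarrow> q a = q b \<longleftrightarrow> a = b"
  by (rule loc.fr_inj[OF M_regular])

lemma Q_act_q: "\<lbrakk>w \<in> W; a \<in> carrier SR\<rbrakk> \<Longrightarrow> Q_act (l, w) (q a) = q (fga_act w a)"
  by (simp add: Q_act_fr s_simps)

lemma Se_closed [simp]: "s \<in> carrier SR \<Longrightarrow> Se s \<in> carrier TR" by simp

lemma Se_simps:
  "\<lbrakk>a \<in> carrier SR; b \<in> carrier SR\<rbrakk> \<Longrightarrow> Se (a \<otimes>\<^bsub>SR\<^esub> b) = Se a \<otimes>\<^bsub>TR\<^esub> Se b"
  "\<lbrakk>a \<in> carrier SR; b \<in> carrier SR\<rbrakk> \<Longrightarrow> Se (a \<oplus>\<^bsub>SR\<^esub> b) = Se a \<oplus>\<^bsub>TR\<^esub> Se b"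
  "Se \<one>\<^bsub>SR\<^esub> = \<one>\<^bsub>TR\<^esub>" "Se \<zero>\<^bsub>SR\<^esub> = \<zero>\<^bsub>TR\<^esub>"
  by (simp_all only: q_simps tw.emb_simps q_closed)

lemma Se_inj: "\<lbrakk>a \<in> carrier SR; b \<in> carrier SR\<rbrakk> \<Longrightarrow> Se a = Se b \<longleftrightarrow> a = b"
  using q_inj[of a b] tw.emb_val[of "q a" "\<one>\<^bsub>WA\<^esub>"] tw.emb_val[of "q b" "\<one>\<^bsub>WA\<^esub>"] by metis

lemma S_emb_eq: "S_emb F \<Phi> = Se"
  by (simp add: fun_eq_iff S_emb_def Q_emb_def tw.emb_def)

definition x_inv :: "'v \<Rightarrow> ('v, 'r) mps set frac" where
  "x_inv b = fr \<one>\<^bsub>SR\<^esub> (xx b)"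

lemma xx_M: "b \<in> \<Phi> \<Longrightarrow> xx b \<in> M"
  using mult_closure.mult[OF _ mult_closure.one, of "xx b" "xx ` \<Phi>" SR] xx_closed[OF root_in_lattice, of b]
  by (simp add: root_denoms_def)

lemma x_inv: "b \<in> \<Phi> \<Longrightarrow> x_inv b \<in> carrier QR" "b \<in> \<Phi> \<Longrightarrow> x_inv b \<otimes>\<^bsub>QR\<^esub> q (xx b) = \<one>\<^bsub>QR\<^esub>"
  unfolding x_inv_def using xx_M loc.fr_inverse by auto

lemma lg_mult:
  assumes "v \<in> \<Lambda>" shows "real k *\<^sub>R v \<in> \<Lambda>" "lg (real k *\<^sub>R v) = add_pow SR k (lg v)"
proof -
  show L: "real k *\<^sub>R v \<in> \<Lambda>" for k using assms unfolding root_lattice_def by (rule group_closure_of_nat)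
  show "lg (real k *\<^sub>R v) = add_pow SR k (lg v)"
    by (induction k) (use assms in \<open>simp_all add: lg_0 scaleR_add_left lg_add L S.a_comm lg_closed\<close>)
qed

text \<open>\<open>lg b\<close> is a unit times \<open>xx b\<close>, and the integer
  \<open>m\<close> is invertible in the base ring.\<close>

lemma lg_multiple_invertible:
  assumes "b \<in> \<Phi>" "m > 0"
  shows "\<exists>c\<in>carrier QR. c \<otimes>\<^bsub>QR\<^esub> q (lg (real m *\<^sub>R b)) = \<one>\<^bsub>QR\<^esub>"
proof -
  have b: "b \<in> \<Lambda>" using assms root_in_lattice by simp
  obtain u u' where u: "u \<in> carrier SR" "u' \<in> carrier SR" "u \<otimes>\<^bsub>SR\<^esub> u' = \<one>\<^bsub>SR\<^esub>" "lg b = xx b \<otimes>\<^bsub>SR\<^esub> u"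
    using lg_unit[OF b] by blast
  obtain d where d: "d \<in> carrier SR" "add_pow SR m d = \<one>\<^bsub>SR\<^esub>" using nat_inverse[OF assms(2)] by blast
  have "u' \<otimes>\<^bsub>SR\<^esub> lg b = (u \<otimes>\<^bsub>SR\<^esub> u') \<otimes>\<^bsub>SR\<^esub> xx b"
    unfolding u(4) using u(1,2) xx_closed[OF b] by (simp add: S.m_ac)
  then have ub: "u' \<otimes>\<^bsub>SR\<^esub> lg b = xx b" using u(3) xx_closed[OF b] by simp
  have "(u' \<otimes>\<^bsub>SR\<^esub> d) \<otimes>\<^bsub>SR\<^esub> lg (real m *\<^sub>R b) = add_pow SR m (d \<otimes>\<^bsub>SR\<^esub> (u' \<otimes>\<^bsub>SR\<^esub> lg b))"
    using u(2) d(1) lg_closed[OF b] by (simp add: lg_mult(2)[OF b] S.add_pow_rdistr S.m_ac)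
  also have "\<dots> = add_pow SR m d \<otimes>\<^bsub>SR\<^esub> xx b"
    unfolding ub using d(1) xx_closed[OF b] by (simp add: S.add_pow_ldistr)
  also have "\<dots> = xx b" using d xx_closed[OF b] by simp
  finally have e: "(u' \<otimes>\<^bsub>SR\<^esub> d) \<otimes>\<^bsub>SR\<^esub> lg (real m *\<^sub>R b) = xx b" .
  have "x_inv b \<otimes>\<^bsub>QR\<^esub> q (u' \<otimes>\<^bsub>SR\<^esub> d) \<otimes>\<^bsub>QR\<^esub> q (lg (real m *\<^sub>R b)) = x_inv b \<otimes>\<^bsub>QR\<^esub> q (xx b)"
    using u d x_inv(1)[OF assms(1)] lg_closed[OF lg_mult(1)[OF b]]
    by (simp only: e[symmetric] q_simps Q.m_assoc q_closed S.m_closed Q.m_closed)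
  then show ?thesis using x_inv[OF assms(1)] u d by (intro bexI[of _ "x_inv b \<otimes>\<^bsub>QR\<^esub> q (u' \<otimes>\<^bsub>SR\<^esub> d)"]) auto
qed

text \<open>These invertible differences serve twice: to eliminate components of an operator in
  \<open>kills_small_support\<close>, and to confine central elements to translations in
  \<open>centre_iff\<close>.\<close>

lemma separating:
  assumes "u \<in> W" "w \<in> W" "u \<noteq> w"
  shows "\<exists>v\<in>\<Lambda>. \<exists>c\<in>carrier QR. c \<otimes>\<^bsub>QR\<^esub> (q (lg (w v)) \<ominus>\<^bsub>QR\<^esub> q (lg (u v))) = \<one>\<^bsub>QR\<^esub>"
proof -
  obtain v b m where v: "v \<in> \<Lambda>" "b \<in> \<Phi>" "m > 0" "w v - u v = real m *\<^sub>R b"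
    using weyl_separated[OF assms] by blast
  obtain c where c: "c \<in> carrier QR" "c \<otimes>\<^bsub>QR\<^esub> q (lg (real m *\<^sub>R b)) = \<one>\<^bsub>QR\<^esub>"
    using lg_multiple_invertible[OF v(2,3)] by blast
  have L: "w v \<in> \<Lambda>" "u v \<in> \<Lambda>" using weyl_root_lattice assms v by auto
  have "q (lg (w v)) \<ominus>\<^bsub>QR\<^esub> q (lg (u v)) = q (lg (real m *\<^sub>R b))"
    using L by (simp only: v(4)[symmetric] lg_diff q_minus lg_closed)
  then have "c \<otimes>\<^bsub>QR\<^esub> (q (lg (w v)) \<ominus>\<^bsub>QR\<^esub> q (lg (u v))) = \<one>\<^bsub>QR\<^esub>" using c(2) by simp
  then show ?thesis using v(1) c(1) by blast
qed


subsection \<open>The projection to the translation part\<close>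

abbreviation tadd (infixl "+t" 65) where "x +t y \<equiv> x \<oplus>\<^bsub>TR\<^esub> y"
abbreviation tmul (infixl "*t" 70) where "x *t y \<equiv> x \<otimes>\<^bsub>TR\<^esub> y"
abbreviation tsub (infixl "-t" 65) where "x -t y \<equiv> x \<ominus>\<^bsub>TR\<^esub> y"
abbreviation "tel \<equiv> tw_elem QR"
abbreviation "CT \<equiv> carrier TR"

text \<open>The map P of the overview.\<close>

definition pp :: "('v, 'r) qwa \<Rightarrow> ('v, 'r) qwa" where "pp x = imath F \<Phi> (pr F \<Phi> x)"

lemma pp_val: "pp x (l, w) = (if w = id then (\<Oplus>\<^bsub>QR\<^esub>w'\<in>W. x (l, w')) else \<zero>\<^bsub>QR\<^esub>)"
  by (simp add: pp_def imath_def pr_def)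

lemma TR_induct [consumes 1, case_names zero add]:
  assumes "x \<in> CT" "P \<zero>\<^bsub>TR\<^esub>"
    "\<And>c l w x. \<lbrakk>c \<in> carrier QR; l \<in> coroot_lattice \<Phi>; w \<in> W; x \<in> CT; P x\<rbrakk> \<Longrightarrow> P (tel c (l, w) +t x)"
  shows "P x"
  using assms(1)
proof (induction rule: tw.T_induct)
  case (add c u f)
  obtain l w where u: "u = (l, w)" by (cases u)
  have "l \<in> coroot_lattice \<Phi>" "w \<in> W" using add(2) unfolding u WA_carrier by auto
  then show ?case unfolding u using add assms(3) by blast
qed (rule assms(2))

lemma tel_closed [simp]: "\<lbrakk>c \<in> carrier QR; l \<in> coroot_lattice \<Phi>; w \<in> W\<rbrakk> \<Longrightarrow> tel c (l, w) \<in> CT"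
  by (simp add: WA_carrier)

lemma Q_act_id: "d \<in> carrier QR \<Longrightarrow> Q_act (l, id) d = d"
  by (elim loc.L_cases) (simp add: Q_act_fr s_id)

lemma Q_act_closed [simp]: "w \<in> W \<Longrightarrow> d \<in> carrier QR \<Longrightarrow> Q_act (l, w) d \<in> carrier QR"
  by (elim loc.L_cases) (simp add: Q_act_fr s_simps M_act)

lemma Q_act_one [simp]: "w \<in> W \<Longrightarrow> Q_act (l, w) \<one>\<^bsub>QR\<^esub> = \<one>\<^bsub>QR\<^esub>"
  by (simp add: loc.L_one Q_act_fr s_simps)

lemma tel_mult:
  assumes "c \<in> carrier QR" "l \<in> coroot_lattice \<Phi>" "w \<in> W" "c' \<in> carrier QR" "l' \<in> coroot_lattice \<Phi>" "w' \<in> W"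
  shows "tel c (l, w) *t tel c' (l', w') = tel (c \<otimes>\<^bsub>QR\<^esub> Q_act (l, w) c') (l + w l', w \<circ> w')"
  using assms by (simp add: tw.tw_mult_tw WA_carrier WA_mult)

lemma coroot_add: "\<lbrakk>l \<in> coroot_lattice \<Phi>; l' \<in> coroot_lattice \<Phi>\<rbrakk> \<Longrightarrow> l + l' \<in> coroot_lattice \<Phi>"
  unfolding coroot_lattice_def by (rule group_closure_add)

lemma eta_tel: "\<eta> w = tel \<one>\<^bsub>QR\<^esub> (0, w)" by (simp add: tw.et_def)

lemma eta_closed [simp]: "w \<in> W \<Longrightarrow> \<eta> w \<in> CT" by simp

lemma eta_mult: "u \<in> W \<Longrightarrow> w \<in> W \<Longrightarrow> \<eta> u *t \<eta> w = \<eta> (u \<circ> w)"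
  by (simp add: tw.et_mult WA_mult linear_0[OF weyl_linear])

lemma eta_id: "\<eta> id = \<one>\<^bsub>TR\<^esub>"
  using tw.et_one by (simp only: WA_one)

lemma Qe_tel: "c \<in> carrier QR \<Longrightarrow> d \<in> carrier QR \<Longrightarrow> l \<in> coroot_lattice \<Phi> \<Longrightarrow> w \<in> W \<Longrightarrow>
    Qe c *t tel d (l, w) = tel (c \<otimes>\<^bsub>QR\<^esub> d) (l, w)"
  unfolding tw.emb_def WA_one
  by (subst tel_mult) (simp_all add: zero_coroot Q_act_id)

lemma tel_split: "c \<in> carrier QR \<Longrightarrow> l \<in> coroot_lattice \<Phi> \<Longrightarrow> w \<in> W \<Longrightarrow> tel c (l, w) = tel c (l, id) *t \<eta> w"
  unfolding eta_tel by (subst tel_mult) (simp_all add: zero_coroot)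

lemma pp_zero: "pp \<zero>\<^bsub>TR\<^esub> = \<zero>\<^bsub>TR\<^esub>"
  by (auto simp: fun_eq_iff pp_val tw.T_simps)

lemma pp_add: "x \<in> CT \<Longrightarrow> y \<in> CT \<Longrightarrow> pp (x +t y) = pp x +t pp y"
proof -
  assume x: "x \<in> CT" and y: "y \<in> CT"
  have "(\<Oplus>\<^bsub>QR\<^esub>w\<in>W. x (l, w) \<oplus>\<^bsub>QR\<^esub> y (l, w)) = (\<Oplus>\<^bsub>QR\<^esub>w\<in>W. x (l, w)) \<oplus>\<^bsub>QR\<^esub> (\<Oplus>\<^bsub>QR\<^esub>w\<in>W. y (l, w))" for l
    by (rule Q.finsum_addf) (use tw.T_val[OF x] tw.T_val[OF y] in auto)
  then show ?thesis by (auto simp: fun_eq_iff pp_val tw.T_simps)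
qed

lemma pp_tel:
  assumes c: "c \<in> carrier QR" and w: "w \<in> W" shows "pp (tel c (l, w)) = tel c (l, id)"
proof (rule ext, clarify)
  fix m u
  have "(\<Oplus>\<^bsub>QR\<^esub>w'\<in>W. tel c (l, w) (m, w')) = (\<Oplus>\<^bsub>QR\<^esub>w'\<in>W. if w = w' then (if m = l then c else \<zero>\<^bsub>QR\<^esub>) else \<zero>\<^bsub>QR\<^esub>)"
    by (rule Q.finsum_cong') (use c in \<open>auto simp: tw.tw_val\<close>)
  also have "\<dots> = (if m = l then c else \<zero>\<^bsub>QR\<^esub>)"
    by (rule Q.add.finprod_singleton) (use w finite_weyl c in auto)
  finally show "pp (tel c (l, w)) (m, u) = tel c (l, id) (m, u)"
    by (auto simp: pp_val tw.tw_val)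
qed

lemma pp_closed [simp]: "x \<in> CT \<Longrightarrow> pp x \<in> CT"
  by (induction rule: TR_induct) (simp_all add: pp_zero pp_add pp_tel)

lemma pp_minus: "x \<in> CT \<Longrightarrow> y \<in> CT \<Longrightarrow> pp (x -t y) = pp x -t pp y"
proof -
  assume x: "x \<in> CT" and y: "y \<in> CT"
  have "pp (x -t y) +t pp y = pp (x -t y +t y)" using x y by (simp add: pp_add)
  also have "x -t y +t y = x" using x y by (simp add: a_minus_def tw.T.a_assoc tw.T.l_neg)
  finally show ?thesis using x y
    by (metis tw.T.add.inv_solve_right' tw.T.minus_closed a_minus_def pp_closed)
qed

lemma pp_Qe: "x \<in> CT \<Longrightarrow> c \<in> carrier QR \<Longrightarrow> pp (Qe c *t x) = Qe c *t pp x"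
proof (induction rule: TR_induct)
  case (add d l w x)
  then show ?case by (simp add: tw.T.r_distr pp_add pp_tel Qe_tel)
qed (simp_all add: pp_zero)

lemma pp_pp: "x \<in> CT \<Longrightarrow> pp (pp x) = pp x"
  by (induction rule: TR_induct) (simp_all add: pp_zero pp_add pp_tel)

lemma pp_Qe0: "c \<in> carrier QR \<Longrightarrow> pp (Qe c) = Qe c"
  unfolding tw.emb_def WA_one by (rule pp_tel) auto

lemma pp_one: "pp \<one>\<^bsub>TR\<^esub> = \<one>\<^bsub>TR\<^esub>"
  using pp_Qe0[of "\<one>\<^bsub>QR\<^esub>"] by (simp add: tw.emb_simps)

lemma pp_mult_eta: "x \<in> CT \<Longrightarrow> w \<in> W \<Longrightarrow> pp (x *t \<eta> w) = pp x"
proof (induction rule: TR_induct)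
  case (add c l v x)
  have "tel c (l, v) *t \<eta> w = tel c (l, v \<circ> w)"
    using add unfolding eta_tel
    by (subst tel_mult) (simp_all add: zero_coroot linear_0[OF weyl_linear])
  then show ?case using add by (simp add: tw.T.l_distr pp_add pp_tel weyl_comp)
qed (simp_all add: pp_zero)

text \<open>Both sides send t_l v to t_(w l) w. If x is invariant under left multiplication by
  \<open>\<eta> w\<close>, this says that \<open>pp x\<close> commutes with
  \<open>\<eta> w\<close>.\<close>

lemma eta_pp: "x \<in> CT \<Longrightarrow> w \<in> W \<Longrightarrow> \<eta> w *t pp x = pp (\<eta> w *t x) *t \<eta> w"
proof (induction rule: TR_induct)
  case (add c l v x)
  have 1: "\<eta> w *t tel c (l, v) = tel (Q_act (0, w) c) (w l, w \<circ> v)" if "v \<in> W" for v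
    using add that unfolding eta_tel by (subst tel_mult) (simp_all add: zero_coroot)
  have 2: "tel (Q_act (0, w) c) (w l, w) = tel (Q_act (0, w) c) (w l, id) *t \<eta> w"
    using add by (intro tel_split) (simp_all add: weyl_coroot_lattice)
  have "\<eta> w *t pp (tel c (l, v) +t x) = tel (Q_act (0, w) c) (w l, w) +t \<eta> w *t pp x"
    using add 1[of id] by (simp add: pp_add pp_tel tw.T.r_distr)
  also have "\<dots> = (tel (Q_act (0, w) c) (w l, id) +t pp (\<eta> w *t x)) *t \<eta> w"
    unfolding 2 add(5)[OF add(6)] using add by (subst tw.T.l_distr) (simp_all add: weyl_coroot_lattice)
  also have "tel (Q_act (0, w) c) (w l, id) +t pp (\<eta> w *t x) = pp (\<eta> w *t (tel c (l, v) +t x))"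
    using add by (simp add: tw.T.r_distr pp_add 1 pp_tel weyl_comp weyl_coroot_lattice)
  finally show ?case .
qed (simp_all add: pp_zero)

text \<open>Translations act trivially on the coefficients and commute with each other, so the image
  of \<open>pp\<close> is a commutative ring.\<close>

lemma pp_mult_pp: "x \<in> CT \<Longrightarrow> y \<in> CT \<Longrightarrow> pp x *t pp y = pp y *t pp x \<and> pp (pp x *t pp y) = pp x *t pp y"
proof (induction rule: TR_induct)
  case (add c l w x)
  define t where "t = tel c (l, id :: 'v \<Rightarrow> 'v)"
  have t: "t \<in> CT" using add by (simp add: t_def)
  have ty: "t *t pp y = pp y *t t \<and> pp (t *t pp y) = t *t pp y"
    using add(6)
  proof (induction rule: TR_induct)
    case (add d m v y)
    have td: "t *t tel d (m, id) = tel (c \<otimes>\<^bsub>QR\<^esub> d) (l + m, id)"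
      "tel d (m, id) *t t = tel (c \<otimes>\<^bsub>QR\<^esub> d) (l + m, id)"
      unfolding t_def using add \<open>c \<in> carrier QR\<close> \<open>l \<in> coroot_lattice \<Phi>\<close>
      by (subst tel_mult, simp_all add: Q_act_id Q.m_comm add.commute)+
    have "pp (tel (c \<otimes>\<^bsub>QR\<^esub> d) (l + m, id)) = tel (c \<otimes>\<^bsub>QR\<^esub> d) (l + m, id)"
      using add \<open>c \<in> carrier QR\<close> by (intro pp_tel) auto
    moreover have "pp (pp y *t t) = pp y *t t" using add(5) by metis
    ultimately show ?case using add t \<open>c \<in> carrier QR\<close> \<open>l \<in> coroot_lattice \<Phi>\<close>
      by (simp add: pp_add pp_tel tw.T.r_distr tw.T.l_distr coroot_add td)
  qed (use t in \<open>simp_all add: pp_zero\<close>)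
  have "pp (tel c (l, w) +t x) = t +t pp x" using add by (simp add: pp_add pp_tel t_def)
  moreover have "pp (pp y *t t) = pp y *t t" "pp (pp y *t pp x) = pp y *t pp x" using ty add(5)[OF add(6)] by metis+
  ultimately show ?case using add t ty by (simp add: pp_add tw.T.r_distr tw.T.l_distr)
qed (simp_all add: pp_zero)

lemma pp_comm: "x \<in> CT \<Longrightarrow> y \<in> CT \<Longrightarrow> pp x *t pp y = pp y *t pp x"
  and pp_mult: "x \<in> CT \<Longrightarrow> y \<in> CT \<Longrightarrow> pp (pp x *t pp y) = pp x *t pp y"
  using pp_mult_pp by auto

lemma pp_right: "x \<in> CT \<Longrightarrow> y \<in> CT \<Longrightarrow> pp (x *t y) = pp (x *t pp y)"
proof (induction rule: TR_induct)
  case (add c l w x)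
  have "pp (tel c (l, w) *t y) = pp (tel c (l, w) *t pp y)"
    using add(6)
  proof (induction rule: TR_induct)
    case (add d m v y)
    have "pp (tel c (l, w) *t tel d (m, v)) = pp (tel c (l, w) *t tel d (m, id))"
      using add \<open>c \<in> carrier QR\<close> \<open>l \<in> coroot_lattice \<Phi>\<close> \<open>w \<in> W\<close>
      by (simp add: tel_mult pp_tel weyl_comp)
    then show ?case using add \<open>c \<in> carrier QR\<close> \<open>l \<in> coroot_lattice \<Phi>\<close> \<open>w \<in> W\<close>
      by (simp add: pp_add pp_tel tw.T.r_distr)
  qed (simp add: pp_zero)
  then show ?case using add by (simp add: pp_add tw.T.l_distr)
qed (simp_all add: pp_zero)

section \<open>Central elements\<close>

definition central :: "('v, 'r) qwa \<Rightarrow> bool" where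
  "central z \<longleftrightarrow> z \<in> CT \<and> (\<forall>x\<in>CT. z *t x = x *t z)"

text \<open>Inside the image of \<open>pp\<close> everything commutes with z already, and that image
  together with the \<open>\<eta> w\<close> generates the ring.\<close>

lemma centralI:
  assumes z: "z \<in> CT" "pp z = z" and w: "\<And>w. w \<in> W \<Longrightarrow> z *t \<eta> w = \<eta> w *t z"
  shows "central z"
proof -
  have "z *t x = x *t z" if "x \<in> CT" for x
    using that
  proof (induction rule: TR_induct)
    case (add c l v x)
    let ?t = "tel c (l, id)"
    have t: "?t \<in> CT" "pp ?t = ?t" using add by (simp_all add: pp_tel)
    have "z *t tel c (l, v) = (z *t ?t) *t \<eta> v" using add z t by (simp add: tel_split[of c l v] tw.T.m_assoc)
    also have "z *t ?t = ?t *t z" using pp_comm[OF z(1) t(1)] by (simp add: z t)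
    also have "?t *t z *t \<eta> v = ?t *t (\<eta> v *t z)" using add z t by (simp add: tw.T.m_assoc w)
    also have "\<dots> = tel c (l, v) *t z" using add z t by (simp add: tel_split[of c l v] tw.T.m_assoc)
    finally show ?case using add z by (simp add: tw.T.l_distr tw.T.r_distr)
  qed (use z in simp)
  then show ?thesis using z by (simp add: central_def)
qed

lemma pp_central:
  assumes z: "central z" "pp z = z" and x: "x \<in> CT" shows "pp (x *t z) = pp x *t z"
  using x
proof (induction rule: TR_induct)
  case (add c l v x)
  have zc: "z \<in> CT" using z by (simp add: central_def)
  let ?t = "tel c (l, id)"
  have t: "?t \<in> CT" "pp ?t = ?t" using add by (simp_all add: pp_tel)
  have "tel c (l, v) *t z = ?t *t z *t \<eta> v"
    using add z zc t by (simp add: tel_split[of c l v] tw.T.m_assoc central_def)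
  then have "pp (tel c (l, v) *t z) = pp (?t *t z)" using add zc t by (simp add: pp_mult_eta)
  also have "\<dots> = ?t *t z" using pp_mult[OF t(1) zc] by (simp add: z t)
  finally show ?case using add zc by (simp add: tw.T.l_distr pp_add pp_tel)
qed (use z in \<open>simp add: pp_zero central_def\<close>)


subsection \<open>The averaging element\<close>

text \<open>The inverse of the order of W in S. Invariance is demanded so that it commutes with all
  \<open>\<eta> w\<close>.\<close>

definition avg :: "('v, 'r) mps set" where
  "avg = (SOME c. c \<in> carrier SR \<and> add_pow SR (card W) c = \<one>\<^bsub>SR\<^esub> \<and> (\<forall>w\<in>W. fga_act w c = c))"

lemma avg: "avg \<in> carrier SR" "add_pow SR (card W) avg = \<one>\<^bsub>SR\<^esub>" "w \<in> W \<Longrightarrow> fga_act w avg = avg"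
proof -
  have "card W > 0" using finite_weyl weyl_id card_gt_0_iff by blast
  from nat_inverse[OF this] have "\<exists>c. c \<in> carrier SR \<and> add_pow SR (card W) c = \<one>\<^bsub>SR\<^esub> \<and> (\<forall>w\<in>W. fga_act w c = c)" by blast
  from someI_ex[OF this] show "avg \<in> carrier SR" "add_pow SR (card W) avg = \<one>\<^bsub>SR\<^esub>" "w \<in> W \<Longrightarrow> fga_act w avg = avg"
    unfolding avg_def by auto
qed

definition e :: "('v, 'r) qwa" where "e = Se avg *t (\<Oplus>\<^bsub>TR\<^esub>w\<in>W. \<eta> w)"

lemma e_closed [simp]: "e \<in> CT"
  unfolding e_def by (intro tw.T.m_closed tw.T.finsum_closed) (auto simp: avg)

lemma eta_Qe: "w \<in> W \<Longrightarrow> c \<in> carrier QR \<Longrightarrow> \<eta> w *t Qe c = Qe (Q_act (0, w) c) *t \<eta> w"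
  by (simp add: tw.et_emb)

lemma eta_Se: "w \<in> W \<Longrightarrow> s \<in> carrier SR \<Longrightarrow> \<eta> w *t Se s = Se (fga_act w s) *t \<eta> w"
  by (simp add: eta_Qe Q_act_q)

lemma eta_e: assumes u: "u \<in> W" shows "\<eta> u *t e = e"
proof -
  obtain v where v: "v \<in> W" "v \<circ> u = id" "u \<circ> v = id" using weyl_inverse[OF u] .
  have f: "(\<lambda>w. \<eta> w) \<in> W \<rightarrow> CT" by auto
  have inj: "inj_on (\<lambda>w. u \<circ> w) W"
  proof (rule inj_onI)
    fix a b assume "u \<circ> a = u \<circ> b"
    then have "v \<circ> (u \<circ> a) = v \<circ> (u \<circ> b)" by simp
    then show "a = b" using v(2) by (simp only: o_assoc id_comp)
  qed
  have im: "(\<lambda>w. u \<circ> w) ` W = W"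
  proof (intro equalityI subsetI)
    fix w assume w: "w \<in> W"
    have "w = u \<circ> (v \<circ> w)" using v(3) by (simp only: o_assoc id_comp)
    then show "w \<in> (\<lambda>w. u \<circ> w) ` W" using weyl_comp[OF v(1) w] by blast
  qed (use weyl_comp[OF u] in blast)
  have "\<eta> u *t (\<Oplus>\<^bsub>TR\<^esub>w\<in>W. \<eta> w) = (\<Oplus>\<^bsub>TR\<^esub>w\<in>W. \<eta> u *t \<eta> w)"
    by (rule tw.T.finsum_rdistr[OF finite_weyl _ f]) (use u in simp)
  also have "\<dots> = (\<Oplus>\<^bsub>TR\<^esub>w\<in>W. \<eta> (u \<circ> w))"
    by (rule tw.T.finsum_cong') (use u in \<open>auto simp only: eta_mult eta_closed weyl_comp\<close>)
  also have "\<dots> = (\<Oplus>\<^bsub>TR\<^esub>w\<in>(\<lambda>w. u \<circ> w) ` W. \<eta> w)"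
    by (rule tw.T.add.finprod_reindex[symmetric, OF _ inj]) (use im in auto)
  finally have s: "\<eta> u *t (\<Oplus>\<^bsub>TR\<^esub>w\<in>W. \<eta> w) = (\<Oplus>\<^bsub>TR\<^esub>w\<in>W. \<eta> w)" unfolding im .
  have c: "(\<Oplus>\<^bsub>TR\<^esub>w\<in>W. \<eta> w) \<in> CT" using f by (rule tw.T.finsum_closed)
  have "\<eta> u *t e = (\<eta> u *t Se avg) *t (\<Oplus>\<^bsub>TR\<^esub>w\<in>W. \<eta> w)"
    unfolding e_def using u c avg(1) by (simp add: tw.T.m_assoc)
  also have "\<dots> = Se avg *t (\<eta> u *t (\<Oplus>\<^bsub>TR\<^esub>w\<in>W. \<eta> w))"
    using u c avg(1) by (simp add: eta_Se avg(3) tw.T.m_assoc)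
  finally show ?thesis unfolding s e_def .
qed

text \<open>Since \<open>\<eta> w *t e = e\<close>, right multiplication by \<open>e\<close> does
  not see the Weyl part that \<open>pp\<close> discards.\<close>

lemma pp_mult_e: "x \<in> CT \<Longrightarrow> pp x *t e = x *t e"
proof (induction rule: TR_induct)
  case (add c l v x)
  have "tel c (l, v) *t e = tel c (l, id) *t e"
    using add by (simp add: tel_split[of c l v] tw.T.m_assoc eta_e)
  then show ?case using add by (simp add: pp_add pp_tel tw.T.l_distr)
qed (simp add: pp_zero)

text \<open>\<open>e *t y\<close> is invariant under left multiplication by W, so
  \<open>eta_pp\<close> gives commutation with every \<open>\<eta> w\<close>, which is all that
  \<open>centralI\<close> asks for.\<close>

lemma central_pp_e: assumes y: "y \<in> CT" shows "central (pp (e *t y))"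
proof (rule centralI)
  fix w assume w: "w \<in> W"
  have "\<eta> w *t pp (e *t y) = pp (\<eta> w *t (e *t y)) *t \<eta> w" using y w by (intro eta_pp) auto
  also have "\<eta> w *t (e *t y) = e *t y" using y w by (simp add: tw.T.m_assoc[symmetric] eta_e)
  finally show "pp (e *t y) *t \<eta> w = \<eta> w *t pp (e *t y)" ..
qed (use y in \<open>simp_all add: pp_pp\<close>)

lemma Se_add_pow: "s \<in> carrier SR \<Longrightarrow> Se (add_pow SR (k::nat) s) = add_pow TR k (Se s)"
proof (induction k)
  case (Suc k)
  have "Se (add_pow SR k s \<oplus>\<^bsub>SR\<^esub> s) = Se (add_pow SR k s) +t Se s" using Suc(2) by (intro Se_simps) auto
  then show ?case using Suc by simp
next
  case 0
  show ?case using Se_simps(4) by simp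
qed

lemma e_mult:
  assumes y: "y \<in> CT" shows "e *t y = Se avg *t (\<Oplus>\<^bsub>TR\<^esub>w\<in>W. \<eta> w *t y)"
proof -
  have "(\<Oplus>\<^bsub>TR\<^esub>w\<in>W. \<eta> w) \<in> CT" by (rule tw.T.finsum_closed) auto
  moreover have "(\<Oplus>\<^bsub>TR\<^esub>w\<in>W. \<eta> w) *t y = (\<Oplus>\<^bsub>TR\<^esub>w\<in>W. \<eta> w *t y)"
    by (rule tw.T.finsum_ldistr[OF finite_weyl y]) auto
  ultimately show ?thesis unfolding e_def using y avg(1) by (simp add: tw.T.m_assoc)
qed

lemma avg_sum:
  assumes y: "y \<in> CT" shows "Se avg *t (\<Oplus>\<^bsub>TR\<^esub>w\<in>W. y) = y"
proof -
  have "(\<Oplus>\<^bsub>TR\<^esub>w\<in>W. y) = add_pow TR (card W) y" using y by (simp add: tw.T.add.finprod_const add_pow_def)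
  then have "Se avg *t (\<Oplus>\<^bsub>TR\<^esub>w\<in>W. y) = add_pow TR (card W) (Se avg) *t y"
    using y avg(1) by (simp add: tw.T.add_pow_rdistr tw.T.add_pow_ldistr)
  also have "\<dots> = y" using y avg by (simp add: Se_add_pow[symmetric]) (simp only: Se_simps tw.T.l_one)
  finally show ?thesis .
qed


subsection \<open>The algebras generated by the operators\<close>

abbreviation "XE \<equiv> X_elem F \<Phi> \<alpha> \<theta>"
definition "D = generate_ring TR (Se ` carrier SR \<union> XE ` {0..n})"
definition "E = generate_ring TR (Se ` carrier SR \<union> XE ` {1..n})"

lemma X_simple:
  assumes "i \<in> {1..n}" shows "XE i = Qe (x_inv (\<alpha> i)) *t (\<one>\<^bsub>TR\<^esub> -t \<eta> (reflection (\<alpha> i)))"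
  using assms by (simp add: X_elem_def Q_emb_def tw.emb_def x_inv_def eta_def tw.et_def)

lemma simple_root: "i \<in> {1..n} \<Longrightarrow> \<alpha> i \<in> \<Phi>" "i \<in> {1..n} \<Longrightarrow> reflection (\<alpha> i) \<in> W"
  using \<alpha>_root[of i] weyl_reflection by (auto simp: I_def)

lemma X_closed: "i \<le> n \<Longrightarrow> XE i \<in> CT"
proof (cases "i = 0")
  case True
  have "XE 0 = Qe (x_inv (- \<theta>)) *t (\<one>\<^bsub>TR\<^esub> -t tw.et (coroot \<theta>, reflection \<theta>))"
    by (simp add: X_elem_def Q_emb_def tw.emb_def x_inv_def eta_def tw.et_def)
  moreover have "(coroot \<theta>, reflection \<theta>) \<in> carrier WA"
    using \<theta> weyl_reflection[OF \<theta>] by (auto simp: WA_carrier coroot_lattice_def intro!: group_closure.base)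
  ultimately show ?thesis using True x_inv(1)[OF uminus_root[OF \<theta>]] by simp
next
  assume "i \<le> n"
  case False
  then have "i \<in> {1..n}" using \<open>i \<le> n\<close> by auto
  then show ?thesis using simple_root[of i] x_inv(1)[of "\<alpha> i"] by (simp only: X_simple) simp
qed

lemma gens_closed: "Se ` carrier SR \<union> XE ` {0..n} \<subseteq> CT" "Se ` carrier SR \<union> XE ` {1..n} \<subseteq> CT"
  using X_closed Se_closed by auto

lemma D_subring: "subring D TR" and E_subring: "subring E TR"
  unfolding D_def E_def by (rule tw.T.generate_ring_is_subring; rule gens_closed)+

lemma E_D: "E \<subseteq> D"
  unfolding D_def E_def by (rule tw.T.mono_generate_ring[OF _ gens_closed(1)]) auto

lemma D_closed: "x \<in> D \<Longrightarrow> x \<in> CT" and E_closed: "x \<in> E \<Longrightarrow> x \<in> CT"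
  using subringE(1)[OF D_subring] subringE(1)[OF E_subring] by auto

lemma Se_E: "s \<in> carrier SR \<Longrightarrow> Se s \<in> E" and X_E: "i \<in> {1..n} \<Longrightarrow> XE i \<in> E"
  unfolding E_def by (auto intro: generate_ring.incl)

lemma E_ops: "x \<in> E \<Longrightarrow> y \<in> E \<Longrightarrow> x +t y \<in> E" "x \<in> E \<Longrightarrow> y \<in> E \<Longrightarrow> x *t y \<in> E"
  "x \<in> E \<Longrightarrow> y \<in> E \<Longrightarrow> x -t y \<in> E" "\<one>\<^bsub>TR\<^esub> \<in> E" "\<zero>\<^bsub>TR\<^esub> \<in> E"
  using subringE[OF E_subring] by (auto simp: a_minus_def)

lemma D_ops: "x \<in> D \<Longrightarrow> y \<in> D \<Longrightarrow> x +t y \<in> D" "x \<in> D \<Longrightarrow> y \<in> D \<Longrightarrow> x *t y \<in> D"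
  "x \<in> D \<Longrightarrow> y \<in> D \<Longrightarrow> x -t y \<in> D" "\<one>\<^bsub>TR\<^esub> \<in> D" "\<zero>\<^bsub>TR\<^esub> \<in> D"
  using subringE[OF D_subring] by (auto simp: a_minus_def)

lemma E_finsum: "finite A \<Longrightarrow> (\<And>i. i \<in> A \<Longrightarrow> f i \<in> E) \<Longrightarrow> (\<Oplus>\<^bsub>TR\<^esub>i\<in>A. f i) \<in> E"
proof (induction A rule: finite_induct)
  case (insert x A)
  then have "f \<in> A \<rightarrow> CT" "f x \<in> CT" using E_closed by auto
  then show ?case using insert by (simp add: E_ops)
qed (simp add: E_ops)

lemma D_finsum: "finite A \<Longrightarrow> (\<And>i. i \<in> A \<Longrightarrow> f i \<in> D) \<Longrightarrow> (\<Oplus>\<^bsub>TR\<^esub>i\<in>A. f i) \<in> D"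
proof (induction A rule: finite_induct)
  case (insert x A)
  then have "f \<in> A \<rightarrow> CT" "f x \<in> CT" using D_closed by auto
  then show ?case using insert by (simp add: D_ops)
qed (simp add: D_ops)

lemma Se_X:
  assumes i: "i \<in> {1..n}" shows "Se (xx (\<alpha> i)) *t XE i = \<one>\<^bsub>TR\<^esub> -t \<eta> (reflection (\<alpha> i))"
proof -
  note a = simple_root[OF i]
  have c: "xx (\<alpha> i) \<in> carrier SR" using xx_closed[OF root_in_lattice[OF a(1)]] .
  have "Se (xx (\<alpha> i)) *t Qe (x_inv (\<alpha> i)) = Qe (q (xx (\<alpha> i)) \<otimes>\<^bsub>QR\<^esub> x_inv (\<alpha> i))"
    using x_inv(1)[OF a(1)] c by (simp add: tw.emb_simps)
  also have "q (xx (\<alpha> i)) \<otimes>\<^bsub>QR\<^esub> x_inv (\<alpha> i) = \<one>\<^bsub>QR\<^esub>"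
    using x_inv[OF a(1)] c by (simp add: Q.m_comm)
  finally have 1: "Se (xx (\<alpha> i)) *t Qe (x_inv (\<alpha> i)) = \<one>\<^bsub>TR\<^esub>" by (simp add: tw.emb_simps)
  have "Se (xx (\<alpha> i)) *t XE i = (Se (xx (\<alpha> i)) *t Qe (x_inv (\<alpha> i))) *t (\<one>\<^bsub>TR\<^esub> -t \<eta> (reflection (\<alpha> i)))"
    unfolding X_simple[OF i] using x_inv(1)[OF a(1)] c a by (simp add: tw.T.m_assoc)
  then show ?thesis unfolding 1 using a by simp
qed

text \<open>The relation x_i X_i = 1 - s_i puts the simple reflections, hence all of W and then
  \<open>e\<close>, into E.\<close>

lemma eta_simple_E: assumes i: "i \<in> {1..n}" shows "\<eta> (reflection (\<alpha> i)) \<in> E"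
proof -
  note a = simple_root[OF i]
  have c: "xx (\<alpha> i) \<in> carrier SR" using xx_closed[OF root_in_lattice[OF a(1)]] .
  have "\<one>\<^bsub>TR\<^esub> -t (\<one>\<^bsub>TR\<^esub> -t \<eta> (reflection (\<alpha> i))) = \<eta> (reflection (\<alpha> i))"
    using a(2) by (simp add: a_minus_def tw.T.minus_add tw.T.a_assoc[symmetric] tw.T.r_neg)
  then show ?thesis unfolding Se_X[OF i, symmetric] using Se_E[OF c] X_E[OF i] E_ops by metis
qed

lemma eta_E: assumes "w \<in> W" shows "\<eta> w \<in> E"
proof -
  obtain "is" where "is": "set is \<subseteq> I" "w = sprod is" using weyl_sprod[OF assms] by blast
  have "\<eta> (sprod is) \<in> E" using "is"(1)
  proof (induction "is")
    case Nil show ?case using E_ops(4) by (simp only: sprod_simps eta_id)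
  next
    case (Cons i "is")
    have i: "i \<in> {1..n}" "set is \<subseteq> I" using Cons(2) by (auto simp: I_def)
    have "\<eta> (sprod (i # is)) = \<eta> (reflection (\<alpha> i)) *t \<eta> (sprod is)"
      unfolding sprod_simps using simple_root(2)[OF i(1)] sprod_weyl[OF i(2)] by (simp only: eta_mult)
    then show ?case using Cons(1)[OF i(2)] eta_simple_E[OF i(1)] by (simp only: E_ops)
  qed
  then show ?thesis by (simp only: "is"(2))
qed

lemma e_E: "e \<in> E"
  unfolding e_def by (intro E_ops E_finsum finite_weyl Se_E avg eta_E)

lemma pp_Se: "s \<in> carrier SR \<Longrightarrow> x \<in> CT \<Longrightarrow> pp (Se s *t x) = Se s *t pp x"
  by (rule pp_Qe) auto

lemma one_minus_eta_Se:
  assumes "w \<in> W" "s \<in> carrier SR"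
  shows "pp ((\<one>\<^bsub>TR\<^esub> -t \<eta> w) *t Se s) = Se (s \<ominus>\<^bsub>SR\<^esub> fga_act w s)"
proof -
  have "(\<one>\<^bsub>TR\<^esub> -t \<eta> w) *t Se s = Se s -t Se (fga_act w s) *t \<eta> w"
    using assms by (simp add: a_minus_def tw.T.l_distr tw.T.l_minus eta_Se)
  then have "pp ((\<one>\<^bsub>TR\<^esub> -t \<eta> w) *t Se s) = pp (Se s) -t pp (Se (fga_act w s))"
    using assms s_simps(1)[OF assms] by (simp add: pp_minus pp_mult_eta)
  then show ?thesis using assms s_simps(1)[OF assms]
    by (simp add: pp_Qe0 q_minus tw.emb_minus)
qed

lemma X_Se:
  assumes i: "i \<in> {1..n}" and s: "s \<in> carrier SR"
  shows "\<exists>c\<in>carrier SR. pp (XE i *t Se s) = Se c"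
proof -
  note a = simple_root[OF i]
  have xc: "xx (\<alpha> i) \<in> carrier SR" using xx_closed[OF root_in_lattice[OF a(1)]] .
  obtain c where c: "c \<in> carrier SR" "s \<ominus>\<^bsub>SR\<^esub> fga_act (reflection (\<alpha> i)) s = xx (\<alpha> i) \<otimes>\<^bsub>SR\<^esub> c"
    using divided_difference[OF a(1) s] by blast
  have "pp (XE i *t Se s) = Qe (x_inv (\<alpha> i)) *t pp ((\<one>\<^bsub>TR\<^esub> -t \<eta> (reflection (\<alpha> i))) *t Se s)"
    unfolding X_simple[OF i] using x_inv(1)[OF a(1)] s a by (simp add: tw.T.m_assoc pp_Qe)
  also have "\<dots> = Qe (x_inv (\<alpha> i)) *t (Se (xx (\<alpha> i)) *t Se c)"
    unfolding one_minus_eta_Se[OF a(2) s] c(2) Se_simps(1)[OF xc c(1)] ..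
  also have "\<dots> = Qe (x_inv (\<alpha> i) \<otimes>\<^bsub>QR\<^esub> q (xx (\<alpha> i))) *t Se c"
    using x_inv(1)[OF a(1)] xc c(1) by (simp add: tw.emb_simps tw.T.m_assoc)
  also have "\<dots> = Se c" unfolding x_inv(2)[OF a(1)] using c(1) by (simp add: tw.emb_simps)
  finally show ?thesis using c(1) by blast
qed

text \<open>S is stable under the operators of E. By \<open>pp_right\<close> products act as
  composites, so generators suffice; for \<open>XE i\<close> stability is the divisibility of s -
  s_i(s) by \<open>xx (\<alpha> i)\<close>.\<close>

lemma E_Se:
  assumes "y \<in> E" shows "s \<in> carrier SR \<Longrightarrow> \<exists>c\<in>carrier SR. pp (y *t Se s) = Se c"
  using assms unfolding E_def
proof (induction arbitrary: s)
  case one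
  then show ?case by (intro bexI[of _ s]) (simp_all add: pp_Qe0)
next
  case (incl h)
  then consider t where "t \<in> carrier SR" "h = Se t" | i where "i \<in> {1..n}" "h = XE i" by blast
  then show ?case
  proof cases
    case 1
    then show ?thesis using incl(2) by (intro bexI[of _ "t \<otimes>\<^bsub>SR\<^esub> s"]) (simp_all add: Se_simps(1)[symmetric] pp_Qe0 del: tw.emb_simps)
  next
    case 2
    then show ?thesis using X_Se incl(2) by simp
  qed
next
  case (a_inv h)
  have h: "h \<in> CT" using a_inv(1) E_closed unfolding E_def by blast
  obtain c where c: "c \<in> carrier SR" "pp (h *t Se s) = Se c" using a_inv(2)[OF a_inv(3)] by blast
  have "\<ominus>\<^bsub>TR\<^esub> h *t Se s = \<zero>\<^bsub>TR\<^esub> -t h *t Se s" using h a_inv(3) by (simp add: a_minus_def tw.T.l_minus)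
  then have "pp (\<ominus>\<^bsub>TR\<^esub> h *t Se s) = Se (\<zero>\<^bsub>SR\<^esub> \<ominus>\<^bsub>SR\<^esub> c)"
    using h a_inv(3) c by (simp add: pp_minus pp_zero q_minus tw.emb_minus) (simp only: Se_simps)
  then show ?case using c(1) by (intro bexI[of _ "\<zero>\<^bsub>SR\<^esub> \<ominus>\<^bsub>SR\<^esub> c"]) auto
next
  case (eng_add h1 h2)
  have h: "h1 \<in> CT" "h2 \<in> CT" using eng_add(1,2) E_closed unfolding E_def by blast+
  obtain c d where c: "c \<in> carrier SR" "pp (h1 *t Se s) = Se c" "d \<in> carrier SR" "pp (h2 *t Se s) = Se d"
    using eng_add(3,4)[OF eng_add(5)] by blast
  then have "pp ((h1 +t h2) *t Se s) = Se (c \<oplus>\<^bsub>SR\<^esub> d)"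
    unfolding Se_simps(2)[OF c(1,3)] using h eng_add(5) by (simp add: tw.T.l_distr pp_add)
  then show ?case using c by (intro bexI[of _ "c \<oplus>\<^bsub>SR\<^esub> d"]) auto
next
  case (eng_mult h1 h2)
  have h: "h1 \<in> CT" "h2 \<in> CT" using eng_mult(1,2) E_closed unfolding E_def by blast+
  obtain c where c: "c \<in> carrier SR" "pp (h2 *t Se s) = Se c" using eng_mult(4)[OF eng_mult(5)] by blast
  obtain d where d: "d \<in> carrier SR" "pp (h1 *t Se c) = Se d" using eng_mult(3)[OF c(1)] by blast
  have "pp (h1 *t h2 *t Se s) = pp (h1 *t pp (h2 *t Se s))"
    using h eng_mult(5) by (simp add: tw.T.m_assoc pp_right[of h1 "h2 *t Se s"])
  then show ?case using c d by auto
qed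


subsection \<open>Nilpotency of divided differences\<close>

text \<open>The subring of \<open>S\<close> generated by the logarithms plays the role of a graded polynomial ring.\<close>

inductive pol :: "nat \<Rightarrow> ('v, 'r) mps set \<Rightarrow> bool" where
  pol_zero: "pol j \<zero>\<^bsub>SR\<^esub>"
| pol_one: "pol 0 \<one>\<^bsub>SR\<^esub>"
| pol_lg: "\<lbrakk>v \<in> \<Lambda>; pol j f\<rbrakk> \<Longrightarrow> pol (Suc j) (lg v \<otimes>\<^bsub>SR\<^esub> f)"
| pol_diff: "\<lbrakk>pol j f; pol j g\<rbrakk> \<Longrightarrow> pol j (f \<ominus>\<^bsub>SR\<^esub> g)"

lemma pol_closed: "pol j f \<Longrightarrow> f \<in> carrier SR"
  by (induction rule: pol.induct) (auto simp: lg_closed)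

lemma pol_minus: "pol j f \<Longrightarrow> pol j (\<ominus>\<^bsub>SR\<^esub> f)"
  using pol_diff[OF pol_zero, of j f] pol_closed[of j f] by (simp add: a_minus_def)

lemma pol_add: "pol j f \<Longrightarrow> pol j g \<Longrightarrow> pol j (f \<oplus>\<^bsub>SR\<^esub> g)"
  using pol_diff[OF _ pol_minus, of j f g] pol_closed[of j g] by (simp add: a_minus_def)

text \<open>\<open>lg (k b)\<close> is k times \<open>lg b\<close>. The integer is absorbed into
  \<open>g\<close>, which keeps its degree because \<open>pol j\<close> is an additive
  group.\<close>

lemma pol_lg_int:
  assumes b: "b \<in> \<Lambda>" and f: "pol j f"
  shows "\<exists>g. pol j g \<and> lg (of_int k *\<^sub>R b) \<otimes>\<^bsub>SR\<^esub> f = lg b \<otimes>\<^bsub>SR\<^esub> g"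
proof -
  have fc: "f \<in> carrier SR" "lg b \<in> carrier SR" using f b pol_closed lg_closed by auto
  have nat: "\<exists>g. pol j g \<and> lg (real k *\<^sub>R b) \<otimes>\<^bsub>SR\<^esub> f = lg b \<otimes>\<^bsub>SR\<^esub> g" for k
  proof (induction k)
    case 0
    show ?case using fc pol_zero by (intro exI[of _ "\<zero>\<^bsub>SR\<^esub>"]) (simp add: lg_0)
  next
    case (Suc k)
    then obtain g where g: "pol j g" "lg (real k *\<^sub>R b) \<otimes>\<^bsub>SR\<^esub> f = lg b \<otimes>\<^bsub>SR\<^esub> g" by blast
    have "real (Suc k) *\<^sub>R b = b + real k *\<^sub>R b" by (simp add: scaleR_add_left)
    then have "lg (real (Suc k) *\<^sub>R b) \<otimes>\<^bsub>SR\<^esub> f = lg b \<otimes>\<^bsub>SR\<^esub> (f \<oplus>\<^bsub>SR\<^esub> g)"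
      using lg_add[OF b lg_mult(1)[OF b]] lg_closed[OF lg_mult(1)[OF b]] fc g pol_closed[OF g(1)]
      by (simp add: S.l_distr S.r_distr)
    then show ?case using pol_add[OF f g(1)] by blast
  qed
  show ?thesis
  proof (cases k rule: int_cases2)
    case (nonneg m) then show ?thesis using nat[of m] by simp
  next
    case (nonpos m)
    obtain g where g: "pol j g" "lg (real m *\<^sub>R b) \<otimes>\<^bsub>SR\<^esub> f = lg b \<otimes>\<^bsub>SR\<^esub> g" using nat[of m] by blast
    have "lg (of_int k *\<^sub>R b) = \<zero>\<^bsub>SR\<^esub> \<ominus>\<^bsub>SR\<^esub> lg (real m *\<^sub>R b)"
      using lg_diff[OF lattice_zero lg_mult(1)[OF b], of m] nonpos by (simp add: lg_0)
    then have "lg (of_int k *\<^sub>R b) \<otimes>\<^bsub>SR\<^esub> f = lg b \<otimes>\<^bsub>SR\<^esub> (\<ominus>\<^bsub>SR\<^esub> g)"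
      using lg_closed[OF lg_mult(1)[OF b], of m] fc g pol_closed[OF g(1)]
      by (simp add: a_minus_def S.l_minus S.r_minus)
    then show ?thesis using pol_minus[OF g(1)] by blast
  qed
qed

text \<open>Twisted Leibniz rule along the generation of \<open>pol\<close>: the degree drops by
  one, and in degree 0 the difference is zero. The divisor is \<open>lg b\<close> and not
  \<open>xx b\<close> because additivity of the logarithm keeps the quotient homogeneous.\<close>

lemma pol_divided_difference:
  assumes "pol j f" and b: "b \<in> \<Phi>"
  shows "(j = 0 \<longrightarrow> f \<ominus>\<^bsub>SR\<^esub> fga_act (reflection b) f = \<zero>\<^bsub>SR\<^esub>) \<and>
    (\<forall>i. j = Suc i \<longrightarrow> (\<exists>g. pol i g \<and> f \<ominus>\<^bsub>SR\<^esub> fga_act (reflection b) f = lg b \<otimes>\<^bsub>SR\<^esub> g))"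
proof -
  let ?s = "fga_act (reflection b) :: ('v, 'r) mps set \<Rightarrow> _"
  have w: "reflection b \<in> W" using b by (rule weyl_reflection)
  have bL: "b \<in> \<Lambda>" "lg b \<in> carrier SR" using b root_in_lattice lg_closed by auto
  have z0: "\<zero>\<^bsub>SR\<^esub> = lg b \<otimes>\<^bsub>SR\<^esub> \<zero>\<^bsub>SR\<^esub>" using bL by simp
  show ?thesis using assms(1)
  proof induction
    case (pol_zero j)
    then show ?case using w z0 pol.pol_zero by (auto simp: s_simps a_minus_def)
  next
    case pol_one
    then show ?case using w by (simp add: s_simps a_minus_def S.r_neg)
  next
    case (pol_lg v j f)
    have c: "f \<in> carrier SR" "lg v \<in> carrier SR" "?s f \<in> carrier SR" "reflection b v \<in> \<Lambda>"
      "lg (reflection b v) \<in> carrier SR"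
      using pol_closed[OF pol_lg(2)] lg_closed pol_lg(1) s_simps(1)[OF w] weyl_root_lattice[OF w] by auto
    obtain k :: int where k: "reflection b v = v - of_int k *\<^sub>R b" using reflection_lattice[OF b pol_lg(1)] by blast
    obtain h where h: "pol j h" "lg (of_int k *\<^sub>R b) \<otimes>\<^bsub>SR\<^esub> f = lg b \<otimes>\<^bsub>SR\<^esub> h"
      using pol_lg_int[OF bL(1) pol_lg(2)] by blast
    have "v - reflection b v = of_int k *\<^sub>R b" by (simp add: k)
    then have d: "lg v \<ominus>\<^bsub>SR\<^esub> lg (reflection b v) = lg (of_int k *\<^sub>R b)"
      using lg_diff[OF pol_lg(1) c(4)] by simp
    have "lg v \<otimes>\<^bsub>SR\<^esub> f \<ominus>\<^bsub>SR\<^esub> ?s (lg v \<otimes>\<^bsub>SR\<^esub> f) = lg v \<otimes>\<^bsub>SR\<^esub> f \<ominus>\<^bsub>SR\<^esub> lg (reflection b v) \<otimes>\<^bsub>SR\<^esub> ?s f"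
      using c by (simp add: s_simps[OF w] s_lg[OF w pol_lg(1)])
    also have "\<dots> = (lg v \<ominus>\<^bsub>SR\<^esub> lg (reflection b v)) \<otimes>\<^bsub>SR\<^esub> f \<oplus>\<^bsub>SR\<^esub> lg (reflection b v) \<otimes>\<^bsub>SR\<^esub> (f \<ominus>\<^bsub>SR\<^esub> ?s f)"
      using c by algebra
    finally have eq: "lg v \<otimes>\<^bsub>SR\<^esub> f \<ominus>\<^bsub>SR\<^esub> ?s (lg v \<otimes>\<^bsub>SR\<^esub> f) =
        lg b \<otimes>\<^bsub>SR\<^esub> h \<oplus>\<^bsub>SR\<^esub> lg (reflection b v) \<otimes>\<^bsub>SR\<^esub> (f \<ominus>\<^bsub>SR\<^esub> ?s f)" unfolding d h(2) .
    have hc: "h \<in> carrier SR" by (rule pol_closed[OF h(1)])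
    have "\<exists>g. pol j g \<and> lg v \<otimes>\<^bsub>SR\<^esub> f \<ominus>\<^bsub>SR\<^esub> ?s (lg v \<otimes>\<^bsub>SR\<^esub> f) = lg b \<otimes>\<^bsub>SR\<^esub> g"
    proof (cases j)
      case 0
      then show ?thesis using eq pol_lg(3) h bL hc c by (intro exI[of _ h]) simp
    next
      case (Suc i)
      then obtain g where g: "pol i g" "f \<ominus>\<^bsub>SR\<^esub> ?s f = lg b \<otimes>\<^bsub>SR\<^esub> g" using pol_lg(3) by blast
      have gc: "g \<in> carrier SR" by (rule pol_closed[OF g(1)])
      have "pol j (h \<oplus>\<^bsub>SR\<^esub> lg (reflection b v) \<otimes>\<^bsub>SR\<^esub> g)"
        using h g Suc c by (intro pol_add) (auto intro: pol.pol_lg)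
      moreover have "lg v \<otimes>\<^bsub>SR\<^esub> f \<ominus>\<^bsub>SR\<^esub> ?s (lg v \<otimes>\<^bsub>SR\<^esub> f) = lg b \<otimes>\<^bsub>SR\<^esub> (h \<oplus>\<^bsub>SR\<^esub> lg (reflection b v) \<otimes>\<^bsub>SR\<^esub> g)"
        unfolding eq g(2) using c bL hc gc by (simp add: S.r_distr S.m_lcomm)
      ultimately show ?thesis by blast
    qed
    then show ?case by blast
  next
    case (pol_diff j f g)
    have c: "f \<in> carrier SR" "?s f \<in> carrier SR" "g \<in> carrier SR" "?s g \<in> carrier SR"
      using pol_closed pol_diff s_simps(1)[OF w] by auto
    have eq: "(f \<ominus>\<^bsub>SR\<^esub> g) \<ominus>\<^bsub>SR\<^esub> ?s (f \<ominus>\<^bsub>SR\<^esub> g) = (f \<ominus>\<^bsub>SR\<^esub> ?s f) \<ominus>\<^bsub>SR\<^esub> (g \<ominus>\<^bsub>SR\<^esub> ?s g)"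
      unfolding s_minus[OF w c(1,3)] using c by algebra
    show ?case
    proof (intro conjI allI impI)
      assume "j = 0"
      then show "(f \<ominus>\<^bsub>SR\<^esub> g) \<ominus>\<^bsub>SR\<^esub> ?s (f \<ominus>\<^bsub>SR\<^esub> g) = \<zero>\<^bsub>SR\<^esub>"
        unfolding eq using pol_diff by (simp add: a_minus_def)
    next
      fix i assume "j = Suc i"
      then obtain g1 g2 where g: "pol i g1" "f \<ominus>\<^bsub>SR\<^esub> ?s f = lg b \<otimes>\<^bsub>SR\<^esub> g1" "pol i g2" "g \<ominus>\<^bsub>SR\<^esub> ?s g = lg b \<otimes>\<^bsub>SR\<^esub> g2"
        using pol_diff by blast
      have "lg b \<otimes>\<^bsub>SR\<^esub> g1 \<ominus>\<^bsub>SR\<^esub> lg b \<otimes>\<^bsub>SR\<^esub> g2 = lg b \<otimes>\<^bsub>SR\<^esub> (g1 \<ominus>\<^bsub>SR\<^esub> g2)"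
        using bL pol_closed[OF g(1)] pol_closed[OF g(3)] by (simp add: a_minus_def S.r_distr S.r_minus)
      then show "\<exists>h. pol i h \<and> (f \<ominus>\<^bsub>SR\<^esub> g) \<ominus>\<^bsub>SR\<^esub> ?s (f \<ominus>\<^bsub>SR\<^esub> g) = lg b \<otimes>\<^bsub>SR\<^esub> h"
        unfolding eq g(2,4) using pol.pol_diff[OF g(1,3)] by blast
    qed
  qed
qed

text \<open>Not the inverse of a logarithm but the quotient of \<open>xx (\<alpha> i)\<close> by
  \<open>lg (\<alpha> i)\<close>, which lies in S. It converts \<open>XE i\<close> into
  \<open>Y i\<close>.\<close>

definition lg_inv :: "nat \<Rightarrow> ('v, 'r) mps set" where
  "lg_inv i = (SOME u'. u' \<in> carrier SR \<and> lg (\<alpha> i) \<otimes>\<^bsub>SR\<^esub> u' = xx (\<alpha> i))"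

text \<open>\<open>Y i\<close> is the additive divided difference \<open>(1 / lg (\<alpha> i)) (1 - s\<^sub>i)\<close>.\<close>

definition Y :: "nat \<Rightarrow> ('v, 'r) qwa" where "Y i = Se (lg_inv i) *t XE i"

lemma lg_inv:
  assumes i: "i \<in> {1..n}" shows "lg_inv i \<in> carrier SR" "lg (\<alpha> i) \<otimes>\<^bsub>SR\<^esub> lg_inv i = xx (\<alpha> i)"
proof -
  have a: "\<alpha> i \<in> \<Lambda>" using simple_root(1)[OF i] root_in_lattice by simp
  obtain u u' where u: "u \<in> carrier SR" "u' \<in> carrier SR" "u \<otimes>\<^bsub>SR\<^esub> u' = \<one>\<^bsub>SR\<^esub>" "lg (\<alpha> i) = xx (\<alpha> i) \<otimes>\<^bsub>SR\<^esub> u"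
    using lg_unit[OF a] by blast
  have "lg (\<alpha> i) \<otimes>\<^bsub>SR\<^esub> u' = xx (\<alpha> i)"
    unfolding u(4) using u(1-3) xx_closed[OF a] by (simp add: S.m_assoc)
  then have "\<exists>u'. u' \<in> carrier SR \<and> lg (\<alpha> i) \<otimes>\<^bsub>SR\<^esub> u' = xx (\<alpha> i)" using u(2) by blast
  from someI_ex[OF this] show "lg_inv i \<in> carrier SR" "lg (\<alpha> i) \<otimes>\<^bsub>SR\<^esub> lg_inv i = xx (\<alpha> i)"
    unfolding lg_inv_def by auto
qed

lemma Y_E: "i \<in> {1..n} \<Longrightarrow> Y i \<in> E"
  unfolding Y_def by (intro E_ops Se_E X_E lg_inv)

lemma lg_Y:
  assumes i: "i \<in> {1..n}" shows "Se (lg (\<alpha> i)) *t Y i = \<one>\<^bsub>TR\<^esub> -t \<eta> (reflection (\<alpha> i))"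
proof -
  have a: "lg (\<alpha> i) \<in> carrier SR" using simple_root(1)[OF i] root_in_lattice lg_closed by simp
  have "Se (lg (\<alpha> i)) *t Y i = Se (lg (\<alpha> i) \<otimes>\<^bsub>SR\<^esub> lg_inv i) *t XE i"
    unfolding Y_def Se_simps(1)[OF a lg_inv(1)[OF i]]
    using a lg_inv(1)[OF i] E_closed[OF X_E[OF i]] by (simp add: tw.T.m_assoc)
  then show ?thesis unfolding lg_inv(2)[OF i] Se_X[OF i] .
qed

lemma Y_Se:
  assumes i: "i \<in> {1..n}" and f: "pol j f"
  shows "(j = 0 \<longrightarrow> pp (Y i *t Se f) = \<zero>\<^bsub>TR\<^esub>) \<and> (\<forall>k. j = Suc k \<longrightarrow> (\<exists>g. pol k g \<and> pp (Y i *t Se f) = Se g))"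
proof -
  note a = simple_root[OF i]
  have aL: "\<alpha> i \<in> \<Lambda>" using root_in_lattice[OF a(1)] .
  have c: "f \<in> carrier SR" "lg (\<alpha> i) \<in> carrier SR" "xx (\<alpha> i) \<in> carrier SR"
    using pol_closed[OF f] lg_closed[OF aL] xx_closed[OF aL] by auto
  have "Y i = Qe (q (lg_inv i) \<otimes>\<^bsub>QR\<^esub> x_inv (\<alpha> i)) *t (\<one>\<^bsub>TR\<^esub> -t \<eta> (reflection (\<alpha> i)))"
    unfolding Y_def X_simple[OF i] using x_inv(1)[OF a(1)] lg_inv(1)[OF i] a
    by (simp add: tw.emb_simps tw.T.m_assoc)
  then have Y: "pp (Y i *t Se f) = Qe (q (lg_inv i) \<otimes>\<^bsub>QR\<^esub> x_inv (\<alpha> i)) *t Se (f \<ominus>\<^bsub>SR\<^esub> fga_act (reflection (\<alpha> i)) f)"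
    using x_inv(1)[OF a(1)] lg_inv(1)[OF i] a c
    by (simp add: tw.T.m_assoc pp_Qe one_minus_eta_Se)
  have "q (lg_inv i) \<otimes>\<^bsub>QR\<^esub> x_inv (\<alpha> i) \<otimes>\<^bsub>QR\<^esub> q (lg (\<alpha> i)) = x_inv (\<alpha> i) \<otimes>\<^bsub>QR\<^esub> q (lg (\<alpha> i) \<otimes>\<^bsub>SR\<^esub> lg_inv i)"
    unfolding q_simps(1)[OF c(2) lg_inv(1)[OF i]]
    using x_inv(1)[OF a(1)] lg_inv(1)[OF i] c by (simp only: Q.m_ac q_closed Q.m_closed)
  also have "\<dots> = \<one>\<^bsub>QR\<^esub>" unfolding lg_inv(2)[OF i] by (rule x_inv(2)[OF a(1)])
  finally have inv: "q (lg_inv i) \<otimes>\<^bsub>QR\<^esub> x_inv (\<alpha> i) \<otimes>\<^bsub>QR\<^esub> q (lg (\<alpha> i)) = \<one>\<^bsub>QR\<^esub>" .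
  have Qc: "q (lg_inv i) \<otimes>\<^bsub>QR\<^esub> x_inv (\<alpha> i) \<in> carrier QR"
    using x_inv(1)[OF a(1)] lg_inv(1)[OF i] by simp
  show ?thesis
  proof (intro conjI allI impI)
    assume "j = 0"
    then have "f \<ominus>\<^bsub>SR\<^esub> fga_act (reflection (\<alpha> i)) f = \<zero>\<^bsub>SR\<^esub>" using pol_divided_difference[OF f a(1)] by simp
    then show "pp (Y i *t Se f) = \<zero>\<^bsub>TR\<^esub>" unfolding Y using Qc Se_simps(4) by simp
  next
    fix k assume "j = Suc k"
    then obtain g where g: "pol k g" "f \<ominus>\<^bsub>SR\<^esub> fga_act (reflection (\<alpha> i)) f = lg (\<alpha> i) \<otimes>\<^bsub>SR\<^esub> g"
      using pol_divided_difference[OF f a(1)] by blast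
    have gc: "g \<in> carrier SR" by (rule pol_closed[OF g(1)])
    have "pp (Y i *t Se f) = Qe (q (lg_inv i) \<otimes>\<^bsub>QR\<^esub> x_inv (\<alpha> i) \<otimes>\<^bsub>QR\<^esub> q (lg (\<alpha> i))) *t Se g"
      unfolding Y g(2) Se_simps(1)[OF c(2) gc] tw.emb_simps(1)[OF Qc q_closed[OF c(2)]]
      using Qc c gc by (simp add: tw.T.m_assoc del: tw.emb_simps)
    also have "\<dots> = Se g" unfolding inv using gc by (simp add: tw.emb_simps)
    finally show "\<exists>g. pol k g \<and> pp (Y i *t Se f) = Se g" using g(1) by blast
  qed
qed

section \<open>Operators that vanish on low degrees\<close>

definition kills :: "nat \<Rightarrow> ('v, 'r) qwa \<Rightarrow> bool" where
  "kills k d \<longleftrightarrow> (\<forall>j<k. \<forall>f. pol j f \<longrightarrow> pp (d *t Se f) = \<zero>\<^bsub>TR\<^esub>)"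

text \<open>\<open>Y i\<close> lowers the degree by one and kills degree 0, so applying it first
  lets the operator kill one degree more.\<close>

lemma kills_Y:
  assumes d: "d \<in> CT" "kills k d" and i: "i \<in> {1..n}" shows "kills (Suc k) (d *t Y i)"
  unfolding kills_def
proof (intro allI impI)
  fix j f assume j: "j < Suc k" and f: "pol j f"
  have c: "Se f \<in> CT" "Y i \<in> CT" using pol_closed[OF f] E_closed[OF Y_E[OF i]] by auto
  have e: "pp (d *t Y i *t Se f) = pp (d *t pp (Y i *t Se f))"
    using d c by (simp only: tw.T.m_assoc pp_right[of d "Y i *t Se f"] tw.T.m_closed)
  show "pp (d *t Y i *t Se f) = \<zero>\<^bsub>TR\<^esub>"
  proof (cases j)
    case 0
    then show ?thesis unfolding e using Y_Se[OF i f] d by (simp add: pp_zero)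
  next
    case (Suc m)
    then obtain g where "pol m g" "pp (Y i *t Se f) = Se g" using Y_Se[OF i f] by blast
    then show ?thesis unfolding e using d(2) j Suc by (auto simp: kills_def)
  qed
qed

definition word :: "nat list \<Rightarrow> ('v, 'r) qwa" where
  "word is = foldr (\<lambda>i x. Y i *t x) is \<one>\<^bsub>TR\<^esub>"

lemma word_simps: "word [] = \<one>\<^bsub>TR\<^esub>" "word (i # is) = Y i *t word is"
  by (simp_all add: word_def)

lemma word_E: "set is \<subseteq> {1..n} \<Longrightarrow> word is \<in> E"
  by (induction "is") (simp_all add: word_simps E_ops Y_E)

lemma word_closed: "set is \<subseteq> {1..n} \<Longrightarrow> word is \<in> CT"
  using word_E E_closed by blast

lemma word_snoc: "set is \<subseteq> {1..n} \<Longrightarrow> i \<in> {1..n} \<Longrightarrow> word (is @ [i]) = word is *t Y i"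
proof (induction "is")
  case Nil then show ?case using E_closed[OF Y_E] by (simp add: word_simps)
next
  case (Cons j "is")
  then show ?case using E_closed[OF Y_E] word_closed by (simp add: word_simps tw.T.m_assoc)
qed

lemma word_kills: "set is \<subseteq> {1..n} \<Longrightarrow> kills (length is) (word is)"
proof (induction "is" rule: rev_induct)
  case Nil then show ?case by (simp add: kills_def)
next
  case (snoc i "is")
  then have i: "set is \<subseteq> {1..n}" "i \<in> {1..n}" by auto
  show ?case using kills_Y[OF word_closed[OF i(1)] snoc(1)[OF i(1)] i(2)] by (simp only: word_snoc[OF i]) simp
qed

text \<open>Multiplication by \<open>lg v\<close> raises the degree, which costs one level. For c =
  lg(u v) this combination has no component at u, which is how the support will shrink.\<close>

lemma kills_commutator:
  assumes d: "d \<in> CT" "kills (Suc k) d" and v: "v \<in> \<Lambda>" and c: "c \<in> carrier QR"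
  shows "kills k (d *t Se (lg v) -t Qe c *t d)"
  unfolding kills_def
proof (intro allI impI)
  fix j f assume j: "j < k" and f: "pol j f"
  have fc: "f \<in> carrier SR" "lg v \<in> carrier SR" using pol_closed[OF f] lg_closed[OF v] by auto
  have "(d *t Se (lg v) -t Qe c *t d) *t Se f = d *t Se (lg v) *t Se f -t Qe c *t d *t Se f"
    using d(1) c fc by (simp add: a_minus_def tw.T.l_distr tw.T.l_minus)
  also have "\<dots> = d *t Se (lg v \<otimes>\<^bsub>SR\<^esub> f) -t Qe c *t (d *t Se f)"
    unfolding Se_simps(1)[OF fc(2,1)] using d(1) c fc by (simp add: tw.T.m_assoc del: tw.emb_simps)
  finally have "pp ((d *t Se (lg v) -t Qe c *t d) *t Se f) = pp (d *t Se (lg v \<otimes>\<^bsub>SR\<^esub> f)) -t Qe c *t pp (d *t Se f)"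
    using d(1) c fc by (simp only: pp_minus pp_Qe tw.T.m_closed Se_closed S.m_closed tw.emb_closed)
  moreover have "pp (d *t Se (lg v \<otimes>\<^bsub>SR\<^esub> f)) = \<zero>\<^bsub>TR\<^esub>" "pp (d *t Se f) = \<zero>\<^bsub>TR\<^esub>"
    using d(2)[unfolded kills_def, rule_format, OF _ pol_lg[OF v f]]
      d(2)[unfolded kills_def, rule_format, OF _ f] j by simp_all
  ultimately show "pp ((d *t Se (lg v) -t Qe c *t d) *t Se f) = \<zero>\<^bsub>TR\<^esub>" using c by (simp add: a_minus_def)
qed

text \<open>Induction on the support, as for independence of characters: d lg(v) - lg(u v) d loses
  the component at u and multiplies the one at w by an invertible difference, so all components
  except that at u vanish.\<close>

lemma kills_small_support:
  assumes "finite B" "B \<subseteq> W" "d \<in> CT" "\<And>u. d u \<noteq> \<zero>\<^bsub>QR\<^esub> \<Longrightarrow> u \<in> {0} \<times> B" "kills (card B) d"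
  shows "d = \<zero>\<^bsub>TR\<^esub>"
  using assms
proof (induction B arbitrary: d rule: finite_induct)
  case empty
  then show ?case by (auto simp: tw.T_simps fun_eq_iff)
next
  case (insert u B)
  have u: "u \<in> W" "B \<subseteq> W" using insert(4) by auto
  have zero: "d (0, w) = \<zero>\<^bsub>QR\<^esub>" if w: "w \<in> B" for w
  proof -
    have wW: "w \<in> W" "u \<noteq> w" using w u insert(2) by auto
    obtain v c where v: "v \<in> \<Lambda>" and c: "c \<in> carrier QR" "c \<otimes>\<^bsub>QR\<^esub> (q (lg (w v)) \<ominus>\<^bsub>QR\<^esub> q (lg (u v))) = \<one>\<^bsub>QR\<^esub>"
      using separating[OF u(1) wW] by blast
    have L: "lg v \<in> carrier SR" "lg (x v) \<in> carrier SR" if "x \<in> W" for x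
      using lg_closed v weyl_root_lattice[OF that v] by auto
    let ?d = "d *t Se (lg v) -t Qe (q (lg (u v))) *t d"
    have dc: "?d \<in> CT" using insert(5) L[OF u(1)] by simp
    have val: "?d (0, x) = d (0, x) \<otimes>\<^bsub>QR\<^esub> (q (lg (x v)) \<ominus>\<^bsub>QR\<^esub> q (lg (u v)))" if x: "x \<in> W" for x
    proof -
      have dx: "d (0, x) \<in> carrier QR" by (rule tw.T_val[OF insert(5)])
      have "?d (0, x) = (d *t Se (lg v)) (0, x) \<ominus>\<^bsub>QR\<^esub> (Qe (q (lg (u v))) *t d) (0, x)"
        using insert(5) L[OF u(1)] by (intro tw.T_minus) simp_all
      also have "\<dots> = d (0, x) \<otimes>\<^bsub>QR\<^esub> q (lg (x v)) \<ominus>\<^bsub>QR\<^esub> q (lg (u v)) \<otimes>\<^bsub>QR\<^esub> d (0, x)"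
        using insert(5) L[OF u(1)] L[OF x] x by (simp add: tw.mult_emb_val tw.emb_mult_val Q_act_q s_lg v)
      also have "\<dots> = d (0, x) \<otimes>\<^bsub>QR\<^esub> (q (lg (x v)) \<ominus>\<^bsub>QR\<^esub> q (lg (u v)))"
        using dx q_closed[OF L(2)[OF x]] q_closed[OF L(2)[OF u(1)]] by algebra
      finally show ?thesis .
    qed
    have "?d = \<zero>\<^bsub>TR\<^esub>"
    proof (rule insert(3)[OF u(2) dc])
      show "kills (card B) ?d"
        using insert(1,2,5,7) v L[OF u(1)] by (intro kills_commutator) simp_all
      fix y assume y: "?d y \<noteq> \<zero>\<^bsub>QR\<^esub>"
      have yc: "y \<in> carrier WA" using y tw.T_off[OF dc] by blast
      then obtain l x where yx: "y = (l, x)" "x \<in> W" by (cases y) (auto simp: WA_carrier)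
      have "?d y = (d *t Se (lg v)) y \<ominus>\<^bsub>QR\<^esub> (Qe (q (lg (u v))) *t d) y"
        using insert(5) L[OF u(1)] by (intro tw.T_minus) simp_all
      also have "\<dots> = d y \<otimes>\<^bsub>QR\<^esub> Q_act y (q (lg v)) \<ominus>\<^bsub>QR\<^esub> q (lg (u v)) \<otimes>\<^bsub>QR\<^esub> d y"
        using insert(5) L[OF u(1)] yc by (simp add: tw.mult_emb_val tw.emb_mult_val)
      finally have "d y \<noteq> \<zero>\<^bsub>QR\<^esub>" using y L[OF u(1)] yx by (auto simp: a_minus_def)
      then have "y \<in> {0} \<times> insert u B" by (rule insert(6))
      moreover have "y \<noteq> (0, u)"
        using y val[OF u(1)] tw.T_val[OF insert(5)] L(2)[OF u(1)] by (auto simp: a_minus_def Q.r_neg)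
      ultimately show "y \<in> {0} \<times> B" by auto
    qed
    then have "d (0, w) \<otimes>\<^bsub>QR\<^esub> (q (lg (w v)) \<ominus>\<^bsub>QR\<^esub> q (lg (u v))) = \<zero>\<^bsub>QR\<^esub>"
      using val[OF wW(1)] by (simp add: tw.T_simps)
    moreover have "q (lg (w v)) \<ominus>\<^bsub>QR\<^esub> q (lg (u v)) \<in> carrier QR" using L[OF wW(1)] L[OF u(1)] by simp
    moreover have "d (0, w) = d (0, w) \<otimes>\<^bsub>QR\<^esub> (c \<otimes>\<^bsub>QR\<^esub> (q (lg (w v)) \<ominus>\<^bsub>QR\<^esub> q (lg (u v))))"
      unfolding c(2) using tw.T_val[OF insert(5)] by simp
    ultimately show ?thesis using c(1) tw.T_val[OF insert(5)] by (simp add: Q.m_lcomm)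
  qed
  \<comment> \<open>Only the component at u is left, and it is read off from the value of
    \<open>d\<close> at the constant 1.\<close>
  define c where "c = d (0, u)"
  have c: "c \<in> carrier QR" unfolding c_def by (rule tw.T_val[OF insert(5)])
  have d: "d = tel c (0, u)"
  proof
    fix y
    show "d y = tel c (0, u) y"
    proof (cases "d y = \<zero>\<^bsub>QR\<^esub>")
      case False
      then have "y \<in> {0} \<times> insert u B" by (rule insert(6))
      then show ?thesis using zero False by (auto simp: tw.tw_val c_def)
    qed (auto simp: tw.tw_val c_def)
  qed
  have "pp (d *t Se \<one>\<^bsub>SR\<^esub>) = \<zero>\<^bsub>TR\<^esub>"
    using insert(1,2,7) pol_one by (auto simp: kills_def)
  then have "tel c (0, id :: 'v \<Rightarrow> 'v) = \<zero>\<^bsub>TR\<^esub>"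
    using insert(5) d pp_tel[OF c u(1)] by (simp only: Se_simps tw.T.r_one)
  then have "tel c (0 :: 'v, id :: 'v \<Rightarrow> 'v) (0, id) = \<zero>\<^bsub>TR\<^esub> (0, id)" by (simp only:)
  then have "c = \<zero>\<^bsub>QR\<^esub>" by (simp only: tw.T_simps tw.tw_val if_True refl)
  then show ?case unfolding d by (auto simp: tw.T_simps tw.tw_val)
qed

lemma E_support: "y \<in> E \<Longrightarrow> y (l, w) \<noteq> \<zero>\<^bsub>QR\<^esub> \<Longrightarrow> l = 0"
  unfolding E_def
proof (induction arbitrary: l w rule: generate_ring.induct)
  case one
  then show ?case by (auto simp: tw.T_simps tw.tw_val WA_one split: if_splits)
next
  case (incl h)
  then consider t where "t \<in> carrier SR" "h = Se t" | i where "i \<in> {1..n}" "h = XE i" by blast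
  then show ?case
  proof cases
    case 1
    then show ?thesis using incl(2) by (auto simp: tw.emb_val WA_one split: if_splits)
  next
    case 2
    note a = simple_root[OF 2(1)]
    have "h (l, w) = x_inv (\<alpha> i) \<otimes>\<^bsub>QR\<^esub> (\<one>\<^bsub>TR\<^esub> -t \<eta> (reflection (\<alpha> i))) (l, w)"
      unfolding 2(2) X_simple[OF 2(1)] using x_inv(1)[OF a(1)] a by (intro tw.emb_mult_val) simp_all
    also have "(\<one>\<^bsub>TR\<^esub> -t \<eta> (reflection (\<alpha> i))) (l, w) = \<one>\<^bsub>TR\<^esub> (l, w) \<ominus>\<^bsub>QR\<^esub> \<eta> (reflection (\<alpha> i)) (l, w)"
      using a by (intro tw.T_minus) simp_all
    finally show ?thesis using incl(2) x_inv(1)[OF a(1)]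
      by (auto simp: tw.T_simps eta_tel tw.tw_val WA_one a_minus_def split: if_splits)
  qed
next
  case (a_inv h)
  have h: "h \<in> CT" using a_inv(1) E_closed unfolding E_def by blast
  have "\<ominus>\<^bsub>TR\<^esub> h = \<zero>\<^bsub>TR\<^esub> -t h" using h by (simp add: a_minus_def)
  then have "(\<ominus>\<^bsub>TR\<^esub> h) (l, w) = \<zero>\<^bsub>QR\<^esub> \<ominus>\<^bsub>QR\<^esub> h (l, w)" using h by (simp add: tw.T_minus) (simp add: tw.T_simps)
  then have "h (l, w) \<noteq> \<zero>\<^bsub>QR\<^esub>" using a_inv(3) by (intro notI) (simp add: a_minus_def)
  then show ?case by (rule a_inv(2))
next
  case (eng_add h1 h2)
  show ?case
  proof (rule ccontr)
    assume "l \<noteq> 0"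
    then have "h1 (l, w) = \<zero>\<^bsub>QR\<^esub>" "h2 (l, w) = \<zero>\<^bsub>QR\<^esub>" using eng_add(3,4)[of l w] by metis+
    then show False using eng_add(5) by (simp only: tw.T_simps(3)) simp
  qed
next
  case (eng_mult h1 h2)
  have h: "h1 \<in> CT" "h2 \<in> CT" using eng_mult(1,2) E_closed unfolding E_def by blast+
  show ?case
  proof (rule ccontr)
    assume l: "l \<noteq> 0"
    have "{(v, v'). h1 v \<noteq> \<zero>\<^bsub>QR\<^esub> \<and> h2 v' \<noteq> \<zero>\<^bsub>QR\<^esub> \<and> v \<otimes>\<^bsub>WA\<^esub> v' = (l, w)} = {}"
    proof (rule ccontr)
      assume "\<not> ?thesis"
      then obtain m u m' u' where *: "h1 (m, u) \<noteq> \<zero>\<^bsub>QR\<^esub>" "h2 (m', u') \<noteq> \<zero>\<^bsub>QR\<^esub>" "(m, u) \<otimes>\<^bsub>WA\<^esub> (m', u') = (l, w)"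
        unfolding ex_in_conv[symmetric] by (elim exE CollectE case_prodE conjE) (metis surj_pair)
      have "m = 0" "m' = 0" using eng_mult(3)[OF *(1)] eng_mult(4)[OF *(2)] by auto
      moreover have "u \<in> W" using *(1) tw.T_off[OF h(1)] WA_carrier by blast
      ultimately show False using * l by (simp add: WA_mult linear_0[OF weyl_linear])
    qed
    then have "(h1 *t h2) (l, w) = \<zero>\<^bsub>QR\<^esub>" by (simp only: tw.T_mult Q.finsum_empty)
    then show False using eng_mult(5) by simp
  qed
qed

text \<open>\<open>card W\<close> is the number of possible support points, so a word of that length
  kills enough degrees for \<open>kills_small_support\<close>.\<close>

lemma word_nilpotent:
  assumes "set is \<subseteq> {1..n}" "length is = card W" shows "word is = \<zero>\<^bsub>TR\<^esub>"
proof (rule kills_small_support[OF finite_weyl order_refl])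
  show "word is \<in> CT" by (rule word_closed[OF assms(1)])
  show "kills (card W) (word is)" using word_kills[OF assms(1)] assms(2) by simp
  fix u assume u: "word is u \<noteq> \<zero>\<^bsub>QR\<^esub>"
  then have "u \<in> carrier WA" using tw.T_off[OF word_closed[OF assms(1)]] by blast
  then show "u \<in> {0} \<times> W" using u E_support[OF word_E[OF assms(1)]] by (cases u) (auto simp: WA_carrier)
qed


subsection \<open>The ideal generated by the averaging element\<close>

text \<open>Left coefficients from S suffice: by \<open>E_mult_e\<close>, left multiplication by E
  keeps S e inside itself. So this is all of E e E, and membership of 1 already has the shape needed
  for dual bases.\<close>

inductive_set JE :: "('v, 'r) qwa set" where
  JE_zero: "\<zero>\<^bsub>TR\<^esub> \<in> JE"
| JE_step: "\<lbrakk>a \<in> carrier SR; d \<in> E; x \<in> JE\<rbrakk> \<Longrightarrow> Se a *t e *t d +t x \<in> JE"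

lemma JE_closed: "x \<in> JE \<Longrightarrow> x \<in> CT"
  by (induction rule: JE.induct) (auto simp: E_closed)

lemma JE_add: "x \<in> JE \<Longrightarrow> y \<in> JE \<Longrightarrow> x +t y \<in> JE"
proof (induction rule: JE.induct)
  case (JE_step a d x)
  then have "Se a *t e *t d +t x +t y = Se a *t e *t d +t (x +t y)"
    by (simp add: tw.T.a_assoc E_closed JE_closed)
  then show ?case using JE_step JE.JE_step by simp
qed (simp add: JE_closed)

lemma JE_gen: "a \<in> carrier SR \<Longrightarrow> d \<in> E \<Longrightarrow> Se a *t e *t d \<in> JE"
  using JE_step[OF _ _ JE_zero, of a d] by (simp add: E_closed)

lemma E_mult_e:
  assumes y: "y \<in> E" and a: "a \<in> carrier SR"
  shows "\<exists>c\<in>carrier SR. y *t (Se a *t e) = Se c *t e"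
proof -
  obtain c where c: "c \<in> carrier SR" "pp (y *t Se a) = Se c" using E_Se[OF y a] by blast
  have "y *t (Se a *t e) = pp (y *t Se a) *t e"
    using E_closed[OF y] a by (simp add: pp_mult_e tw.T.m_assoc)
  then show ?thesis using c by auto
qed

lemma JE_left: "x \<in> JE \<Longrightarrow> y \<in> E \<Longrightarrow> y *t x \<in> JE"
proof (induction rule: JE.induct)
  case (JE_step a d x)
  obtain c where c: "c \<in> carrier SR" "y *t (Se a *t e) = Se c *t e" using E_mult_e[OF JE_step(5,1)] by blast
  have "y *t (Se a *t e *t d +t x) = y *t (Se a *t e) *t d +t y *t x"
    using JE_step by (simp add: tw.T.r_distr tw.T.m_assoc E_closed JE_closed)
  then show ?case unfolding c(2) using JE.JE_step[OF c(1) JE_step(2)] JE_step by simp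
qed (simp add: JE_zero E_closed)

lemma JE_minus: "x \<in> JE \<Longrightarrow> y \<in> JE \<Longrightarrow> x -t y \<in> JE"
proof -
  assume x: "x \<in> JE" and y: "y \<in> JE"
  have "(\<zero>\<^bsub>TR\<^esub> -t \<one>\<^bsub>TR\<^esub>) *t y \<in> JE" by (rule JE_left[OF y]) (intro E_ops)
  then have "\<ominus>\<^bsub>TR\<^esub> y \<in> JE" using JE_closed[OF y] by (simp add: a_minus_def tw.T.l_minus)
  then show ?thesis using JE_add[OF x] by (simp add: a_minus_def)
qed

lemma JE_finsum: "finite A \<Longrightarrow> (\<And>i. i \<in> A \<Longrightarrow> f i \<in> JE) \<Longrightarrow> (\<Oplus>\<^bsub>TR\<^esub>i\<in>A. f i) \<in> JE"
proof (induction A rule: finite_induct)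
  case (insert x A)
  then have "f \<in> A \<rightarrow> CT" "f x \<in> CT" using JE_closed by auto
  then show ?case using insert by (simp add: JE_add)
qed (simp add: JE_zero)

text \<open>Modulo the ideal, a nonzero word of maximal length would be \<open>W\<close>-invariant, hence equal to its average.\<close>

lemma JE_invariant:
  assumes u: "u \<in> E" and Yu: "\<And>i. i \<in> {1..n} \<Longrightarrow> Y i *t u \<in> JE"
  shows "u \<in> JE"
proof -
  have uc: "u \<in> CT" by (rule E_closed[OF u])
  have s: "\<eta> (reflection (\<alpha> i)) *t u -t u \<in> JE" if i: "i \<in> {1..n}" for i
  proof -
    have a: "lg (\<alpha> i) \<in> carrier SR" using simple_root(1)[OF i] root_in_lattice lg_closed by simp
    have Yc: "Y i \<in> CT" "\<eta> (reflection (\<alpha> i)) \<in> CT" using E_closed[OF Y_E[OF i]] simple_root(2)[OF i] by auto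
    have "Se (lg (\<alpha> i)) *t (Y i *t u) = (\<one>\<^bsub>TR\<^esub> -t \<eta> (reflection (\<alpha> i))) *t u"
      unfolding lg_Y[OF i, symmetric] using a Yc uc by (simp add: tw.T.m_assoc)
    also have "\<dots> = u -t \<eta> (reflection (\<alpha> i)) *t u"
      using Yc uc by (simp add: a_minus_def tw.T.l_distr tw.T.l_minus)
    finally have "u -t \<eta> (reflection (\<alpha> i)) *t u \<in> JE" using JE_left[OF Yu[OF i] Se_E[OF a]] by simp
    from JE_minus[OF JE_zero this] show ?thesis
      using Yc uc by (simp add: a_minus_def tw.T.minus_add tw.T.a_comm)
  qed
  have w: "\<eta> w *t u -t u \<in> JE" if w: "w \<in> W" for w
  proof -
    obtain "is" where "is": "set is \<subseteq> I" "w = sprod is" using weyl_sprod[OF w] by blast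
    have "\<eta> (sprod is) *t u -t u \<in> JE" using "is"(1)
    proof (induction "is")
      case Nil
      have "\<eta> (sprod []) *t u -t u = \<zero>\<^bsub>TR\<^esub>" using uc
        by (simp only: sprod_simps eta_id tw.T.l_one) (simp add: a_minus_def tw.T.r_neg)
      then show ?case by (simp only: JE_zero)
    next
      case (Cons i "is")
      have i: "i \<in> {1..n}" "set is \<subseteq> I" using Cons(2) by (auto simp: I_def)
      let ?s = "\<eta> (reflection (\<alpha> i))" and ?w = "\<eta> (sprod is)"
      have c: "?s \<in> CT" "?w \<in> CT" using simple_root(2)[OF i(1)] sprod_weyl[OF i(2)] by auto
      have e: "\<eta> (sprod (i # is)) = ?s *t ?w"
        unfolding sprod_simps using simple_root(2)[OF i(1)] sprod_weyl[OF i(2)] by (simp only: eta_mult)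
      have "?s *t (?w *t u -t u) +t (?s *t u -t u) = ?s *t ?w *t u -t ?s *t u +t (?s *t u -t u)"
        using c uc by (simp add: a_minus_def tw.T.r_distr tw.T.r_minus tw.T.m_assoc)
      also have "\<dots> = ?s *t ?w *t u -t u"
      proof -
        have "A -t B +t (B -t u) = A -t u" if "A \<in> CT" "B \<in> CT" for A B
        proof -
          have "A -t B +t (B -t u) = A +t ((\<ominus>\<^bsub>TR\<^esub> B +t B) +t \<ominus>\<^bsub>TR\<^esub> u)"
            using that uc by (simp add: a_minus_def tw.T.a_assoc)
          then show ?thesis using that uc by (simp add: tw.T.l_neg a_minus_def)
        qed
        then show ?thesis using c uc by simp
      qed
      finally have "?s *t ?w *t u -t u = ?s *t (?w *t u -t u) +t (?s *t u -t u)" ..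
      moreover have "?s *t (?w *t u -t u) +t (?s *t u -t u) \<in> JE"
        by (intro JE_add JE_left Cons(1)[OF i(2)] eta_simple_E[OF i(1)] s[OF i(1)])
      ultimately show ?case unfolding e by simp
    qed
    then show ?thesis by (simp only: "is"(2))
  qed
  have sub: "A -t B +t B = A" if "A \<in> CT" "B \<in> CT" for A B
    using that by (simp add: a_minus_def tw.T.a_assoc tw.T.l_neg)
  have ewc: "\<eta> w *t u -t u \<in> CT" if "w \<in> W" for w using that uc by simp
  have "(\<Oplus>\<^bsub>TR\<^esub>w\<in>W. \<eta> w *t u) = (\<Oplus>\<^bsub>TR\<^esub>w\<in>W. (\<eta> w *t u -t u) +t u)"
    by (rule tw.T.finsum_cong') (use uc sub in auto)
  also have "\<dots> = (\<Oplus>\<^bsub>TR\<^esub>w\<in>W. \<eta> w *t u -t u) +t (\<Oplus>\<^bsub>TR\<^esub>w\<in>W. u)"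
    by (rule tw.T.finsum_addf) (use uc ewc in auto)
  finally have "e *t u = Se avg *t ((\<Oplus>\<^bsub>TR\<^esub>w\<in>W. \<eta> w *t u -t u) +t (\<Oplus>\<^bsub>TR\<^esub>w\<in>W. u))"
    by (simp only: e_mult[OF uc])
  also have "\<dots> = Se avg *t (\<Oplus>\<^bsub>TR\<^esub>w\<in>W. \<eta> w *t u -t u) +t Se avg *t (\<Oplus>\<^bsub>TR\<^esub>w\<in>W. u)"
    by (rule tw.T.r_distr) (use avg(1) uc ewc in \<open>auto intro!: tw.T.finsum_closed\<close>)
  \<comment> \<open>\<open>e *t u\<close> differs from \<open>u\<close> by an element of the ideal,
    and it also lies in the ideal itself.\<close>
  finally have eu: "e *t u = Se avg *t (\<Oplus>\<^bsub>TR\<^esub>w\<in>W. \<eta> w *t u -t u) +t u" unfolding avg_sum[OF uc] .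
  have J: "Se avg *t (\<Oplus>\<^bsub>TR\<^esub>w\<in>W. \<eta> w *t u -t u) \<in> JE"
    by (rule JE_left[OF JE_finsum[OF finite_weyl w] Se_E[OF avg(1)]])
  have "Se \<one>\<^bsub>SR\<^esub> *t e *t u \<in> JE" by (rule JE_gen) (use u in auto)
  then have "e *t u \<in> JE" using uc by (simp only: Se_simps tw.T.l_one e_closed)
  then have "e *t u -t Se avg *t (\<Oplus>\<^bsub>TR\<^esub>w\<in>W. \<eta> w *t u -t u) \<in> JE" using J by (rule JE_minus)
  moreover have "A +t u -t A = u" if "A \<in> CT" for A
    using that uc by (simp add: a_minus_def tw.T.a_comm[of A u] tw.T.a_assoc tw.T.r_neg)
  ultimately show ?thesis unfolding eu using JE_closed[OF J] by simp
qed

lemma one_JE: "\<one>\<^bsub>TR\<^esub> \<in> JE"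
proof (rule ccontr)
  assume 1: "\<one>\<^bsub>TR\<^esub> \<notin> JE"
  let ?P = "\<lambda>k. \<forall>is. set is \<subseteq> {1..n} \<and> length is = k \<longrightarrow> word is \<in> JE"
  have step: "?P k" if h: "?P (Suc k)" for k
  proof (intro allI impI)
    fix "is" assume "is": "set is \<subseteq> {1..n} \<and> length is = k"
    show "word is \<in> JE"
    proof (rule JE_invariant)
      show "word is \<in> E" using word_E "is" by blast
      fix i assume "i \<in> {1..n}"
      then show "Y i *t word is \<in> JE" using h[rule_format, of "i # is"] "is" by (simp add: word_simps)
    qed
  qed
  have "?P (card W)" using word_nilpotent JE_zero by auto
  moreover have "?P k \<Longrightarrow> ?P 0" for k
    by (induction k) (use step in blast)+
  ultimately have "?P 0" by blast
  then show False using 1 word_simps(1) by force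
qed


subsection \<open>The two isomorphisms\<close>

abbreviation "SW \<equiv> S_invariants F \<Phi>"
abbreviation "Z \<equiv> ring_centre (TR\<lparr>carrier := D\<rparr>)"

lemma SW_iff: "s \<in> carrier SW \<longleftrightarrow> s \<in> carrier SR \<and> (\<forall>w\<in>W. fga_act w s = s)"
  by (simp add: S_invariants_def)

lemma central_Se: "s \<in> carrier SR \<Longrightarrow> central (Se s) \<longleftrightarrow> s \<in> carrier SW"
proof
  assume s: "s \<in> carrier SR" "central (Se s)"
  have "fga_act w s = s" if w: "w \<in> W" for w
  proof -
    have a: "fga_act w s \<in> carrier SR" using s w s_simps(1) by blast
    have "Se s *t \<eta> w = Se (fga_act w s) *t \<eta> w"
      using s(2) w eta_closed[OF w] unfolding eta_Se[OF w s(1), symmetric] by (auto simp: central_def)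
    then have "pp (Se s *t \<eta> w) = pp (Se (fga_act w s) *t \<eta> w)" by simp
    then have "Se s = Se (fga_act w s)" using s w a by (simp add: pp_mult_eta pp_Qe0)
    then show ?thesis using Se_inj[OF s(1) a] by simp
  qed
  then show "s \<in> carrier SW" using s by (simp add: SW_iff)
next
  assume s: "s \<in> carrier SR" "s \<in> carrier SW"
  show "central (Se s)"
    by (rule centralI) (use s in \<open>simp_all add: pp_Qe0 eta_Se SW_iff\<close>)
qed

text \<open>Centrality in D is as strong as centrality in the whole ring. Commuting with all
  \<open>Se (lg v)\<close> removes the coefficients off the translations, since v can be chosen with
  lg(w v) - lg(v) invertible; commuting with the \<open>\<eta> w\<close> then suffices by
  \<open>centralI\<close>.\<close>

lemma centre_iff: "z \<in> Z \<longleftrightarrow> z \<in> D \<and> central z \<and> pp z = z"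
proof
  assume "z \<in> Z"
  then have z: "z \<in> D" and comm: "\<And>y. y \<in> D \<Longrightarrow> z *t y = y *t z" by (auto simp: ring_centre_def)
  have zc: "z \<in> CT" by (rule D_closed[OF z])
  have off: "z (l, w) = \<zero>\<^bsub>QR\<^esub>" if w: "w \<noteq> id" for l w
  proof (cases "(l, w) \<in> carrier WA")
    case True
    then have wW: "w \<in> W" by (simp add: WA_carrier)
    obtain v c where v: "v \<in> \<Lambda>" and c: "c \<in> carrier QR" "c \<otimes>\<^bsub>QR\<^esub> (q (lg (w v)) \<ominus>\<^bsub>QR\<^esub> q (lg (id v))) = \<one>\<^bsub>QR\<^esub>"
      using separating[OF weyl_id wW] w by metis
    have L: "lg v \<in> carrier SR" "lg (w v) \<in> carrier SR" using lg_closed v weyl_root_lattice[OF wW v] by auto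
    have zl: "z (l, w) \<in> carrier QR" by (rule tw.T_val[OF zc])
    have "(z *t Se (lg v)) (l, w) = (Se (lg v) *t z) (l, w)"
      using comm[of "Se (lg v)"] Se_E[OF L(1)] E_D by auto
    then have "z (l, w) \<otimes>\<^bsub>QR\<^esub> q (lg (w v)) = q (lg v) \<otimes>\<^bsub>QR\<^esub> z (l, w)"
      using zc L True wW by (simp add: tw.mult_emb_val tw.emb_mult_val Q_act_q s_lg v)
    then have "z (l, w) \<otimes>\<^bsub>QR\<^esub> (q (lg (w v)) \<ominus>\<^bsub>QR\<^esub> q (lg v)) = \<zero>\<^bsub>QR\<^esub>"
      using zl q_closed[OF L(1)] q_closed[OF L(2)]
      by (simp add: a_minus_def Q.r_distr Q.r_minus Q.m_comm[of "q (lg v)"] Q.r_neg)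
    then have "c \<otimes>\<^bsub>QR\<^esub> (q (lg (w v)) \<ominus>\<^bsub>QR\<^esub> q (lg v)) \<otimes>\<^bsub>QR\<^esub> z (l, w) = \<zero>\<^bsub>QR\<^esub>"
      using zl c(1) q_closed[OF L(1)] q_closed[OF L(2)]
      by (simp add: Q.m_assoc Q.m_comm[of "q (lg (w v)) \<ominus>\<^bsub>QR\<^esub> q (lg v)"])
    then show ?thesis using c(2) zl by simp
  qed (rule tw.T_off[OF zc])
  have "pp z (l, w) = z (l, w)" for l w
  proof (cases "w = id")
    case True
    have "(\<Oplus>\<^bsub>QR\<^esub>w'\<in>W. z (l, w')) = (\<Oplus>\<^bsub>QR\<^esub>w'\<in>W. if id = w' then z (l, w') else \<zero>\<^bsub>QR\<^esub>)"
    proof (rule Q.finsum_cong')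
      show "z (l, w') = (if id = w' then z (l, w') else \<zero>\<^bsub>QR\<^esub>)" for w' using off[of w' l] by (cases "id = w'") metis+
      show "(\<lambda>w'. if id = w' then z (l, w') else \<zero>\<^bsub>QR\<^esub>) \<in> W \<rightarrow> carrier QR" using tw.T_val[OF zc] by simp
    qed simp
    also have "\<dots> = z (l, id)"
      by (rule Q.add.finprod_singleton) (use tw.T_val[OF zc] finite_weyl weyl_id in auto)
    finally show ?thesis unfolding pp_val True by (simp only: if_True refl)
  next
    case False
    then show ?thesis using off[OF False, of l] by (simp only: pp_val if_False)
  qed
  then have pz: "pp z = z" by (simp add: fun_eq_iff)
  have "central z" by (rule centralI[OF zc pz]) (use comm eta_E E_D in blast)
  then show "z \<in> D \<and> central z \<and> pp z = z" using z pz by simp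
next
  assume "z \<in> D \<and> central z \<and> pp z = z"
  then show "z \<in> Z" using D_closed by (auto simp: ring_centre_def central_def)
qed

lemma Z_closed: "z \<in> Z \<Longrightarrow> z \<in> CT" and Z_comm: "z \<in> Z \<Longrightarrow> x \<in> CT \<Longrightarrow> z *t x = x *t z"
  by (auto simp: centre_iff central_def)

lemma Z_subring: "subring Z TR"
proof (rule tw.T.subringI)
  show "Z \<subseteq> CT" using Z_closed by blast
  show "\<one>\<^bsub>TR\<^esub> \<in> Z" using D_ops(4) by (auto simp: centre_iff central_def pp_one)
next
  fix x assume x: "x \<in> Z"
  have xc: "x \<in> CT" and xD: "x \<in> D" and px: "pp x = x" using x Z_closed centre_iff by auto
  have neg: "\<ominus>\<^bsub>TR\<^esub> x = \<zero>\<^bsub>TR\<^esub> -t x" using xc by (simp add: a_minus_def)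
  have "\<ominus>\<^bsub>TR\<^esub> x \<in> D" unfolding neg by (intro D_ops xD)
  moreover have "pp (\<ominus>\<^bsub>TR\<^esub> x) = \<ominus>\<^bsub>TR\<^esub> x" unfolding neg using xc px by (simp add: pp_minus pp_zero)
  moreover have "central (\<ominus>\<^bsub>TR\<^esub> x)"
    using xc Z_comm[OF x] by (simp add: central_def tw.T.l_minus tw.T.r_minus)
  ultimately show "\<ominus>\<^bsub>TR\<^esub> x \<in> Z" by (simp add: centre_iff)
next
  fix x y assume x: "x \<in> Z" and y: "y \<in> Z"
  note h = x[unfolded centre_iff] y[unfolded centre_iff] Z_closed[OF x] Z_closed[OF y]
  have "central (x +t y)"
    using h Z_comm[OF x] Z_comm[OF y] by (simp add: central_def tw.T.l_distr tw.T.r_distr)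
  then show "x +t y \<in> Z" using h by (simp add: centre_iff D_ops pp_add)
  have "central (x *t y)"
    unfolding central_def
  proof (intro conjI ballI)
    fix u assume u: "u \<in> CT"
    have "x *t y *t u = x *t (u *t y)" using h u by (simp add: tw.T.m_assoc Z_comm[OF y u])
    also have "\<dots> = u *t x *t y" using h u by (simp add: tw.T.m_assoc[symmetric] Z_comm[OF x u])
    finally show "x *t y *t u = u *t (x *t y)" using h u by (simp add: tw.T.m_assoc)
  qed (use h in simp)
  then show "x *t y \<in> Z" using h pp_mult[of x y] by (simp add: centre_iff D_ops)
qed

lemma D_Wa_eq: "D_Wa F \<Phi> n \<alpha> \<theta> = TR\<lparr>carrier := D\<rparr>"
  and D_W_eq: "D_W F \<Phi> n \<alpha> \<theta> = TR\<lparr>carrier := E\<rparr>"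
  by (simp_all add: D_Wa_def D_W_def D_def E_def S_emb_eq)

lemma Z_Wa_eq: "Z_Wa F \<Phi> n \<alpha> \<theta> = TR\<lparr>carrier := Z\<rparr>"
  by (simp add: Z_Wa_def D_Wa_eq)

lemma D_Qv_eq: "D_Qv F \<Phi> n \<alpha> \<theta> = TR\<lparr>carrier := pp ` D\<rparr>"
  by (simp add: D_Qv_def D_Wa_eq image_image pp_def)

lemma one_JE_sum:
  "\<exists>N a d. (\<forall>k<N. a k \<in> carrier SR \<and> d k \<in> E) \<and> \<one>\<^bsub>TR\<^esub> = (\<Oplus>\<^bsub>TR\<^esub>k\<in>{..<N::nat}. Se (a k) *t e *t d k)"
  using one_JE
proof (induction rule: JE.induct)
  case JE_zero
  have "\<zero>\<^bsub>TR\<^esub> = (\<Oplus>\<^bsub>TR\<^esub>k\<in>{..<0::nat}. Se (undefined k) *t e *t undefined k)" by simp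
  then show ?case by blast
next
  case (JE_step b h x)
  then obtain N a d where *: "\<forall>k<N. a k \<in> carrier SR \<and> d k \<in> E" "x = (\<Oplus>\<^bsub>TR\<^esub>k\<in>{..<N::nat}. Se (a k) *t e *t d k)"
    by blast
  let ?a = "a(N := b)" and ?d = "d(N := h)"
  have c: "\<forall>k<Suc N. ?a k \<in> carrier SR \<and> ?d k \<in> E" using * JE_step by (simp add: less_Suc_eq)
  have t: "Se (?a k) *t e *t ?d k \<in> CT" if "k < Suc N" for k using c that E_closed by simp
  have tb: "Se b *t e *t h \<in> CT" using JE_step E_closed by simp
  have "(\<Oplus>\<^bsub>TR\<^esub>k\<in>{..<N}. Se (?a k) *t e *t ?d k) = x"
    unfolding *(2) by (rule tw.T.finsum_cong') (use * E_closed in auto)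
  moreover have "{..<Suc N} = insert N {..<N}" by auto
  ultimately have eq: "(\<Oplus>\<^bsub>TR\<^esub>k\<in>{..<Suc N}. Se (?a k) *t e *t ?d k) = Se b *t e *t h +t x"
    using t tb by (simp only:) (subst tw.T.finsum_insert, auto)
  show ?case
    by (rule exI[of _ "Suc N"], rule exI[of _ ?a], rule exI[of _ ?d], rule conjI[OF c eq[symmetric]])
qed

text \<open>\<open>pp (e *t y)\<close> is the average over W of the value of y at 1. It lies in S by
  \<open>E_Se\<close>, and it is central, hence invariant by \<open>central_Se\<close>.\<close>

lemma e_E_invariant:
  assumes "y \<in> E" shows "\<exists>s. s \<in> carrier SW \<and> Se s = pp (e *t y)"
proof -
  have y: "y \<in> CT" "e *t y \<in> E" using assms E_closed E_ops(2)[OF e_E] by auto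
  obtain s where s: "s \<in> carrier SR" "pp (e *t y *t Se \<one>\<^bsub>SR\<^esub>) = Se s" using E_Se[OF y(2), of "\<one>\<^bsub>SR\<^esub>"] by auto
  have s2: "pp (e *t y) = Se s" using s(2) E_closed[OF y(2)] by (simp only: Se_simps tw.T.r_one)
  have "central (Se s)" unfolding s2[symmetric] by (rule central_pp_e[OF y(1)])
  then show ?thesis using s s2 central_Se by auto
qed

definition inv_elt :: "('v, 'r) qwa \<Rightarrow> ('v, 'r) mps set" where
  "inv_elt y = (SOME s. s \<in> carrier SW \<and> Se s = pp (e *t y))"

lemma inv_elt:
  assumes "y \<in> E" shows "inv_elt y \<in> carrier SW" "Se (inv_elt y) = pp (e *t y)" "inv_elt y \<in> carrier SR"
  using someI_ex[OF e_E_invariant[OF assms]] by (auto simp: inv_elt_def SW_iff)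

lemma Se_finsum:
  assumes "finite A" "\<And>k. k \<in> A \<Longrightarrow> f k \<in> carrier SR"
  shows "Se (\<Oplus>\<^bsub>SR\<^esub>k\<in>A. f k) = (\<Oplus>\<^bsub>TR\<^esub>k\<in>A. Se (f k))"
  using assms
proof (induction A rule: finite_induct)
  case empty
  then show ?case using Se_simps(4) by simp
next
  case (insert x A)
  have fc: "f x \<in> carrier SR" "(\<Oplus>\<^bsub>SR\<^esub>k\<in>A. f k) \<in> carrier SR" using insert by auto
  have "Se (\<Oplus>\<^bsub>SR\<^esub>k\<in>insert x A. f k) = Se (f x \<oplus>\<^bsub>SR\<^esub> (\<Oplus>\<^bsub>SR\<^esub>k\<in>A. f k))" using insert by simp
  also have "\<dots> = Se (f x) +t (\<Oplus>\<^bsub>TR\<^esub>k\<in>A. Se (f k))"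
    unfolding Se_simps(2)[OF fc] using insert by simp
  also have "\<dots> = (\<Oplus>\<^bsub>TR\<^esub>k\<in>insert x A. Se (f k))" using insert by (subst tw.T.finsum_insert) auto
  finally show ?case .
qed

lemma Se_hom: "Se \<in> ring_hom SR TR"
  by (rule ring_hom_memI) (auto simp only: Se_simps Se_closed)

lemma SW_Z: "s \<in> carrier SW \<Longrightarrow> Se s \<in> Z"
  using central_Se[of s] Se_E[of s] E_D by (auto simp: SW_iff centre_iff pp_Qe0)

lemma pp_mult_Z: "x \<in> CT \<Longrightarrow> z \<in> Z \<Longrightarrow> pp (x *t z) = pp x *t z"
  using pp_central by (simp add: centre_iff)

section \<open>Dual bases extracted from a decomposition of 1\<close>

context
  fixes N :: nat and a and d
  assumes ad: "\<And>k. k < N \<Longrightarrow> a k \<in> carrier SR" "\<And>k. k < N \<Longrightarrow> d k \<in> E"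
    and unity: "\<one>\<^bsub>TR\<^esub> = (\<Oplus>\<^bsub>TR\<^esub>k\<in>{..<N}. Se (a k) *t e *t d k)"
begin

lemma d_closed: "k < N \<Longrightarrow> d k \<in> CT"
  using ad(2) E_closed by blast

lemma expand_left:
  assumes y: "y \<in> CT" shows "y = (\<Oplus>\<^bsub>TR\<^esub>k\<in>{..<N}. Se (a k) *t (e *t (d k *t y)))"
proof -
  have "y = (\<Oplus>\<^bsub>TR\<^esub>k\<in>{..<N}. Se (a k) *t e *t d k) *t y" using y unity[symmetric] by simp
  also have "\<dots> = (\<Oplus>\<^bsub>TR\<^esub>k\<in>{..<N}. Se (a k) *t e *t d k *t y)"
    by (rule tw.T.finsum_ldistr) (use y ad d_closed in auto)
  also have "\<dots> = (\<Oplus>\<^bsub>TR\<^esub>k\<in>{..<N}. Se (a k) *t (e *t (d k *t y)))"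
    by (rule tw.T.finsum_cong') (use y ad d_closed in \<open>auto simp: tw.T.m_assoc\<close>)
  finally show ?thesis .
qed

lemma expand_right:
  assumes y: "y \<in> CT" shows "y = (\<Oplus>\<^bsub>TR\<^esub>k\<in>{..<N}. y *t Se (a k) *t e *t d k)"
proof -
  have "y = y *t (\<Oplus>\<^bsub>TR\<^esub>k\<in>{..<N}. Se (a k) *t e *t d k)" using y unity[symmetric] by simp
  also have "\<dots> = (\<Oplus>\<^bsub>TR\<^esub>k\<in>{..<N}. y *t (Se (a k) *t e *t d k))"
    by (rule tw.T.finsum_rdistr) (use y ad d_closed in auto)
  also have "\<dots> = (\<Oplus>\<^bsub>TR\<^esub>k\<in>{..<N}. y *t Se (a k) *t e *t d k)"
    by (rule tw.T.finsum_cong') (use y ad d_closed in \<open>auto simp: tw.T.m_assoc\<close>)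
  finally show ?thesis .
qed

lemma pp_finsum: "finite A \<Longrightarrow> (\<And>k. k \<in> A \<Longrightarrow> f k \<in> CT) \<Longrightarrow> pp (\<Oplus>\<^bsub>TR\<^esub>k\<in>A. f k) = (\<Oplus>\<^bsub>TR\<^esub>k\<in>A. pp (f k))"
proof (induction A rule: finite_induct)
  case (insert x A)
  then have "f \<in> A \<rightarrow> CT" "(\<lambda>k. pp (f k)) \<in> A \<rightarrow> CT" by auto
  then show ?case using insert by (simp add: pp_add)
qed (simp add: pp_zero)

lemma pp_expand:
  assumes y: "y \<in> CT" shows "pp y = (\<Oplus>\<^bsub>TR\<^esub>k\<in>{..<N}. Se (a k) *t pp (e *t (d k *t y)))"
proof -
  have "pp y = pp (\<Oplus>\<^bsub>TR\<^esub>k\<in>{..<N}. Se (a k) *t (e *t (d k *t y)))"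
    by (rule arg_cong[OF expand_left[OF y]])
  also have "\<dots> = (\<Oplus>\<^bsub>TR\<^esub>k\<in>{..<N}. pp (Se (a k) *t (e *t (d k *t y))))"
    by (rule pp_finsum) (use y ad d_closed in auto)
  also have "\<dots> = (\<Oplus>\<^bsub>TR\<^esub>k\<in>{..<N}. Se (a k) *t pp (e *t (d k *t y)))"
    by (rule tw.T.finsum_cong') (use y ad d_closed in \<open>auto simp: pp_Se\<close>)
  finally show ?thesis .
qed

text \<open>The single terms of x in the basis eta need not lie in D. Multiplying by the
  decomposition of 1 on the right helps: \<open>pp x\<close> commutes with \<open>Se (a k)\<close>,
  and \<open>pp x *t e = x *t e\<close> replaces it by x.\<close>

lemma pp_D:
  assumes x: "x \<in> D" shows "pp x \<in> D"
proof -
  have xc: "x \<in> CT" by (rule D_closed[OF x])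
  have k: "pp x *t Se (a k) *t e *t d k = Se (a k) *t (x *t e) *t d k" if "k < N" for k
  proof -
    have "pp x *t Se (a k) = Se (a k) *t pp x" using pp_comm[OF xc, of "Se (a k)"] ad that by (simp add: pp_Qe0)
    then have "pp x *t Se (a k) *t e *t d k = Se (a k) *t (pp x *t e) *t d k"
      using xc ad that by (simp add: tw.T.m_assoc)
    then show ?thesis unfolding pp_mult_e[OF xc] .
  qed
  have "(\<Oplus>\<^bsub>TR\<^esub>k\<in>{..<N}. pp x *t Se (a k) *t e *t d k) \<in> D"
  proof (rule D_finsum)
    fix i assume "i \<in> {..<N}"
    then have i: "i < N" by simp
    show "pp x *t Se (a i) *t e *t d i \<in> D"
      unfolding k[OF i] using x Se_E[OF ad(1)[OF i]] e_E ad(2)[OF i] E_D by (intro D_ops) auto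
  qed simp
  then show ?thesis using expand_right[OF pp_closed[OF xc]] by simp
qed

lemma pp_e_Z: "y \<in> D \<Longrightarrow> pp (e *t y) \<in> Z"
  using central_pp_e[of y] pp_pp[of "e *t y"] pp_D[of "e *t y"] D_ops(2)[of e y] e_E E_D D_closed
  by (auto simp: centre_iff)

lemma Peterson_subring: "subring (pp ` D) TR"
proof (rule tw.T.subringI)
  show "pp ` D \<subseteq> CT" using D_closed by auto
  show "\<one>\<^bsub>TR\<^esub> \<in> pp ` D" using pp_one D_ops(4) by (metis imageI)
next
  fix x assume "x \<in> pp ` D"
  then obtain u where u: "u \<in> D" "x = pp u" by blast
  have "pp (\<zero>\<^bsub>TR\<^esub> -t u) = \<zero>\<^bsub>TR\<^esub> -t x" using u D_closed by (simp add: pp_minus pp_zero)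
  then have "\<ominus>\<^bsub>TR\<^esub> x = pp (\<zero>\<^bsub>TR\<^esub> -t u)" using u D_closed by (simp add: a_minus_def)
  then show "\<ominus>\<^bsub>TR\<^esub> x \<in> pp ` D" using D_ops(3)[OF D_ops(5) u(1)] by blast
next
  fix x y assume "x \<in> pp ` D" "y \<in> pp ` D"
  then obtain u v where u: "u \<in> D" "x = pp u" and v: "v \<in> D" "y = pp v" by blast
  have "x +t y = pp (u +t v)" using u v D_closed by (simp add: pp_add)
  then show "x +t y \<in> pp ` D" using D_ops(1)[OF u(1) v(1)] by blast
  have "x *t y = pp (pp u *t pp v)" using u v D_closed by (simp add: pp_mult)
  then show "x *t y \<in> pp ` D" using D_ops(2)[OF pp_D[OF u(1)] pp_D[OF v(1)]] by blast
qed

text \<open>Coordinates in the Peterson algebra are the central elements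
  \<open>pp (e *t (d l *t y))\<close>; for y in S they are the images of the invariants
  \<open>inv_elt\<close>, so the one family \<open>a\<close> serves both modules.\<close>

lemma dual_basis_S:
  "dual_basis TR SR (TR\<lparr>carrier := Z\<rparr>) Se (\<lambda>z. z) SW (\<lambda>s. s) Se (pp ` D) {..<N} a
     (\<lambda>l s. inv_elt (d l *t Se s)) (\<lambda>l y. pp (e *t (d l *t y)))"
proof -
  interpret B: ring "TR\<lparr>carrier := Z\<rparr>" by (rule tw.T.subring_is_ring[OF Z_subring])
  have dS: "d l *t Se s \<in> E" if "l < N" "s \<in> carrier SR" for l s
    using that ad Se_E by (intro E_ops)
  have dD: "d l *t y \<in> D" if "l < N" "y \<in> D" for l y
    using that ad E_D by (intro D_ops) auto
  have C: "y \<in> D \<and> y \<in> CT \<and> pp y = y" if "y \<in> pp ` D" for y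
    using that pp_D D_closed pp_pp by auto
  show ?thesis
  proof (intro dual_basis.intro dual_basis_axioms.intro)
    show "ring TR" "ring SR" "ring (TR\<lparr>carrier := Z\<rparr>)" by unfold_locales
    show "Se \<in> ring_hom SR TR" by (rule Se_hom)
    show "(\<lambda>z. z) \<in> ring_hom (TR\<lparr>carrier := Z\<rparr>) TR" using Z_closed by (intro ring_hom_memI) auto
    show "k \<in> carrier SR \<and> Se k \<in> carrier (TR\<lparr>carrier := Z\<rparr>) \<and> Se k = Se k" if "k \<in> carrier SW" for k
      using that SW_Z by (simp add: SW_iff)
    show "Se s *t b = b *t Se s" if "s \<in> carrier SR" "b \<in> carrier (TR\<lparr>carrier := Z\<rparr>)" for s b
      using Z_comm[of b "Se s"] that by simp
    show "subring (pp ` D) TR" by (rule Peterson_subring)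
    show "Se s *t b \<in> pp ` D" if s: "s \<in> carrier SR" and "b \<in> carrier (TR\<lparr>carrier := Z\<rparr>)" for s b
    proof -
      have b: "b \<in> Z" using that by simp
      have "Se s *t b = pp (Se s *t b)" using s b by (simp add: pp_mult_Z pp_Qe0)
      moreover have "Se s *t b \<in> D" using b Se_E[OF s] E_D centre_iff by (intro D_ops) auto
      ultimately show ?thesis by blast
    qed
    show "a l \<in> carrier SR" if "l \<in> {..<N}" for l using that ad by simp
    show "inv_elt (d l *t Se s) \<in> carrier SW" if "l \<in> {..<N}" "s \<in> carrier SR" for l s
      using that inv_elt(1)[OF dS] by simp
    show "s = (\<Oplus>\<^bsub>SR\<^esub>l\<in>{..<N}. a l \<otimes>\<^bsub>SR\<^esub> inv_elt (d l *t Se s))" if s: "s \<in> carrier SR" for s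
    proof -
      have c: "a l \<otimes>\<^bsub>SR\<^esub> inv_elt (d l *t Se s) \<in> carrier SR" if "l \<in> {..<N}" for l
        using that ad inv_elt(3)[OF dS[OF _ s]] by simp
      have "Se s = (\<Oplus>\<^bsub>TR\<^esub>l\<in>{..<N}. Se (a l) *t pp (e *t (d l *t Se s)))"
        using pp_expand[OF Se_closed[OF s]] s by (simp add: pp_Qe0)
      also have "\<dots> = (\<Oplus>\<^bsub>TR\<^esub>l\<in>{..<N}. Se (a l \<otimes>\<^bsub>SR\<^esub> inv_elt (d l *t Se s)))"
      proof (rule tw.T.finsum_cong')
        fix l assume "l \<in> {..<N}"
        then have l: "l < N" by simp
        show "Se (a l) *t pp (e *t (d l *t Se s)) = Se (a l \<otimes>\<^bsub>SR\<^esub> inv_elt (d l *t Se s))"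
          unfolding Se_simps(1)[OF ad(1)[OF l] inv_elt(3)[OF dS[OF l s]]] inv_elt(2)[OF dS[OF l s]] ..
      qed (use c Se_closed in auto)
      also have "\<dots> = Se (\<Oplus>\<^bsub>SR\<^esub>l\<in>{..<N}. a l \<otimes>\<^bsub>SR\<^esub> inv_elt (d l *t Se s))"
        by (rule Se_finsum[symmetric, OF _ c]) simp_all
      finally show ?thesis by (rule Se_inj[THEN iffD1, OF s S.finsum_closed, rotated]) (use c in auto)
    qed
    show "pp (e *t (d l *t y)) \<in> carrier (TR\<lparr>carrier := Z\<rparr>)" if "l \<in> {..<N}" "y \<in> pp ` D" for l y
      using pp_e_Z[OF dD, of l y] C[OF that(2)] that(1) by simp
    show "pp (e *t (d l *t (x +t y))) = pp (e *t (d l *t x)) \<oplus>\<^bsub>TR\<lparr>carrier := Z\<rparr>\<^esub> pp (e *t (d l *t y))"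
      if "l \<in> {..<N}" "x \<in> pp ` D" "y \<in> pp ` D" for l x y
      using C[OF that(2)] C[OF that(3)] d_closed[of l] that(1) by (simp add: tw.T.r_distr pp_add)
    show "pp (e *t (d l *t (Se s *t b))) = Se (inv_elt (d l *t Se s)) \<otimes>\<^bsub>TR\<lparr>carrier := Z\<rparr>\<^esub> b"
      if l: "l \<in> {..<N}" and s: "s \<in> carrier SR" and b: "b \<in> carrier (TR\<lparr>carrier := Z\<rparr>)" for l s b
    proof -
      have l': "l < N" and b': "b \<in> Z" using l b by auto
      have "e *t (d l *t (Se s *t b)) = e *t (d l *t Se s) *t b"
        using s Z_closed[OF b'] d_closed[OF l'] by (simp add: tw.T.m_assoc)
      then have "pp (e *t (d l *t (Se s *t b))) = pp (e *t (d l *t Se s)) *t b"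
        using pp_mult_Z[OF _ b', of "e *t (d l *t Se s)"] s d_closed[OF l'] by simp
      then show ?thesis unfolding inv_elt(2)[OF dS[OF l' s]] by simp
    qed
    show "y = (\<Oplus>\<^bsub>TR\<^esub>l\<in>{..<N}. Se (a l) *t pp (e *t (d l *t y)))" if "y \<in> pp ` D" for y
      using pp_expand[of y] C[OF that] by simp
  qed simp
qed

text \<open>The decomposition of 1 is used on both sides of y. On the right it gives y a_k e = pp(y
  a_k) e, on the left it expands pp(y a_k), and the central coefficients that arise are moved to the
  far right. The index p is the pair (k, l).\<close>

lemma expand_both:
  assumes y: "y \<in> CT"
  shows "y = (\<Oplus>\<^bsub>TR\<^esub>p\<in>{..<N} \<times> {..<N}. Se (a (snd p)) *t e *t d (fst p) *t pp (e *t (d (snd p) *t y *t Se (a (fst p)))))"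
proof -
  have ac: "Se (a k) \<in> CT" if "k < N" for k using ad that by simp
  have cen: "Se (a l) *t e *t d k *t pp (e *t (d l *t y *t Se (a k))) =
      Se (a l) *t pp (e *t (d l *t (y *t Se (a k)))) *t (e *t d k)" if k: "k < N" and l: "l < N" for k l
  proof -
    let ?z = "pp (e *t (d l *t y *t Se (a k)))"
    have "central ?z" using y ad d_closed k l by (intro central_pp_e) auto
    then have "e *t d k *t ?z = ?z *t (e *t d k)" "?z \<in> CT" using d_closed[OF k] by (auto simp: central_def)
    then show ?thesis using y ac d_closed k l by (simp add: tw.T.m_assoc)
  qed
  have inner: "(\<Oplus>\<^bsub>TR\<^esub>l\<in>{..<N}. Se (a l) *t e *t d k *t pp (e *t (d l *t y *t Se (a k)))) = y *t Se (a k) *t e *t d k"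
    if k: "k < N" for k
  proof -
    have "(\<Oplus>\<^bsub>TR\<^esub>l\<in>{..<N}. Se (a l) *t e *t d k *t pp (e *t (d l *t y *t Se (a k)))) =
        (\<Oplus>\<^bsub>TR\<^esub>l\<in>{..<N}. Se (a l) *t pp (e *t (d l *t (y *t Se (a k)))) *t (e *t d k))"
      by (rule tw.T.finsum_cong') (use y ac d_closed k cen in auto)
    also have "\<dots> = (\<Oplus>\<^bsub>TR\<^esub>l\<in>{..<N}. Se (a l) *t pp (e *t (d l *t (y *t Se (a k))))) *t (e *t d k)"
      by (rule tw.T.finsum_ldistr[symmetric]) (use y ac d_closed k in auto)
    also have "\<dots> = pp (y *t Se (a k)) *t (e *t d k)"
      using pp_expand[of "y *t Se (a k)"] y ac[OF k] by simp
    also have "\<dots> = pp (y *t Se (a k)) *t e *t d k" using y ac[OF k] d_closed[OF k] by (simp add: tw.T.m_assoc)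
    also have "\<dots> = y *t Se (a k) *t e *t d k" using y ac[OF k] by (simp add: pp_mult_e)
    finally show ?thesis .
  qed
  have "y = (\<Oplus>\<^bsub>TR\<^esub>k\<in>{..<N}. y *t Se (a k) *t e *t d k)" by (rule expand_right[OF y])
  also have "\<dots> = (\<Oplus>\<^bsub>TR\<^esub>k\<in>{..<N}. \<Oplus>\<^bsub>TR\<^esub>l\<in>{..<N}. Se (a l) *t e *t d k *t pp (e *t (d l *t y *t Se (a k))))"
    by (rule tw.T.finsum_cong') (use y ac d_closed inner in \<open>auto intro!: tw.T.finsum_closed\<close>)
  also have "\<dots> = (\<Oplus>\<^bsub>TR\<^esub>p\<in>{..<N} \<times> {..<N}. Se (a (snd p)) *t e *t d (fst p) *t pp (e *t (d (snd p) *t y *t Se (a (fst p)))))"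
    by (subst tw.T.finsum_Times) (use y ac d_closed in auto)
  finally show ?thesis .
qed

lemma dual_basis_E:
  "dual_basis TR (TR\<lparr>carrier := E\<rparr>) (TR\<lparr>carrier := Z\<rparr>) (\<lambda>d. d) (\<lambda>z. z) SW Se Se D ({..<N} \<times> {..<N})
     (\<lambda>p. Se (a (snd p)) *t e *t d (fst p))
     (\<lambda>p y. inv_elt (d (snd p) *t y *t Se (a (fst p)))) (\<lambda>p y. pp (e *t (d (snd p) *t y *t Se (a (fst p)))))"
proof -
  interpret A: ring "TR\<lparr>carrier := E\<rparr>" by (rule tw.T.subring_is_ring[OF E_subring])
  interpret B: ring "TR\<lparr>carrier := Z\<rparr>" by (rule tw.T.subring_is_ring[OF Z_subring])
  have dE: "d l *t y *t Se (a k) \<in> E" if "l < N" "k < N" "y \<in> E" for l k y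
    using that ad Se_E by (intro E_ops) auto
  have dD: "d l *t y *t Se (a k) \<in> D" if "l < N" "k < N" "y \<in> D" for l k y
    using that ad Se_E E_D by (intro D_ops) auto
  have p: "Se (a l) *t e *t d k \<in> E" if "l < N" "k < N" for l k
    using that ad Se_E e_E by (intro E_ops) auto
  have SWE: "Se k \<in> E" if "k \<in> carrier SW" for k using that Se_E by (simp add: SW_iff)
  show ?thesis
  proof (intro dual_basis.intro dual_basis_axioms.intro)
    show "ring TR" "ring (TR\<lparr>carrier := E\<rparr>)" "ring (TR\<lparr>carrier := Z\<rparr>)" by unfold_locales
    show "(\<lambda>d. d) \<in> ring_hom (TR\<lparr>carrier := E\<rparr>) TR" using E_closed by (intro ring_hom_memI) auto
    show "(\<lambda>z. z) \<in> ring_hom (TR\<lparr>carrier := Z\<rparr>) TR" using Z_closed by (intro ring_hom_memI) auto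
    show "Se k \<in> carrier (TR\<lparr>carrier := E\<rparr>) \<and> Se k \<in> carrier (TR\<lparr>carrier := Z\<rparr>) \<and> Se k = Se k"
      if "k \<in> carrier SW" for k
      using that SW_Z SWE by simp
    show "y *t b = b *t y" if "y \<in> carrier (TR\<lparr>carrier := E\<rparr>)" "b \<in> carrier (TR\<lparr>carrier := Z\<rparr>)" for y b
      using Z_comm[of b y] that E_closed by simp
    show "subring D TR" by (rule D_subring)
    show "y *t b \<in> D" if "y \<in> carrier (TR\<lparr>carrier := E\<rparr>)" "b \<in> carrier (TR\<lparr>carrier := Z\<rparr>)" for y b
      using that E_D centre_iff by (intro D_ops) auto
    show "Se (a (snd l)) *t e *t d (fst l) \<in> carrier (TR\<lparr>carrier := E\<rparr>)" if "l \<in> {..<N} \<times> {..<N}" for l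
      using that p by auto
    show "inv_elt (d (snd l) *t y *t Se (a (fst l))) \<in> carrier SW"
      if "l \<in> {..<N} \<times> {..<N}" "y \<in> carrier (TR\<lparr>carrier := E\<rparr>)" for l y
      using that by (intro inv_elt(1) dE) auto
    show "y = (\<Oplus>\<^bsub>TR\<lparr>carrier := E\<rparr>\<^esub>l\<in>{..<N} \<times> {..<N}. Se (a (snd l)) *t e *t d (fst l)
        \<otimes>\<^bsub>TR\<lparr>carrier := E\<rparr>\<^esub> Se (inv_elt (d (snd l) *t y *t Se (a (fst l)))))"
      if "y \<in> carrier (TR\<lparr>carrier := E\<rparr>)" for y
    proof -
      have y: "y \<in> E" using that by simp
      let ?f = "\<lambda>l. Se (a (snd l)) *t e *t d (fst l) *t Se (inv_elt (d (snd l) *t y *t Se (a (fst l))))"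
      have c: "?f l \<in> E" if "l \<in> {..<N} \<times> {..<N}" for l
        using that y by (intro E_ops(2) p SWE inv_elt(1) dE) auto
      \<comment> \<open>For y in E the central coefficients of \<open>expand_both\<close> are images
        of invariants in S, so the same formula expands E over the invariants and D over the
        centre.\<close>
      have "y = (\<Oplus>\<^bsub>TR\<^esub>l\<in>{..<N} \<times> {..<N}. ?f l)"
        by (rule trans[OF expand_both[OF E_closed[OF y]]], rule tw.T.finsum_cong')
          (use c E_closed inv_elt(2)[OF dE] y in auto)
      also have "\<dots> = (\<Oplus>\<^bsub>TR\<lparr>carrier := E\<rparr>\<^esub>l\<in>{..<N} \<times> {..<N}. ?f l)"
        by (rule tw.T.finsum_subring[symmetric, OF E_subring]) (use c in auto)
      finally show ?thesis by simp
    qed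
    show "pp (e *t (d (snd l) *t y *t Se (a (fst l)))) \<in> carrier (TR\<lparr>carrier := Z\<rparr>)"
      if "l \<in> {..<N} \<times> {..<N}" "y \<in> D" for l y
      using that by (auto intro!: pp_e_Z dD)
    show "pp (e *t (d (snd l) *t (x +t y) *t Se (a (fst l)))) =
        pp (e *t (d (snd l) *t x *t Se (a (fst l)))) \<oplus>\<^bsub>TR\<lparr>carrier := Z\<rparr>\<^esub> pp (e *t (d (snd l) *t y *t Se (a (fst l))))"
      if "l \<in> {..<N} \<times> {..<N}" "x \<in> D" "y \<in> D" for l x y
      using that D_closed d_closed ad by (auto simp: tw.T.r_distr tw.T.l_distr pp_add)
    show "pp (e *t (d (snd l) *t (y *t b) *t Se (a (fst l)))) =
        Se (inv_elt (d (snd l) *t y *t Se (a (fst l)))) \<otimes>\<^bsub>TR\<lparr>carrier := Z\<rparr>\<^esub> b"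
      if l: "l \<in> {..<N} \<times> {..<N}" and y: "y \<in> carrier (TR\<lparr>carrier := E\<rparr>)" and b: "b \<in> carrier (TR\<lparr>carrier := Z\<rparr>)" for l y b
    proof -
      have l': "fst l < N" "snd l < N" and b': "b \<in> Z" and y': "y \<in> E" using l b y by auto
      note c = Z_closed[OF b'] E_closed[OF y'] d_closed[OF l'(2)] Se_closed[OF ad(1)[OF l'(1)]]
      have "e *t (d (snd l) *t (y *t b) *t Se (a (fst l))) = e *t (d (snd l) *t y *t Se (a (fst l))) *t b"
        using c by (simp add: tw.T.m_assoc Z_comm[OF b' c(4)])
      then have "pp (e *t (d (snd l) *t (y *t b) *t Se (a (fst l)))) = pp (e *t (d (snd l) *t y *t Se (a (fst l)))) *t b"
        using pp_mult_Z[OF _ b', of "e *t (d (snd l) *t y *t Se (a (fst l)))"] c by simp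
      then show ?thesis unfolding inv_elt(2)[OF dE[OF l'(2,1) y']] by simp
    qed
    show "y = (\<Oplus>\<^bsub>TR\<^esub>l\<in>{..<N} \<times> {..<N}. Se (a (snd l)) *t e *t d (fst l) *t pp (e *t (d (snd l) *t y *t Se (a (fst l)))))"
      if "y \<in> D" for y by (rule expand_both[OF D_closed[OF that]])
  qed simp
qed

end

theorem isomorphisms:
  "Theta F \<Phi> \<in> ring_iso (S_tensor_Z F \<Phi> n \<alpha> \<theta>) (D_Qv F \<Phi> n \<alpha> \<theta>)"
  "Xi F \<Phi> \<in> ring_iso (D_W_tensor_Z F \<Phi> n \<alpha> \<theta>) (D_Wa F \<Phi> n \<alpha> \<theta>)"
proof -
  obtain N a d where *: "\<And>k. k < N \<Longrightarrow> a k \<in> carrier SR" "\<And>k. k < N \<Longrightarrow> d k \<in> E"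
    "\<one>\<^bsub>TR\<^esub> = (\<Oplus>\<^bsub>TR\<^esub>k\<in>{..<N::nat}. Se (a k) *t e *t d k)" using one_JE_sum by blast
  show "Theta F \<Phi> \<in> ring_iso (S_tensor_Z F \<Phi> n \<alpha> \<theta>) (D_Qv F \<Phi> n \<alpha> \<theta>)"
    unfolding Theta_def S_tensor_Z_def D_Qv_eq Z_Wa_eq S_emb_eq
    by (rule dual_basis.tensor_mult_map_iso[OF dual_basis_S[OF *]])
  show "Xi F \<Phi> \<in> ring_iso (D_W_tensor_Z F \<Phi> n \<alpha> \<theta>) (D_Wa F \<Phi> n \<alpha> \<theta>)"
    unfolding Xi_def D_W_tensor_Z_def D_Wa_eq D_W_eq Z_Wa_eq S_emb_eq
    by (rule dual_basis.tensor_mult_map_iso[OF dual_basis_E[OF *]])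
qed

end

theorem theorem4p4:
  fixes F :: "nat \<Rightarrow> nat \<Rightarrow> 'r::{comm_ring_1, ring_char_0}"
    and \<Phi> :: "'v::euclidean_space set"
    and n :: nat and \<alpha> :: "nat \<Rightarrow> 'v" and \<theta> :: 'v
  assumes "formal_group_law F"
    and "irreducible_root_system \<Phi>"
    and "simple_roots \<Phi> n \<alpha>"
    and "highest_root \<Phi> n \<alpha> \<theta>"
    and "\<forall>\<beta>\<in>\<Phi>. regular_elt (S_ring F \<Phi>) (S_var F \<Phi> \<beta>)"
    and "contains_rat TYPE('r)"
  shows "Theta F \<Phi> \<in> ring_iso (S_tensor_Z F \<Phi> n \<alpha> \<theta>) (D_Qv F \<Phi> n \<alpha> \<theta>) \<and>
         Xi F \<Phi> \<in> ring_iso (D_W_tensor_Z F \<Phi> n \<alpha> \<theta>) (D_Wa F \<Phi> n \<alpha> \<theta>)"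
proof -
  interpret demazure \<Phi> n \<alpha> F \<theta>
    by unfold_locales (use assms in \<open>auto simp: irreducible_root_system_def highest_root_def\<close>)
  show ?thesis using isomorphisms by simp
qed

end
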